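(* Let $Z$ be a distribution of points in $\mathbb{C}$, i.e. a function $Z\colon\mathbb{C}\to\{0,1,2,\dots\}\cup\{+\infty\}$. Let $S\subset\mathbb{C}$ be a compact set with connected complement $\mathbb{C}\setminus S$ and with $0\in\operatorname{co}S$, where $\operatorname{co}S$ is the convex hull of $S$. Let $\bar S=\{\bar z: z\in S\}$ be the complex conjugate of $S$. Suppose that for some real $r_0>0$ $$\sup_{r_0\le r<R<+\infty}\left(\int_r^R\frac{Z^{\mathrm{rad}}_{\bar S}(t)}{t^2}\,dt-\frac{\operatorname{area}(\operatorname{co}S)}{\pi}\ln\frac{R}{r}\right)=+\infty .$$ Then the exponential system $\operatorname{Exp}^Z$ is complete in the space $C(S)\cap\operatorname{Hol}(\operatorname{int}S)$.
   Context: A distribution of points $Z$ on $\mathbb{C}$ (repetitions allowed) is identified with its multiplicity function $Z\colon\mathbb{C}\to\overline{\mathbb{N}}_0:=\{0,1,2,\dots\}\cup\{+\infty\}$; $Z(z)$ is the number of occurrences of $z$, and $z\in Z$ means $Z(z)>0$. No local finiteness is assumed. $Z$ is also regarded as the measure $Z(A)=\sum_{z\in A}Z(z)\in\overline{\mathbb{N}}_0$, $A\subset\mathbb{C}$. For a function $f\ge 0$ on $A$, the sum over points of $Z$ in $A$ counts multiplicity: $\sum_{z\in Z,\,z\in A}f(z):=\int_A f\,dZ=\sum_{z\in A}Z(z)f(z)\in[0,+\infty]$, with the convention $0\cdot(+\infty)=0$. Exponential system with exponents $Z$: $\operatorname{Exp}^Z:=\{\,w\mapsto w^p e^{zw} :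 z\in Z,\ p\in\{0,1,2,\dots\},\ p\le Z(z)-1\,\}$ (functions of $w\in\mathbb{C}$, restricted to $S$). Support function of a set $A\subset\mathbb{C}$: $\operatorname{spf}_A(\theta):=\sup_{s\in A}\operatorname{Re}(se^{-i\theta})$, $\theta\in\mathbb{R}$; it is $2\pi$-periodic, so $\operatorname{spf}_A(\arg z)$ is well defined for $z\ne0$. It is nonnegative if and only if $0$ belongs to the closure of $\operatorname{co}A$. Radial counting function of $Z$ by arguments relative to a bounded set $A\subset\mathbb{C}$ with $0\in\overline{\operatorname{co}A}$: $$Z^{\mathrm{rad}}_A(r):=Z(0)\,\sup_{\theta\in\mathbb{R}}|\operatorname{spf}_A(\theta)|+\sum_{z\in Z,\ 0<|z|\le r}\operatorname{spf}_A(\arg z)\in[0,+\infty],\qquad r\ge0 .$$ $\operatorname{area}$ denotes Euclidean area (planar Lebesgue measure). For compact $S$, $C(S)\cap\operatorname{Hol}(\operatorname{int}S)$ is the Banach space of functions $f\colon S\to\mathbb{C}$ continuous on $S$ and holomorphic on the interior $\operatorname{int}S$, with norm $\sup_S|f|$ (it equals $C(S)$ if $\operatorname{int}S=\emptyset$). A system of vectors is complete in a topological vector space if the closure of its linear span is the whole space. *)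

theory Defs
  imports "HOL-Analysis.Analysis" "HOL-Library.Function_Algebras"
begin

text \<open>
  A distribution of points is a function \<open>Z :: complex \<Rightarrow> enat\<close> giving multiplicities.
  On \<open>enat\<close> we have \<open>\<infinity> - 1 = \<infinity>\<close>, so a point of infinite multiplicity contributes all powers.
\<close>

definition Exp_system :: "(complex \<Rightarrow> enat) \<Rightarrow> (complex \<Rightarrow> complex) set" where
  "Exp_system Z = {(\<lambda>w. w ^ p * exp (z * w)) | z p. 0 < Z z \<and> enat p \<le> Z z - 1}"

text \<open>The real supremum is meaningful for bounded nonempty \<open>A\<close>.\<close>

definition spf :: "complex set \<Rightarrow> real \<Rightarrow> real" where
  "spf A \<theta> = (SUP s\<in>A. Re (s * exp (- (\<i> * complex_of_real \<theta>))))"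

text \<open>
  Meant for bounded \<open>A\<close> with \<open>0\<close> in the closure of the convex hull of \<open>A\<close>, where \<open>spf A \<ge> 0\<close>, so that
  \<open>ennreal\<close> does not truncate. Integration over a counting measure is the unordered sum, also over
  uncountable sets, and \<open>0 * \<infinity> = 0\<close> on \<open>ennreal\<close>.
\<close>

definition Zrad :: "(complex \<Rightarrow> enat) \<Rightarrow> complex set \<Rightarrow> real \<Rightarrow> ennreal" where
  "Zrad Z A r =
     ennreal_of_enat (Z 0) * ennreal (SUP \<theta>. \<bar>spf A \<theta>\<bar>) +
     (\<integral>\<^sup>+ z. ennreal_of_enat (Z z) * ennreal (spf A (Arg z))
        \<partial>count_space {z. 0 < cmod z \<and> cmod z \<le> r})"

text \<open>
  The space \<open>C(S) \<inter> Hol(int S)\<close> for compact \<open>S\<close>. Functions on \<open>S\<close> are represented by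
  \<open>extensional\<close> functions, and \<open>cfunspace\<close> carries the metric of the supremum norm over \<open>S\<close>.
\<close>

definition CHol :: "complex set \<Rightarrow> (complex \<Rightarrow> complex) metric" where
  "CHol S = submetric (cfunspace (top_of_set S) euclidean_metric) {f. f holomorphic_on interior S}"

interpretation cfun: vector_space "\<lambda>(c::complex) (f::complex \<Rightarrow> complex) w. c * f w"
  by unfold_locales (auto simp: fun_eq_iff algebra_simps)

text \<open>
  The vectors of the system are the restrictions to \<open>S\<close> of the functions in \<open>E\<close>. Restriction is linear,
  so the linear span of the restrictions is the image of the span taken among functions on the
  whole plane.
\<close>

definition complete_in_CHol :: "complex set \<Rightarrow> (complex \<Rightarrow> complex) set \<Rightarrow> bool" where
  "complete_in_CHol S E \<longleftrightarrow>
     mtopology_of (CHol S) closure_of ((\<lambda>f. restrict f S) ` cfun.span E) = mspace (CHol S)"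

lemma mspace_CHol:
  assumes "compact S"
  shows "mspace (CHol S) = {f. f \<in> extensional S \<and> continuous_on S f \<and> f holomorphic_on interior S}"
proof -
  have "bounded (f ` S)" if "continuous_on S f" for f :: "complex \<Rightarrow> complex"
    using that assms compact_continuous_image compact_imp_bounded by blast
  then show ?thesis
    by (auto simp: CHol_def)
qed

lemma mdist_CHol:
  assumes "compact S" "S \<noteq> {}" "f \<in> mspace (CHol S)" "g \<in> mspace (CHol S)"
  shows "mdist (CHol S) f g = (SUP w\<in>S. cmod (f w - g w))"
  using assms by (auto simp: CHol_def mdist_cfunspace_eq_mdist_funspace Met_TC.fdist_def
      Met_TC.fspace_def dist_norm)

lemma restrict_span_Exp_system:
  assumes "compact S"
  shows "(\<lambda>f. restrict f S) ` cfun.span (Exp_system Z) \<subseteq> mspace (CHol S)"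
proof -
  have ent: "f holomorphic_on UNIV" if "f \<in> cfun.span (Exp_system Z)" for f
    using that
  proof (induction rule: cfun.span_induct_alt)
    case base
    show ?case by (simp add: zero_fun_def)
  next
    case (step c x y)
    then show ?case
      by (auto simp: Exp_system_def plus_fun_def intro!: holomorphic_intros)
  qed
  have "restrict f S holomorphic_on interior S" if "f holomorphic_on UNIV" for f :: "complex \<Rightarrow> complex"
  proof -
    have "f holomorphic_on interior S"
      using that holomorphic_on_subset by blast
    moreover have "f w = restrict f S w" if "w \<in> interior S" for w
      using that interior_subset by fastforce
    ultimately show ?thesis
      using holomorphic_transform by blast
  qed
  moreover have "continuous_on S (restrict f S)" if "f holomorphic_on UNIV" for f :: "complex \<Rightarrow> complex"
    using that continuous_on_subset[OF holomorphic_on_imp_continuous_on, of f UNIV S]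
    by (simp add: continuous_on_restrict)
  ultimately show ?thesis
    using ent by (auto simp: mspace_CHol[OF assms])
qed

end

theory Submission
  imports Defs "HOL-Complex_Analysis.Complex_Analysis"
begin

text \<open>
  If the system is not complete, Mergelyan's theorem gives a polynomial at positive distance from its
  span. A bounded functional that vanishes on the span but not on all polynomials has a Laplace transform \<open>F\<close>,
  a nonzero entire function that vanishes on \<open>Z\<close> with multiplicities and satisfies \<open>\<bar>F z\<bar> \<le> exp (H z)\<close>, where
  \<open>H z = sup {Re (w z) | w \<in> S}\<close>.

  Approximate \<open>H\<close> on the unit circle from above by a trigonometric polynomial \<open>h\<close> with \<open>h > 0\<close>
  and \<open>h + h'' > 0\<close>. The \<open>k\<close>-th Fourier coefficient of \<open>ln \<bar>1 - z / a\<bar>\<close> on the circle of radius \<open>\<rho>\<close> is annihilated by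
  \<open>(\<rho> d/d\<rho>)\<^sup>2 - k\<^sup>2\<close> off \<open>\<rho> = \<bar>a\<bar>\<close>. The weight \<open>w(\<rho>) = \<rho> (1 / max(r, \<rho>)\<^sup>2 - 1 / R\<^sup>2)\<close> is annihilated by \<open>(\<rho> d/d\<rho>)\<^sup>2 - 1\<close>
  off \<open>r\<close>, so integrating the means of \<open>(h + h'') ln \<bar>F\<bar>\<close> against \<open>w(\<rho>) / \<rho>\<close> over \<open>[0, R]\<close> yields the sum of \<open>w(\<bar>a\<bar>) h(arg a)\<close> over the
  zeros up to boundary terms. As \<open>ln \<bar>F\<bar> \<le> \<rho> h\<close> and half the integral of \<open>h (h + h'')\<close> is the area of the convex body with
  support function \<open>h\<close>, this sum, and with it the integral of the radial counting function over \<open>t\<^sup>2\<close>, is at most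
  \<open>area / \<pi> ln (R / r) + O(1)\<close>.
\<close>

unbundle no fps_syntax

section \<open>Circle averages of planar integrals\<close>

text \<open>Only an upper bound for ln|F| is available, and this shapes the argument. A mean of
  ln|F| that is to be bounded above must carry a nonnegative weight, hence the demand on h + h''.
  The one mean needed from below is the boundary term at r, with weight h \<le> H: it is H times the
  plain mean minus the mean with weight H - h, and the plain mean is nonnegative by Jensen's formula
  once F is divided by its leading term at 0. The weight w is dictated by the target: a zero of
  modulus \<rho> in [r, R] contributes 1/\<rho> - 1/R to the integral of the counting function over
  t^2, and w(\<rho>) = 1/\<rho> - \<rho>/R^2 dominates this; zeros of modulus below r, where w is
  too small, are only O(r) many. A trigonometric polynomial h reduces Green's formula to finitely
  many Fourier modes with explicit antiderivatives. Since h has to be chosen depending on R/r, all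
  errors must be uniform in r and R. On the functional side no measures occur: the functional lives
  on polynomials, and F is the power series built from its moments.\<close>

definition complex_of_vec :: "real^2 \<Rightarrow> complex" where "complex_of_vec x = Complex (x$1) (x$2)"

lemma linear_complex_of_vec: "linear complex_of_vec"
  by (auto simp: complex_of_vec_def linear_iff complex_eq_iff)

lemma continuous_complex_of_vec: "continuous_on A complex_of_vec"
  using linear_complex_of_vec by (rule linear_continuous_on[OF linear_conv_bounded_linear[THEN iffD1]])

lemma measurable_complex_of_vec [measurable]: "complex_of_vec \<in> borel_measurable borel"
  using continuous_complex_of_vec by (rule borel_measurable_continuous_onI)

text \<open>Carries Lebesgue measure between the complex plane and \<open>real^2\<close>, where
  \<open>measure_orthogonal_image\<close> and the change of variables formula are stated.\<close>

lemma lborel_complex_distr_vec: "lborel = distr lborel borel complex_of_vec"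
proof (rule lborel_eqI)
  fix l u :: complex
  assume lu: "\<And>b. b \<in> Basis \<Longrightarrow> l \<bullet> b \<le> u \<bullet> b"
  have lu': "Re l \<le> Re u" "Im l \<le> Im u"
    using lu[of 1] lu[of \<i>] by (auto simp: Basis_complex_def)
  define l' u' :: "real^2" where "l' = vector [Re l, Im l]" and "u' = vector [Re u, Im u]"
  have "complex_of_vec -` box l u = box l' u'"
    by (auto simp: box_def Basis_complex_def Basis_vec_def complex_of_vec_def inner_axis l'_def u'_def forall_2
        split: if_splits)
  moreover have "emeasure lborel (box l' u') = (\<Prod>b\<in>Basis. (u - l) \<bullet> b)"
  proof -
    have B: "(Basis :: (real^2) set) = {axis 1 1, axis 2 1}"
      by (auto simp: Basis_vec_def) (metis exhaust_2)
    have "axis 1 1 \<noteq> (axis 2 1 :: real^2)"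
      by (simp add: axis_eq_axis)
    then have "(\<Prod>b\<in>Basis. (u' - l') \<bullet> b) = (\<Prod>b\<in>Basis. (u - l) \<bullet> b)"
      unfolding B by (simp add: Basis_complex_def inner_axis l'_def u'_def)
    moreover have "l' \<bullet> b \<le> u' \<bullet> b" if "b \<in> Basis" for b
      using that lu' unfolding B by (auto simp: inner_axis l'_def u'_def)
    ultimately show ?thesis
      by (subst emeasure_lborel_box) auto
  qed
  ultimately show "emeasure (distr lborel borel complex_of_vec) (box l u) = (\<Prod>b\<in>Basis. (u - l) \<bullet> b)"
    by (subst emeasure_distr) auto
qed auto

lemma lborel_distr_rotation:
  fixes a :: complex
  assumes a: "cmod a = 1"
  shows "distr lborel borel (\<lambda>w. a * w) = lborel"
proof -
  define rot :: "complex \<Rightarrow> real^2 \<Rightarrow> real^2" where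
    "rot b x = vector [Re b * x$1 - Im b * x$2, Re b * x$2 + Im b * x$1]" for b x
  have lin: "linear (rot b)" for b
    by (auto simp: rot_def linear_iff vec_eq_iff forall_2 algebra_simps)
  have n: "norm (x :: real^2) = sqrt ((x$1)\<^sup>2 + (x$2)\<^sup>2)" for x
    by (simp add: norm_vec_def L2_set_def sum_2)
  have orth: "orthogonal_transformation (rot b)" if "cmod b = 1" for b
  proof -
    have b: "(Re b)\<^sup>2 + (Im b)\<^sup>2 = 1" using that
      by (metis cmod_power2 one_power2)
    have "(Re b * x$1 - Im b * x$2)\<^sup>2 + (Re b * x$2 + Im b * x$1)\<^sup>2
        = ((Re b)\<^sup>2 + (Im b)\<^sup>2) * ((x$1)\<^sup>2 + (x$2)\<^sup>2)" for x :: "real^2"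
      by (simp add: power2_eq_square algebra_simps)
    then show ?thesis
      unfolding orthogonal_transformation by (simp add: lin n rot_def b)
  qed
  have meas: "rot b \<in> borel_measurable borel" for b
    by (intro borel_measurable_continuous_onI linear_continuous_on
        linear_conv_bounded_linear[THEN iffD1] lin)
  have inv: "rot (cnj a) (rot a x) = x" "rot a (rot (cnj a) x) = x" for x
  proof -
    have b: "(Re a)\<^sup>2 + (Im a)\<^sup>2 = 1" using a
      by (metis cmod_power2 one_power2)
    have 1: "Re a * (Re a * p) + Im a * (Im a * p) = p" for p
      using b by (metis distrib_right mult.assoc mult_1 power2_eq_square)
    show "rot (cnj a) (rot a x) = x" "rot a (rot (cnj a) x) = x"
      by (auto simp: rot_def vec_eq_iff forall_2 algebra_simps 1 1[unfolded add.commute[of "Re a * _"]])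
  qed
  have R: "distr lborel borel (rot a) = lborel"
  proof (rule lborel_eqI[symmetric])
    fix l u :: "real^2"
    assume lu: "\<And>b. b \<in> Basis \<Longrightarrow> l \<bullet> b \<le> u \<bullet> b"
    \<comment> \<open>The preimage is the image under the inverse rotation, whose measure is given
      by \<open>measure_orthogonal_image\<close>.\<close>
    have eq: "rot a -` box l u = rot (cnj a) ` box l u"
      using inv by (auto simp: image_iff) (metis inv)
    have oc: "orthogonal_transformation (rot (cnj a))" using a by (intro orth) simp
    have m: "rot (cnj a) ` box l u \<in> lmeasurable"
      by (intro measurable_orthogonal_image oc) simp
    have b: "rot a -` box l u \<in> sets borel"
      using measurable_sets[OF meas, of "box l u" a] by simp
    have "emeasure lborel (rot a -` box l u) = emeasure lebesgue (rot a -` box l u)"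
      using b by simp
    also have "\<dots> = ennreal (measure lebesgue (rot (cnj a) ` box l u))"
      unfolding eq using m by (simp add: emeasure_eq_measure2)
    also have "\<dots> = ennreal (measure lebesgue (box l u))"
      by (subst measure_orthogonal_image[OF oc]) auto
    also have "\<dots> = (\<Prod>b\<in>Basis. (u - l) \<bullet> b)"
      using emeasure_lborel_box[OF lu] by (simp add: measure_def)
    finally show "emeasure (distr lborel borel (rot a)) (box l u) = (\<Prod>b\<in>Basis. (u - l) \<bullet> b)"
      using meas by (subst emeasure_distr) auto
  qed auto
  have "distr lborel borel (\<lambda>w. a * w) = distr (distr lborel borel complex_of_vec) borel (\<lambda>w. a * w)"
    by (simp add: lborel_complex_distr_vec[symmetric])
  also have "\<dots> = distr lborel borel ((\<lambda>w. a * w) \<circ> complex_of_vec)"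
    by (rule distr_distr) auto
  also have "(\<lambda>w. a * w) \<circ> complex_of_vec = complex_of_vec \<circ> rot a"
    by (auto simp: complex_of_vec_def rot_def complex_eq_iff)
  also have "distr lborel borel (complex_of_vec \<circ> rot a) = distr (distr lborel borel (rot a)) borel complex_of_vec"
    using meas by (subst distr_distr) auto
  also have "\<dots> = lborel"
    unfolding R by (rule lborel_complex_distr_vec[symmetric])
  finally show ?thesis .
qed

text \<open>Period 1 instead of 2 pi, so that integrals over \<open>{0..1}\<close> are circle means
  without a normalising factor.\<close>

definition unit_e :: "real \<Rightarrow> complex" where "unit_e t = exp (2 * of_real pi * \<i> * of_real t)"

lemma norm_unit_e [simp]: "cmod (unit_e t) = 1"
  by (simp add: unit_e_def norm_exp_eq_Re)

lemma continuous_on_unit_e [continuous_intros]: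
  "continuous_on A g \<Longrightarrow> continuous_on A (\<lambda>x. unit_e (g x))"
  unfolding unit_e_def by (intro continuous_intros)

lemma measurable_unit_e [measurable]: "unit_e \<in> borel_measurable borel"
  by (intro borel_measurable_continuous_onI continuous_intros)

lemma has_integral_circle_mean:
  assumes "(g has_contour_integral I) (circlepath 0 r)"
  shows "((\<lambda>t. g (of_real r * unit_e t) * (of_real r * unit_e t)) has_integral I / (2 * pi * \<i>)) {0..1}"
proof -
  have "((\<lambda>t. g (circlepath 0 r t) * vector_derivative (circlepath 0 r) (at t)) has_integral I) {0..1}"
    using assms by (simp add: has_contour_integral)
  then have "((\<lambda>t. g (of_real r * unit_e t) * (2 * pi * \<i> * (of_real r * unit_e t))) has_integral I) {0..1}"
    unfolding vector_derivative_circlepath by (simp add: circlepath unit_e_def mult_ac)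
  from has_integral_mult_left[OF this, of "1 / (2 * pi * \<i>)"] show ?thesis
    by (simp add: mult_ac)
qed

lemma lborel_integrable_rotation:
  fixes F :: "complex \<Rightarrow> 'a::{banach, second_countable_topology}"
  assumes "integrable lborel F" "cmod a = 1"
  shows "integrable lborel (\<lambda>w. F (a * w))"
    and "integral\<^sup>L lborel (\<lambda>w. F (a * w)) = integral\<^sup>L lborel F"
proof -
  have F: "F \<in> borel_measurable borel" using assms(1) by auto
  have m: "(\<lambda>w. a * w) \<in> measurable lborel borel" by auto
  show "integrable lborel (\<lambda>w. F (a * w))"
    using integrable_distr_eq[OF m F] assms by (simp add: lborel_distr_rotation)
  show "integral\<^sup>L lborel (\<lambda>w. F (a * w)) = integral\<^sup>L lborel F"
    using integral_distr[OF m F] assms by (simp add: lborel_distr_rotation)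
qed

text \<open>Stands in for polar coordinates: rotations preserve the integral of \<open>F\<close>, so
  averaging over all rotations and exchanging the order by Fubini replaces \<open>F\<close> by its
  circle mean \<open>G\<close>, with no radial integration.\<close>

lemma lborel_integral_circle_average:
  fixes F G :: "complex \<Rightarrow> complex"
  assumes F: "integrable lborel F"
    and G: "AE w in lborel. ((\<lambda>t. F (unit_e t * w)) has_integral G w) {0..1}"
    and Gm: "G \<in> borel_measurable borel"
  shows "integral\<^sup>L lborel F = integral\<^sup>L lborel G"
proof -
  let ?f = "\<lambda>(t::real, w). indicator {0..1} t *\<^sub>R F (unit_e t * w)"
  have Fm [measurable]: "F \<in> borel_measurable borel" using F by auto
  have int: "integrable (lborel \<Otimes>\<^sub>M lborel) ?f"
  proof (rule lborel_pair.Fubini_integrable)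
    show "?f \<in> borel_measurable (lborel \<Otimes>\<^sub>M lborel)"
      by measurable
    have "(LINT w|lborel. norm (?f (t, w))) = indicator {0..1} t *\<^sub>R (LINT w|lborel. norm (F w))" for t
      using lborel_integrable_rotation(2)[of "\<lambda>w. norm (F w)" "unit_e t"] F
      by (simp add: integrable_norm_iff)
    moreover have "integrable lborel (\<lambda>t::real. indicator {0..1} t *\<^sub>R (LINT w|lborel. norm (F w)))"
      by (intro integrable_scaleR_left) auto
    ultimately show "integrable lborel (\<lambda>t. LINT w|lborel. norm (?f (t, w)))"
      by presburger
    show "AE t in lborel. integrable lborel (\<lambda>w. ?f (t, w))"
      using lborel_integrable_rotation(1)[OF F] by auto
  qed
  have "integral\<^sup>L lborel F = (LINT t|lborel. indicator {0..1::real} t *\<^sub>R integral\<^sup>L lborel F)"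
    by (subst integral_scaleR_left) auto
  also have "\<dots> = (LINT t|lborel. (LINT w|lborel. ?f (t, w)))"
    by (intro Bochner_Integration.integral_cong refl)
      (simp add: lborel_integrable_rotation(2)[OF F])
  also have "\<dots> = (LINT w|lborel. (LINT t|lborel. ?f (t, w)))"
    using lborel_pair.Fubini_integral[OF int] by simp
  also have "\<dots> = integral\<^sup>L lborel G"
  proof (rule integral_cong_AE)
    show "(\<lambda>w. LINT t|lborel. ?f (t, w)) \<in> borel_measurable lborel" by measurable
    show "G \<in> borel_measurable lborel" using Gm by simp
    have "AE w in lborel. integrable lborel (\<lambda>t. ?f (t, w))"
      using lborel_pair.AE_integrable_snd[OF int] by simp
    with G show "AE w in lborel. (LINT t|lborel. ?f (t, w)) = G w"
    proof eventually_elim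
      case (elim w)
      then have "set_integrable lborel {0..1} (\<lambda>t. F (unit_e t * w))"
        by (simp add: set_integrable_def)
      from set_borel_integral_eq_integral(2)[OF this] elim show ?case
        by (simp add: set_lebesgue_integral_def integral_unique)
    qed
  qed
  ultimately show ?thesis by simp
qed

section \<open>Planar integrals of negative powers of the modulus\<close>

lemma emeasure_cball_complex: "r \<ge> 0 \<Longrightarrow> emeasure lborel (cball (c::complex) r) = ennreal (pi * r\<^sup>2)"
  by (simp add: emeasure_cball unit_ball_vol_2 ennreal_mult' flip: ennreal_power)

text \<open>Layer-cake form of Tonelli: a radial function written as a tail integral of \<phi> sees
  only the areas of discs. This is another way around polar coordinates.\<close>

lemma nn_integral_layer_bound:
  fixes A :: "complex set" and \<phi> :: "real \<Rightarrow> ennreal"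
  assumes [measurable]: "A \<in> sets borel" "\<phi> \<in> borel_measurable borel"
  shows "(\<integral>\<^sup>+ w\<in>A. (\<integral>\<^sup>+ t\<in>{cmod w..}. \<phi> t \<partial>lborel) \<partial>lborel) = (\<integral>\<^sup>+ t. \<phi> t * emeasure lborel (A \<inter> cball 0 t) \<partial>lborel)"
proof -
  have "(\<integral>\<^sup>+ w\<in>A. (\<integral>\<^sup>+ t\<in>{cmod w..}. \<phi> t \<partial>lborel) \<partial>lborel)
      = (\<integral>\<^sup>+ w. (\<integral>\<^sup>+ t. \<phi> t * indicator {w\<in>A. cmod w \<le> t} w \<partial>lborel) \<partial>lborel)"
  proof (intro nn_integral_cong)
    fix w :: complex
    show "(\<integral>\<^sup>+ t\<in>{cmod w..}. \<phi> t \<partial>lborel) * indicator A w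
        = (\<integral>\<^sup>+ t. \<phi> t * indicator {w\<in>A. cmod w \<le> t} w \<partial>lborel)"
      by (cases "w \<in> A") (auto simp: indicator_def intro!: nn_integral_cong)
  qed
  also have "\<dots> = (\<integral>\<^sup>+ t. (\<integral>\<^sup>+ w. \<phi> t * indicator {w\<in>A. cmod w \<le> t} w \<partial>lborel) \<partial>lborel)"
    by (rule lborel_pair.Fubini') measurable
  also have "\<dots> = (\<integral>\<^sup>+ t. \<phi> t * emeasure lborel (A \<inter> cball 0 t) \<partial>lborel)"
  proof (intro nn_integral_cong)
    fix t :: real
    have "{w\<in>A. cmod w \<le> t} = A \<inter> cball 0 t" by auto
    then show "(\<integral>\<^sup>+ w. \<phi> t * indicator {w\<in>A. cmod w \<le> t} w \<partial>lborel) = \<phi> t * emeasure lborel (A \<inter> cball 0 t)"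
      by (simp add: nn_integral_cmult_indicator)
  qed
  finally show ?thesis .
qed

lemma nn_integral_inverse_powers:
  assumes "a > 0" "n > 0"
  shows "(\<integral>\<^sup>+ t\<in>{a..}. ennreal (real n / t ^ Suc n) \<partial>lborel) = ennreal (1 / a ^ n)"
proof -
  have "(\<integral>\<^sup>+ t\<in>{a..}. ennreal (real n / t ^ Suc n) \<partial>lborel) = ennreal (0 - (- (1 / a ^ n)))"
  proof (rule nn_integral_FTC_atLeast)
    fix x assume "a \<le> x"
    then have x: "x > 0" using assms by simp
    obtain m where m: "n = Suc m" using assms(2) by (cases n) auto
    consider "m = 0" | k where "m = Suc k" by (cases m) auto
    then show "((\<lambda>t. - (1 / t ^ n)) has_real_derivative real n / x ^ Suc n) (at x)"
      using x unfolding m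
      by cases ((auto intro!: derivative_eq_intros simp: field_simps; fail) |
        (auto intro!: derivative_eq_intros simp: field_simps simp del: power_Suc simp flip: power_Suc power_add; fail))+
    show "0 \<le> real n / x ^ Suc n" using x by simp
  next
    have "((\<lambda>t::real. 1 / t ^ n) \<longlongrightarrow> 0) at_top"
      by (intro tendsto_divide_0[OF tendsto_const] filterlim_at_top_imp_at_infinity
          filterlim_pow_at_top assms(2) filterlim_ident)
    from tendsto_minus[OF this] show "((\<lambda>t::real. - (1 / t ^ n)) \<longlongrightarrow> 0) at_top"
      by simp
  qed simp
  then show ?thesis by simp
qed

lemma nn_integral_inverse_norm_ball:
  assumes "s > 0"
  shows "(\<integral>\<^sup>+ w\<in>cball 0 s. ennreal (1 / cmod w) \<partial>lborel) \<le> ennreal (2 * pi * s)"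
proof -
  have "(\<integral>\<^sup>+ w\<in>cball 0 s. ennreal (1 / cmod w) \<partial>lborel)
     \<le> (\<integral>\<^sup>+ w\<in>cball 0 s. (\<integral>\<^sup>+ t\<in>{cmod w..}. ennreal (1 / t\<^sup>2) \<partial>lborel) \<partial>lborel)"
  proof (intro nn_integral_mono mult_right_mono)
    fix w :: complex
    \<comment> \<open>An equality for \<open>w \<noteq> 0\<close>; at \<open>w = 0\<close> the left
      side is 0 because \<open>1 / 0 = 0\<close>.\<close>
    show "ennreal (1 / cmod w) \<le> (\<integral>\<^sup>+ t\<in>{cmod w..}. ennreal (1 / t\<^sup>2) \<partial>lborel)"
      using nn_integral_inverse_powers[of "cmod w" 1] by (cases "w = 0") (auto simp: power2_eq_square)
  qed auto
  also have "\<dots> = (\<integral>\<^sup>+ t. ennreal (1 / t\<^sup>2) * emeasure lborel (cball 0 s \<inter> cball (0::complex) t) \<partial>lborel)"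
    by (rule nn_integral_layer_bound) auto
  \<comment> \<open>Split at \<open>t = s\<close>: the disc areas pi t^2 below and pi s^2 above
    contribute pi s each.\<close>
  also have "\<dots> \<le> (\<integral>\<^sup>+ t. ennreal pi * indicator {0..s} t + ennreal (pi * s\<^sup>2) * (ennreal (1 / t\<^sup>2) * indicator {s..} t) \<partial>lborel)"
  proof (intro nn_integral_mono)
    fix t :: real
    consider "t < 0" | "t = 0" | "0 < t" "t \<le> s" | "t > s" by linarith
    then show "ennreal (1 / t\<^sup>2) * emeasure lborel (cball 0 s \<inter> cball (0::complex) t)
      \<le> ennreal pi * indicator {0..s} t + ennreal (pi * s\<^sup>2) * (ennreal (1 / t\<^sup>2) * indicator {s..} t)"
    proof cases
      case 3
      then have "cball 0 s \<inter> cball (0::complex) t = cball 0 t" by auto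
      with 3 show ?thesis
        by (auto simp: emeasure_cball_complex indicator_def add_increasing2 simp flip: ennreal_mult)
    next
      case 4
      then have "cball 0 s \<inter> cball (0::complex) t = cball 0 s" by auto
      with 4 assms show ?thesis
        by (auto simp: emeasure_cball_complex indicator_def mult.commute)
    qed (use assms in auto)
  qed
  also have "\<dots> = ennreal pi * ennreal s + ennreal (pi * s\<^sup>2) * ennreal (1 / s)"
    using assms nn_integral_inverse_powers[of s 1]
    by (subst nn_integral_add) (auto simp: nn_integral_cmult power2_eq_square nn_integral_cmult_indicator)
  also have "\<dots> = ennreal (2 * pi * s)"
    using assms by (simp add: power2_eq_square flip: ennreal_mult ennreal_plus)
  finally show ?thesis .
qed

text \<open>With 1/|w|^3 as the tail integral of 3/t^4, the area of the annulus is bounded by that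
  of the whole disc; this gives 3 pi / s, where the exact value is 2 pi / s.\<close>

lemma nn_integral_inverse_norm_cube:
  assumes "s > 0"
  shows "(\<integral>\<^sup>+ w\<in>- ball 0 s. ennreal (1 / cmod w ^ 3) \<partial>lborel) \<le> ennreal (3 * pi / s)"
proof -
  have "(\<integral>\<^sup>+ w\<in>- ball 0 s. ennreal (1 / cmod w ^ 3) \<partial>lborel)
     \<le> (\<integral>\<^sup>+ w\<in>- ball 0 s. (\<integral>\<^sup>+ t\<in>{cmod w..}. ennreal (3 / t ^ 4) \<partial>lborel) \<partial>lborel)"
  proof (intro nn_integral_mono mult_right_mono)
    fix w :: complex
    show "ennreal (1 / cmod w ^ 3) \<le> (\<integral>\<^sup>+ t\<in>{cmod w..}. ennreal (3 / t ^ 4) \<partial>lborel)"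
      using nn_integral_inverse_powers[of "cmod w" 3] by (cases "w = 0") auto
  qed auto
  also have "\<dots> = (\<integral>\<^sup>+ t. ennreal (3 / t ^ 4) * emeasure lborel ((- ball 0 s) \<inter> cball (0::complex) t) \<partial>lborel)"
    by (rule nn_integral_layer_bound) auto
  also have "\<dots> \<le> (\<integral>\<^sup>+ t. ennreal (3 * pi) * (ennreal (1 / t\<^sup>2) * indicator {s..} t) \<partial>lborel)"
  proof (intro nn_integral_mono)
    fix t :: real
    show "ennreal (3 / t ^ 4) * emeasure lborel ((- ball 0 s) \<inter> cball (0::complex) t)
      \<le> ennreal (3 * pi) * (ennreal (1 / t\<^sup>2) * indicator {s..} t)"
    proof (cases "t < s")
      case True
      then have "(- ball 0 s) \<inter> cball (0::complex) t = {}" by auto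
      then show ?thesis by (metis emeasure_empty mult_zero_right zero_le)
    next
      case False
      then have t: "t > 0" "t \<ge> s" using assms by auto
      have "emeasure lborel ((- ball 0 s) \<inter> cball (0::complex) t) \<le> ennreal (pi * t\<^sup>2)"
        using t by (subst emeasure_cball_complex[symmetric, of _ 0]) (auto intro!: emeasure_mono)
      then have "ennreal (3 / t ^ 4) * emeasure lborel ((- ball 0 s) \<inter> cball (0::complex) t)
          \<le> ennreal (3 / t ^ 4) * ennreal (pi * t\<^sup>2)"
        by (rule mult_left_mono) simp
      also have "\<dots> = ennreal (3 * pi) * ennreal (1 / t\<^sup>2)"
        using t by (simp add: power_eq_if flip: ennreal_mult)
      finally show ?thesis using t by simp
    qed
  qed
  also have "\<dots> = ennreal (3 * pi) * ennreal (1 / s)"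
    using assms nn_integral_inverse_powers[of s 1]
    by (subst nn_integral_cmult) (auto simp: power2_eq_square)
  also have "\<dots> = ennreal (3 * pi / s)"
    using assms by (simp flip: ennreal_mult)
  finally show ?thesis .
qed

lemma pred_ball [measurable]: "Measurable.pred borel (\<lambda>x::complex. x \<in> ball c d)"
  and pred_cball [measurable]: "Measurable.pred borel (\<lambda>x::complex. x \<in> cball c d)"
  by (simp_all add: pred_def)

section \<open>Cauchy transforms of bounded functions and of a disc moment\<close>

lemma nn_integral_lborel_shift:
  fixes f :: "complex \<Rightarrow> ennreal"
  assumes [measurable]: "f \<in> borel_measurable borel"
  shows "(\<integral>\<^sup>+ w. f (c - w) \<partial>lborel) = (\<integral>\<^sup>+ w. f w \<partial>lborel)"
proof -
  have "(\<integral>\<^sup>+ w. f w \<partial>lborel) = (\<integral>\<^sup>+ w. f w \<partial>distr lborel borel ((+) c))"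
    by (simp add: lborel_distr_plus)
  also have "\<dots> = (\<integral>\<^sup>+ w. f (c + w) \<partial>lborel)"
    by (simp add: nn_integral_distr)
  also have "\<dots> = (\<integral>\<^sup>+ w. f (c + w) \<partial>distr lborel borel (\<lambda>w. (-1) * w))"
    by (subst lborel_distr_rotation) simp_all
  also have "\<dots> = (\<integral>\<^sup>+ w. f (c - w) \<partial>lborel)"
    by (subst nn_integral_distr; (measurable; fail)?)
  finally show ?thesis ..
qed

lemma lborel_integral_shift:
  fixes f :: "complex \<Rightarrow> complex"
  assumes [measurable]: "f \<in> borel_measurable borel"
  shows "(LINT w|lborel. f (c - w)) = (LINT w|lborel. f w)"
    and "integrable lborel (\<lambda>w. f (c - w)) \<longleftrightarrow> integrable lborel f"
proof -
  have d: "distr lborel borel (\<lambda>w. c - w) = (lborel :: complex measure)"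
  proof -
    have "distr lborel borel (\<lambda>w. c - w) = distr (distr lborel borel (\<lambda>w. (-1) * w)) borel ((+) c)"
      by (subst distr_distr; (measurable; fail)?) (simp add: o_def)
    also have "\<dots> = distr lborel borel ((+) c)"
      by (subst lborel_distr_rotation) auto
    finally show ?thesis by (simp add: lborel_distr_plus)
  qed
  show "(LINT w|lborel. f (c - w)) = (LINT w|lborel. f w)"
    using integral_distr[of "\<lambda>w. c - w" lborel borel f] by (simp add: d)
  show "integrable lborel (\<lambda>w. f (c - w)) \<longleftrightarrow> integrable lborel f"
    using integrable_distr_eq[of "\<lambda>w. c - w" lborel borel f] by (simp add: d)
qed

text \<open>The substitution of z - w for w centres the singularity at 0 and puts the support into
  the disc of radius \<open>s + cmod z\<close>, where 1/|w| is integrable.\<close>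

lemma Cauchy_kernel_bound:
  fixes f :: "complex \<Rightarrow> complex"
  assumes [measurable]: "f \<in> borel_measurable borel"
    and M: "\<And>w. cmod (f w) \<le> M" and supp: "\<And>w. f w \<noteq> 0 \<Longrightarrow> cmod w \<le> s" and s: "s > 0"
  shows "(\<integral>\<^sup>+ w. ennreal (cmod (f w / (z - w))) \<partial>lborel) \<le> ennreal (M * (2 * pi * (s + cmod z)))"
    and "integrable lborel (\<lambda>w. f w / (z - w))"
proof -
  have M0: "M \<ge> 0" using M[of 0] norm_ge_zero order_trans by blast
  have "(\<integral>\<^sup>+ w. ennreal (cmod (f w / (z - w))) \<partial>lborel)
      \<le> (\<integral>\<^sup>+ w. ennreal M * (ennreal (1 / cmod (z - w)) * indicator (cball 0 (s + cmod z)) (z - w)) \<partial>lborel)"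
  proof (intro nn_integral_mono)
    fix w
    show "ennreal (cmod (f w / (z - w))) \<le> ennreal M * (ennreal (1 / cmod (z - w)) * indicator (cball 0 (s + cmod z)) (z - w))"
    proof (cases "f w = 0")
      case False
      then have "cmod (z - w) \<le> s + cmod z"
        using supp[of w] norm_triangle_ineq4[of z w] by linarith
      moreover have "cmod (f w) / cmod (z - w) \<le> M / cmod (z - w)"
        by (intro divide_right_mono M) auto
      ultimately show ?thesis
        using M0 by (simp add: norm_divide flip: ennreal_mult)
    qed auto
  qed
  also have "\<dots> = (\<integral>\<^sup>+ w. ennreal M * (ennreal (1 / cmod w) * indicator (cball 0 (s + cmod z)) w) \<partial>lborel)"
    by (rule nn_integral_lborel_shift) measurable
  also have "\<dots> = ennreal M * (\<integral>\<^sup>+ w\<in>cball 0 (s + cmod z). ennreal (1 / cmod w) \<partial>lborel)"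
    by (rule nn_integral_cmult) measurable
  also have "\<dots> \<le> ennreal M * ennreal (2 * pi * (s + cmod z))"
    using s by (intro mult_left_mono nn_integral_inverse_norm_ball add_pos_nonneg) auto
  also have "\<dots> = ennreal (M * (2 * pi * (s + cmod z)))"
    using M0 s by (simp flip: ennreal_mult)
  finally show b: "(\<integral>\<^sup>+ w. ennreal (cmod (f w / (z - w))) \<partial>lborel) \<le> ennreal (M * (2 * pi * (s + cmod z)))" .
  show "integrable lborel (\<lambda>w. f w / (z - w))"
    using b by (intro integrableI_bounded) (auto intro: le_less_trans)
qed

text \<open>Minus the d-bar derivative of the bump max(0, d^2 - |w|^2). Integrating \<open>f\<close>
  against its translates therefore gives d-bar of a mollification of \<open>f\<close>, up to sign
  and normalisation, and makes sense for merely continuous \<open>f\<close>.\<close>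

definition disc_moment :: "real \<Rightarrow> complex \<Rightarrow> complex" where
  "disc_moment d w = indicator (ball 0 d) w *\<^sub>R w"

lemma disc_moment_measurable [measurable]: "disc_moment d \<in> borel_measurable borel"
  unfolding disc_moment_def by (intro borel_measurable_scaleR) measurable

lemma disc_moment_bound: "d > 0 \<Longrightarrow> cmod (disc_moment d w) \<le> d"
  by (auto simp: disc_moment_def indicator_def)

lemma disc_moment_supp: "disc_moment d w \<noteq> 0 \<Longrightarrow> cmod w \<le> d"
  by (auto simp: disc_moment_def indicator_def split: if_splits)

lemma AE_norm_neq: "AE w in lborel. cmod (w::complex) \<noteq> r"
proof (rule AE_I')
  show "sphere 0 r \<in> null_sets (lborel :: complex measure)"
    using negligible_sphere[of "0::complex" r]
    by (simp add: negligible_iff_null_sets null_sets_def)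
  show "{w \<in> space lborel. \<not> cmod w \<noteq> r} \<subseteq> sphere 0 r" by auto
qed

lemma contour_integral_inverse_circle:
  assumes "cmod a \<noteq> 1"
  shows "((\<lambda>\<zeta>. 1 / (\<zeta> - a)) has_contour_integral (if cmod a < 1 then 2 * pi * \<i> else 0)) (circlepath 0 1)"
proof (cases "cmod a < 1")
  case True
  have "((\<lambda>u. 1 / (u - a)) has_contour_integral (2 * of_real pi * \<i> * 1)) (circlepath 0 1)"
    by (rule Cauchy_integral_circlepath) (use True in auto)
  then show ?thesis using True by simp
next
  case False
  then have "((\<lambda>u. 1 / (u - a)) has_contour_integral 0) (circlepath 0 1)"
    using assms
    by (intro Cauchy_theorem_disc_simple[of _ 0 "cmod a"]) (auto intro!: holomorphic_intros)
  then show ?thesis using False by simp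
qed

text \<open>Pompeiu's formula for the bump max(0, d^2 - |w|^2). On the circle |w| = \<rho> the mean
  of w / (z - w) is -1 if \<rho> > |z| and 0 if \<rho> < |z|, so only minus the area of the annulus
  |z| < |w| < d remains.\<close>

lemma disc_moment_Cauchy:
  assumes d: "d > 0"
  shows "(LINT w|lborel. disc_moment d w / (z - w)) = - of_real (pi * max 0 (d\<^sup>2 - (cmod z)\<^sup>2))"
proof -
  let ?A = "ball 0 d - cball 0 (cmod z) :: complex set"
  have "(LINT w|lborel. disc_moment d w / (z - w)) = (LINT w|lborel. - (indicator ?A w *\<^sub>R (1::complex)))"
  proof (rule lborel_integral_circle_average)
    show "integrable lborel (\<lambda>w. disc_moment d w / (z - w))"
      using disc_moment_bound[OF d] disc_moment_supp d
      by (intro Cauchy_kernel_bound(2)[of _ d d]) auto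
    have "AE w in lborel. cmod w \<noteq> cmod z" "AE w in lborel. cmod (w::complex) \<noteq> 0"
      by (rule AE_norm_neq)+
    then show "AE w in lborel. ((\<lambda>t. disc_moment d (unit_e t * w) / (z - unit_e t * w)) has_integral
        - (indicator ?A w *\<^sub>R (1::complex))) {0..1}"
    proof eventually_elim
      case (elim w)
      then have w: "w \<noteq> 0" "cmod (z / w) \<noteq> 1" by (auto simp: norm_divide)
      have "((\<lambda>t. 1 / (unit_e t - z / w) * unit_e t) has_integral
          (if cmod (z / w) < 1 then 2 * pi * \<i> else 0) / (2 * pi * \<i>)) {0..1}"
        using has_integral_circle_mean[OF contour_integral_inverse_circle[OF w(2)]] by simp
      then have "((\<lambda>t. 1 / (unit_e t - z / w) * unit_e t) has_integral
          (if cmod (z / w) < 1 then 1 else 0)) {0..1}"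
        by (auto split: if_splits)
      from has_integral_mult_left[OF this, of "- indicator (ball 0 d) w"]
      have "((\<lambda>t. 1 / (unit_e t - z / w) * unit_e t * - indicator (ball 0 d) w) has_integral
          (if cmod (z / w) < 1 then 1 else 0) * - indicator (ball 0 d) w) {0..1}" .
      moreover have "(if cmod (z / w) < 1 then 1 else 0) * - indicator (ball 0 d) w = - (indicator ?A w *\<^sub>R (1::complex))"
        using w by (auto simp: indicator_def norm_divide)
      moreover have "1 / (unit_e t - z / w) * unit_e t * - indicator (ball 0 d) w
          = disc_moment d (unit_e t * w) / (z - unit_e t * w)" for t
      proof -
        have "unit_e t - z / w = - ((z - unit_e t * w) / w)" using w by (simp add: field_simps)
        moreover have "z \<noteq> unit_e t * w" using elim by (auto simp: norm_mult)
        ultimately show ?thesis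
          using w by (simp add: disc_moment_def indicator_def norm_mult field_simps)
      qed
      ultimately show ?case by simp
    qed
    show "(\<lambda>w. - (indicator ?A w *\<^sub>R (1::complex))) \<in> borel_measurable borel"
      by measurable
  qed
  also have "\<dots> = - of_real (measure lborel ?A)"
  proof -
    have "emeasure lborel ?A < \<infinity>"
      by (rule emeasure_bounded_finite) (simp add: bounded_diff)
    then show ?thesis
      unfolding integral_minus by (subst integral_scaleR_left) (auto simp: scaleR_conv_of_real)
  qed
  also have "measure lborel ?A = pi * max 0 (d\<^sup>2 - (cmod z)\<^sup>2)"
  proof (cases "cmod z < d")
    case True
    have "measure lborel ?A = measure lborel (ball (0::complex) d) - measure lborel (cball (0::complex) (cmod z))"
      using True by (intro measurable_measure_Diff) (auto simp: fmeasurable_def emeasure_bounded_finite[OF bounded_ball, unfolded infinity_ennreal_def])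
    also have "\<dots> = pi * d\<^sup>2 - pi * (cmod z)\<^sup>2"
      using d by (simp add: content_ball content_cball unit_ball_vol_2)
    finally show ?thesis using True by (simp add: algebra_simps max_def power_mono)
  next
    case False
    then have "?A = {}" by auto
    then have "measure lborel ?A = 0" by (metis measure_empty)
    moreover have "d\<^sup>2 \<le> (cmod z)\<^sup>2" using False d by (intro power_mono) auto
    ultimately show ?thesis by simp
  qed
  finally show ?thesis .
qed

text \<open>On each circle of radius below \<open>d\<close> the mean of f(\<zeta> - w) w is a
  multiple of a contour integral of a holomorphic function, hence 0 by Cauchy's theorem.\<close>

lemma disc_moment_holomorphic:
  assumes d: "d > 0" and f: "f holomorphic_on ball \<zeta> d" and cont: "continuous_on UNIV f"
  shows "(LINT w|lborel. f (\<zeta> - w) * disc_moment d w) = 0"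
proof -
  have [measurable]: "f \<in> borel_measurable borel"
    using cont by (rule borel_measurable_continuous_onI)
  have "compact (f ` cball \<zeta> d)"
    by (intro compact_continuous_image continuous_on_subset[OF cont]) auto
  then obtain M where M: "\<And>w. w \<in> cball \<zeta> d \<Longrightarrow> cmod (f w) \<le> M"
    using compact_imp_bounded bounded_iff by (metis imageI)
  have "(LINT w|lborel. f (\<zeta> - w) * disc_moment d w) = (LINT w|(lborel :: complex measure). (0::complex))"
  proof (rule lborel_integral_circle_average)
    show "integrable lborel (\<lambda>w. f (\<zeta> - w) * disc_moment d w)"
    proof (rule integrableI_bounded_set[where A = "cball 0 d" and B = "M * d"])
      show "AE w in lborel. w \<in> cball 0 d \<longrightarrow> cmod (f (\<zeta> - w) * disc_moment d w) \<le> M * d"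
      proof (intro AE_I2 impI)
        fix w :: complex assume "w \<in> cball 0 d"
        then have "cmod (f (\<zeta> - w)) \<le> M" by (intro M) (auto simp: dist_norm)
        then show "cmod (f (\<zeta> - w) * disc_moment d w) \<le> M * d"
          unfolding norm_mult using disc_moment_bound[OF d, of w]
          by (intro mult_mono) (auto intro: order_trans[OF norm_ge_zero])
      qed
      show "AE w in lborel. w \<notin> cball 0 d \<longrightarrow> f (\<zeta> - w) * disc_moment d w = 0"
        using disc_moment_supp by (intro AE_I2) fastforce
    qed (use d in \<open>auto simp: emeasure_cball_complex\<close>)
    show "AE w in lborel. ((\<lambda>t. f (\<zeta> - unit_e t * w) * disc_moment d (unit_e t * w)) has_integral 0) {0..1}"
    proof (rule AE_I2)
      fix w :: complex
      show "((\<lambda>t. f (\<zeta> - unit_e t * w) * disc_moment d (unit_e t * w)) has_integral 0) {0..1}"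
      proof (cases "w = 0 \<or> cmod w \<ge> d")
        case True
        then have "disc_moment d (unit_e t * w) = 0" for t
          by (auto simp: disc_moment_def norm_mult)
        then show ?thesis by simp
      next
        case False
        then have w: "w \<noteq> 0" "cmod w < d" by auto
        have "((\<lambda>x. f (\<zeta> - x * w) * w) has_contour_integral 0) (circlepath 0 1)"
        proof (rule Cauchy_theorem_disc_simple[of _ 0 "d / cmod w"])
          have "(\<lambda>x. \<zeta> - x * w) ` ball 0 (d / cmod w) \<subseteq> ball \<zeta> d"
            using w by (auto simp: dist_norm norm_mult field_simps)
          then show "(\<lambda>x. f (\<zeta> - x * w) * w) holomorphic_on ball 0 (d / cmod w)"
            by (intro holomorphic_intros holomorphic_on_compose_gen[OF _ f, unfolded o_def]) auto
          show "path_image (circlepath 0 1) \<subseteq> ball 0 (d / cmod w)"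
            using w by (auto simp: field_simps)
        qed auto
        from has_integral_circle_mean[OF this]
        have "((\<lambda>t. f (\<zeta> - unit_e t * w) * w * unit_e t) has_integral 0) {0..1}" by simp
        moreover have "disc_moment d (unit_e t * w) = w * unit_e t" for t
          using w by (simp add: disc_moment_def norm_mult)
        ultimately show ?thesis by (simp add: mult_ac)
      qed
    qed
  qed auto
  then show ?thesis by simp
qed

section \<open>Mergelyan's theorem\<close>

definition polyapprox :: "complex set \<Rightarrow> (complex \<Rightarrow> complex) \<Rightarrow> bool" where
  "polyapprox K f \<longleftrightarrow> (\<forall>e>0. \<exists>p. \<forall>z\<in>K. cmod (f z - poly p z) < e)"

lemma polyapprox_poly [simp]: "polyapprox K (\<lambda>z. poly p z)"
  unfolding polyapprox_def by (metis diff_self norm_zero)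

lemma polyapprox_const [simp]: "polyapprox K (\<lambda>z. c)"
  using polyapprox_poly[of K "[:c:]"] by simp

lemma polyapprox_ident [simp]: "polyapprox K (\<lambda>z. z)"
  using polyapprox_poly[of K "[:0, 1:]"] by simp

lemma polyapprox_cong: "(\<And>z. z \<in> K \<Longrightarrow> f z = g z) \<Longrightarrow> polyapprox K f \<longleftrightarrow> polyapprox K g"
  by (simp add: polyapprox_def)

lemma polyapprox_uniform_limit:
  assumes "\<And>e. e > 0 \<Longrightarrow> \<exists>g. polyapprox K g \<and> (\<forall>z\<in>K. cmod (f z - g z) < e)"
  shows "polyapprox K f"
  unfolding polyapprox_def
proof (intro allI impI)
  fix e :: real assume "e > 0"
  then have e: "e / 2 > 0" by simp
  obtain g where g: "polyapprox K g" "\<forall>z\<in>K. cmod (f z - g z) < e / 2"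
    using assms[OF e] by blast
  obtain p where p: "\<forall>z\<in>K. cmod (g z - poly p z) < e / 2"
    using g(1) e unfolding polyapprox_def by blast
  have "cmod (f z - poly p z) < e" if "z \<in> K" for z
    using g(2) p that norm_triangle_ineq[of "f z - g z" "g z - poly p z"] by fastforce
  then show "\<exists>p. \<forall>z\<in>K. cmod (f z - poly p z) < e" by blast
qed

lemma polyapprox_add:
  assumes "polyapprox K f" "polyapprox K g"
  shows "polyapprox K (\<lambda>z. f z + g z)"
  unfolding polyapprox_def
proof (intro allI impI)
  fix e :: real assume "e > 0"
  then have e: "e / 2 > 0" by simp
  obtain p q where p: "\<forall>z\<in>K. cmod (f z - poly p z) < e / 2" and q: "\<forall>z\<in>K. cmod (g z - poly q z) < e / 2"
    using assms e unfolding polyapprox_def by meson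
  have "cmod (f z + g z - poly (p + q) z) < e" if "z \<in> K" for z
  proof -
    have eq: "f z + g z - poly (p + q) z = (f z - poly p z) + (g z - poly q z)" by simp
    have "cmod (f z - poly p z) < e / 2" "cmod (g z - poly q z) < e / 2"
      using p q that by auto
    then show ?thesis
      unfolding eq using norm_triangle_ineq[of "f z - poly p z" "g z - poly q z"] by linarith
  qed
  then show "\<exists>p. \<forall>z\<in>K. cmod (f z + g z - poly p z) < e" by blast
qed

lemma polyapprox_bounded:
  assumes "polyapprox K f" "compact K"
  obtains B where "B > 0" "\<And>z. z \<in> K \<Longrightarrow> cmod (f z) \<le> B"
proof -
  obtain p where p: "\<forall>z\<in>K. cmod (f z - poly p z) < 1"
    using assms(1) unfolding polyapprox_def by (metis zero_less_one)
  have "compact (poly p ` K)"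
    by (intro compact_continuous_image assms(2) continuous_intros)
  then obtain B where B: "B > 0" "\<And>z. z \<in> K \<Longrightarrow> cmod (poly p z) \<le> B"
    by (metis bounded_pos compact_imp_bounded imageI)
  have "cmod (f z) \<le> B + 1" if "z \<in> K" for z
    using norm_triangle_ineq[of "f z - poly p z" "poly p z"] p B(2)[OF that] that by fastforce
  then show thesis using that[of "B + 1"] B(1) by simp
qed

lemma polyapprox_mult:
  assumes f: "polyapprox K f" and g: "polyapprox K g" and K: "compact K"
  shows "polyapprox K (\<lambda>z. f z * g z)"
  unfolding polyapprox_def
proof (intro allI impI)
  fix e :: real assume e: "e > 0"
  obtain B where B: "B > 0" "\<And>z. z \<in> K \<Longrightarrow> cmod (f z) \<le> B"
    using polyapprox_bounded[OF f K] by metis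
  obtain q where q: "\<forall>z\<in>K. cmod (g z - poly q z) < e / (2 * B)"
    using g e B(1) unfolding polyapprox_def by (metis divide_pos_pos mult_pos_pos zero_less_numeral)
  obtain C where C: "C > 0" "\<And>z. z \<in> K \<Longrightarrow> cmod (poly q z) \<le> C"
    using polyapprox_bounded[OF polyapprox_poly K] by blast
  obtain p where p: "\<forall>z\<in>K. cmod (f z - poly p z) < e / (2 * C)"
    using f e C(1) unfolding polyapprox_def by (metis divide_pos_pos mult_pos_pos zero_less_numeral)
  have "cmod (f z * g z - poly (p * q) z) < e" if z: "z \<in> K" for z
  proof -
    have "f z * g z - poly (p * q) z = f z * (g z - poly q z) + (f z - poly p z) * poly q z"
      by (simp add: algebra_simps)
    then have "cmod (f z * g z - poly (p * q) z) \<le> cmod (f z) * cmod (g z - poly q z) + cmod (f z - poly p z) * cmod (poly q z)"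
      by (metis norm_mult norm_triangle_ineq)
    also have "\<dots> \<le> B * cmod (g z - poly q z) + cmod (f z - poly p z) * C"
      using B C z by (intro add_mono mult_mono) auto
    also have "\<dots> < B * (e / (2 * B)) + (e / (2 * C)) * C"
      using p q z B(1) C(1) by (intro add_strict_mono mult_strict_left_mono mult_strict_right_mono) auto
    also have "\<dots> = e" using B(1) C(1) by simp
    finally show ?thesis .
  qed
  then show "\<exists>p. \<forall>z\<in>K. cmod (f z * g z - poly p z) < e" by blast
qed

lemma polyapprox_cmult: "polyapprox K f \<Longrightarrow> compact K \<Longrightarrow> polyapprox K (\<lambda>z. c * f z)"
  by (intro polyapprox_mult) auto

lemma polyapprox_minus: "polyapprox K f \<Longrightarrow> compact K \<Longrightarrow> polyapprox K (\<lambda>z. - f z)"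
  using polyapprox_cmult[of K f "-1"] by simp

lemma polyapprox_diff: "polyapprox K f \<Longrightarrow> polyapprox K g \<Longrightarrow> compact K \<Longrightarrow> polyapprox K (\<lambda>z. f z - g z)"
  using polyapprox_add[OF _ polyapprox_minus, of K f g] by simp

lemma polyapprox_power: "polyapprox K f \<Longrightarrow> compact K \<Longrightarrow> polyapprox K (\<lambda>z. f z ^ n)"
  by (induction n) (simp_all add: polyapprox_mult)

lemma polyapprox_sum:
  "(\<And>i. i \<in> A \<Longrightarrow> polyapprox K (f i)) \<Longrightarrow> polyapprox K (\<lambda>z. \<Sum>i\<in>A. f i z)"
  by (induction A rule: infinite_finite_induct) (simp_all add: polyapprox_add)

text \<open>The strict gap between the bound \<open>q\<close> on |f| and the radius \<open>r\<close>
  of convergence makes the partial sums converge uniformly on the image of \<open>K\<close>.\<close>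

lemma polyapprox_power_series:
  assumes f: "polyapprox K f" and K: "compact K"
    and a: "\<And>x. cmod x \<le> r \<Longrightarrow> (\<lambda>n. a n * x ^ n) sums F x"
    and r: "r > 0" and fr: "\<And>z. z \<in> K \<Longrightarrow> cmod (f z) \<le> q" and q: "q < r"
  shows "polyapprox K (\<lambda>z. F (f z))"
proof (rule polyapprox_uniform_limit)
  fix e :: real assume e: "e > 0"
  have "summable (\<lambda>n. a n * complex_of_real r ^ n)"
    using sums_summable[OF a[of "of_real r"]] r by simp
  from conv_radius_geI[OF this] have "ereal r \<le> conv_radius a"
    using r by simp
  then have "ereal (max q 0) < conv_radius a"
    using q r by (intro order.strict_trans2[OF _ \<open>ereal r \<le> conv_radius a\<close>]) auto
  from uniform_limitD[OF powser_uniform_limit[OF this, of 0] e]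
  obtain k where k: "\<forall>x\<in>cball 0 (max q 0). dist (\<Sum>n<k. a n * (x - 0) ^ n) (\<Sum>n. a n * (x - 0) ^ n) < e"
    unfolding eventually_sequentially by blast
  have "cmod (F (f z) - (\<Sum>n<k. a n * f z ^ n)) < e" if "z \<in> K" for z
  proof -
    have "cmod (f z) \<le> r" using fr[OF that] q by linarith
    then have "F (f z) = (\<Sum>n. a n * f z ^ n)"
      by (rule sums_unique[OF a])
    moreover have "f z \<in> cball 0 (max q 0)" using fr[OF that] by simp
    ultimately show ?thesis
      using k[rule_format, of "f z"] by (simp add: dist_norm norm_minus_commute)
  qed
  moreover have "polyapprox K (\<lambda>z. \<Sum>n<k. a n * f z ^ n)"
    by (intro polyapprox_sum polyapprox_cmult polyapprox_power f K)
  ultimately show "\<exists>g. polyapprox K g \<and> (\<forall>z\<in>K. cmod (F (f z) - g z) < e)"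
    by (intro exI[of _ "\<lambda>z. \<Sum>n<k. a n * f z ^ n"]) simp
qed

lemma polyapprox_exp:
  assumes f: "polyapprox K f" and K: "compact K"
  shows "polyapprox K (\<lambda>z. exp (f z))"
proof -
  obtain B where B: "B > 0" "\<And>z. z \<in> K \<Longrightarrow> cmod (f z) \<le> B"
    using polyapprox_bounded[OF f K] by metis
  show ?thesis
  proof (rule polyapprox_power_series[OF f K, of "B + 1" "\<lambda>n. inverse (fact n)" exp B])
    fix x :: complex
    have "inverse (fact n) * x ^ n = x ^ n /\<^sub>R fact n" for n
      by (simp add: scaleR_conv_of_real of_real_inverse)
    then show "(\<lambda>n. inverse (fact n) * x ^ n) sums exp x"
      using exp_converges[of x] by simp
  qed (use B in simp_all)
qed

lemma polyapprox_inverse_one_minus: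
  assumes f: "polyapprox K f" and K: "compact K" and q: "\<And>z. z \<in> K \<Longrightarrow> cmod (f z) \<le> q" "q < 1"
  shows "polyapprox K (\<lambda>z. 1 / (1 - f z))"
\<comment> \<open>A radius halfway between the bound and 1. The maximum with 0 covers an empty
  \<open>K\<close>, where \<open>q\<close> may be negative.\<close>
proof (rule polyapprox_power_series[OF f K, of "(max q 0 + 1) / 2" "\<lambda>n. 1" "\<lambda>x. 1 / (1 - x)" "max q 0"])
  fix x :: complex assume "cmod x \<le> (max q 0 + 1) / 2"
  then have "cmod x < 1" using q(2) by auto
  from geometric_sums[OF this] show "(\<lambda>n. 1 * x ^ n) sums (1 / (1 - x))" by simp
next
  fix z assume "z \<in> K"
  from q(1)[OF this] show "cmod (f z) \<le> max q 0" by simp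
qed (use q(2) in \<open>simp_all add: max_def\<close>)

lemma polyapprox_Ln_one_plus:
  assumes f: "polyapprox K f" and K: "compact K" and q: "\<And>z. z \<in> K \<Longrightarrow> cmod (f z) \<le> q" "q < 1"
  shows "polyapprox K (\<lambda>z. Ln (1 + f z))"
proof (rule polyapprox_power_series[OF f K, of "(max q 0 + 1) / 2" "\<lambda>n. (-1) ^ Suc n / of_nat n" "\<lambda>x. Ln (1 + x)" "max q 0"])
  fix x :: complex assume "cmod x \<le> (max q 0 + 1) / 2"
  then have "cmod x < 1" using q(2) by auto
  then show "(\<lambda>n. (-1) ^ Suc n / of_nat n * x ^ n) sums Ln (1 + x)" by (rule Ln_series)
next
  fix z assume "z \<in> K"
  from q(1)[OF this] show "cmod (f z) \<le> max q 0" by simp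
qed (use q(2) in \<open>simp_all add: max_def\<close>)

section \<open>Pole pushing\<close>

lemma polyapprox_pole:
  assumes K: "compact K" and conn: "connected (- K)" and t: "t \<notin> K"
  shows "polyapprox K (\<lambda>z. 1 / (t - z))"
proof -
  \<comment> \<open>A pole can move by less than its distance to \<open>K\<close>: 1 / (s - z) is 1
    / (t - z) times a geometric series in (t - s) / (t - z), whose modulus stays below 1 on
    \<open>K\<close>.\<close>
  have step: "polyapprox K (\<lambda>z. 1 / (s - z))"
    if "polyapprox K (\<lambda>z. 1 / (t - z))" and d: "\<And>z. z \<in> K \<Longrightarrow> d \<le> cmod (t - z)" "0 < d" "cmod (t - s) < d" for s t d
  proof -
    have "polyapprox K (\<lambda>z. (1 / (t - z)) * (1 / (1 - (t - s) * (1 / (t - z)))))"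
    proof (rule polyapprox_mult[OF that(1) _ K])
      have "polyapprox K (\<lambda>z. (t - s) * (1 / (t - z)))" by (rule polyapprox_cmult[OF that(1) K])
      moreover have "cmod ((t - s) * (1 / (t - z))) \<le> cmod (t - s) / d" if "z \<in> K" for z
      proof -
        have "1 / cmod (t - z) \<le> 1 / d" using d(1)[OF that] d(2) by (intro divide_left_mono mult_pos_pos) auto
        from mult_left_mono[OF this, of "cmod (t - s)"] show ?thesis
          by (simp add: norm_mult norm_divide)
      qed
      moreover have "cmod (t - s) / d < 1" using d by simp
      ultimately show "polyapprox K (\<lambda>z. 1 / (1 - (t - s) * (1 / (t - z))))"
        using polyapprox_inverse_one_minus[OF _ K, of "\<lambda>z. (t - s) * (1 / (t - z))" "cmod (t - s) / d"] by blast
    qed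
    moreover have "(1 / (t - z)) * (1 / (1 - (t - s) * (1 / (t - z)))) = 1 / (s - z)" if "z \<in> K" for z
    proof -
      have tz: "t - z \<noteq> 0" using d(1)[OF that] d(2) by auto
      then have "1 - (t - s) * (1 / (t - z)) = (s - z) / (t - z)"
        by (simp add: diff_divide_eq_iff)
      then show ?thesis using tz by simp
    qed
    ultimately show ?thesis
      using polyapprox_cong[of K "\<lambda>z. (1 / (t - z)) * (1 / (1 - (t - s) * (1 / (t - z))))" "\<lambda>z. 1 / (s - z)"] by blast
  qed
  have clo: "closed K" using K by (rule compact_imp_closed)
  obtain B where B: "B > 0" "\<And>z. z \<in> K \<Longrightarrow> cmod z \<le> B"
    using compact_imp_bounded[OF K] bounded_pos by metis
  \<comment> \<open>Twice the bound on \<open>K\<close>, so that |z / a| \<le> 1/2 and the geometric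
    series for 1 / (a - z) converges uniformly.\<close>
  define a where "a = complex_of_real (2 * B)"
  have aK: "a \<notin> K" using B by (force simp: a_def)
  have far: "polyapprox K (\<lambda>z. 1 / (a - z))"
  proof -
    have "polyapprox K (\<lambda>z. (1 / a) * (1 / (1 - (1 / a) * z)))"
    proof (intro polyapprox_mult K polyapprox_const)
      show "polyapprox K (\<lambda>z. 1 / (1 - (1 / a) * z))"
      proof (rule polyapprox_inverse_one_minus[of _ _ "1 / 2"])
        fix z assume "z \<in> K"
        then have "cmod z / (2 * B) \<le> B / (2 * B)" using B by (intro divide_right_mono) auto
        then show "cmod (1 / a * z) \<le> 1 / 2"
          using B(1) by (simp add: a_def norm_mult norm_divide)
      qed (use polyapprox_cmult[OF polyapprox_ident K, of "1 / a"] K in simp_all)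
    qed
    moreover have "(1 / a) * (1 / (1 - (1 / a) * z)) = 1 / (a - z)" for z
    proof -
      have "a \<noteq> 0" using B by (simp add: a_def)
      then have "1 - (1 / a) * z = (a - z) / a" by (simp add: diff_divide_distrib)
      then show ?thesis using \<open>a \<noteq> 0\<close> by simp
    qed
    ultimately show ?thesis by simp
  qed
  \<comment> \<open>Approximability passes back and forth between nearby poles; as the complement is
    connected, it reaches \<open>t\<close> from the distant point \<open>a\<close>.\<close>
  let ?R = "\<lambda>x y. polyapprox K (\<lambda>z. 1 / (x - z)) \<longleftrightarrow> polyapprox K (\<lambda>z. 1 / (y - z))"
  have "?R a t"
  proof (rule connected_equivalence_relation[OF conn, where R = ?R])
    fix x assume "x \<in> - K"
    then obtain d where d: "d > 0" "ball x d \<subseteq> - K"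
      using clo open_contains_ball by (metis open_Compl)
    have dx: "d \<le> cmod (x - z)" if "z \<in> K" for z
      using d that by (force simp: dist_norm)
    \<comment> \<open>Half of the distance \<open>d\<close> works in both directions, since
      \<open>y\<close> is still at distance at least \<open>d / 2\<close> from
      \<open>K\<close>.\<close>
    have "?R x y" if y: "y \<in> ball x (d / 2)" for y
    proof
      assume "polyapprox K (\<lambda>z. 1 / (x - z))"
      then show "polyapprox K (\<lambda>z. 1 / (y - z))"
        using step[of x d y] dx y d by (auto simp: dist_norm)
    next
      have "d / 2 \<le> cmod (y - z)" if "z \<in> K" for z
        using dx[OF that] y norm_triangle_ineq[of "x - y" "y - z"] by (simp add: dist_norm)
      moreover assume "polyapprox K (\<lambda>z. 1 / (y - z))"
      ultimately show "polyapprox K (\<lambda>z. 1 / (x - z))"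
        using step[of y "d / 2" x] y d by (auto simp: dist_norm norm_minus_commute)
    qed
    moreover have "ball x (d / 2) \<subseteq> - K"
      using subset_ball[of "d / 2" d x] d by auto
    then have "openin (top_of_set (- K)) (ball x (d / 2))"
      using clo by (simp add: openin_open_eq open_Compl)
    ultimately show "\<exists>T. openin (top_of_set (- K)) T \<and> x \<in> T \<and> (\<forall>y\<in>T. ?R x y)"
      using d by (intro exI[of _ "ball x (d / 2)"]) auto
  qed (use aK t in auto)
  with far show ?thesis by simp
qed

section \<open>Logarithms off the set and local approximants of the Cauchy kernel\<close>

lemma connected_component_reaches_sphere:
  fixes c :: complex
  assumes K: "compact K" and conn: "connected (- K)" and c: "c \<notin> K" and d: "d > 0"
  obtains q where "q \<in> connected_component_set (- K \<inter> ball c (2 * d)) c" "cmod (q - c) = d"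
proof -
  define W where "W = - K \<inter> ball c (2 * d)"
  define U where "U = connected_component_set W c"
  have oW: "open W" using K by (auto simp: W_def compact_imp_closed open_Compl)
  have cW: "c \<in> W" using c d by (simp add: W_def)
  have cU: "c \<in> U" using cW by (simp add: U_def)
  have connU: "connected U" by (simp add: U_def)
  have UW: "U \<subseteq> W" by (simp add: U_def connected_component_subset)
  have "\<exists>q\<in>U. cmod (q - c) = d"
  proof (rule ccontr)
    \<comment> \<open>Otherwise the component stays inside the disc of radius \<open>d\<close> and
      does not feel the truncation to \<open>ball c (2 * d)\<close>. It is then clopen in
      \<open>- K\<close>, hence equal to it, although \<open>- K\<close> is unbounded.\<close>
    assume neg: "\<not> (\<exists>q\<in>U. cmod (q - c) = d)"
    have U: "cmod (x - c) < d" if "x \<in> U" for x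
    proof (rule ccontr)
      assume "\<not> cmod (x - c) < d"
      moreover have "connected ((\<lambda>x. cmod (x - c)) ` U)"
        by (intro connected_continuous_image connU continuous_intros)
      ultimately have "d \<in> (\<lambda>x. cmod (x - c)) ` U"
        by (intro connectedD_interval[of "(\<lambda>x. cmod (x - c)) ` U" "cmod (c - c)" "cmod (x - c)" d])
          (use cU that d in auto)
      with neg show False by auto
    qed
    have "- K \<inter> closure U \<subseteq> U"
    proof
      fix x assume x: "x \<in> - K \<inter> closure U"
      have "closure U \<subseteq> cball c d"
        using U by (intro closure_minimal) (auto simp: dist_norm norm_minus_commute less_imp_le)
      with x d have "x \<in> W" by (force simp: W_def)
      moreover have "closedin (top_of_set W) U"
        unfolding U_def by (rule closedin_connected_component)
      then obtain T where "closed T" "U = W \<inter> T"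
        unfolding closedin_closed by blast
      ultimately show "x \<in> U" using x closure_minimal[of U T] by blast
    qed
    then have "closedin (top_of_set (- K)) U"
      using UW closure_subset[of U] unfolding closedin_closed W_def
      by (intro exI[of _ "closure U"]) auto
    moreover have "openin (top_of_set (- K)) U"
      using UW oW by (auto simp: openin_open_eq K compact_imp_closed open_Compl W_def U_def open_connected_component)
    ultimately have "U = - K"
      using conn cU unfolding connected_clopen by blast
    then have "bounded (- K)"
      using U by (metis bounded_ball bounded_subset dist_commute dist_norm mem_ball subsetI)
    then show False
      using cobounded_imp_unbounded[of "- K"] compact_imp_bounded[OF K] by simp
  qed
  then show thesis using that by (auto simp: U_def W_def)
qed

text \<open>Both arguments lie in (-pi/2, pi/2), so their difference stays in the principal
  strip.\<close>

lemma Ln_divide_pos: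
  assumes "Re x > 0" "Re y > 0"
  shows "Ln (x / y) = Ln x - Ln y"
proof -
  have nz: "x \<noteq> 0" "y \<noteq> 0" using assms by auto
  have "\<bar>Im (Ln x)\<bar> < pi / 2" "\<bar>Im (Ln y)\<bar> < pi / 2"
    using assms nz Re_Ln_pos_lt by auto
  then have "Ln (exp (Ln x - Ln y)) = Ln x - Ln y"
    by (intro Ln_exp) auto
  then show ?thesis using nz by (simp add: exp_diff)
qed

lemma Re_quotient_pos:
  fixes t c z :: complex
  assumes "cmod (t - c) < r" "cmod (z - c) \<ge> r"
  shows "Re ((t - z) / (c - z)) > 0"
proof -
  have nz: "cmod (c - z) > 0" "c - z \<noteq> 0"
    using assms norm_ge_zero[of "t - c"] by (auto simp: norm_minus_commute simp del: norm_ge_zero)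
  then have eq: "(t - z) / (c - z) = 1 + (t - c) / (c - z)"
    by (simp add: add_divide_eq_iff)
  have "cmod ((t - c) / (c - z)) < 1"
    using assms nz by (simp add: norm_divide norm_minus_commute)
  then have "\<bar>Re ((t - c) / (c - z))\<bar> < 1"
    using abs_Re_le_cmod le_less_trans by blast
  then show ?thesis unfolding eq by simp
qed

text \<open>
  A logarithm of \<open>(q - z) / (c - z)\<close> exists on \<open>K\<close> because \<open>c\<close> and \<open>q\<close> can be joined off \<open>K\<close>; joining them
  inside a small disc forces it to be the principal branch away from that disc.
\<close>

lemma polyapprox_log_quotient:
  assumes K: "compact K" and conn: "connected (- K)"
    and q: "q \<in> connected_component_set (- K \<inter> ball c r) c"
  obtains l where "polyapprox K l" "\<And>z. z \<in> K \<Longrightarrow> exp (l z) = (q - z) / (c - z)"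
    "\<And>z. z \<in> K \<Longrightarrow> cmod (z - c) \<ge> r \<Longrightarrow> l z = Ln ((q - z) / (c - z))"
proof -
  define W where "W = - K \<inter> ball c r"
  define U where "U = connected_component_set W c"
  have oW: "open W" using K by (auto simp: W_def compact_imp_closed open_Compl)
  have qU: "q \<in> U" using q by (simp add: U_def W_def)
  have cU: "c \<in> U"
    using q unfolding U_def W_def by (metis connected_component_eq_empty connected_component_refl emptyE mem_Collect_eq)
  have UW: "U \<subseteq> W" by (simp add: U_def connected_component_subset)
  \<comment> \<open>Logarithms of (t' - z) / (t - z), normalised outside the disc relative to the
    base point \<open>c\<close>. With this normalisation the values add along chains of points, so
    \<open>R\<close> is symmetric and transitive and has to be checked only locally.\<close>
  define R where "R t t' \<longleftrightarrow> (\<exists>l. polyapprox K l \<and> (\<forall>z\<in>K. exp (l z) = (t' - z) / (t - z)) \<and>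
      (\<forall>z\<in>K. cmod (z - c) \<ge> r \<longrightarrow> l z = Ln ((t' - z) / (c - z)) - Ln ((t - z) / (c - z))))" for t t'
  have "R c q"
  proof (rule connected_equivalence_relation[of U])
    show "R y x" if "R x y" "x \<in> U" "y \<in> U" for x y
    proof -
      from that(1) obtain l where l: "polyapprox K l" "\<forall>z\<in>K. exp (l z) = (y - z) / (x - z)"
        "\<forall>z\<in>K. cmod (z - c) \<ge> r \<longrightarrow> l z = Ln ((y - z) / (c - z)) - Ln ((x - z) / (c - z))"
        unfolding R_def by blast
      show ?thesis unfolding R_def
        using l polyapprox_minus[OF l(1) K] by (intro exI[of _ "\<lambda>z. - l z"]) (simp add: exp_minus)
    qed
    show "R x z" if xy: "R x y" and yz: "R y z" and U: "x \<in> U" "y \<in> U" "z \<in> U" for x y z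
    proof -
      from xy obtain l where l: "polyapprox K l" "\<forall>w\<in>K. exp (l w) = (y - w) / (x - w)"
        "\<forall>w\<in>K. cmod (w - c) \<ge> r \<longrightarrow> l w = Ln ((y - w) / (c - w)) - Ln ((x - w) / (c - w))"
        unfolding R_def by blast
      from yz obtain k where k: "polyapprox K k" "\<forall>w\<in>K. exp (k w) = (z - w) / (y - w)"
        "\<forall>w\<in>K. cmod (w - c) \<ge> r \<longrightarrow> k w = Ln ((z - w) / (c - w)) - Ln ((y - w) / (c - w))"
        unfolding R_def by blast
      have "y \<notin> K" using U UW by (auto simp: W_def)
      then have "\<forall>w\<in>K. exp (l w + k w) = (z - w) / (x - w)"
        using l(2) k(2) by (auto simp: exp_add)
      then show ?thesis unfolding R_def
        using l k polyapprox_add[OF l(1) k(1)] by (intro exI[of _ "\<lambda>z. l z + k z"]) simp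
    qed
    fix t assume t: "t \<in> U"
    then obtain e where e: "e > 0" "ball t e \<subseteq> U"
      using open_connected_component[OF oW, of c] open_contains_ball unfolding U_def by blast
    \<comment> \<open>For \<open>t'\<close> within \<open>e / 2\<close> of \<open>t\<close> the
      quotient is within 1/2 of 1, where the power series of \<open>Ln\<close> applies.\<close>
    have "R t t'" if t': "t' \<in> ball t (e / 2)" for t'
    proof -
      have ez: "e \<le> cmod (t - z)" if "z \<in> K" for z
        using e that UW by (force simp: W_def dist_norm)
      have t'U: "t' \<in> U" using t' e by auto
      have far: "cmod ((t' - t) * (1 / (t - z))) \<le> 1 / 2" if "z \<in> K" for z
      proof -
        have "cmod (t' - t) / cmod (t - z) \<le> (e / 2) / e"
          using ez[OF that] t' e by (intro frac_le) (auto simp: dist_norm norm_minus_commute)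
        then show ?thesis using e by (simp add: norm_mult norm_divide)
      qed
      have eq: "1 + (t' - t) * (1 / (t - z)) = (t' - z) / (t - z)" if "z \<in> K" for z
      proof -
        have "t - z \<noteq> 0" using ez[OF that] e by auto
        then have "1 + (t' - t) * (1 / (t - z)) = (t - z + (t' - t)) / (t - z)"
          by (simp only: add_divide_distrib) simp
        then show ?thesis by simp
      qed
      have "polyapprox K (\<lambda>z. Ln (1 + (t' - t) * (1 / (t - z))))"
      proof (rule polyapprox_Ln_one_plus[OF _ K far])
        show "polyapprox K (\<lambda>z. (t' - t) * (1 / (t - z)))"
          using t UW by (intro polyapprox_cmult[OF polyapprox_pole[OF K conn] K]) (auto simp: W_def)
      qed auto
      moreover have "exp (Ln (1 + (t' - t) * (1 / (t - z)))) = (t' - z) / (t - z)" if "z \<in> K" for z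
        unfolding eq[OF that] using t t'U UW that by (intro exp_Ln) (auto simp: W_def)
      moreover have "Ln (1 + (t' - t) * (1 / (t - z))) = Ln ((t' - z) / (c - z)) - Ln ((t - z) / (c - z))"
        if "z \<in> K" "cmod (z - c) \<ge> r" for z
      proof -
        have "cmod (t - c) < r" "cmod (t' - c) < r"
          using t t'U UW by (auto simp: W_def dist_norm norm_minus_commute)
        then have "Re ((t' - z) / (c - z)) > 0" "Re ((t - z) / (c - z)) > 0"
          using that by (auto intro: Re_quotient_pos)
        from Ln_divide_pos[OF this] show ?thesis
          unfolding eq[OF that(1)] using \<open>Re ((t - z) / (c - z)) > 0\<close> by (auto simp: divide_simps split: if_splits)
      qed
      ultimately show ?thesis unfolding R_def by blast
    qed
    moreover have "ball t (e / 2) \<subseteq> U"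
      using subset_ball[of "e / 2" e t] e by auto
    then have "openin (top_of_set U) (ball t (e / 2))"
      unfolding U_def by (simp add: openin_open_eq open_connected_component[OF oW])
    ultimately show "\<exists>T. openin (top_of_set U) T \<and> t \<in> T \<and> (\<forall>x\<in>T. R t x)"
      using e by (intro exI[of _ "ball t (e / 2)"]) auto
  qed (use qU cU in \<open>auto simp: U_def\<close>)
  then obtain l where l: "polyapprox K l" "\<forall>w\<in>K. exp (l w) = (q - w) / (c - w)"
    "\<forall>w\<in>K. cmod (w - c) \<ge> r \<longrightarrow> l w = Ln ((q - w) / (c - w)) - Ln ((c - w) / (c - w))"
    unfolding R_def by blast
  have "c \<notin> K" using cU UW by (auto simp: W_def)
  then have "(c - w) / (c - w) = 1" if "w \<in> K" for w using that by auto
  with l that show thesis by simp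
qed

text \<open>With \<open>g\<close> close to 1/v, the expression g + a g^2 matches the first two terms
  of 1/(v - a) = 1/v + a/v^2 + a^2/(v^2 (v - a)), and the remainder has cubic decay. In
  \<open>Mergelyan_block\<close>, v = z - m and a = \<zeta> - m.\<close>

lemma kernel_error_bound:
  fixes v a g :: complex
  assumes d: "d > 0" and \<rho>: "\<rho> \<ge> 2 * d" and v: "cmod v \<ge> 3 / 4 * \<rho>" and g: "cmod g \<le> 8 / 3 / \<rho>"
    and gv: "cmod (g - 1 / v) \<le> d\<^sup>2 / \<rho> ^ 3" and a: "cmod a \<le> 5 / 2 * d"
    and D: "cmod (v - a) \<le> 2 * \<rho>" "v \<noteq> a"
  shows "cmod (g + a * g\<^sup>2 - 1 / (v - a)) \<le> 100 * d\<^sup>2 / cmod (v - a) ^ 3"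
proof -
  define D' where "D' = cmod (v - a)"
  have \<rho>0: "\<rho> > 0" using d \<rho> by linarith
  have D0: "D' > 0" "D' \<le> 2 * \<rho>" using D by (auto simp: D'_def)
  have v0: "v \<noteq> 0" using v \<rho>0 by auto
  have va: "v - a \<noteq> 0" using D by simp
  have "1 / (v - a) = 1 / v + a / v\<^sup>2 + a\<^sup>2 / (v\<^sup>2 * (v - a))"
  proof -
    have "1 / v + a / v\<^sup>2 + a\<^sup>2 / (v\<^sup>2 * (v - a)) = (v * (v - a) + a * (v - a) + a\<^sup>2) / (v\<^sup>2 * (v - a))"
      using v0 va by (simp add: add_divide_distrib power2_eq_square)
    also have "v * (v - a) + a * (v - a) + a\<^sup>2 = v\<^sup>2" by (simp add: power2_eq_square algebra_simps)
    finally show ?thesis using v0 by simp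
  qed
  moreover have "(g - 1 / v) * (g + 1 / v) = g\<^sup>2 - 1 / v\<^sup>2"
  proof -
    have "(x - y) * (x + y) = x\<^sup>2 - y\<^sup>2" for x y :: complex
      by (simp add: power2_eq_square algebra_simps)
    from this[of g "1 / v"] show ?thesis by (simp add: power_divide)
  qed
  ultimately have eq: "g + a * g\<^sup>2 - 1 / (v - a) = (g - 1 / v) + a * ((g - 1 / v) * (g + 1 / v)) - a\<^sup>2 / (v\<^sup>2 * (v - a))"
    by (simp add: right_diff_distrib)
  have iv: "cmod (1 / v) \<le> 4 / 3 / \<rho>"
    using v \<rho>0 v0 by (simp add: norm_divide divide_simps)
  have "cmod (g + 1 / v) \<le> 8 / 3 / \<rho> + 4 / 3 / \<rho>"
    using norm_triangle_ineq[of g "1 / v"] g iv by linarith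
  also have "\<dots> = 4 / \<rho>" by (simp add: add_divide_distrib[symmetric])
  finally have gp: "cmod (g + 1 / v) \<le> 4 / \<rho>" .
  have t2: "cmod (a * ((g - 1 / v) * (g + 1 / v))) \<le> (5 / 2 * d) * ((d\<^sup>2 / \<rho> ^ 3) * (4 / \<rho>))"
    unfolding norm_mult using \<rho>0 d by (intro mult_mono a gv gp mult_nonneg_nonneg) auto
  also have "\<dots> = 5 * (2 * d / \<rho>) * (d\<^sup>2 / \<rho> ^ 3)" by (simp add: mult_ac)
  also have "\<dots> \<le> 5 * 1 * (d\<^sup>2 / \<rho> ^ 3)"
    using \<rho>0 \<rho> d by (intro mult_right_mono mult_left_mono) auto
  finally have t2: "cmod (a * ((g - 1 / v) * (g + 1 / v))) \<le> 5 * (d\<^sup>2 / \<rho> ^ 3)" by simp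
  have "(3 / 4 * \<rho>)\<^sup>2 * D' \<le> (cmod v)\<^sup>2 * cmod (v - a)"
    unfolding D'_def using v \<rho>0 by (intro mult_right_mono power_mono) auto
  moreover have "(cmod a)\<^sup>2 \<le> (5 / 2 * d)\<^sup>2"
    using a by (intro power_mono) auto
  ultimately have "cmod (a\<^sup>2 / (v\<^sup>2 * (v - a))) \<le> (5 / 2 * d)\<^sup>2 / ((3 / 4 * \<rho>)\<^sup>2 * D')"
    unfolding norm_divide norm_mult norm_power using \<rho>0 D0 by (intro frac_le) auto
  also have "\<dots> = 100 / 9 * d\<^sup>2 * ((1 / \<rho>) * (1 / \<rho>) / D')"
    by (simp add: power2_eq_square)
  also have "\<dots> \<le> 100 / 9 * d\<^sup>2 * ((2 / D') * (2 / D') / D')"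
    using \<rho>0 D0 by (intro mult_left_mono divide_right_mono mult_mono) (auto simp: divide_simps)
  also have "\<dots> = 400 / 9 * (d\<^sup>2 / D' ^ 3)" by (simp add: power3_eq_cube)
  finally have t3: "cmod (a\<^sup>2 / (v\<^sup>2 * (v - a))) \<le> 400 / 9 * (d\<^sup>2 / D' ^ 3)" .
  have "1 / \<rho> \<le> 2 / D'" using \<rho>0 D0 by (simp add: divide_simps)
  then have "(1 / \<rho>) ^ 3 \<le> (2 / D') ^ 3" using \<rho>0 by (intro power_mono) auto
  from mult_left_mono[OF this, of "d\<^sup>2"] have r: "d\<^sup>2 / \<rho> ^ 3 \<le> 8 * (d\<^sup>2 / D' ^ 3)"
    by (simp add: power_divide mult.commute)
  have "cmod (g + a * g\<^sup>2 - 1 / (v - a)) \<le> d\<^sup>2 / \<rho> ^ 3 + 5 * (d\<^sup>2 / \<rho> ^ 3) + 400 / 9 * (d\<^sup>2 / D' ^ 3)"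
    unfolding eq using norm_triangle_ineq4[of "(g - 1 / v) + a * ((g - 1 / v) * (g + 1 / v))" "a\<^sup>2 / (v\<^sup>2 * (v - a))"]
      norm_triangle_ineq[of "g - 1 / v" "a * ((g - 1 / v) * (g + 1 / v))"] gv t2 t3 by linarith
  \<comment> \<open>The constants add up to (1 + 5) * 8 + 400 / 9 < 93.\<close>
  also have "\<dots> \<le> 100 * (d\<^sup>2 / D' ^ 3)"
  proof -
    have "d\<^sup>2 / D' ^ 3 \<ge> 0" using D0 by simp
    then show ?thesis using r by linarith
  qed
  finally show ?thesis by (simp add: D'_def)
qed

text \<open>
  If \<open>s\<^sup>2 = (z - c)(z - q)\<close> off a continuum joining \<open>c\<close> and \<open>q\<close>, the bounded function \<open>z - (c + q) / 2 - s\<close> behaves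
  like a multiple of \<open>1 / z\<close> at infinity. It replaces the conformal map and the Koebe theorem in the
  usual proof of Mergelyan's theorem.
\<close>

lemma Mergelyan_block:
  assumes K: "compact K" and conn: "connected (- K)" and c: "c \<notin> K" and d: "d > 0"
  obtains g m where "polyapprox K g"
    "\<And>z \<zeta>. z \<in> K \<Longrightarrow> cmod (\<zeta> - c) < 2 * d \<Longrightarrow> cmod (g z + (\<zeta> - m) * (g z)\<^sup>2) \<le> 5000 / d"
    "\<And>z \<zeta>. z \<in> K \<Longrightarrow> cmod (\<zeta> - c) < 2 * d \<Longrightarrow> cmod (z - \<zeta>) \<ge> 4 * d \<Longrightarrow>
       cmod (g z + (\<zeta> - m) * (g z)\<^sup>2 - 1 / (z - \<zeta>)) \<le> 100 * d\<^sup>2 / cmod (z - \<zeta>) ^ 3"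
proof -
  obtain q where q: "q \<in> connected_component_set (- K \<inter> ball c (2 * d)) c" "cmod (q - c) = d"
    using connected_component_reaches_sphere[OF K conn c d] .
  obtain l where l: "polyapprox K l" "\<And>z. z \<in> K \<Longrightarrow> exp (l z) = (q - z) / (c - z)"
    "\<And>z. z \<in> K \<Longrightarrow> cmod (z - c) \<ge> 2 * d \<Longrightarrow> l z = Ln ((q - z) / (c - z))"
    using polyapprox_log_quotient[OF K conn q(1)] by metis
  \<comment> \<open>Since (z - c)(z - q) = (z - m)^2 - e^2, the square root \<open>s\<close>
    satisfies (z - m - s)(z - m + s) = e^2. Thus g = 2 / (z - m + s), which is close to 1 / (z - m)
    far away, while the form in the definition bounds \<open>g\<close> near
    \<open>c\<close>.\<close>
  define m e where "m = (c + q) / 2" and "e = (q - c) / 2"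
  define s where "s z = (z - c) * exp (1 / 2 * l z)" for z
  define g where "g z = 2 / e\<^sup>2 * (z - m - s z)" for z
  have e: "cmod e = d / 2" "e \<noteq> 0" using q(2) d by (auto simp: e_def norm_divide)
  have gP: "polyapprox K g"
    unfolding g_def s_def
    by (intro polyapprox_mult[OF polyapprox_const _ K] polyapprox_diff[OF _ _ K] polyapprox_const polyapprox_ident
        polyapprox_mult[OF _ polyapprox_exp K] polyapprox_cmult[OF l(1) K] K)
  have s2: "(s z)\<^sup>2 = (z - c) * (z - q)" if z: "z \<in> K" for z
  proof -
    have zc: "c - z \<noteq> 0" using z c by auto
    have "(exp (1 / 2 * l z))\<^sup>2 = exp (l z)" by (simp flip: exp_double)
    then have "(s z)\<^sup>2 = (c - z)\<^sup>2 * ((q - z) / (c - z))"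
      unfolding s_def power_mult_distrib l(2)[OF z] by (simp add: power2_commute)
    also have "\<dots> = (c - z) * (q - z)" using zc by (simp add: power2_eq_square)
    also have "\<dots> = (z - c) * (z - q)" by (simp add: algebra_simps)
    finally show ?thesis .
  qed
  have vs: "(z - m - s z) * (z - m + s z) = e\<^sup>2" if z: "z \<in> K" for z
  proof -
    have "(z - m - s z) * (z - m + s z) = (z - m)\<^sup>2 - (s z)\<^sup>2" by (simp add: power2_eq_square algebra_simps)
    also have "\<dots> = e\<^sup>2" unfolding s2[OF z] m_def e_def by (simp add: power2_eq_square field_simps)
    finally show ?thesis .
  qed
  have mc: "cmod (m - c) = d / 2"
  proof -
    have "m - c = e" by (simp add: m_def e_def field_simps)
    then show ?thesis using e by simp
  qed
  \<comment> \<open>Away from the disc \<open>s\<close> is z - c times the principal root of x = (q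
    - z) / (c - z), where |x - 1| \<le> 1/2. Then z - m + s is z - c times a number of real part at
    least 3/4, so no cancellation occurs.\<close>
  have far: "cmod (z - m + s z) \<ge> 3 / 4 * cmod (z - c)" if z: "z \<in> K" "cmod (z - c) \<ge> 2 * d" for z
  proof -
    define x where "x = (q - z) / (c - z)"
    have nz: "c - z \<noteq> 0" "q - z \<noteq> 0" "x \<noteq> 0"
      using z c q(1) connected_component_subset[of "- K \<inter> ball c (2 * d)" c] by (auto simp: x_def)
    have "exp (1 / 2 * l z) = csqrt x"
      using l(3)[OF z] nz by (simp add: x_def csqrt_exp_Ln)
    then have sz: "s z = (z - c) * csqrt x" by (simp add: s_def)
    have "(z - c) * x = z - q"
    proof -
      have "(z - c) * x = - ((c - z) * x)" by (simp add: algebra_simps)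
      also have "(c - z) * x = q - z" using nz by (simp add: x_def)
      finally show ?thesis by simp
    qed
    moreover have "(z - c) * ((1 + x) / 2 + csqrt x) = ((z - c) + (z - c) * x) / 2 + (z - c) * csqrt x"
      by (simp add: algebra_simps add_divide_distrib diff_divide_distrib)
    ultimately have "(z - c) * ((1 + x) / 2 + csqrt x) = ((z - c) + (z - q)) / 2 + (z - c) * csqrt x"
      by (simp only:)
    then have "z - m + s z = (z - c) * ((1 + x) / 2 + csqrt x)"
      unfolding sz by (simp add: m_def add_divide_distrib diff_divide_distrib)
    moreover have "Re ((1 + x) / 2 + csqrt x) \<ge> 3 / 4"
    proof -
      have "x = 1 + (q - c) / (c - z)" using nz by (simp add: x_def add_divide_eq_iff)
      moreover have "cmod ((q - c) / (c - z)) \<le> 1 / 2"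
        using z q(2) d by (simp add: norm_divide norm_minus_commute divide_simps)
      then have "\<bar>Re ((q - c) / (c - z))\<bar> \<le> 1 / 2"
        using abs_Re_le_cmod order_trans by blast
      ultimately have "Re x \<ge> 1 / 2" by simp
      then have "3 / 4 \<le> (1 + Re x) / 2 + t" if "0 \<le> t" for t
        using that by (simp add: add_divide_distrib)
      from this[OF Re_csqrt] show ?thesis by (simp del: csqrt.simps)
    qed
    then have "cmod ((1 + x) / 2 + csqrt x) \<ge> 3 / 4"
      using complex_Re_le_cmod order_trans by blast
    then have "3 / 4 * cmod (z - c) \<le> cmod ((1 + x) / 2 + csqrt x) * cmod (z - c)"
      by (rule mult_right_mono) simp
    ultimately show ?thesis by (simp add: norm_mult mult.commute del: csqrt.simps)
  qed
  have g_far: "g z = 2 / (z - m + s z)" if z: "z \<in> K" for z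
  proof -
    have "z - m + s z \<noteq> 0" using vs[OF z] e by auto
    then have "z - m - s z = e\<^sup>2 / (z - m + s z)" using vs[OF z] by (simp add: eq_divide_eq)
    then show ?thesis using e by (simp add: g_def)
  qed
  have g83: "cmod (g z) \<le> 8 / 3 / cmod (z - c)" if z: "z \<in> K" "cmod (z - c) \<ge> 2 * d" for z
  proof -
    have "cmod (g z) = 2 / cmod (z - m + s z)" unfolding g_far[OF z(1)] by (simp add: norm_divide)
    also have "\<dots> \<le> 2 / (3 / 4 * cmod (z - c))"
      using far[OF z] z d by (intro divide_left_mono mult_pos_pos) auto
    finally show ?thesis by simp
  qed
  \<comment> \<open>Near \<open>c\<close>, |s|^2 \<le> 6 d^2 and |z - m| \<le> 5/2 d bound the
    numerator by 11/2 d, and 2 / |e|^2 = 8 / d^2.\<close>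
  have g44: "cmod (g z) \<le> 44 / d" if z: "z \<in> K" for z
  proof (cases "cmod (z - c) \<ge> 2 * d")
    case True
    then have "8 / 3 / cmod (z - c) \<le> 8 / 3 / (2 * d)"
      using d by (intro divide_left_mono mult_pos_pos) linarith+
    also have "\<dots> \<le> 44 / d" using d by (simp add: divide_simps)
    finally show ?thesis using g83[OF z True] by linarith
  next
    case False
    have "cmod (z - q) \<le> 3 * d"
      using norm_triangle_ineq4[of "z - c" "q - c"] q(2) False by simp
    then have "cmod (z - c) * cmod (z - q) \<le> (2 * d) * (3 * d)"
      using False d by (intro mult_mono) auto
    also have "\<dots> \<le> (3 * d)\<^sup>2" using d by (simp add: power2_eq_square)
    finally have "(cmod (s z))\<^sup>2 \<le> (3 * d)\<^sup>2"
      using s2[OF z] by (metis norm_mult norm_power)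
    then have "cmod (s z) \<le> 3 * d" by (rule power2_le_imp_le) (use d in simp)
    moreover have "cmod (z - m) \<le> 5 / 2 * d"
      using norm_triangle_ineq4[of "z - c" "m - c"] mc False by simp
    ultimately have "cmod (z - m - s z) \<le> 11 / 2 * d"
      using norm_triangle_ineq4[of "z - m" "s z"] by linarith
    then have "cmod (g z) \<le> 2 / (d / 2)\<^sup>2 * (11 / 2 * d)"
      unfolding g_def norm_mult norm_divide norm_power e by (intro mult_mono) auto
    also have "\<dots> = 44 / d" using d by (simp add: power2_eq_square field_simps)
    finally show ?thesis .
  qed
  show thesis
  proof (rule that[of g m, OF gP])
    fix z \<zeta> assume z: "z \<in> K" and \<zeta>: "cmod (\<zeta> - c) < 2 * d"
    have a: "cmod (\<zeta> - m) \<le> 5 / 2 * d"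
      using norm_triangle_ineq4[of "\<zeta> - c" "m - c"] mc \<zeta> by simp
    have "cmod (g z + (\<zeta> - m) * (g z)\<^sup>2) \<le> cmod (g z) + cmod (\<zeta> - m) * (cmod (g z))\<^sup>2"
      using norm_triangle_ineq[of "g z" "(\<zeta> - m) * (g z)\<^sup>2"] by (simp add: norm_mult norm_power)
    also have "\<dots> \<le> 44 / d + (5 / 2 * d) * (44 / d)\<^sup>2"
      using g44[OF z] a d by (intro add_mono mult_mono power_mono) auto
    \<comment> \<open>44 + 5/2 * 44^2 = 4884.\<close>
    also have "\<dots> \<le> 5000 / d" using d by (simp add: power2_eq_square field_simps)
    finally show "cmod (g z + (\<zeta> - m) * (g z)\<^sup>2) \<le> 5000 / d" .
    assume big: "cmod (z - \<zeta>) \<ge> 4 * d"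
    have zc: "cmod (z - c) \<ge> 2 * d"
      using norm_triangle_ineq4[of "z - c" "\<zeta> - c"] \<zeta> big by simp
    have v: "3 / 4 * cmod (z - c) \<le> cmod (z - m)"
      using norm_triangle_ineq[of "z - m" "m - c"] mc zc by simp
    have "cmod ((z - m) - (\<zeta> - m)) \<le> 2 * cmod (z - c)"
      using norm_triangle_ineq4[of "z - c" "\<zeta> - c"] \<zeta> zc by simp
    moreover have "cmod (g z - 1 / (z - m)) \<le> d\<^sup>2 / cmod (z - c) ^ 3"
    proof -
      have nz: "z - m \<noteq> 0" "z - m + s z \<noteq> 0"
        using v zc d vs[OF z] e by auto
      have "g z - 1 / (z - m) = (z - m - s z) / ((z - m) * (z - m + s z))"
      proof -
        have "2 / x - 1 / y = (2 * y - x) / (y * x)" if "x \<noteq> 0" "y \<noteq> 0" for x y :: complex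
          using that by (simp add: diff_frac_eq mult.commute)
        from this[OF nz(2,1)] show ?thesis unfolding g_far[OF z] by simp
      qed
      also have "z - m - s z = e\<^sup>2 / (z - m + s z)"
        using vs[OF z] nz by (simp add: eq_divide_eq)
      finally have "cmod (g z - 1 / (z - m)) = (cmod e)\<^sup>2 / (cmod (z - m) * (cmod (z - m + s z))\<^sup>2)"
        by (simp add: norm_divide norm_mult norm_power power2_eq_square mult_ac)
      also have "\<dots> \<le> (d / 2)\<^sup>2 / ((3 / 4 * cmod (z - c)) * (3 / 4 * cmod (z - c))\<^sup>2)"
        unfolding e using v far[OF z zc] zc d
        by (intro divide_left_mono mult_mono power_mono mult_pos_pos) auto
      also have "\<dots> \<le> d\<^sup>2 / cmod (z - c) ^ 3"
      proof -
        have "(d / 2)\<^sup>2 / ((3 / 4 * cmod (z - c)) * (3 / 4 * cmod (z - c))\<^sup>2) = 16 / 27 * (d\<^sup>2 / cmod (z - c) ^ 3)"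
          by (simp add: power2_eq_square power3_eq_cube)
        also have "\<dots> \<le> 1 * (d\<^sup>2 / cmod (z - c) ^ 3)"
          by (intro mult_right_mono) auto
        finally show ?thesis by simp
      qed
      finally show ?thesis .
    qed
    moreover have "z - m \<noteq> \<zeta> - m" using big d by auto
    ultimately have "cmod (g z + (\<zeta> - m) * (g z)\<^sup>2 - 1 / ((z - m) - (\<zeta> - m))) \<le> 100 * d\<^sup>2 / cmod ((z - m) - (\<zeta> - m)) ^ 3"
      by (intro kernel_error_bound[OF d zc v g83[OF z zc] _ a])
    then show "cmod (g z + (\<zeta> - m) * (g z)\<^sup>2 - 1 / (z - \<zeta>)) \<le> 100 * d\<^sup>2 / cmod (z - \<zeta>) ^ 3"
      by simp
  qed
qed

section \<open>Smoothing by a compactly supported kernel\<close>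

lemma lborel_integral_translate:
  fixes f :: "complex \<Rightarrow> complex"
  assumes [measurable]: "f \<in> borel_measurable borel"
  shows "(LINT w|lborel. f (c + w)) = (LINT w|lborel. f w)"
  using integral_distr[of "(+) c" lborel borel f] by (simp add: lborel_distr_plus)

lemma lborel_integral_norm_le:
  fixes f :: "complex \<Rightarrow> complex"
  assumes "integrable lborel f" "(\<integral>\<^sup>+ w. ennreal (cmod (f w)) \<partial>lborel) \<le> ennreal B" "B \<ge> 0"
  shows "cmod (LINT w|lborel. f w) \<le> B"
proof -
  have "ennreal (cmod (LINT w|lborel. f w)) \<le> (\<integral>\<^sup>+ w. ennreal (cmod (f w)) \<partial>lborel)"
    by (rule integral_norm_bound_ennreal[OF assms(1)])
  then have "ennreal (cmod (LINT w|lborel. f w)) \<le> ennreal B" using assms(2) by simp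
  then show ?thesis using assms(3) by simp
qed

lemma integrable_bounded_supp:
  fixes f :: "complex \<Rightarrow> complex"
  assumes [measurable]: "f \<in> borel_measurable borel"
    and "\<And>w. cmod (f w) \<le> M" "\<And>w. f w \<noteq> 0 \<Longrightarrow> w \<in> cball c s"
  shows "integrable lborel f"
  by (rule integrableI_bounded_set[where A = "cball c s" and B = M])
    (use assms in \<open>auto simp: emeasure_bounded_finite[OF bounded_cball, unfolded infinity_ennreal_def]\<close>)

lemma nn_integral_bounded_supp:
  assumes "\<And>w. g w \<le> ennreal M" "\<And>w. g w \<noteq> 0 \<Longrightarrow> w \<in> cball (c::complex) s" "s \<ge> 0" "M \<ge> 0"
  shows "(\<integral>\<^sup>+ w. g w \<partial>lborel) \<le> ennreal (M * (pi * s\<^sup>2))"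
proof -
  have "(\<integral>\<^sup>+ w. g w \<partial>lborel) \<le> (\<integral>\<^sup>+ w. ennreal M * indicator (cball c s) w \<partial>lborel)"
    using assms(1,2) by (intro nn_integral_mono) (auto simp: indicator_def)
  also have "\<dots> = ennreal (M * (pi * s\<^sup>2))"
    using assms(3,4) by (simp add: nn_integral_cmult_indicator emeasure_cball_complex ennreal_mult)
  finally show ?thesis .
qed

text \<open>The unnormalised mollifier, a paraboloid cap, whose d-bar derivative inside the disc is
  minus \<open>disc_moment d\<close>.\<close>

definition cone_kernel :: "real \<Rightarrow> complex \<Rightarrow> real" where
  "cone_kernel d w = max 0 (d\<^sup>2 - (cmod w)\<^sup>2)"

lemma cone_kernel_measurable [measurable]: "cone_kernel d \<in> borel_measurable borel"
  unfolding cone_kernel_def by measurable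

lemma cone_kernel_nonneg: "cone_kernel d w \<ge> 0"
  by (simp add: cone_kernel_def)

lemma cone_kernel_le: "cone_kernel d w \<le> d\<^sup>2"
  by (simp add: cone_kernel_def)

lemma cone_kernel_supp: "d > 0 \<Longrightarrow> cone_kernel d w \<noteq> 0 \<Longrightarrow> cmod w < d"
  by (auto simp: cone_kernel_def max_def split: if_splits intro: power2_less_imp_less)

lemma integrable_cone_kernel:
  assumes d: "d > 0"
  shows "integrable lborel (cone_kernel d)"
proof (rule integrableI_bounded_set[where A = "cball 0 d" and B = "d\<^sup>2"])
  show "AE w in lborel. w \<in> cball 0 d \<longrightarrow> norm (cone_kernel d w) \<le> d\<^sup>2"
    using cone_kernel_le cone_kernel_nonneg by simp
  show "AE w in lborel. w \<notin> cball 0 d \<longrightarrow> cone_kernel d w = 0"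
    using cone_kernel_supp[OF d] by fastforce
qed (use d in \<open>auto simp: emeasure_cball_complex\<close>)

text \<open>The exact mass is pi d^4 / 2; the contribution of the disc of half the radius is enough
  for the constants below.\<close>

lemma cone_kernel_mass:
  assumes d: "d > 0"
  shows "(LINT w|lborel. cone_kernel d w) \<ge> 3 * pi * d ^ 4 / 16"
proof -
  have "3 * pi * d ^ 4 / 16 = (LINT w|lborel. (3 / 4 * d\<^sup>2) * indicator (cball (0::complex) (d / 2)) w)"
  proof -
    have "measure lborel (cball (0::complex) (d / 2)) = pi * (d / 2)\<^sup>2"
      using d emeasure_cball_complex[of "d / 2" 0] by (simp add: measure_def)
    then show ?thesis by (simp add: power_divide power4_eq_xxxx power2_eq_square)
  qed
  also have "\<dots> \<le> (LINT w|lborel. cone_kernel d w)"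
  proof (rule integral_mono)
    show "integrable lborel (\<lambda>w. 3 / 4 * d\<^sup>2 * indicator (cball (0::complex) (d / 2)) w)"
      using d by (intro integrable_mult_right integrable_real_indicator) (auto simp: emeasure_cball_complex)
    show "3 / 4 * d\<^sup>2 * indicator (cball (0::complex) (d / 2)) w \<le> cone_kernel d w" for w
    proof (cases "cmod w \<le> d / 2")
      case True
      then have "(cmod w)\<^sup>2 \<le> (d / 2)\<^sup>2" by (intro power_mono) auto
      then have "3 / 4 * d\<^sup>2 \<le> d\<^sup>2 - (cmod w)\<^sup>2" by (simp add: power_divide)
      then have "3 / 4 * d\<^sup>2 \<le> cone_kernel d w" unfolding cone_kernel_def by linarith
      then show ?thesis using True by simp
    qed (simp add: cone_kernel_nonneg)
  qed (rule integrable_cone_kernel[OF d])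
  finally show ?thesis .
qed

text \<open>Up to normalisation \<psi> is the d-bar derivative of \<open>f\<close> mollified by
  \<open>cone_kernel d\<close>, so its Cauchy transform is that mollification, which is within
  \<omega> of \<open>f\<close>. The derivative is formed by convolving \<open>f\<close> with
  \<open>disc_moment d\<close>; it vanishes where \<open>f\<close> is holomorphic on the surrounding
  disc and costs only a factor 1/d.\<close>

lemma Cauchy_smoothing:
  fixes f :: "complex \<Rightarrow> complex"
  assumes cont: "continuous_on UNIV f" and supp: "\<And>w. f w \<noteq> 0 \<Longrightarrow> cmod w \<le> M" and M: "M > 0"
    and d: "d > 0" and \<omega>: "\<And>x y. cmod (x - y) \<le> d \<Longrightarrow> cmod (f x - f y) \<le> \<omega>"
  obtains \<psi> where "\<psi> \<in> borel_measurable borel" "\<And>\<zeta>. cmod (\<psi> \<zeta>) \<le> 2 * \<omega> / d"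
    "\<And>\<zeta>. \<psi> \<zeta> \<noteq> 0 \<Longrightarrow> cmod \<zeta> \<le> M + d" "\<And>\<zeta>. f holomorphic_on ball \<zeta> d \<Longrightarrow> \<psi> \<zeta> = 0"
    "\<And>z. cmod ((LINT \<zeta>|lborel. \<psi> \<zeta> / (z - \<zeta>)) - f z) \<le> \<omega>"
proof -
  have [measurable]: "f \<in> borel_measurable borel"
    using cont by (rule borel_measurable_continuous_onI)
  have \<omega>0: "\<omega> \<ge> 0" using \<omega>[of 0 0] d by simp
  have "compact (f ` cball 0 M)"
    by (intro compact_continuous_image continuous_on_subset[OF cont]) auto
  then obtain B0 where B0: "\<And>w. w \<in> cball 0 M \<Longrightarrow> cmod (f w) \<le> B0"
    using compact_imp_bounded bounded_iff by (metis imageI)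
  define B where "B = max B0 0"
  have B: "B \<ge> 0" "cmod (f w) \<le> B" for w
    using B0[of w] supp[of w] by (cases "f w = 0"; force simp: B_def)+
  define N where "N = (LINT w|lborel. cone_kernel d w)"
  have N: "N \<ge> 3 * pi * d ^ 4 / 16"
    using cone_kernel_mass[OF d] by (simp add: N_def)
  moreover have "3 * pi * d ^ 4 / 16 > 0" using d by simp
  ultimately have N: "N \<ge> 3 * pi * d ^ 4 / 16" "N > 0" by linarith+
  define I where "I \<zeta> = (LINT u|lborel. f u * disc_moment d (\<zeta> - u))" for \<zeta>
  define \<psi> where "\<psi> \<zeta> = - I \<zeta> / (pi * N)" for \<zeta>
  have dm: "cmod (disc_moment d w) \<le> d" for w by (rule disc_moment_bound[OF d])
  have int_fd: "integrable lborel (\<lambda>u. f u * disc_moment d (\<zeta> - u))" for \<zeta>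
  proof (rule integrable_bounded_supp[where M = "B * d" and c = 0 and s = M])
    show "cmod (f u * disc_moment d (\<zeta> - u)) \<le> B * d" for u
      unfolding norm_mult using B dm by (intro mult_mono) auto
    show "u \<in> cball 0 M" if "f u * disc_moment d (\<zeta> - u) \<noteq> 0" for u
      using that supp by auto
  qed measurable
  have int_d: "integrable lborel (\<lambda>u. disc_moment d (\<zeta> - u))" for \<zeta>
  proof (rule integrable_bounded_supp[where M = d and c = \<zeta> and s = d])
    show "u \<in> cball \<zeta> d" if "disc_moment d (\<zeta> - u) \<noteq> 0" for u
      using disc_moment_supp[OF that] by (simp add: dist_norm)
  qed (measurable, rule dm)
  \<comment> \<open>The moment has mean zero, so \<open>f u\<close> may be replaced by
    \<open>f u - f \<zeta>\<close>; this brings \<omega> into the bound for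
    \<open>I\<close>.\<close>
  have mean0: "(LINT u|lborel. disc_moment d (\<zeta> - u)) = 0" for \<zeta>
    using disc_moment_holomorphic[OF d, of "\<lambda>_. 1" 0] lborel_integral_shift(1)[of "disc_moment d" \<zeta>] by simp
  have I_bound: "cmod (I \<zeta>) \<le> \<omega> * d * (pi * d\<^sup>2)" for \<zeta>
  proof -
    have "I \<zeta> = I \<zeta> - f \<zeta> * (LINT u|lborel. disc_moment d (\<zeta> - u))" by (simp add: mean0)
    also have "\<dots> = (LINT u|lborel. f u * disc_moment d (\<zeta> - u) - f \<zeta> * disc_moment d (\<zeta> - u))"
      unfolding I_def using int_fd int_d by (simp add: Bochner_Integration.integral_diff)
    also have "cmod \<dots> \<le> \<omega> * d * (pi * d\<^sup>2)"
    proof (rule lborel_integral_norm_le)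
      show "integrable lborel (\<lambda>u. f u * disc_moment d (\<zeta> - u) - f \<zeta> * disc_moment d (\<zeta> - u))"
        using int_fd int_d by simp
      show "(\<integral>\<^sup>+ u. ennreal (cmod (f u * disc_moment d (\<zeta> - u) - f \<zeta> * disc_moment d (\<zeta> - u))) \<partial>lborel)
          \<le> ennreal (\<omega> * d * (pi * d\<^sup>2))"
      proof (rule nn_integral_bounded_supp[where c = \<zeta>])
        fix u
        have eq: "f u * disc_moment d (\<zeta> - u) - f \<zeta> * disc_moment d (\<zeta> - u) = (f u - f \<zeta>) * disc_moment d (\<zeta> - u)"
          by (simp add: algebra_simps)
        show "u \<in> cball \<zeta> d" if "ennreal (cmod (f u * disc_moment d (\<zeta> - u) - f \<zeta> * disc_moment d (\<zeta> - u))) \<noteq> 0"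
          using that disc_moment_supp[of d "\<zeta> - u"] unfolding eq by (auto simp: dist_norm)
        show "ennreal (cmod (f u * disc_moment d (\<zeta> - u) - f \<zeta> * disc_moment d (\<zeta> - u))) \<le> ennreal (\<omega> * d)"
        proof (cases "disc_moment d (\<zeta> - u) = 0")
          case False
          then have "cmod (u - \<zeta>) \<le> d" using disc_moment_supp[of d "\<zeta> - u"] by (simp add: norm_minus_commute)
          then show ?thesis unfolding eq norm_mult
            using \<omega>[of u \<zeta>] dm \<omega>0 by (intro ennreal_leI mult_mono) auto
        qed simp
      qed (use d \<omega>0 in auto)
    qed (use d \<omega>0 in auto)
    finally show ?thesis .
  qed
  show thesis
  proof (rule that[of \<psi>])
    show "\<psi> \<in> borel_measurable borel"
      unfolding \<psi>_def I_def by measurable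
    show "cmod (\<psi> \<zeta>) \<le> 2 * \<omega> / d" for \<zeta>
    proof -
      have "cmod (\<psi> \<zeta>) = cmod (I \<zeta>) / (pi * N)"
        using N by (simp add: \<psi>_def norm_divide norm_mult)
      also have "\<dots> \<le> (\<omega> * d * (pi * d\<^sup>2)) / (pi * (3 * pi * d ^ 4 / 16))"
        using I_bound N d \<omega>0 by (intro frac_le mult_left_mono) auto
      also have "\<dots> = (\<omega> / d) * (16 / (3 * pi))"
        using d by (simp add: power2_eq_square power4_eq_xxxx)
      \<comment> \<open>16 / (3 pi) < 2.\<close>
      also have "\<dots> \<le> (\<omega> / d) * 2"
        using \<omega>0 d pi_gt3 by (intro mult_left_mono) (auto simp: divide_simps)
      finally show ?thesis by (simp add: mult.commute)
    qed
    show "cmod \<zeta> \<le> M + d" if "\<psi> \<zeta> \<noteq> 0" for \<zeta>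
    proof (rule ccontr)
      assume neg: "\<not> cmod \<zeta> \<le> M + d"
      have "f u * disc_moment d (\<zeta> - u) = 0" for u
      proof (rule ccontr)
        assume "f u * disc_moment d (\<zeta> - u) \<noteq> 0"
        then have "cmod u \<le> M" "cmod (\<zeta> - u) \<le> d"
          using supp[of u] disc_moment_supp[of d "\<zeta> - u"] by auto
        with neg show False using norm_triangle_ineq[of "\<zeta> - u" u] by simp
      qed
      then have "I \<zeta> = (LINT u|(lborel :: complex measure). 0)"
        unfolding I_def by (intro Bochner_Integration.integral_cong refl)
      then show False using that by (simp add: \<psi>_def)
    qed
    show "\<psi> \<zeta> = 0" if "f holomorphic_on ball \<zeta> d" for \<zeta>
    proof -
      have "I \<zeta> = (LINT w|lborel. f (\<zeta> - w) * disc_moment d w)"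
        unfolding I_def
        using lborel_integral_shift(1)[of "\<lambda>u. f u * disc_moment d (\<zeta> - u)" \<zeta>] by simp
      then show ?thesis using disc_moment_holomorphic[OF d that cont] by (simp add: \<psi>_def)
    qed
    fix z
    \<comment> \<open>Fubini in (u, \<zeta>): integrating over u first gives the Cauchy transform of
      \<open>I\<close>, integrating over \<zeta> first turns the Cauchy transform of the moment into
      the cone kernel by \<open>disc_moment_Cauchy\<close>.\<close>
    let ?H = "\<lambda>(u, \<zeta>). f u * (disc_moment d (\<zeta> - u) / (z - \<zeta>))"
    have inner: "(\<integral>\<^sup>+ \<zeta>. ennreal (cmod (disc_moment d (\<zeta> - u) / (z - \<zeta>))) \<partial>lborel)
         \<le> ennreal (d * (2 * pi * ((cmod u + d) + cmod z)))"
      "integrable lborel (\<lambda>\<zeta>. disc_moment d (\<zeta> - u) / (z - \<zeta>))" for u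
    proof -
      have 1: "cmod \<zeta> \<le> cmod u + d" if "disc_moment d (\<zeta> - u) \<noteq> 0" for \<zeta>
        using disc_moment_supp[OF that] norm_triangle_ineq[of "\<zeta> - u" u] by simp
      have 2: "cmod u + d > 0" using d by (simp add: add_nonneg_pos)
      have 3: "(\<lambda>\<zeta>. disc_moment d (\<zeta> - u)) \<in> borel_measurable borel" by measurable
      show "(\<integral>\<^sup>+ \<zeta>. ennreal (cmod (disc_moment d (\<zeta> - u) / (z - \<zeta>))) \<partial>lborel)
         \<le> ennreal (d * (2 * pi * ((cmod u + d) + cmod z)))"
        by (rule Cauchy_kernel_bound(1)[OF 3 dm 1 2])
      show "integrable lborel (\<lambda>\<zeta>. disc_moment d (\<zeta> - u) / (z - \<zeta>))"
        by (rule Cauchy_kernel_bound(2)[OF 3 dm 1 2])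
    qed
    have Hint: "integrable (lborel \<Otimes>\<^sub>M lborel) ?H"
    proof (rule integrableI_bounded)
      show "?H \<in> borel_measurable (lborel \<Otimes>\<^sub>M lborel)" by measurable
      have "(\<integral>\<^sup>+ x. ennreal (norm (?H x)) \<partial>(lborel \<Otimes>\<^sub>M lborel))
          = (\<integral>\<^sup>+ u. (\<integral>\<^sup>+ \<zeta>. ennreal (norm (?H (u, \<zeta>))) \<partial>lborel) \<partial>lborel)"
        by (rule lborel.nn_integral_fst[symmetric]) measurable
      also have "\<dots> \<le> ennreal ((B * (d * (2 * pi * ((M + d) + cmod z)))) * (pi * M\<^sup>2))"
      proof (rule nn_integral_bounded_supp[where c = 0])
        fix u :: complex
        have eq: "(\<integral>\<^sup>+ \<zeta>. ennreal (norm (?H (u, \<zeta>))) \<partial>lborel)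
            = ennreal (cmod (f u)) * (\<integral>\<^sup>+ \<zeta>. ennreal (cmod (disc_moment d (\<zeta> - u) / (z - \<zeta>))) \<partial>lborel)"
          by (subst nn_integral_cmult[symmetric], measurable)
            (simp add: norm_mult norm_divide flip: ennreal_mult)
        show "u \<in> cball 0 M" if "(\<integral>\<^sup>+ \<zeta>. ennreal (norm (?H (u, \<zeta>))) \<partial>lborel) \<noteq> 0"
          using that supp[of u] unfolding eq by auto
        show "(\<integral>\<^sup>+ \<zeta>. ennreal (norm (?H (u, \<zeta>))) \<partial>lborel) \<le> ennreal (B * (d * (2 * pi * ((M + d) + cmod z))))"
        proof (cases "f u = 0")
          case False
          have "ennreal (cmod (f u)) * (\<integral>\<^sup>+ \<zeta>. ennreal (cmod (disc_moment d (\<zeta> - u) / (z - \<zeta>))) \<partial>lborel)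
             \<le> ennreal B * ennreal (d * (2 * pi * ((M + d) + cmod z)))"
          proof (rule mult_mono)
            show "ennreal (cmod (f u)) \<le> ennreal B" using B by (intro ennreal_leI)
            have "d * (2 * pi * ((cmod u + d) + cmod z)) \<le> d * (2 * pi * ((M + d) + cmod z))"
              using supp[OF False] d by (intro mult_left_mono add_mono) auto
            then show "(\<integral>\<^sup>+ \<zeta>. ennreal (cmod (disc_moment d (\<zeta> - u) / (z - \<zeta>))) \<partial>lborel)
                \<le> ennreal (d * (2 * pi * ((M + d) + cmod z)))"
              using inner(1)[of u] ennreal_leI order_trans by blast
          qed auto
          also have "\<dots> = ennreal (B * (d * (2 * pi * ((M + d) + cmod z))))"
            using B d M by (simp flip: ennreal_mult)
          finally show ?thesis unfolding eq .
        qed simp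
      qed (use B d M in auto)
      also have "\<dots> < \<infinity>" by simp
      finally show "(\<integral>\<^sup>+ x. ennreal (norm (?H x)) \<partial>(lborel \<Otimes>\<^sub>M lborel)) < \<infinity>" .
    qed
    have cone: "(LINT \<zeta>|lborel. ?H (u, \<zeta>)) = - (pi * (f u * cone_kernel d (z - u)))" for u
    proof -
      have "(LINT \<zeta>|lborel. ?H (u, \<zeta>)) = f u * (LINT \<zeta>|lborel. disc_moment d (\<zeta> - u) / (z - \<zeta>))"
        by (simp only: prod.case integral_mult_right_zero)
      also have "(LINT \<zeta>|lborel. disc_moment d (\<zeta> - u) / (z - \<zeta>)) = (LINT w|lborel. disc_moment d w / ((z - u) - w))"
        using lborel_integral_translate[of "\<lambda>\<zeta>. disc_moment d (\<zeta> - u) / (z - \<zeta>)" u] by (simp add: algebra_simps)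
      also have "\<dots> = - of_real (pi * cone_kernel d (z - u))"
        unfolding cone_kernel_def by (rule disc_moment_Cauchy[OF d])
      finally show ?thesis by simp
    qed
    have "(LINT \<zeta>|lborel. I \<zeta> / (z - \<zeta>)) = (LINT \<zeta>|lborel. (LINT u|lborel. ?H (u, \<zeta>)))"
    proof -
      have "(LINT u|lborel. ?H (u, \<zeta>)) = I \<zeta> / (z - \<zeta>)" for \<zeta>
      proof -
        have "(LINT u|lborel. ?H (u, \<zeta>)) = (LINT u|lborel. f u * disc_moment d (\<zeta> - u) / (z - \<zeta>))"
          by simp
        also have "\<dots> = I \<zeta> / (z - \<zeta>)"
          unfolding I_def by (rule integral_divide_zero)
        finally show ?thesis .
      qed
      then show ?thesis by (simp only:)
    qed
    also have "\<dots> = (LINT u|lborel. (LINT \<zeta>|lborel. ?H (u, \<zeta>)))"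
      using lborel_pair.Fubini_integral[OF Hint] by simp
    also have "\<dots> = - pi * (LINT u|lborel. f u * cone_kernel d (z - u))"
      unfolding cone by simp
    finally have \<Phi>0: "(LINT \<zeta>|lborel. I \<zeta> / (z - \<zeta>)) = - pi * (LINT u|lborel. f u * cone_kernel d (z - u))" .
    have "\<psi> \<zeta> / (z - \<zeta>) = (- 1 / (pi * N)) * (I \<zeta> / (z - \<zeta>))" for \<zeta>
      by (simp add: \<psi>_def)
    then have "(LINT \<zeta>|lborel. \<psi> \<zeta> / (z - \<zeta>)) = (- 1 / (pi * N)) * (LINT \<zeta>|lborel. I \<zeta> / (z - \<zeta>))"
      by (simp only: integral_mult_right_zero)
    then have \<Phi>: "(LINT \<zeta>|lborel. \<psi> \<zeta> / (z - \<zeta>)) = (LINT u|lborel. f u * cone_kernel d (z - u)) / N"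
      unfolding \<Phi>0 using N(2) by simp
    have ck: "integrable lborel (\<lambda>u. complex_of_real (cone_kernel d (z - u)))"
      "(LINT u|lborel. complex_of_real (cone_kernel d (z - u))) = N"
      using lborel_integral_shift[of "\<lambda>w. complex_of_real (cone_kernel d w)" z] integrable_cone_kernel[OF d]
      by (auto simp: N_def)
    have int_fc: "integrable lborel (\<lambda>u. f u * cone_kernel d (z - u))"
    proof (rule integrable_bounded_supp[where M = "B * d\<^sup>2" and c = 0 and s = M])
      show "cmod (f u * cone_kernel d (z - u)) \<le> B * d\<^sup>2" for u
        unfolding norm_mult using B cone_kernel_le[of d "z - u"] cone_kernel_nonneg[of d "z - u"]
        by (intro mult_mono) auto
      show "u \<in> cball 0 M" if "f u * cone_kernel d (z - u) \<noteq> 0" for u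
        using that supp by auto
    qed measurable
    have "(LINT u|lborel. f u * cone_kernel d (z - u)) - f z * N
        = (LINT u|lborel. f u * cone_kernel d (z - u) - f z * cone_kernel d (z - u))"
      using int_fc ck by (simp add: Bochner_Integration.integral_diff)
    also have "cmod \<dots> \<le> \<omega> * N"
    proof -
      have "cmod (LINT u|lborel. f u * cone_kernel d (z - u) - f z * cone_kernel d (z - u))
          \<le> (LINT u|lborel. cmod (f u * cone_kernel d (z - u) - f z * cone_kernel d (z - u)))"
        by (rule integral_norm_bound)
      also have "\<dots> \<le> (LINT u|lborel. \<omega> * cone_kernel d (z - u))"
      proof (rule integral_mono)
        show "integrable lborel (\<lambda>u. cmod (f u * cone_kernel d (z - u) - f z * cone_kernel d (z - u)))"
          using int_fc ck(1) by (intro integrable_norm Bochner_Integration.integrable_diff) auto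
        have "integrable lborel (\<lambda>u. cone_kernel d (z - u))"
          using ck(1) by (simp only: complex_of_real_integrable_eq)
        then show "integrable lborel (\<lambda>u. \<omega> * cone_kernel d (z - u))" by simp
        fix u
        have eq: "f u * cone_kernel d (z - u) - f z * cone_kernel d (z - u) = (f u - f z) * cone_kernel d (z - u)"
          by (simp add: algebra_simps)
        show "cmod (f u * cone_kernel d (z - u) - f z * cone_kernel d (z - u)) \<le> \<omega> * cone_kernel d (z - u)"
        proof (cases "cone_kernel d (z - u) = 0")
          case False
          then have "cmod (u - z) \<le> d" using cone_kernel_supp[OF d] by (metis less_imp_le norm_minus_commute)
          then show ?thesis unfolding eq norm_mult
            using \<omega> cone_kernel_nonneg[of d "z - u"] by (simp add: mult_right_mono)
        qed simp
      qed
      also have "\<dots> = \<omega> * N"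
      proof -
        have "complex_of_real (LINT u|lborel. cone_kernel d (z - u)) = complex_of_real N"
          using ck(2) by simp
        then show ?thesis by (simp only: of_real_eq_iff) simp
      qed
      finally show ?thesis .
    qed
    finally have "cmod ((LINT u|lborel. f u * cone_kernel d (z - u)) - f z * N) / N \<le> \<omega>"
      using N(2) by (simp add: divide_le_eq)
    moreover have "(LINT u|lborel. f u * cone_kernel d (z - u)) / N - f z = ((LINT u|lborel. f u * cone_kernel d (z - u)) - f z * N) / N"
      using N(2) by (simp add: diff_divide_distrib)
    ultimately show "cmod ((LINT \<zeta>|lborel. \<psi> \<zeta> / (z - \<zeta>)) - f z) \<le> \<omega>"
      unfolding \<Phi> using N(2) by (simp add: norm_divide)
  qed
qed

text \<open>A majorant, with w = z - \<zeta>, for the error of replacing 1/(z - \<zeta>) by the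
  expression g + (\<zeta> - m) g^2 of \<open>Mergelyan_block\<close>: up to distance 4 d both are
  bounded separately, beyond it the cubic decay is used. Its integral is O(d), which cancels the 1/d
  in the bound for \<psi>.\<close>

definition Mergelyan_kernel :: "real \<Rightarrow> complex \<Rightarrow> ennreal" where
  "Mergelyan_kernel d w = ennreal (5000 / d) * indicator (cball 0 (4 * d)) w
     + ennreal (1 / cmod w) * indicator (cball 0 (4 * d)) w
     + ennreal (100 * d\<^sup>2) * (ennreal (1 / cmod w ^ 3) * indicator (- ball 0 (4 * d)) w)"

lemma Mergelyan_kernel_measurable [measurable]: "Mergelyan_kernel d \<in> borel_measurable borel"
  unfolding Mergelyan_kernel_def by measurable

lemma nn_integral_Mergelyan_kernel:
  assumes d: "d > 0"
  shows "(\<integral>\<^sup>+ w. Mergelyan_kernel d w \<partial>lborel) \<le> ennreal (81000 * pi * d)"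
proof -
  have "(\<integral>\<^sup>+ w. Mergelyan_kernel d w \<partial>lborel)
      = ennreal (5000 / d) * emeasure lborel (cball (0::complex) (4 * d))
        + (\<integral>\<^sup>+ w\<in>cball 0 (4 * d). ennreal (1 / cmod w) \<partial>lborel)
        + ennreal (100 * d\<^sup>2) * (\<integral>\<^sup>+ w\<in>- ball 0 (4 * d). ennreal (1 / cmod w ^ 3) \<partial>lborel)"
    unfolding Mergelyan_kernel_def
    by (simp add: nn_integral_add nn_integral_cmult nn_integral_cmult_indicator)
  also have "\<dots> \<le> ennreal (5000 / d) * ennreal (pi * (4 * d)\<^sup>2) + ennreal (2 * pi * (4 * d))
        + ennreal (100 * d\<^sup>2) * ennreal (3 * pi / (4 * d))"
    using d by (intro add_mono mult_left_mono nn_integral_inverse_norm_ball nn_integral_inverse_norm_cube)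
      (auto simp: emeasure_cball_complex)
  also have "\<dots> = ennreal (5000 / d * (pi * (4 * d)\<^sup>2) + 2 * pi * (4 * d) + 100 * d\<^sup>2 * (3 * pi / (4 * d)))"
    using d by (simp flip: ennreal_mult ennreal_plus)
  also have "5000 / d * (pi * (4 * d)\<^sup>2) + 2 * pi * (4 * d) + 100 * d\<^sup>2 * (3 * pi / (4 * d)) = 80083 * (pi * d)"
    using d by (simp add: power2_eq_square)
  also have "ennreal (80083 * (pi * d)) \<le> ennreal (81000 * pi * d)"
    using d by (intro ennreal_leI) simp
  finally show ?thesis .
qed

section \<open>Assembling the polynomial approximation\<close>

lemma continuous_compact_support_extension:
  fixes f :: "complex \<Rightarrow> complex"
  assumes K: "compact K" and f: "continuous_on K f"
  obtains h M where "continuous_on UNIV h" "\<And>w. w \<in> K \<Longrightarrow> h w = f w" "M > 0" "\<And>w. h w \<noteq> 0 \<Longrightarrow> cmod w \<le> M"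
proof -
  obtain h0 where h0: "continuous_on UNIV h0" "\<And>w. w \<in> K \<Longrightarrow> h0 w = f w"
    using Tietze_unbounded[of K f UNIV] f compact_imp_closed[OF K] by auto
  obtain B where B: "B > 0" "\<And>w. w \<in> K \<Longrightarrow> cmod w \<le> B"
    using compact_imp_bounded[OF K] bounded_pos by metis
  define h where "h w = of_real (max 0 (min 1 (B + 1 - cmod w))) * h0 w" for w
  show thesis
  proof (rule that[of h "B + 1"])
    show "continuous_on UNIV h" unfolding h_def by (intro continuous_intros h0)
    show "h w = f w" if "w \<in> K" for w using B(2)[OF that] h0(2)[OF that] by (simp add: h_def min_def)
    show "cmod w \<le> B + 1" if "h w \<noteq> 0" for w
      using that by (auto simp: h_def max_def min_def split: if_splits)
  qed (use B in auto)
qed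

lemma compact_support_uniformly_continuous:
  fixes h :: "complex \<Rightarrow> complex"
  assumes cont: "continuous_on UNIV h" and supp: "\<And>w. h w \<noteq> 0 \<Longrightarrow> cmod w \<le> M" and e: "e > 0"
  obtains d where "d > 0" "\<And>x y. cmod (x - y) \<le> d \<Longrightarrow> cmod (h x - h y) \<le> e"
proof -
  have "uniformly_continuous_on (cball 0 (M + 1)) h"
    by (intro compact_uniformly_continuous continuous_on_subset[OF cont]) auto
  then obtain d0 where d0: "d0 > 0"
    "\<And>x y. x \<in> cball 0 (M + 1) \<Longrightarrow> y \<in> cball 0 (M + 1) \<Longrightarrow> dist y x < d0 \<Longrightarrow> dist (h y) (h x) < e"
    using e unfolding uniformly_continuous_on_def by meson
  show thesis
  proof (rule that[of "min (d0 / 2) 1"])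
    fix x y assume xy: "cmod (x - y) \<le> min (d0 / 2) 1"
    show "cmod (h x - h y) \<le> e"
    proof (cases "cmod x \<le> M \<or> cmod y \<le> M")
      case True
      then have "cmod x \<le> M + 1" "cmod y \<le> M + 1"
        using xy norm_triangle_ineq2[of x y] norm_triangle_ineq3[of x y] by auto
      then show ?thesis using d0(2)[of y x] xy d0(1) by (simp add: dist_norm)
    next
      case False
      then have "h x = 0" "h y = 0" using supp[of x] supp[of y] by auto
      then show ?thesis using e by simp
    qed
  qed (use d0 in auto)
qed

text \<open>The Cauchy transform of \<psi> is uniformly close to \<open>f\<close>, and \<psi> lives
  within distance d of the complement. On each piece of its support 1/(z - \<zeta>) is replaced by g
  + (\<zeta> - m) g^2 with a polynomially approximable \<open>g\<close>; integrating in \<zeta>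
  leaves a finite combination of the functions \<open>g j\<close> and their squares. The error is a
  constant multiple of \<omega>, whatever d is.\<close>

theorem Mergelyan:
  assumes K: "compact K" and conn: "connected (- K)" and f: "continuous_on K f" "f holomorphic_on interior K"
  shows "polyapprox K f"
proof (rule polyapprox_uniform_limit)
  fix e :: real assume e: "e > 0"
  \<comment> \<open>The total error below is at most 162000 * 3.5 + 1 = 567001 times
    \<omega>.\<close>
  define \<omega> where "\<omega> = e / 600000"
  have \<omega>: "\<omega> > 0" using e by (simp add: \<omega>_def)
  obtain h M where h: "continuous_on UNIV h" "\<And>w. w \<in> K \<Longrightarrow> h w = f w"
    and M: "M > 0" "\<And>w. h w \<noteq> 0 \<Longrightarrow> cmod w \<le> M"
    using continuous_compact_support_extension[OF K f(1)] by metis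
  obtain d where d: "d > 0" "\<And>x y. cmod (x - y) \<le> d \<Longrightarrow> cmod (h x - h y) \<le> \<omega>"
    using compact_support_uniformly_continuous[OF h(1) M(2) \<omega>] by metis
  obtain \<psi> where [measurable]: "\<psi> \<in> borel_measurable borel" and \<psi>b: "\<And>\<zeta>. cmod (\<psi> \<zeta>) \<le> 2 * \<omega> / d"
    and \<psi>s: "\<And>\<zeta>. \<psi> \<zeta> \<noteq> 0 \<Longrightarrow> cmod \<zeta> \<le> M + d"
    and \<psi>h: "\<And>\<zeta>. h holomorphic_on ball \<zeta> d \<Longrightarrow> \<psi> \<zeta> = 0"
    and \<psi>: "\<And>z. cmod ((LINT \<zeta>|lborel. \<psi> \<zeta> / (z - \<zeta>)) - h z) \<le> \<omega>"
    using Cauchy_smoothing[OF h(1) M(2,1) d] by metis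
  define X where "X = {\<zeta>. \<psi> \<zeta> \<noteq> 0}"
  \<comment> \<open>If the disc of radius \<open>d\<close> about \<zeta> lay in \<open>K\<close>,
    then \<open>h\<close> would agree with the holomorphic \<open>f\<close> there and \<psi> would
    vanish at \<zeta>.\<close>
  have Xc: "\<exists>c\<in>- K. cmod (\<zeta> - c) < d" if "\<zeta> \<in> X" for \<zeta>
  proof (rule ccontr)
    assume "\<not> ?thesis"
    then have "ball \<zeta> d \<subseteq> K" by (auto simp: dist_norm)
    then have sub: "ball \<zeta> d \<subseteq> interior K" by (simp add: interior_maximal)
    then have "f holomorphic_on ball \<zeta> d" using f(2) holomorphic_on_subset by blast
    moreover have "f w = h w" if "w \<in> ball \<zeta> d" for w
    proof -
      have "w \<in> K" using that sub interior_subset[of K] by blast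
      then show ?thesis using h(2) by simp
    qed
    ultimately have "h holomorphic_on ball \<zeta> d"
      by (rule holomorphic_transform)
    then show False using \<psi>h that by (simp add: X_def)
  qed
  \<comment> \<open>The closure provides compactness for a finite subcover; its points are within
    \<open>d\<close> of \<open>X\<close>, hence within \<open>2 * d\<close> of a centre off
    \<open>K\<close>.\<close>
  have "compact (closure X)"
    using \<psi>s by (auto simp: compact_closure X_def intro!: boundedI)
  moreover have "closure X \<subseteq> (\<Union>c\<in>- K. ball c (2 * d))"
  proof
    fix x assume "x \<in> closure X"
    then obtain y where y: "y \<in> X" "dist y x < d" using d(1) by (auto simp: closure_approachable)
    then obtain c where c: "c \<in> - K" "cmod (y - c) < d" using Xc by blast
    then have "dist c x < 2 * d" using y dist_triangle[of c x y] by (simp add: dist_norm norm_minus_commute)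
    then show "x \<in> (\<Union>c\<in>- K. ball c (2 * d))" using c by auto
  qed
  ultimately obtain C where C: "C \<subseteq> - K" "finite C" "closure X \<subseteq> (\<Union>c\<in>C. ball c (2 * d))"
    using compactE_image[of "closure X" "- K" "\<lambda>c. ball c (2 * d)"] by (metis open_ball)
  obtain cs n where cs: "C = cs ` {i::nat. i < n}" using C(2) finite_imp_nat_seg_image_inj_on by metis
  define Y where "Y j = X \<inter> ball (cs j) (2 * d) - (\<Union>i<j. ball (cs i) (2 * d))" for j
  have Xm [measurable]: "X \<in> sets borel" unfolding X_def by measurable
  have Ym [measurable]: "Y j \<in> sets borel" for j
    unfolding Y_def by (intro sets.Diff sets.Int Xm sets.countable_UN) auto
  have Ydisj: "disjoint_family_on Y {..<n}"
    unfolding disjoint_family_on_def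
  proof (intro ballI impI)
    fix i j :: nat assume "i \<noteq> j"
    then show "Y i \<inter> Y j = {}"
      by (cases i j rule: linorder_cases) (auto simp: Y_def)
  qed
  have YX: "(\<Union>j<n. Y j) = X"
  proof
    show "X \<subseteq> (\<Union>j<n. Y j)"
    proof
      fix x assume x: "x \<in> X"
      then have "x \<in> (\<Union>c\<in>C. ball c (2 * d))" using C(3) closure_subset by blast
      then have ex: "\<exists>j. j < n \<and> x \<in> ball (cs j) (2 * d)" unfolding cs by auto
      define j where "j = (LEAST j. j < n \<and> x \<in> ball (cs j) (2 * d))"
      have j: "j < n" "x \<in> ball (cs j) (2 * d)" using LeastI_ex[OF ex] by (auto simp: j_def)
      have "x \<notin> ball (cs i) (2 * d)" if "i < j" for i
        using not_less_Least[of i "\<lambda>j. j < n \<and> x \<in> ball (cs j) (2 * d)"] that j(1) by (simp add: j_def)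
      then have "x \<in> Y j" using x j by (auto simp: Y_def)
      then show "x \<in> (\<Union>j<n. Y j)" using j by blast
    qed
  qed (auto simp: Y_def)
  have "\<exists>g m. polyapprox K g \<and>
    (\<forall>z \<zeta>. z \<in> K \<longrightarrow> cmod (\<zeta> - cs j) < 2 * d \<longrightarrow> cmod (g z + (\<zeta> - m) * (g z)\<^sup>2) \<le> 5000 / d) \<and>
    (\<forall>z \<zeta>. z \<in> K \<longrightarrow> cmod (\<zeta> - cs j) < 2 * d \<longrightarrow> cmod (z - \<zeta>) \<ge> 4 * d \<longrightarrow>
       cmod (g z + (\<zeta> - m) * (g z)\<^sup>2 - 1 / (z - \<zeta>)) \<le> 100 * d\<^sup>2 / cmod (z - \<zeta>) ^ 3)" if "j < n" for j
  proof -
    have "cs j \<notin> K" using C(1) cs that by auto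
    from Mergelyan_block[OF K conn this d(1)] show ?thesis by metis
  qed
  then obtain g m where gP: "\<And>j. j < n \<Longrightarrow> polyapprox K (g j)"
    and gb: "\<And>j z \<zeta>. j < n \<Longrightarrow> z \<in> K \<Longrightarrow> cmod (\<zeta> - cs j) < 2 * d \<Longrightarrow> cmod (g j z + (\<zeta> - m j) * (g j z)\<^sup>2) \<le> 5000 / d"
    and gf: "\<And>j z \<zeta>. j < n \<Longrightarrow> z \<in> K \<Longrightarrow> cmod (\<zeta> - cs j) < 2 * d \<Longrightarrow> cmod (z - \<zeta>) \<ge> 4 * d \<Longrightarrow>
       cmod (g j z + (\<zeta> - m j) * (g j z)\<^sup>2 - 1 / (z - \<zeta>)) \<le> 100 * d\<^sup>2 / cmod (z - \<zeta>) ^ 3"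
    by metis
  define \<psi>j where "\<psi>j j \<zeta> = indicator (Y j) \<zeta> *\<^sub>R \<psi> \<zeta>" for j \<zeta>
  have \<psi>j_m [measurable]: "\<psi>j j \<in> borel_measurable borel" for j
    unfolding \<psi>j_def by measurable
  have \<psi>j_b: "cmod (\<psi>j j \<zeta>) \<le> 2 * \<omega> / d" for j \<zeta>
    using \<psi>b[of \<zeta>] \<omega> d(1) by (auto simp: \<psi>j_def indicator_def)
  have \<psi>j_s: "\<zeta> \<in> cball 0 (M + d)" if "\<psi>j j \<zeta> \<noteq> 0" for j \<zeta>
    using that \<psi>s[of \<zeta>] by (auto simp: \<psi>j_def indicator_def split: if_splits)
  have sum_\<psi>: "\<psi> \<zeta> = (\<Sum>j<n. \<psi>j j \<zeta>)" for \<zeta>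
  proof -
    have "(\<Sum>j<n. \<psi>j j \<zeta>) = (\<Sum>j<n. indicator (Y j) \<zeta>) *\<^sub>R \<psi> \<zeta>"
      by (simp add: \<psi>j_def scaleR_sum_left)
    also have "(\<Sum>j<n. indicator (Y j) \<zeta>) = (indicator X \<zeta> :: real)"
    proof -
      have "(indicator (\<Union>j<n. Y j) \<zeta> :: real) = (\<Sum>j<n. indicator (Y j) \<zeta>)"
        by (rule indicator_UN_disjoint[OF _ Ydisj]) simp
      then show ?thesis by (simp add: YX)
    qed
    finally show ?thesis by (simp add: X_def indicator_def)
  qed
  \<comment> \<open>Moments of the pieces of \<psi>: integrating g + (\<zeta> - m) g^2 against
    \<open>\<psi>j j\<close> gives \<alpha> g + \<beta> g^2.\<close>
  define \<alpha> where "\<alpha> j = (LINT \<zeta>|lborel. \<psi>j j \<zeta>)" for j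
  define \<beta> where "\<beta> j = (LINT \<zeta>|lborel. \<psi>j j \<zeta> * (\<zeta> - m j))" for j
  have int1: "integrable lborel (\<psi>j j)" for j
    by (rule integrable_bounded_supp[OF \<psi>j_m \<psi>j_b \<psi>j_s])
  have int2: "integrable lborel (\<lambda>\<zeta>. \<psi>j j \<zeta> * (\<zeta> - m j))" for j
  proof (rule integrable_bounded_supp[where M = "2 * \<omega> / d * (M + d + cmod (m j))" and c = 0 and s = "M + d"])
    fix \<zeta>
    show "\<zeta> \<in> cball 0 (M + d)" if "\<psi>j j \<zeta> * (\<zeta> - m j) \<noteq> 0" using that \<psi>j_s[of j \<zeta>] by auto
    show "cmod (\<psi>j j \<zeta> * (\<zeta> - m j)) \<le> 2 * \<omega> / d * (M + d + cmod (m j))"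
    proof (cases "\<psi>j j \<zeta> = 0")
      case False
      then have "cmod (\<zeta> - m j) \<le> M + d + cmod (m j)"
        using \<psi>j_s[of j \<zeta>] norm_triangle_ineq4[of \<zeta> "m j"] by simp
      then show ?thesis unfolding norm_mult
        using \<psi>j_b[of j \<zeta>] by (intro mult_mono) (auto intro: order_trans[OF norm_ge_zero])
    qed (use \<omega> d M in simp)
  qed measurable
  define F where "F z = (\<Sum>j<n. \<alpha> j * g j z + \<beta> j * (g j z)\<^sup>2)" for z
  have "polyapprox K F"
    unfolding F_def
    by (intro polyapprox_sum polyapprox_add polyapprox_cmult polyapprox_power gP K) auto
  moreover have "cmod (f z - F z) < e" if z: "z \<in> K" for z
  proof -
    let ?Q = "\<lambda>j \<zeta>. \<psi>j j \<zeta> * (g j z + (\<zeta> - m j) * (g j z)\<^sup>2)"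
    have intQ: "integrable lborel (?Q j)" and intQ_eq: "(LINT \<zeta>|lborel. ?Q j \<zeta>) = \<alpha> j * g j z + \<beta> j * (g j z)\<^sup>2" for j
    proof -
      have eq: "?Q j \<zeta> = \<psi>j j \<zeta> * g j z + (\<psi>j j \<zeta> * (\<zeta> - m j)) * (g j z)\<^sup>2" for \<zeta>
        by (simp add: algebra_simps)
      show "integrable lborel (?Q j)" unfolding eq using int1[of j] int2[of j] by (intro Bochner_Integration.integrable_add integrable_mult_left) auto
      show "(LINT \<zeta>|lborel. ?Q j \<zeta>) = \<alpha> j * g j z + \<beta> j * (g j z)\<^sup>2"
        unfolding eq \<alpha>_def \<beta>_def using int1[of j] int2[of j]
        by (subst Bochner_Integration.integral_add) auto
    qed
    have F_eq: "F z = (LINT \<zeta>|lborel. (\<Sum>j<n. ?Q j \<zeta>))"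
      unfolding F_def using intQ by (subst Bochner_Integration.integral_sum) (auto simp: intQ_eq)
    have intC: "integrable lborel (\<lambda>\<zeta>. \<psi> \<zeta> / (z - \<zeta>))"
      by (rule Cauchy_kernel_bound(2)[OF _ \<psi>b \<psi>s]) (use M d in auto)
    let ?D = "\<lambda>\<zeta>. (\<Sum>j<n. ?Q j \<zeta>) - \<psi> \<zeta> / (z - \<zeta>)"
    have intD: "integrable lborel ?D"
      using intQ intC by (intro Bochner_Integration.integrable_diff Bochner_Integration.integrable_sum) auto
    have "F z - (LINT \<zeta>|lborel. \<psi> \<zeta> / (z - \<zeta>)) = (LINT \<zeta>|lborel. ?D \<zeta>)"
      unfolding F_eq using intQ intC
      by (intro Bochner_Integration.integral_diff[symmetric] Bochner_Integration.integrable_sum) auto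
    also have "cmod \<dots> \<le> 2 * \<omega> / d * (81000 * pi * d)"
    proof (rule lborel_integral_norm_le[OF intD])
      have "(\<integral>\<^sup>+ \<zeta>. ennreal (cmod (?D \<zeta>)) \<partial>lborel) \<le> (\<integral>\<^sup>+ \<zeta>. ennreal (2 * \<omega> / d) * Mergelyan_kernel d (z - \<zeta>) \<partial>lborel)"
      proof (rule nn_integral_mono)
        fix \<zeta>
        show "ennreal (cmod (?D \<zeta>)) \<le> ennreal (2 * \<omega> / d) * Mergelyan_kernel d (z - \<zeta>)"
        proof (cases "\<zeta> \<in> X")
          case False
          then have "\<psi> \<zeta> = 0" by (simp add: X_def)
          then have "?D \<zeta> = 0" by (simp add: \<psi>j_def)
          then show ?thesis by (simp only: norm_zero ennreal_0) simp
        next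
          case True
          then obtain j where j: "j < n" "\<zeta> \<in> Y j" using YX by blast
          have "\<psi>j i \<zeta> = (if i = j then \<psi> \<zeta> else 0)" if "i < n" for i
            using Ydisj j that by (auto simp: \<psi>j_def disjoint_family_on_def indicator_def)
          then have "(\<Sum>i<n. ?Q i \<zeta>) = (\<Sum>i<n. if i = j then ?Q j \<zeta> else 0)"
            by (intro sum.cong) auto
          also have "\<dots> = ?Q j \<zeta>" using j by simp
          also have "\<psi>j j \<zeta> = \<psi> \<zeta>" using j by (simp add: \<psi>j_def)
          finally have D: "?D \<zeta> = \<psi> \<zeta> * (g j z + (\<zeta> - m j) * (g j z)\<^sup>2 - 1 / (z - \<zeta>))"
            by (simp add: algebra_simps)
          have \<zeta>c: "cmod (\<zeta> - cs j) < 2 * d" using j by (auto simp: Y_def dist_norm norm_minus_commute)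
          have "ennreal (cmod (g j z + (\<zeta> - m j) * (g j z)\<^sup>2 - 1 / (z - \<zeta>))) \<le> Mergelyan_kernel d (z - \<zeta>)"
          proof (cases "cmod (z - \<zeta>) \<ge> 4 * d")
            case True
            have "ennreal (cmod (g j z + (\<zeta> - m j) * (g j z)\<^sup>2 - 1 / (z - \<zeta>))) \<le> ennreal (100 * d\<^sup>2 * (1 / cmod (z - \<zeta>) ^ 3))"
              using gf[OF j(1) z \<zeta>c True] by (intro ennreal_leI) simp
            also have "\<dots> = ennreal (100 * d\<^sup>2) * (ennreal (1 / cmod (z - \<zeta>) ^ 3) * indicator (- ball 0 (4 * d)) (z - \<zeta>))"
              using True by (subst ennreal_mult) auto
            also have "\<dots> \<le> Mergelyan_kernel d (z - \<zeta>)"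
              unfolding Mergelyan_kernel_def by (rule add_increasing) auto
            finally show ?thesis .
          next
            case False
            have "cmod (g j z + (\<zeta> - m j) * (g j z)\<^sup>2 - 1 / (z - \<zeta>)) \<le> 5000 / d + 1 / cmod (z - \<zeta>)"
              using gb[OF j(1) z \<zeta>c] norm_triangle_ineq4[of "g j z + (\<zeta> - m j) * (g j z)\<^sup>2" "1 / (z - \<zeta>)"]
              by (simp add: norm_divide)
            then have "ennreal (cmod (g j z + (\<zeta> - m j) * (g j z)\<^sup>2 - 1 / (z - \<zeta>))) \<le> ennreal (5000 / d + 1 / cmod (z - \<zeta>))"
              by (rule ennreal_leI)
            also have "\<dots> = ennreal (5000 / d) + ennreal (1 / cmod (z - \<zeta>))"
              using d(1) by (intro ennreal_plus) auto
            also have "\<dots> \<le> Mergelyan_kernel d (z - \<zeta>)"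
              unfolding Mergelyan_kernel_def using False by (simp add: indicator_def)
            finally show ?thesis .
          qed
          then show ?thesis
            unfolding D norm_mult using \<psi>b[of \<zeta>]
            by (subst ennreal_mult) (auto intro!: mult_mono ennreal_leI)
        qed
      qed
      also have "\<dots> = ennreal (2 * \<omega> / d) * (\<integral>\<^sup>+ \<zeta>. Mergelyan_kernel d (z - \<zeta>) \<partial>lborel)"
        by (rule nn_integral_cmult) measurable
      also have "(\<integral>\<^sup>+ \<zeta>. Mergelyan_kernel d (z - \<zeta>) \<partial>lborel) = (\<integral>\<^sup>+ \<zeta>. Mergelyan_kernel d \<zeta> \<partial>lborel)"
        by (rule nn_integral_lborel_shift) measurable
      also have "ennreal (2 * \<omega> / d) * \<dots> \<le> ennreal (2 * \<omega> / d) * ennreal (81000 * pi * d)"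
        by (intro mult_left_mono nn_integral_Mergelyan_kernel d) auto
      also have "\<dots> = ennreal (2 * \<omega> / d * (81000 * pi * d))"
        using \<omega> d(1) by (intro ennreal_mult[symmetric]) auto
      finally show "(\<integral>\<^sup>+ \<zeta>. ennreal (cmod (?D \<zeta>)) \<partial>lborel) \<le> ennreal (2 * \<omega> / d * (81000 * pi * d))" .
    qed (use \<omega> d in auto)
    also have "\<dots> = 162000 * pi * \<omega>" using d(1) by simp
    finally have "cmod (F z - (LINT \<zeta>|lborel. \<psi> \<zeta> / (z - \<zeta>))) \<le> 162000 * pi * \<omega>" .
    moreover have "162000 * pi * \<omega> \<le> 162000 * 3.5 * \<omega>"
      using \<omega> pi_less_4 pi_approx by (intro mult_right_mono mult_left_mono) auto
    moreover have "f z - F z = - (F z - (LINT \<zeta>|lborel. \<psi> \<zeta> / (z - \<zeta>))) - ((LINT \<zeta>|lborel. \<psi> \<zeta> / (z - \<zeta>)) - h z)"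
      using h(2)[OF z] by simp
    then have "cmod (f z - F z) \<le> cmod (F z - (LINT \<zeta>|lborel. \<psi> \<zeta> / (z - \<zeta>))) + cmod ((LINT \<zeta>|lborel. \<psi> \<zeta> / (z - \<zeta>)) - h z)"
      by (metis norm_minus_cancel norm_triangle_ineq4)
    ultimately show "cmod (f z - F z) < e"
      using \<psi>[of z] \<omega> unfolding \<omega>_def by linarith
  qed
  ultimately show "\<exists>g. polyapprox K g \<and> (\<forall>z\<in>K. cmod (f z - g z) < e)"
    by (intro exI[of _ F]) simp
qed

section \<open>The Hahn-Banach theorem and the annihilating entire function\<close>

text \<open>The scalar action is a parameter because polynomials with complex scalars are later
  viewed as a real vector space.\<close>

definition sublinear :: "(real \<Rightarrow> 'b \<Rightarrow> 'b) \<Rightarrow> ('b::ab_group_add \<Rightarrow> real) \<Rightarrow> bool" where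
  "sublinear s q \<longleftrightarrow> (\<forall>x y. q (x + y) \<le> q x + q y) \<and> (\<forall>t x. t \<ge> 0 \<longrightarrow> q (s t x) = t * q x)"

context
  fixes s :: "real \<Rightarrow> 'b::ab_group_add \<Rightarrow> 'b"
  assumes vs: "vector_space s"
begin

interpretation vector_space s by (rule vs)

lemma sublinear_zero: "sublinear s q \<Longrightarrow> q 0 = 0"
  unfolding sublinear_def using scale_zero_left by (metis mult_zero_left order_refl)

lemma sublinear_minus:
  assumes q: "sublinear s q"
  shows "- q (- x) \<le> q x"
proof -
  have "q (x + - x) \<le> q x + q (- x)" using q unfolding sublinear_def by blast
  then show ?thesis using sublinear_zero[OF q] by simp
qed

text \<open>The best decrease of \<open>q\<close> along \<open>y\<close>: it stays sublinear and
  below \<open>q\<close>, and its value at \<open>- y\<close> is at most \<open>- q y\<close>. A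
  sublinear functional that no such step lowers is additive.\<close>

definition sublinear_step :: "('b \<Rightarrow> real) \<Rightarrow> 'b \<Rightarrow> 'b \<Rightarrow> real" where
  "sublinear_step q y x = (INF t\<in>{0..}. q (x + s t y) - t * q y)"

lemma sublinear_step_bdd:
  assumes q: "sublinear s q"
  shows "bdd_below ((\<lambda>t. q (x + s t y) - t * q y) ` {0..})"
proof (rule bdd_belowI2[where m = "- q (- x)"])
  fix t :: real assume t: "t \<in> {0..}"
  have "q ((x + s t y) + - x) \<le> q (x + s t y) + q (- x)"
    using q unfolding sublinear_def by blast
  then have "q (s t y) \<le> q (x + s t y) + q (- x)" by simp
  moreover have "q (s t y) = t * q y" using q t by (simp add: sublinear_def)
  ultimately show "- q (- x) \<le> q (x + s t y) - t * q y" by simp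
qed

lemma sublinear_step_le:
  assumes q: "sublinear s q" and "t \<ge> 0"
  shows "sublinear_step q y x \<le> q (x + s t y) - t * q y"
  unfolding sublinear_step_def
  by (rule cINF_lower[OF sublinear_step_bdd[OF q]]) (use assms in auto)

lemma sublinear_step_sublinear:
  assumes q: "sublinear s q"
  shows "sublinear s (sublinear_step q y)"
proof -
  note le = sublinear_step_le[OF q]
  have add: "q (a + b) \<le> q a + q b" and hom: "t \<ge> 0 \<Longrightarrow> q (s t a) = t * q a" for a b t
    using q by (auto simp: sublinear_def)
  have "sublinear_step q y (a + b) \<le> sublinear_step q y a + sublinear_step q y b" for a b
  proof -
    have *: "sublinear_step q y (a + b) \<le> (q (a + s t y) - t * q y) + (q (b + s u y) - u * q y)"
      if "t \<ge> 0" "u \<ge> 0" for t u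
    proof -
      have "sublinear_step q y (a + b) \<le> q (a + b + s (t + u) y) - (t + u) * q y"
        using that by (intro le) simp
      also have "a + b + s (t + u) y = (a + s t y) + (b + s u y)"
        by (simp add: scale_left_distrib algebra_simps)
      also have "q \<dots> \<le> q (a + s t y) + q (b + s u y)" by (rule add)
      finally show ?thesis by (simp add: algebra_simps)
    qed
    have "sublinear_step q y (a + b) - sublinear_step q y b \<le> q (a + s t y) - t * q y" if "t \<ge> 0" for t
    proof -
      have "sublinear_step q y (a + b) - (q (a + s t y) - t * q y) \<le> sublinear_step q y b"
        unfolding sublinear_step_def[of q y b]
        by (rule cINF_greatest) (use *[OF that] in \<open>auto simp: algebra_simps\<close>)
      then show ?thesis by simp
    qed
    then have "sublinear_step q y (a + b) - sublinear_step q y b \<le> sublinear_step q y a"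
      unfolding sublinear_step_def[of q y a] by (intro cINF_greatest) auto
    then show ?thesis by simp
  qed
  moreover have "sublinear_step q y (s t x) = t * sublinear_step q y x" if t: "t \<ge> 0" for t x
  proof (cases "t = 0")
    case True
    have "sublinear_step q y 0 = (INF t\<in>{0::real..}. 0)"
      unfolding sublinear_step_def by (intro INF_cong refl) (simp add: hom)
    then show ?thesis using True by simp
  next
    case False
    then have t0: "t > 0" using t by simp
    have ge: "t' * sublinear_step q y x' \<le> sublinear_step q y (s t' x')" if "t' > 0" for t' x'
      unfolding sublinear_step_def[of q y "s t' x'"]
    proof (rule cINF_greatest)
      fix u :: real assume u: "u \<in> {0..}"
      have "sublinear_step q y x' \<le> q (x' + s (u / t') y) - (u / t') * q y"
        using u that by (intro le) simp
      then have "t' * sublinear_step q y x' \<le> t' * (q (x' + s (u / t') y) - (u / t') * q y)"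
        using that by (intro mult_left_mono) auto
      also have "\<dots> = q (s t' (x' + s (u / t') y)) - u * q y"
        using that by (simp add: hom right_diff_distrib)
      also have "s t' (x' + s (u / t') y) = s t' x' + s u y"
        using that by (simp add: scale_right_distrib)
      finally show "t' * sublinear_step q y x' \<le> q (s t' x' + s u y) - u * q y" .
    qed auto
    have "(1 / t) * sublinear_step q y (s t x) \<le> sublinear_step q y (s (1 / t) (s t x))"
      using t0 by (intro ge) simp
    then have "sublinear_step q y (s t x) \<le> t * sublinear_step q y x"
      using t0 by (simp add: field_simps)
    with ge[OF t0, of x] show ?thesis by simp
  qed
  ultimately show ?thesis by (simp add: sublinear_def)
qed

text \<open>Zorn's lemma downwards. The infimum of a chain is finite because - p(-x) \<le> q(x) for
  every sublinear q \<le> p, and it is subadditive because two members of a chain have a common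
  lower bound in the chain.\<close>

lemma minimal_sublinear_exists:
  assumes p: "sublinear s p"
  obtains q where "sublinear s q" "\<And>x. q x \<le> p x" "\<And>q'. sublinear s q' \<Longrightarrow> (\<And>x. q' x \<le> q x) \<Longrightarrow> q' = q"
proof -
  define A where "A = {q. sublinear s q \<and> q \<le> p}"
  have "\<exists>m\<in>A. \<forall>a\<in>A. a \<le> m \<longrightarrow> a = m"
  proof (rule predicate_Zorn[where P = "\<lambda>a b. b \<le> a"])
    show "partial_order_on A (relation_of (\<lambda>a b. b \<le> a) A)"
      by (rule partial_order_on_relation_ofI) auto
    fix C assume "C \<in> Chains (relation_of (\<lambda>a b. b \<le> a) A)"
    then have CA: "C \<subseteq> A" and ch: "\<And>a b. a \<in> C \<Longrightarrow> b \<in> C \<Longrightarrow> a \<le> b \<or> b \<le> a"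
      by (auto simp: Chains_def relation_of_def)
    show "\<exists>u\<in>A. \<forall>a\<in>C. u \<le> a"
    proof (cases "C = {}")
      case True
      then show ?thesis using p by (auto simp: A_def)
    next
      case False
      define u where "u x = (INF q\<in>C. q x)" for x
      have bdd: "bdd_below ((\<lambda>q. q x) ` C)" for x
      proof (rule bdd_belowI2[where m = "- p (- x)"])
        fix q assume "q \<in> C"
        then have "sublinear s q" "q (- x) \<le> p (- x)" using CA by (auto simp: A_def le_fun_def)
        then show "- p (- x) \<le> q x" using sublinear_minus[of q x] by simp
      qed
      have le: "u x \<le> q x" if "q \<in> C" for q x
        unfolding u_def by (rule cINF_lower[OF bdd that])
      have "sublinear s u"
        unfolding sublinear_def
      proof (intro conjI allI impI)
        fix x y
        have *: "u (x + y) \<le> q x + q' y" if qq: "q \<in> C" "q' \<in> C" for q q'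
        proof -
          obtain r where r: "r \<in> C" "r \<le> q" "r \<le> q'"
            using ch[OF qq] qq by auto
          have "u (x + y) \<le> r (x + y)" by (rule le[OF r(1)])
          also have "\<dots> \<le> r x + r y" using r(1) CA by (auto simp: A_def sublinear_def)
          also have "\<dots> \<le> q x + q' y" using r(2,3) by (intro add_mono) (auto simp: le_fun_def)
          finally show ?thesis .
        qed
        have "u (x + y) - u y \<le> q x" if q: "q \<in> C" for q
        proof -
          have "u (x + y) - q x \<le> u y"
            unfolding u_def[of y] by (rule cINF_greatest[OF False]) (use *[OF q] in \<open>simp add: algebra_simps\<close>)
          then show ?thesis by simp
        qed
        then have "u (x + y) - u y \<le> u x"
          unfolding u_def[of x] by (intro cINF_greatest[OF False])
        then show "u (x + y) \<le> u x + u y" by simp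
      next
        fix t :: real and x assume t: "t \<ge> 0"
        have eq: "q (s t x) = t * q x" if "q \<in> C" for q
          using that CA t by (auto simp: A_def sublinear_def)
        show "u (s t x) = t * u x"
        proof (cases "t = 0")
          case True
          have "u (s t x) = (INF q\<in>C. 0)" unfolding u_def using eq True by (intro INF_cong refl) simp
          then show ?thesis using True False by simp
        next
          case tn: False
          then have t0: "t > 0" using t by simp
          show ?thesis
          proof (rule antisym)
            have "u (s t x) / t \<le> q x" if "q \<in> C" for q
              using le[OF that, of "s t x"] eq[OF that] t0 by (simp add: divide_le_eq mult.commute)
            then have "u (s t x) / t \<le> u x" unfolding u_def[of x] by (intro cINF_greatest[OF False])
            then show "u (s t x) \<le> t * u x" using t0 by (simp add: divide_le_eq mult.commute)
            show "t * u x \<le> u (s t x)"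
              unfolding u_def[of "s t x"]
            proof (rule cINF_greatest[OF False])
              fix q assume q: "q \<in> C"
              have "t * u x \<le> t * q x" using le[OF q] t0 by (intro mult_left_mono) auto
              then show "t * u x \<le> q (s t x)" using eq[OF q] by simp
            qed
          qed
        qed
      qed
      moreover obtain q0 where "q0 \<in> C" using False by blast
      then have "u \<le> p"
        using CA le[of q0] by (auto simp: A_def le_fun_def intro: order_trans[of _ "q0 _"])
      ultimately show ?thesis
        using le by (intro bexI[of _ u]) (auto simp: A_def le_fun_def)
    qed
  qed
  then obtain m where "m \<in> A" "\<forall>a\<in>A. a \<le> m \<longrightarrow> a = m" by blast
  then show thesis
    by (intro that[of m]) (auto simp: A_def le_fun_def intro: order_trans)
qed

text \<open>A minimal sublinear functional is linear, so nothing is extended from subspaces.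
  Starting the minimisation at the step of \<open>p\<close> in direction \<open>x0\<close> forces
  \<open>L (- x0) \<le> - p x0\<close>, whence equality at \<open>x0\<close>.\<close>

theorem Hahn_Banach_sublinear:
  assumes p: "sublinear s p"
  obtains L where "\<And>x y. L (x + y) = L x + L y" "\<And>t x. L (s t x) = t * L x" "\<And>x. L x \<le> p x" "L x0 = p x0"
proof -
  obtain L where L: "sublinear s L" "\<And>x. L x \<le> sublinear_step p x0 x"
    and min: "\<And>q'. sublinear s q' \<Longrightarrow> (\<And>x. q' x \<le> L x) \<Longrightarrow> q' = L"
    using minimal_sublinear_exists[OF sublinear_step_sublinear[OF p]] by metis
  have sub: "L (x + y) \<le> L x + L y" and hom: "t \<ge> 0 \<Longrightarrow> L (s t x) = t * L x" for x y t
    using L(1) by (auto simp: sublinear_def)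
  have add: "L (x + y) = L x + L y" for x y
  proof (rule antisym[OF sub])
    \<comment> \<open>The parameter value 0 shows that the step lies below \<open>L\<close>, so
      minimality makes them equal; the value 1 then gives the reverse inequality.\<close>
    have "sublinear_step L y x \<le> L x" for x
      using sublinear_step_le[OF L(1), of 0 y x] by simp
    then have "sublinear_step L y = L"
      by (intro min sublinear_step_sublinear L)
    then show "L x + L y \<le> L (x + y)"
      using sublinear_step_le[OF L(1), of 1 y x] by simp
  qed
  have L0: "L 0 = 0" using L(1) by (rule sublinear_zero)
  have neg: "L (- x) = - L x" for x
    using add[of x "- x"] L0 by simp
  have hom': "L (s t x) = t * L x" for t x
  proof (cases "t \<ge> 0")
    case False
    have "L (s t x) = - L (s (- t) x)" using neg[of "s (- t) x"] by simp
    also have "L (s (- t) x) = - t * L x" using False by (intro hom) simp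
    finally show ?thesis by simp
  qed (rule hom)
  have le: "L x \<le> p x" for x
    using L(2)[of x] sublinear_step_le[OF p, of 0 x0 x] by simp
  have "L (- x0) \<le> p (- x0 + s 1 x0) - 1 * p x0"
    using L(2)[of "- x0"] sublinear_step_le[OF p, of 1 x0 "- x0"] by linarith
  then have "p x0 \<le> L x0" using neg sublinear_zero[OF p] by simp
  with le[of x0] have "L x0 = p x0" by simp
  with add hom' le show thesis using that by blast
qed

end

lemma complex_Hahn_Banach:
  fixes c :: "complex \<Rightarrow> 'b::ab_group_add \<Rightarrow> 'b" and p :: "'b \<Rightarrow> real"
  assumes vs: "vector_space c" and add: "\<And>x y. p (x + y) \<le> p x + p y" and hom: "\<And>t x. p (c t x) = cmod t * p x"
  obtains L where "\<And>x y. L (x + y) = L x + L y" "\<And>t x. L (c t x) = t * L x" "\<And>x. cmod (L x) \<le> p x" "Re (L x0) = p x0"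
proof -
  interpret vector_space c by (rule vs)
  have vsr: "vector_space (\<lambda>t. c (of_real t))"
    by unfold_locales (simp_all add: scale_right_distrib scale_left_distrib)
  have "sublinear (\<lambda>t. c (of_real t)) p"
    using add hom by (simp add: sublinear_def)
  then obtain R where R: "\<And>x y. R (x + y) = R x + R y" "\<And>t x. R (c (of_real t) x) = t * R x"
    "\<And>x. R x \<le> p x" "R x0 = p x0"
    using Hahn_Banach_sublinear[OF vsr, of p x0] by metis
  \<comment> \<open>A complex linear functional is determined by its real part: L(x) = R(x) - i R(i
    x). Multiplying x by the unimodular scalar that makes L(x) real and positive transfers the bound
    from R to the modulus of L.\<close>
  define L where "L x = Complex (R x) (- R (c \<i> x))" for x
  have Ladd: "L (x + y) = L x + L y" for x y
    by (simp add: L_def R scale_right_distrib complex_eq_iff)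
  have Lhom: "L (c t x) = t * L x" for t x
  proof -
    have t: "t = of_real (Re t) + of_real (Im t) * \<i>" by (simp add: complex_eq_iff)
    have "R (c t x) = Re t * R x + Im t * R (c \<i> x)" for x
      by (subst t) (simp add: scale_left_distrib R flip: scale_scale)
    note eq = this
    have "c \<i> (c \<i> x) = - x" by simp
    then have ii: "R (c \<i> (c \<i> x)) = - R x" using R(2)[of "-1" x] by simp
    have "c \<i> (c t x) = c t (c \<i> x)" by (rule scale_left_commute)
    then show ?thesis
      using eq[of x] eq[of "c \<i> x"] by (simp only: L_def complex_eq_iff ii) simp
  qed
  have "cmod (L x) \<le> p x" for x
  proof (cases "L x = 0")
    case True
    have "0 \<le> p x" using R(3)[of x] R(3)[of "- x"] hom[of "-1" x] R(2)[of "-1" x] by simp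
    then show ?thesis using True by simp
  next
    case False
    define a where "a = of_real (cmod (L x)) / L x"
    have a: "cmod a = 1" using False by (simp add: a_def norm_divide)
    have "L (c a x) = of_real (cmod (L x))" using False by (simp add: Lhom a_def)
    then have "cmod (L x) = R (c a x)" by (metis L_def Re_complex_of_real complex.sel(1))
    also have "\<dots> \<le> p x" using R(3)[of "c a x"] hom[of a x] a by simp
    finally show ?thesis .
  qed
  moreover have "Re (L x0) = p x0" by (simp add: L_def R)
  ultimately show thesis using that Ladd Lhom by blast
qed

section \<open>The annihilating functional and its Laplace transform\<close>

lemma exp_series_uniform:
  fixes e R :: real
  assumes e: "e > 0"
  obtains N where "\<And>n x. n \<ge> N \<Longrightarrow> cmod x \<le> R \<Longrightarrow> cmod ((\<Sum>k<n. x ^ k / fact k) - exp x) < e"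
proof -
  have S: "summable (\<lambda>k. (1 / fact k) * complex_of_real (\<bar>R\<bar> + 1) ^ k)"
    using summable_exp[of "complex_of_real (\<bar>R\<bar> + 1)"] by (simp add: inverse_eq_divide)
  have "ereal (\<bar>R\<bar> + 1) \<le> conv_radius (\<lambda>k. 1 / fact k :: complex)"
    using conv_radius_geI[OF S] by (simp only: norm_of_real) simp
  then have "ereal R < conv_radius (\<lambda>k. 1 / fact k :: complex)"
    by (rule less_le_trans[rotated]) simp
  from uniform_limitD[OF powser_uniform_limit[OF this, of 0] e]
  have "\<exists>N. \<forall>n\<ge>N. \<forall>x\<in>cball (0::complex) R. dist (\<Sum>k<n. 1 / fact k * (x - 0) ^ k) (\<Sum>k. 1 / fact k * (x - 0) ^ k) < e"
    by (simp only: eventually_sequentially)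
  then obtain N where N: "\<forall>n\<ge>N. \<forall>x\<in>cball (0::complex) R. dist (\<Sum>k<n. 1 / fact k * (x - 0) ^ k) (\<Sum>k. 1 / fact k * (x - 0) ^ k) < e" ..
  show thesis
  proof (rule that[of N])
    fix n and x :: complex assume n: "n \<ge> N" "cmod x \<le> R"
    have "(\<Sum>k. 1 / fact k * x ^ k) = exp x"
      by (simp add: exp_def scaleR_conv_of_real divide_inverse mult.commute)
    then show "cmod ((\<Sum>k<n. x ^ k / fact k) - exp x) < e"
      using N[rule_format, of n x] n by (simp add: dist_norm)
  qed
qed

text \<open>The functional is defined only on polynomials, so w^p exp(z w) enters through its Taylor
  polynomials in w.\<close>

definition exp_trunc :: "nat \<Rightarrow> nat \<Rightarrow> complex \<Rightarrow> complex poly" where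
  "exp_trunc n p z = (\<Sum>k<n. monom (z ^ k / fact k) (k + p))"

lemma poly_exp_trunc: "poly (exp_trunc n p z) w = w ^ p * (\<Sum>k<n. (z * w) ^ k / fact k)"
  by (simp add: exp_trunc_def poly_sum poly_monom sum_distrib_left power_add power_mult_distrib mult_ac)

text \<open>The functional \<open>L\<close> is dominated by the uniform distance on \<open>S\<close>
  from a polynomial to \<open>V\<close>, and it does not vanish at \<open>P0\<close>. Formally F(z)
  = L(exp(z w)), realised as the power series with coefficients L(w^k) / k!, so that the p-th
  derivative of F is L(w^p exp(z w)).\<close>

lemma annihilating_entire_function:
  fixes S :: "complex set" and V :: "(complex \<Rightarrow> complex) set"
  assumes S: "compact S" and V: "cfun.subspace V"
    and P0: "\<And>v. v \<in> V \<Longrightarrow> \<exists>w\<in>S. e \<le> cmod (poly P0 w - v w)" and e: "e > 0"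
  obtains F where "F holomorphic_on UNIV" "\<exists>z. F z \<noteq> 0"
    "\<And>z m. (\<And>w. w \<in> S \<Longrightarrow> Re (z * w) \<le> m) \<Longrightarrow> cmod (F z) \<le> exp m"
    "\<And>z p. (\<lambda>w. w ^ p * exp (z * w)) \<in> V \<Longrightarrow> (deriv ^^ p) F z = 0"
proof -
  obtain B where B: "B > 0" "\<And>w. w \<in> S \<Longrightarrow> cmod w \<le> B"
    using compact_imp_bounded[OF S] bounded_pos by metis
  \<comment> \<open>Distances are recorded through upper bounds, so that no supremum over
    \<open>S\<close> has to be shown finite.\<close>
  define A where "A P = {r. r \<ge> 0 \<and> (\<exists>v\<in>V. \<forall>w\<in>S. cmod (poly P w - v w) \<le> r)}" for P
  define p where "p P = Inf (A P)" for P
  have bdd: "bdd_below (A P)" for P by (auto simp: A_def intro!: bdd_belowI[of _ 0])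
  have V0: "(\<lambda>w. 0) \<in> V" using cfun.subspace_0[OF V] by (simp add: zero_fun_def)
  have ne: "A P \<noteq> {}" for P
  proof -
    have "compact (poly P ` S)" by (intro compact_continuous_image S continuous_intros)
    then obtain M where "M > 0" "\<And>w. w \<in> S \<Longrightarrow> cmod (poly P w) \<le> M"
      using compact_imp_bounded bounded_pos by (metis imageI)
    then have "M \<in> A P" using V0 by (auto simp: A_def intro!: bexI[of _ "\<lambda>w. 0"])
    then show ?thesis by blast
  qed
  have p_le: "p P \<le> r" if "r \<in> A P" for P r unfolding p_def by (rule cInf_lower[OF that bdd])
  have padd: "p (P + Q) \<le> p P + p Q" for P Q
  proof -
    have *: "p (P + Q) \<le> r + t" if rt: "r \<in> A P" "t \<in> A Q" for r t
    proof -
      from rt obtain v u where v: "v \<in> V" "\<forall>w\<in>S. cmod (poly P w - v w) \<le> r"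
        and u: "u \<in> V" "\<forall>w\<in>S. cmod (poly Q w - u w) \<le> t" by (auto simp: A_def)
      have b: "cmod (poly (P + Q) w - (v + u) w) \<le> r + t" if "w \<in> S" for w
      proof -
        have eq: "poly (P + Q) w - (v + u) w = (poly P w - v w) + (poly Q w - u w)"
          by (simp add: plus_fun_def)
        show ?thesis unfolding eq using v(2) u(2) that by (intro norm_triangle_mono) auto
      qed
      have m: "v + u \<in> V" using cfun.subspace_add[OF V v(1) u(1)] .
      have nn: "r + t \<ge> 0" using rt by (simp add: A_def)
      have "r + t \<in> A (P + Q)"
        unfolding A_def by (intro CollectI conjI bexI[of _ "v + u"] ballI nn m) (rule b)
      then show ?thesis by (rule p_le)
    qed
    have "p (P + Q) - p Q \<le> r" if r: "r \<in> A P" for r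
    proof -
      have "p (P + Q) - r \<le> p Q"
        unfolding p_def[of Q] by (rule cInf_greatest[OF ne]) (use *[OF r] in \<open>simp add: algebra_simps\<close>)
      then show ?thesis by simp
    qed
    then have "p (P + Q) - p Q \<le> p P" unfolding p_def[of P] by (intro cInf_greatest[OF ne])
    then show ?thesis by simp
  qed
  have phom_le: "p (smult t P) \<le> cmod t * p P" if t: "t \<noteq> 0" for t P
  proof -
    have "p (smult t P) / cmod t \<le> r" if r: "r \<in> A P" for r
    proof -
      from r obtain v where v: "v \<in> V" "\<forall>w\<in>S. cmod (poly P w - v w) \<le> r" and r0: "r \<ge> 0"
        by (auto simp: A_def)
      have b: "cmod (poly (smult t P) w - t * v w) \<le> cmod t * r" if "w \<in> S" for w
      proof -
        have "poly (smult t P) w - t * v w = t * (poly P w - v w)" by (simp add: algebra_simps)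
        then show ?thesis using v(2) that by (simp add: norm_mult mult_left_mono)
      qed
      have m: "(\<lambda>w. t * v w) \<in> V" using cfun.subspace_scale[OF V v(1)] .
      have nn: "cmod t * r \<ge> 0" using r0 by simp
      have "cmod t * r \<in> A (smult t P)"
        unfolding A_def by (intro CollectI conjI bexI[of _ "\<lambda>w. t * v w"] ballI nn m) (rule b)
      from p_le[OF this] show ?thesis using t by (simp add: divide_le_eq mult.commute)
    qed
    then have "p (smult t P) / cmod t \<le> p P" unfolding p_def[of P] by (intro cInf_greatest[OF ne])
    then show ?thesis using t by (simp add: divide_le_eq mult.commute)
  qed
  have phom: "p (smult t P) = cmod t * p P" for t P
  proof (cases "t = 0")
    case True
    have "0 \<in> A 0" using V0 by (auto simp: A_def intro!: bexI[of _ "\<lambda>w. 0"])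
    then have "p 0 \<le> 0" by (rule p_le)
    moreover have "p 0 \<ge> 0" unfolding p_def by (rule cInf_greatest[OF ne]) (auto simp: A_def)
    ultimately show ?thesis using True by simp
  next
    case False
    have "p (smult (1 / t) (smult t P)) \<le> cmod (1 / t) * p (smult t P)"
      using False by (intro phom_le) simp
    then have "p P \<le> p (smult t P) / cmod t" using False by (simp add: norm_divide)
    then have "cmod t * p P \<le> p (smult t P)" using False by (simp add: pos_le_divide_eq mult.commute)
    with phom_le[OF False, of P] show ?thesis by simp
  qed
  have pP0: "p P0 \<ge> e"
    unfolding p_def using P0 by (intro cInf_greatest[OF ne]) (force simp: A_def intro: order_trans)
  have "vector_space (smult :: complex \<Rightarrow> complex poly \<Rightarrow> complex poly)"
    by unfold_locales (simp_all add: smult_add_right smult_add_left)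
  from complex_Hahn_Banach[OF this, of p P0] padd phom
  obtain L where Ladd: "\<And>P Q. L (P + Q) = L P + L Q" and Lhom: "\<And>t P. L (smult t P) = t * L P"
    and Lp: "\<And>P. cmod (L P) \<le> p P" and LP0: "Re (L P0) = p P0" by metis
  have L0: "L 0 = 0" using Lhom[of 0 0] by simp
  have Lsum: "L (\<Sum>k\<in>K. f k) = (\<Sum>k\<in>K. L (f k))" for f :: "nat \<Rightarrow> complex poly" and K
    by (induction K rule: infinite_finite_induct) (simp_all add: L0 Ladd)
  have Lle: "cmod (L P) \<le> r" if "v \<in> V" "\<And>w. w \<in> S \<Longrightarrow> cmod (poly P w - v w) \<le> r" "r \<ge> 0" for P v r
  proof -
    have "r \<in> A P" using that by (auto simp: A_def)
    from p_le[OF this] Lp[of P] show ?thesis by simp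
  qed
  define l where "l k = L (monom 1 k)" for k
  have Lmonom: "L (monom a k) = a * l k" for a k
    using Lhom[of a "monom 1 k"] by (simp add: l_def smult_monom)
  have lB: "cmod (l k) \<le> B ^ k" for k
    unfolding l_def
    by (rule Lle[OF V0]) (use B in \<open>auto simp: poly_monom norm_power intro!: power_mono\<close>)
  \<comment> \<open>\<open>E q z\<close> plays the part of L at w^q exp(z w): it is the limit of
    \<open>L\<close> along Taylor polynomials, and \<open>E q\<close> is the q-th derivative of
    \<open>E 0\<close>.\<close>
  define E where "E q z = (\<Sum>k. l (k + q) / fact k * z ^ k)" for q z
  have summ: "summable (\<lambda>k. l (k + q) / fact k * z ^ k)" for q z
  proof (rule summable_comparison_test')
    show "summable (\<lambda>k. B ^ q * ((1 / fact k) * (B * cmod z) ^ k))"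
      using summable_exp[of "B * cmod z"] by (intro summable_mult) (simp add: inverse_eq_divide)
    fix k
    have "cmod (l (k + q) / fact k * z ^ k) = cmod (l (k + q)) * (cmod z ^ k / fact k)"
      by (simp add: norm_mult norm_divide norm_power)
    also have "\<dots> \<le> B ^ (k + q) * (cmod z ^ k / fact k)"
      by (intro mult_right_mono lB) simp
    also have "\<dots> = B ^ q * ((1 / fact k) * (B * cmod z) ^ k)"
      by (simp add: power_add power_mult_distrib)
    finally show "norm (l (k + q) / fact k * z ^ k) \<le> B ^ q * ((1 / fact k) * (B * cmod z) ^ k)" by simp
  qed
  have Ederiv: "(E q has_field_derivative E (Suc q) z) (at z)" for q z
  proof -
    have "((\<lambda>x. \<Sum>k. l (k + q) / fact k * x ^ k) has_field_derivative
      (\<Sum>k. diffs (\<lambda>k. l (k + q) / fact k) k * z ^ k)) (at z)"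
      by (rule termdiffs_strong_converges_everywhere) (rule summ)
    moreover have "diffs (\<lambda>k. l (k + q) / fact k) k = l (k + Suc q) / fact k" for k
      by (simp add: diffs_def del: of_nat_Suc)
    ultimately show ?thesis unfolding E_def by simp
  qed
  have Edn: "(deriv ^^ q) (E 0) = E q" for q
  proof (induction q)
    case (Suc q)
    have "deriv (E q) = E (Suc q)" using Ederiv DERIV_imp_deriv by blast
    then show ?case using Suc by simp
  qed simp
  have LT: "(\<lambda>n. L (exp_trunc n q z)) \<longlonglongrightarrow> E q z" for q z
  proof -
    have "L (exp_trunc n q z) = (\<Sum>k<n. l (k + q) / fact k * z ^ k)" for n
      by (simp add: exp_trunc_def Lsum Lmonom mult.commute)
    then show ?thesis unfolding E_def using summable_LIMSEQ[OF summ[of q z]] by simp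
  qed
  have close: "\<exists>N. \<forall>n\<ge>N. \<forall>w\<in>S. cmod (poly (exp_trunc n q z) w - w ^ q * exp (z * w)) \<le> d" if d: "d > 0" for q z d
  proof -
    obtain N where N: "\<And>n x. n \<ge> N \<Longrightarrow> cmod x \<le> cmod z * B \<Longrightarrow> cmod ((\<Sum>k<n. x ^ k / fact k) - exp x) < d / B ^ q"
      using exp_series_uniform[of "d / B ^ q" "cmod z * B"] d B(1) by auto
    have "cmod (poly (exp_trunc n q z) w - w ^ q * exp (z * w)) \<le> d" if n: "n \<ge> N" and w: "w \<in> S" for n w
    proof -
      have "cmod (z * w) \<le> cmod z * B" using B(2)[OF w] by (simp add: norm_mult mult_left_mono)
      then have "cmod ((\<Sum>k<n. (z * w) ^ k / fact k) - exp (z * w)) \<le> d / B ^ q" using N n by (simp add: less_imp_le)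
      moreover have "cmod w ^ q \<le> B ^ q" using B(2)[OF w] by (intro power_mono) auto
      ultimately have "cmod w ^ q * cmod ((\<Sum>k<n. (z * w) ^ k / fact k) - exp (z * w)) \<le> B ^ q * (d / B ^ q)"
        using B(1) by (intro mult_mono) auto
      moreover have "poly (exp_trunc n q z) w - w ^ q * exp (z * w) = w ^ q * ((\<Sum>k<n. (z * w) ^ k / fact k) - exp (z * w))"
        by (simp add: poly_exp_trunc right_diff_distrib)
      ultimately show ?thesis using B(1) by (simp add: norm_mult norm_power)
    qed
    then show ?thesis by blast
  qed
  show thesis
  proof (rule that[of "E 0"])
    show "E 0 holomorphic_on UNIV"
      using Ederiv by (auto simp: holomorphic_on_open)
    show "\<exists>z. E 0 z \<noteq> 0"
    proof (rule ccontr)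
      assume "\<not> ?thesis"
      then have E0: "E 0 = (\<lambda>z. 0)" by auto
      have "l q = 0" for q
      proof -
        have "(deriv ^^ q) (\<lambda>z::complex. 0 :: complex) = (\<lambda>z. 0)"
          by (induction q) simp_all
        then have "E q = (\<lambda>z. 0)"
          using Edn[of q] unfolding E0 by (simp only:)
        moreover have "E q 0 = l q"
          unfolding E_def by (subst powser_zero) simp
        ultimately show ?thesis by (metis)
      qed
      then have "L P0 = 0"
        by (subst poly_as_sum_of_monoms[symmetric]) (simp add: Lsum Lmonom)
      then show False using LP0 pP0 e by simp
    qed
    show "cmod (E 0 z) \<le> exp m" if m: "\<And>w. w \<in> S \<Longrightarrow> Re (z * w) \<le> m" for z m
    proof (rule field_le_epsilon)
      fix d :: real assume d: "d > 0"
      from close[OF d, of 0 z] obtain N where N: "\<forall>n\<ge>N. \<forall>w\<in>S. cmod (poly (exp_trunc n 0 z) w - exp (z * w)) \<le> d" by auto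
      have "cmod (L (exp_trunc n 0 z)) \<le> exp m + d" if n: "n \<ge> N" for n
      proof (rule Lle[OF V0])
        fix w assume w: "w \<in> S"
        have "cmod (exp (z * w)) \<le> exp m" using m[OF w] by (simp add: norm_exp_eq_Re)
        moreover have "cmod (poly (exp_trunc n 0 z) w - exp (z * w)) \<le> d" using N n w by blast
        ultimately show "cmod (poly (exp_trunc n 0 z) w - 0) \<le> exp m + d"
          using norm_triangle_ineq[of "poly (exp_trunc n 0 z) w - exp (z * w)" "exp (z * w)"]
          unfolding diff_add_cancel diff_0_right by linarith
      qed (use d in \<open>simp add: add_nonneg_nonneg\<close>)
      then have "\<forall>\<^sub>F n in sequentially. cmod (L (exp_trunc n 0 z)) \<le> exp m + d"
        unfolding eventually_sequentially by blast
      then show "cmod (E 0 z) \<le> exp m + d"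
        by (intro tendsto_upperbound[OF tendsto_norm[OF LT]]) auto
    qed
    show "(deriv ^^ q) (E 0) z = 0" if v: "(\<lambda>w. w ^ q * exp (z * w)) \<in> V" for z q
    proof -
      have "cmod (E q z) \<le> 0 + d" if d: "d > 0" for d
      proof -
        from close[OF d, of q z] obtain N where N: "\<forall>n\<ge>N. \<forall>w\<in>S. cmod (poly (exp_trunc n q z) w - w ^ q * exp (z * w)) \<le> d" by auto
        then have "cmod (L (exp_trunc n q z)) \<le> d" if "n \<ge> N" for n
          using that d by (intro Lle[OF v]) auto
        then have "\<forall>\<^sub>F n in sequentially. cmod (L (exp_trunc n q z)) \<le> d"
          unfolding eventually_sequentially by blast
        then show ?thesis
          using tendsto_upperbound[OF tendsto_norm[OF LT[of q z]]] by auto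
      qed
      then have "cmod (E q z) \<le> 0" by (rule field_le_epsilon)
      then show ?thesis by (simp add: Edn)
    qed
  qed
qed

section \<open>Zeros of entire functions and logarithmic potentials\<close>

text \<open>The two antiderivatives only have to agree at the breakpoint. \<open>E2\<close> is
  required to be continuous from \<open>m\<close> onwards only, since it will contain logarithms or
  negative powers.\<close>

lemma piecewise_FTC:
  fixes E1 E2 f1 f2 :: "real \<Rightarrow> complex"
  assumes "p \<le> q"
    and c1: "continuous_on {p..q} E1" and c2: "continuous_on ({p..q} \<inter> {m..}) E2" and eq: "E1 m = E2 m"
    and d1: "\<And>x. p < x \<Longrightarrow> x < q \<Longrightarrow> x < m \<Longrightarrow> (E1 has_vector_derivative f1 x) (at x)"
    and d2: "\<And>x. p < x \<Longrightarrow> x < q \<Longrightarrow> m < x \<Longrightarrow> (E2 has_vector_derivative f2 x) (at x)"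
  shows "((\<lambda>x. if x \<le> m then f1 x else f2 x) has_integral
     ((if q \<le> m then E1 q else E2 q) - (if p \<le> m then E1 p else E2 p))) {p..q}"
proof (rule fundamental_theorem_of_calculus_interior_strong[where S = "{m}"])
  have "continuous_on ({p..q} \<inter> {..m} \<union> {p..q} \<inter> {m..}) (\<lambda>x. if x \<le> m then E1 x else E2 x)"
  proof (rule continuous_on_cases)
    show "closed ({p..q} \<inter> {..m})" "closed ({p..q} \<inter> {m..})" by auto
    show "continuous_on ({p..q} \<inter> {..m}) E1" using c1 continuous_on_subset by blast
    show "continuous_on ({p..q} \<inter> {m..}) E2" by (rule c2)
    show "\<forall>x. x \<in> {p..q} \<inter> {..m} \<and> \<not> x \<le> m \<or> x \<in> {p..q} \<inter> {m..} \<and> x \<le> m \<longrightarrow> E1 x = E2 x"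
      using eq by (metis IntD2 atLeast_iff atMost_iff order_antisym)
  qed
  moreover have "{p..q} \<inter> {..m} \<union> {p..q} \<inter> {m..} = {p..q}" by auto
  ultimately show "continuous_on {p..q} (\<lambda>x. if x \<le> m then E1 x else E2 x)" by simp
  fix x assume x: "x \<in> {p<..<q} - {m}"
  show "((\<lambda>x. if x \<le> m then E1 x else E2 x) has_vector_derivative (if x \<le> m then f1 x else f2 x)) (at x)"
  proof (cases "x < m")
    case True
    have "(E1 has_vector_derivative f1 x) (at x)" using d1 x True by simp
    then have "((\<lambda>x. if x \<le> m then E1 x else E2 x) has_vector_derivative f1 x) (at x)"
      by (rule has_vector_derivative_transform_within_open[where S = "{..<m}"]) (use True in auto)
    then show ?thesis using True by simp
  next
    case False
    then have xm: "x > m" using x by simp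
    have "(E2 has_vector_derivative f2 x) (at x)" using d2 x xm by simp
    then have "((\<lambda>x. if x \<le> m then E1 x else E2 x) has_vector_derivative f2 x) (at x)"
      by (rule has_vector_derivative_transform_within_open[where S = "{m<..}"]) (use xm in auto)
    then show ?thesis using xm by simp
  qed
qed (use assms in auto)

text \<open>The \<open>k\<close>-th Fourier coefficient of \<open>ln \<bar>1 - z / a\<bar>\<close> on the circle of radius \<open>\<rho>\<close>.\<close>

definition log_coeff :: "complex \<Rightarrow> nat \<Rightarrow> real \<Rightarrow> complex" where
  "log_coeff a k \<rho> = (if k = 0 then (if \<rho> \<le> cmod a then 0 else of_real (ln (\<rho> / cmod a)))
     else if \<rho> \<le> cmod a then - ((of_real \<rho> / cnj a) ^ k) / (2 * of_nat k) else - ((a / of_real \<rho>) ^ k) / (2 * of_nat k))"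

lemma has_vector_derivative_of_real_mult:
  assumes "(f has_real_derivative f') (at x)"
  shows "((\<lambda>x. of_real (f x) * (c::complex)) has_vector_derivative of_real f' * c) (at x)"
  by (intro has_vector_derivative_mult_left has_vector_derivative_of_real assms)

text \<open>
  Both weights \<open>\<alpha> \<rho> + \<beta> / \<rho>\<close> solve \<open>(\<rho> d/d\<rho>)\<^sup>2 w = w\<close>, while \<open>(\<rho> d/d\<rho>)\<^sup>2\<close> acts on the \<open>k\<close>-th Fourier coefficient of a
  logarithmic potential as multiplication by \<open>k\<^sup>2\<close> away from the pole, with a jump at the pole.
\<close>

lemma log_coeff_weighted_integral:
  fixes a :: complex and \<alpha> \<beta> p q :: real
  assumes a: "a \<noteq> 0" and pq: "0 \<le> p" "p \<le> q" and \<beta>: "p = 0 \<Longrightarrow> \<beta> = 0"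
  defines "w \<rho> \<equiv> \<alpha> * \<rho> + \<beta> / \<rho>"
  defines "D k \<rho> \<equiv> (if k = 0 then (if \<rho> \<le> cmod a then 0 else 1)
     else if \<rho> \<le> cmod a then - ((of_real \<rho> / cnj a) ^ k) / 2 else (a / of_real \<rho>) ^ k / 2)"
  defines "E k \<rho> \<equiv> of_real (\<alpha> * \<rho> - \<beta> / \<rho>) * log_coeff a k \<rho> - of_real (w \<rho>) * D k \<rho>
      + (if \<rho> \<le> cmod a then 0 else of_real (w (cmod a)) * (a / of_real (cmod a)) ^ k)"
  shows "((\<lambda>\<rho>. of_real ((\<alpha> + \<beta> / \<rho>\<^sup>2) * (1 - (real k)\<^sup>2)) * log_coeff a k \<rho>) has_integral (E k q - E k p)) {p..q}"
proof -
  \<comment> \<open>\<open>D k\<close> is \<rho> d/d\<rho> of \<open>log_coeff a k\<close>, and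
    \<open>E k\<close> starts with the Wronskian of \<open>w\<close> and
    \<open>log_coeff a k\<close> with respect to \<rho> d/d\<rho>, an antiderivative by Green's
    identity. At \<rho> = |a| the function \<open>D k\<close> jumps by (a / |a|)^k; the last term of
    \<open>E k\<close> restores continuity.\<close>
  define m where "m = cmod a"
  have m: "m > 0" using a by (simp add: m_def)
  have am: "cnj a * a = of_real (m ^ 2)" unfolding m_def complex_norm_square by (rule mult.commute)
  consider "k = 0" | "k > 0" by auto
  then show ?thesis
  proof cases
    case 1
    define E2 where "E2 \<rho> = complex_of_real ((\<alpha> * \<rho> - \<beta> / \<rho>) * ln (\<rho> / m) - w \<rho> + w m)" for \<rho>
    have "((\<lambda>\<rho>. if \<rho> \<le> m then 0 else of_real ((\<alpha> + \<beta> / \<rho>\<^sup>2) * ln (\<rho> / m))) has_integral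
        ((if q \<le> m then 0 else E2 q) - (if p \<le> m then 0 else E2 p))) {p..q}"
    proof (rule piecewise_FTC[OF pq(2)])
      show "continuous_on ({p..q} \<inter> {m..}) E2"
        unfolding E2_def w_def using m by (intro continuous_intros) auto
      show "0 = E2 m" using m by (simp add: E2_def)
      fix x assume "m < x"
      then have x: "x > 0" using m by simp
      have "((\<lambda>\<rho>. (\<alpha> * \<rho> - \<beta> / \<rho>) * ln (\<rho> / m) - w \<rho> + w m) has_real_derivative
          ((\<alpha> + \<beta> / x\<^sup>2) * ln (x / m) + (\<alpha> * x - \<beta> / x) * (1 / x) - (\<alpha> - \<beta> / x\<^sup>2))) (at x)"
        unfolding w_def using x m
        by (auto intro!: derivative_eq_intros simp: power2_eq_square)
      moreover have "(\<alpha> * x - \<beta> / x) * (1 / x) = \<alpha> - \<beta> / x\<^sup>2"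
        using x by (simp add: power2_eq_square diff_divide_distrib)
      ultimately have "((\<lambda>\<rho>. (\<alpha> * \<rho> - \<beta> / \<rho>) * ln (\<rho> / m) - w \<rho> + w m) has_real_derivative
          ((\<alpha> + \<beta> / x\<^sup>2) * ln (x / m))) (at x)" by simp
      from has_vector_derivative_of_real_mult[OF this, of 1]
      show "(E2 has_vector_derivative of_real ((\<alpha> + \<beta> / x\<^sup>2) * ln (x / m))) (at x)"
        unfolding E2_def by simp
    qed auto
    moreover have "(if \<rho> \<le> m then 0 else E2 \<rho>) = E k \<rho>" for \<rho>
      using 1 by (simp add: E_def E2_def D_def log_coeff_def m_def)
    moreover have "(if \<rho> \<le> m then 0 else of_real ((\<alpha> + \<beta> / \<rho>\<^sup>2) * ln (\<rho> / m))) = of_real ((\<alpha> + \<beta> / \<rho>\<^sup>2) * (1 - (real k)\<^sup>2)) * log_coeff a k \<rho>" for \<rho>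
      using 1 by (simp add: log_coeff_def m_def)
    ultimately show ?thesis by simp
  next
    case 2
    \<comment> \<open>The coefficients of \<rho>^k inside and of \<rho>^(-k) outside the pole. On
      either side \<open>E k\<close> becomes a combination of powers of \<rho>, up to a
      constant.\<close>
    define c1 where "c1 = - ((1 / cnj a) ^ k) / (2 * of_nat k)"
    define c2 where "c2 = - (a ^ k) / (2 * of_nat k)"
    define E1 where "E1 \<rho> = of_real (\<alpha> * (1 - real k) * \<rho> ^ (k + 1) - \<beta> * (1 + real k) * (\<rho> ^ k / \<rho>)) * c1" for \<rho>
    define E2 where "E2 \<rho> = of_real (\<alpha> * (1 + real k) * (\<rho> / \<rho> ^ k) - \<beta> * (1 - real k) / \<rho> ^ (k + 1)) * c2 + of_real (w m) * (a / of_real m) ^ k" for \<rho>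
    have "((\<lambda>\<rho>. if \<rho> \<le> m then of_real ((\<alpha> + \<beta> / \<rho>\<^sup>2) * (1 - (real k)\<^sup>2) * \<rho> ^ k) * c1
          else of_real ((\<alpha> + \<beta> / \<rho>\<^sup>2) * (1 - (real k)\<^sup>2) / \<rho> ^ k) * c2) has_integral
        ((if q \<le> m then E1 q else E2 q) - (if p \<le> m then E1 p else E2 p))) {p..q}"
    proof (rule piecewise_FTC[OF pq(2)])
      show "continuous_on {p..q} E1"
      proof (cases "p = 0")
        case True
        then show ?thesis unfolding E1_def using \<beta> by (simp, intro continuous_intros)
      next
        case False
        then show ?thesis unfolding E1_def using pq by (intro continuous_intros) auto
      qed
      show "continuous_on ({p..q} \<inter> {m..}) E2"
        unfolding E2_def using m by (intro continuous_intros) auto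
      show "E1 m = E2 m"
      proof -
        have c12: "of_real (m ^ k * m ^ k) * c1 = c2"
        proof -
          have "of_real (m ^ k * m ^ k) = (cnj a * a) ^ k"
            unfolding am by (simp add: power2_eq_square power_mult_distrib)
          then show ?thesis using a by (simp add: c1_def c2_def power_mult_distrib power_one_over)
        qed
        have ak: "(a / of_real m) ^ k = - (2 * of_nat k) * of_real (1 / m ^ k) * c2"
          using 2 by (simp add: c2_def power_divide)
        have mc: "of_real (m ^ k) * c1 = of_real (1 / m ^ k) * c2"
          unfolding c12[symmetric] using m by simp
        have "\<alpha> * (1 - real k) * m ^ (k + 1) - \<beta> * (1 + real k) * (m ^ k / m) = (\<alpha> * (1 - real k) * m - \<beta> * (1 + real k) / m) * m ^ k"
          by (simp add: left_diff_distrib)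
        then have "E1 m = of_real (\<alpha> * (1 - real k) * m - \<beta> * (1 + real k) / m) * (of_real (m ^ k) * c1)"
          unfolding E1_def by (simp only: of_real_mult mult.assoc)
        then have "E1 m = of_real ((\<alpha> * (1 - real k) * m - \<beta> * (1 + real k) / m) / m ^ k) * c2"
          unfolding mc by simp
        moreover have "E2 m = of_real ((\<alpha> * (1 + real k) * m - \<beta> * (1 - real k) / m - 2 * real k * w m) / m ^ k) * c2"
          unfolding E2_def ak by (simp add: algebra_simps add_divide_distrib diff_divide_distrib)
        moreover have "\<alpha> * (1 - real k) * m - \<beta> * (1 + real k) / m = \<alpha> * (1 + real k) * m - \<beta> * (1 - real k) / m - 2 * real k * w m"
          by (simp add: w_def algebra_simps add_divide_distrib diff_divide_distrib)
        ultimately show ?thesis by simp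
      qed
      fix x assume x: "p < x" "x < q"
      have x0: "x > 0" using x pq by simp
      obtain n where n: "k = Suc n" using 2 by (cases k) auto
      have "((\<lambda>\<rho>. \<alpha> * (1 - real k) * \<rho> ^ (k + 1) - \<beta> * (1 + real k) * (\<rho> ^ k / \<rho>)) has_real_derivative
          ((\<alpha> + \<beta> / x\<^sup>2) * (1 - (real k)\<^sup>2) * x ^ k)) (at x)"
      proof -
        have "((\<lambda>\<rho>. \<rho> ^ k / \<rho>) has_real_derivative (real k * x ^ (k - Suc 0) * x - x ^ k * 1) / (x * x)) (at x)"
          using DERIV_divide[OF DERIV_pow[of k x] DERIV_ident] x0 by simp
        moreover have "real k * x ^ (k - Suc 0) * x - x ^ k * 1 = (real k - 1) * x ^ k"
          unfolding n by (simp add: algebra_simps)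
        ultimately have "((\<lambda>\<rho>. \<rho> ^ k / \<rho>) has_real_derivative (real k - 1) * (x ^ k / x\<^sup>2)) (at x)"
          by (simp add: power2_eq_square)
        moreover have "((\<lambda>\<rho>. \<rho> ^ (k + 1)) has_real_derivative (real k + 1) * x ^ k) (at x)"
          using DERIV_pow[of "k + 1" x] by (simp add: add.commute)
        ultimately have "((\<lambda>\<rho>. \<alpha> * (1 - real k) * \<rho> ^ (k + 1) - \<beta> * (1 + real k) * (\<rho> ^ k / \<rho>)) has_real_derivative
          (\<alpha> * (1 - real k) * ((real k + 1) * x ^ k) - \<beta> * (1 + real k) * ((real k - 1) * (x ^ k / x\<^sup>2)))) (at x)"
          by (intro DERIV_diff DERIV_cmult)
        moreover have "\<alpha> * (1 - real k) * ((real k + 1) * x ^ k) - \<beta> * (1 + real k) * ((real k - 1) * (x ^ k / x\<^sup>2))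
           = (\<alpha> + \<beta> / x\<^sup>2) * (1 - (real k)\<^sup>2) * x ^ k"
          by (simp add: power2_eq_square[of "real k"] algebra_simps add_divide_distrib diff_divide_distrib)
        ultimately show ?thesis by simp
      qed
      from has_vector_derivative_of_real_mult[OF this]
      show "(E1 has_vector_derivative of_real ((\<alpha> + \<beta> / x\<^sup>2) * (1 - (real k)\<^sup>2) * x ^ k) * c1) (at x)"
        unfolding E1_def .
      have "((\<lambda>\<rho>. \<alpha> * (1 + real k) * (\<rho> / \<rho> ^ k) - \<beta> * (1 - real k) / \<rho> ^ (k + 1)) has_real_derivative
          ((\<alpha> + \<beta> / x\<^sup>2) * (1 - (real k)\<^sup>2) / x ^ k)) (at x)"
      proof -
        have 1: "((\<lambda>\<rho>. \<rho> / \<rho> ^ k) has_real_derivative (1 - real k) * (1 / x ^ k)) (at x)"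
        proof -
          have "((\<lambda>\<rho>. \<rho> / \<rho> ^ k) has_real_derivative (1 * x ^ k - x * (real k * x ^ (k - Suc 0))) / (x ^ k * x ^ k)) (at x)"
            using DERIV_divide[OF DERIV_ident DERIV_pow[of k x]] x0 by simp
          moreover have "1 * x ^ k - x * (real k * x ^ (k - Suc 0)) = (1 - real k) * x ^ k"
            unfolding n by (simp add: algebra_simps)
          ultimately show ?thesis using x0 by simp
        qed
        have 2: "((\<lambda>\<rho>. 1 / \<rho> ^ (k + 1)) has_real_derivative - (1 + real k) * (1 / (x ^ k * x\<^sup>2))) (at x)"
        proof -
          have "((\<lambda>\<rho>. 1 / \<rho> ^ (k + 1)) has_real_derivative (0 * x ^ (k + 1) - 1 * (real (k + 1) * x ^ k)) / (x ^ (k + 1) * x ^ (k + 1))) (at x)"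
            using DERIV_divide[OF DERIV_const[where k = "1 :: real"] DERIV_pow[of "k + 1" x]] x0 by simp
          moreover have "(0 * x ^ (k + 1) - 1 * (real (k + 1) * x ^ k)) / (x ^ (k + 1) * x ^ (k + 1)) = - (1 + real k) * (1 / (x ^ k * x\<^sup>2))"
            using x0 by (simp add: power2_eq_square mult_ac minus_divide_left)
          ultimately show ?thesis by simp
        qed
        have "((\<lambda>\<rho>. \<alpha> * (1 + real k) * (\<rho> / \<rho> ^ k) - \<beta> * (1 - real k) * (1 / \<rho> ^ (k + 1))) has_real_derivative
          (\<alpha> * (1 + real k) * ((1 - real k) * (1 / x ^ k)) - \<beta> * (1 - real k) * (- (1 + real k) * (1 / (x ^ k * x\<^sup>2))))) (at x)"
          by (intro DERIV_diff DERIV_cmult 1 2)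
        moreover have "\<alpha> * (1 + real k) * ((1 - real k) * (1 / x ^ k)) - \<beta> * (1 - real k) * (- (1 + real k) * (1 / (x ^ k * x\<^sup>2)))
           = (\<alpha> + \<beta> / x\<^sup>2) * (1 - (real k)\<^sup>2) / x ^ k"
          by (simp add: power2_eq_square[of "real k"] algebra_simps add_divide_distrib diff_divide_distrib)
        ultimately show ?thesis by simp
      qed
      from has_vector_derivative_add_const[THEN iffD2, OF has_vector_derivative_of_real_mult[OF this]]
      show "(E2 has_vector_derivative of_real ((\<alpha> + \<beta> / x\<^sup>2) * (1 - (real k)\<^sup>2) / x ^ k) * c2) (at x)"
        unfolding E2_def .
    qed
    moreover have "(if \<rho> \<le> m then E1 \<rho> else E2 \<rho>) = E k \<rho>" if "\<rho> \<ge> 0" for \<rho>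
    proof (cases "\<rho> \<le> m")
      case True
      have "log_coeff a k \<rho> = of_real (\<rho> ^ k) * c1" "D k \<rho> = of_real (real k * \<rho> ^ k) * c1"
        using 2 True by (simp_all add: log_coeff_def D_def c1_def m_def power_divide)
      then have "E k \<rho> = of_real ((\<alpha> * \<rho> - \<beta> / \<rho>) * \<rho> ^ k - w \<rho> * (real k * \<rho> ^ k)) * c1"
        using True by (simp add: E_def m_def left_diff_distrib)
      also have "(\<alpha> * \<rho> - \<beta> / \<rho>) * \<rho> ^ k - w \<rho> * (real k * \<rho> ^ k) = \<alpha> * (1 - real k) * \<rho> ^ (k + 1) - \<beta> * (1 + real k) * (\<rho> ^ k / \<rho>)"
        by (simp add: w_def algebra_simps)
      finally show ?thesis using True by (simp add: E1_def)
    next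
      case False
      have "log_coeff a k \<rho> = of_real (1 / \<rho> ^ k) * c2" "D k \<rho> = - of_real (real k * (1 / \<rho> ^ k)) * c2"
        using 2 False by (simp_all add: log_coeff_def D_def c2_def m_def power_divide)
      then have "E k \<rho> = of_real ((\<alpha> * \<rho> - \<beta> / \<rho>) * (1 / \<rho> ^ k) + w \<rho> * (real k * (1 / \<rho> ^ k))) * c2 + of_real (w m) * (a / of_real m) ^ k"
        using False by (simp add: E_def m_def distrib_right)
      also have "(\<alpha> * \<rho> - \<beta> / \<rho>) * (1 / \<rho> ^ k) + w \<rho> * (real k * (1 / \<rho> ^ k)) = \<alpha> * (1 + real k) * (\<rho> / \<rho> ^ k) - \<beta> * (1 - real k) / \<rho> ^ (k + 1)"
        by (simp add: w_def algebra_simps add_divide_distrib diff_divide_distrib)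
      finally show ?thesis using False by (simp add: E2_def)
    qed
    moreover have "(if \<rho> \<le> m then of_real ((\<alpha> + \<beta> / \<rho>\<^sup>2) * (1 - (real k)\<^sup>2) * \<rho> ^ k) * c1
          else of_real ((\<alpha> + \<beta> / \<rho>\<^sup>2) * (1 - (real k)\<^sup>2) / \<rho> ^ k) * c2)
        = of_real ((\<alpha> + \<beta> / \<rho>\<^sup>2) * (1 - (real k)\<^sup>2)) * log_coeff a k \<rho>" for \<rho>
      using 2 by (auto simp: log_coeff_def c1_def c2_def m_def power_divide)
    ultimately show ?thesis using pq by simp
  qed
qed

text \<open>This is w(\<rho>) / \<rho>. Up to r, w is \<rho>/r^2 - \<rho>/R^2, and beyond r it is
  1/\<rho> - \<rho>/R^2; both pieces have the form \<alpha> \<rho> + \<beta>/\<rho>, and w vanishes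
  at R.\<close>

definition radial_weight :: "real \<Rightarrow> real \<Rightarrow> real \<Rightarrow> real" where
  "radial_weight r R \<rho> = 1 / (max r \<rho>)\<^sup>2 - 1 / R\<^sup>2"

lemma radial_weight_nonneg: "0 < r \<Longrightarrow> r \<le> R \<Longrightarrow> \<rho> \<le> R \<Longrightarrow> radial_weight r R \<rho> \<ge> 0"
  by (auto simp: radial_weight_def intro!: divide_left_mono power_mono)

text \<open>Glue the weights with (\<alpha>, \<beta>) = (1/r^2 - 1/R^2, 0) on [0, r] and (- 1/R^2,
  1) on [r, R]. At r the weight is continuous while \<rho> w' drops by 2/r; at R the weight vanishes
  and \<rho> w' = - 2/R. These give the two boundary terms, and a pole inside radius R contributes
  w(|a|) (a / |a|)^k.\<close>

lemma log_coeff_radial_weight_integral: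
  fixes a :: complex
  assumes a: "a \<noteq> 0" and rR: "0 < r" "r < R"
  shows "((\<lambda>\<rho>. of_real (radial_weight r R \<rho> * (1 - (real k)\<^sup>2)) * log_coeff a k \<rho>) has_integral
     (of_real (2 / r) * log_coeff a k r - of_real (2 / R) * log_coeff a k R
      + (if cmod a < R then of_real (cmod a * radial_weight r R (cmod a)) * (a / of_real (cmod a)) ^ k else 0))) {0..R}"
proof -
  define m where "m = cmod a"
  have m: "m > 0" using a by (simp add: m_def)
  define D where "D \<rho> = (if k = 0 then (if \<rho> \<le> cmod a then 0 else 1)
     else if \<rho> \<le> cmod a then - ((of_real \<rho> / cnj a) ^ k) / 2 else (a / of_real \<rho>) ^ k / 2)" for \<rho>
  define \<kappa> where "\<kappa> = 1 / r\<^sup>2 - 1 / R\<^sup>2"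
  define E1 where "E1 \<rho> = of_real (\<kappa> * \<rho> - 0 / \<rho>) * log_coeff a k \<rho> - of_real (\<kappa> * \<rho> + 0 / \<rho>) * D \<rho>
      + (if \<rho> \<le> cmod a then 0 else of_real (\<kappa> * cmod a + 0 / cmod a) * (a / of_real (cmod a)) ^ k)" for \<rho>
  define E2 where "E2 \<rho> = of_real (- (1 / R\<^sup>2) * \<rho> - 1 / \<rho>) * log_coeff a k \<rho> - of_real (- (1 / R\<^sup>2) * \<rho> + 1 / \<rho>) * D \<rho>
      + (if \<rho> \<le> cmod a then 0 else of_real (- (1 / R\<^sup>2) * cmod a + 1 / cmod a) * (a / of_real (cmod a)) ^ k)" for \<rho>
  have "((\<lambda>\<rho>. of_real ((\<kappa> + 0 / \<rho>\<^sup>2) * (1 - (real k)\<^sup>2)) * log_coeff a k \<rho>) has_integral (E1 r - E1 0)) {0..r}"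
    unfolding E1_def D_def by (rule log_coeff_weighted_integral[OF a]) (use rR in auto)
  then have 1: "((\<lambda>\<rho>. of_real (radial_weight r R \<rho> * (1 - (real k)\<^sup>2)) * log_coeff a k \<rho>) has_integral (E1 r - E1 0)) {0..r}"
    by (rule has_integral_eq[rotated]) (auto simp: radial_weight_def \<kappa>_def max_def)
  have "((\<lambda>\<rho>. of_real ((- (1 / R\<^sup>2) + 1 / \<rho>\<^sup>2) * (1 - (real k)\<^sup>2)) * log_coeff a k \<rho>) has_integral (E2 R - E2 r)) {r..R}"
    unfolding E2_def D_def by (rule log_coeff_weighted_integral[OF a]) (use rR in auto)
  then have 2: "((\<lambda>\<rho>. of_real (radial_weight r R \<rho> * (1 - (real k)\<^sup>2)) * log_coeff a k \<rho>) has_integral (E2 R - E2 r)) {r..R}"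
    by (rule has_integral_eq[rotated]) (auto simp: radial_weight_def max_def)
  have "((\<lambda>\<rho>. of_real (radial_weight r R \<rho> * (1 - (real k)\<^sup>2)) * log_coeff a k \<rho>) has_integral ((E1 r - E1 0) + (E2 R - E2 r))) {0..R}"
    by (rule has_integral_combine[OF _ _ 1 2]) (use rR in auto)
  moreover have "(E1 r - E1 0) + (E2 R - E2 r) = of_real (2 / r) * log_coeff a k r - of_real (2 / R) * log_coeff a k R
      + (if cmod a < R then of_real (cmod a * radial_weight r R (cmod a)) * (a / of_real (cmod a)) ^ k else 0)"
  proof -
    have w: "\<kappa> * r = - (1 / R\<^sup>2) * r + 1 / r"
      using rR by (simp add: \<kappa>_def left_diff_distrib power2_eq_square)
    have E10: "E1 0 = 0" using a by (simp add: E1_def)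
    have "\<kappa> * r - (- (1 / R\<^sup>2) * r - 1 / r) = 2 / r"
      unfolding w by simp
    then have z: "of_real (\<kappa> * r) * log_coeff a k r - of_real (- (1 / R\<^sup>2) * r - 1 / r) * log_coeff a k r = of_real (2 / r) * log_coeff a k r"
      by (simp only: left_diff_distrib[symmetric] of_real_diff[symmetric])
    have E12: "E1 r - E2 r = of_real (2 / r) * log_coeff a k r
       + (if r \<le> cmod a then 0 else (of_real (\<kappa> * m) - of_real (- (1 / R\<^sup>2) * m + 1 / m)) * (a / of_real m) ^ k)"
      unfolding E1_def E2_def z[symmetric] w[symmetric] by (simp add: m_def left_diff_distrib)
    have RR: "- (1 / R\<^sup>2) * R - 1 / R = - (2 / R)" "- (1 / R\<^sup>2) * R + 1 / R = 0"
      using rR by (simp_all add: power2_eq_square)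
    have E2R: "E2 R = - of_real (2 / R) * log_coeff a k R + (if R \<le> m then 0 else of_real (- (1 / R\<^sup>2) * m + 1 / m) * (a / of_real m) ^ k)"
      unfolding E2_def RR by (simp add: m_def)
    have sum: "(E1 r - E1 0) + (E2 R - E2 r) = (E1 r - E2 r) + E2 R"
      by (simp add: E10)
    define U where "U = (a / of_real m) ^ k"
    consider "m < r" | "r \<le> m" "m < R" | "R \<le> m" by linarith
    then have "of_real (2 / r) * log_coeff a k r + (if r \<le> m then 0 else (of_real (\<kappa> * m) - of_real (- (1 / R\<^sup>2) * m + 1 / m)) * U)
          + (- of_real (2 / R) * log_coeff a k R + (if R \<le> m then 0 else of_real (- (1 / R\<^sup>2) * m + 1 / m) * U))
        = of_real (2 / r) * log_coeff a k r - of_real (2 / R) * log_coeff a k R + (if m < R then of_real (m * radial_weight r R m) * U else 0)"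
    proof cases
      case 1
      then have "m * radial_weight r R m = \<kappa> * m" using rR by (simp add: radial_weight_def \<kappa>_def mult.commute)
      then have eq: "complex_of_real (m * radial_weight r R m) = of_real (\<kappa> * m)" by (rule arg_cong)
      show "of_real (2 / r) * log_coeff a k r + (if r \<le> m then 0 else (of_real (\<kappa> * m) - of_real (- (1 / R\<^sup>2) * m + 1 / m)) * U)
          + (- of_real (2 / R) * log_coeff a k R + (if R \<le> m then 0 else of_real (- (1 / R\<^sup>2) * m + 1 / m) * U))
        = of_real (2 / r) * log_coeff a k r - of_real (2 / R) * log_coeff a k R + (if m < R then of_real (m * radial_weight r R m) * U else 0)"
        unfolding eq using 1 rR by (simp add: left_diff_distrib)
    next
      case 2
      then have "m * radial_weight r R m = - (1 / R\<^sup>2) * m + 1 / m"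
        using m by (simp add: radial_weight_def right_diff_distrib power2_eq_square)
      then have eq: "complex_of_real (m * radial_weight r R m) = of_real (- (1 / R\<^sup>2) * m + 1 / m)" by (rule arg_cong)
      show "of_real (2 / r) * log_coeff a k r + (if r \<le> m then 0 else (of_real (\<kappa> * m) - of_real (- (1 / R\<^sup>2) * m + 1 / m)) * U)
          + (- of_real (2 / R) * log_coeff a k R + (if R \<le> m then 0 else of_real (- (1 / R\<^sup>2) * m + 1 / m) * U))
        = of_real (2 / r) * log_coeff a k r - of_real (2 / R) * log_coeff a k R + (if m < R then of_real (m * radial_weight r R m) * U else 0)"
        unfolding eq using 2 rR by simp
    next
      case 3
      then show "of_real (2 / r) * log_coeff a k r + (if r \<le> m then 0 else (of_real (\<kappa> * m) - of_real (- (1 / R\<^sup>2) * m + 1 / m)) * U)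
          + (- of_real (2 / R) * log_coeff a k R + (if R \<le> m then 0 else of_real (- (1 / R\<^sup>2) * m + 1 / m) * U))
        = of_real (2 / r) * log_coeff a k r - of_real (2 / R) * log_coeff a k R + (if m < R then of_real (m * radial_weight r R m) * U else 0)"
        using rR by simp
    qed
    then show ?thesis unfolding sum unfolding E12 E2R U_def m_def .
  qed
  ultimately show ?thesis by simp
qed

section \<open>Fourier coefficients on circles\<close>

lemma unit_e_int_power_integral:
  "((\<lambda>t. exp (2 * of_real pi * \<i> * of_int j * of_real t)) has_integral (if j = 0 then 1 else 0)) {0..1}"
proof (cases "j = 0")
  case True
  have "((\<lambda>t::real. 1 :: complex) has_integral (1 - 0) *\<^sub>R 1) {0..1}"
    using has_integral_const_real[of "1::complex" 0 1] by simp
  then show ?thesis using True by simp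
next
  case False
  define c where "c = 2 * of_real pi * \<i> * of_int j"
  have c: "c \<noteq> 0" using False by (simp add: c_def)
  have "((\<lambda>t. exp (c * of_real t)) has_integral (exp (c * of_real 1) / c - exp (c * of_real 0) / c)) {0..1}"
  proof (rule fundamental_theorem_of_calculus)
    fix x :: real
    have "((\<lambda>z. exp (c * z) / c) has_field_derivative exp (c * of_real x)) (at (of_real x))"
      using c by (auto intro!: derivative_eq_intros)
    then show "((\<lambda>t. exp (c * of_real t) / c) has_vector_derivative exp (c * of_real x)) (at x within {0..1})"
      by (intro has_vector_derivative_real_field)
  qed simp
  moreover have "exp (c * of_real 1) = 1"
    unfolding c_def exp_eq_1 by (intro conjI exI[of _ j]) simp_all
  ultimately show ?thesis using False by (simp add: c_def)
qed

lemma unit_e_power_integral: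
  "((\<lambda>t. unit_e t ^ n) has_integral (if n = 0 then 1 else 0)) {0..1}"
  "((\<lambda>t. unit_e t ^ n * cnj (unit_e t) ^ k) has_integral (if n = k then 1 else 0)) {0..1}"
proof -
  have e: "unit_e t ^ n = exp (2 * of_real pi * \<i> * of_int (int n) * of_real t)" for t n
    by (simp add: unit_e_def mult_ac flip: exp_of_nat_mult)
  have c: "cnj (unit_e t) = exp (2 * of_real pi * \<i> * of_int (- 1) * of_real t)" for t
    by (simp add: unit_e_def exp_cnj)
  have ec: "unit_e t ^ n * cnj (unit_e t) ^ k = exp (2 * of_real pi * \<i> * of_int (int n - int k) * of_real t)" for t
    unfolding e c by (simp add: algebra_simps flip: exp_add exp_of_nat_mult)
  show "((\<lambda>t. unit_e t ^ n) has_integral (if n = 0 then 1 else 0)) {0..1}"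
    using unit_e_int_power_integral[of "int n"] by (simp only: e) simp
  show "((\<lambda>t. unit_e t ^ n * cnj (unit_e t) ^ k) has_integral (if n = k then 1 else 0)) {0..1}"
    unfolding ec using unit_e_int_power_integral[of "int n - int k"] by simp
qed

lemma power_series_circle_coefficients:
  fixes c :: "nat \<Rightarrow> complex"
  assumes g: "\<And>z. cmod z < R \<Longrightarrow> (\<lambda>n. c n * z ^ n) sums g z" and \<rho>: "0 < \<rho>" "\<rho> < R"
  shows "((\<lambda>t. g (of_real \<rho> * unit_e t) * unit_e t ^ k) has_integral (if k = 0 then c 0 else 0)) {0..1}"
    and "((\<lambda>t. g (of_real \<rho> * unit_e t) * cnj (unit_e t) ^ k) has_integral (c k * of_real \<rho> ^ k)) {0..1}"
proof -
  define R' where "R' = (\<rho> + R) / 2"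
  have R': "\<rho> < R'" "R' < R" "0 < R'" using \<rho> by (auto simp: R'_def)
  have "summable (\<lambda>n. c n * of_real R' ^ n)"
    using g[of "of_real R'"] R' by (auto simp: sums_iff)
  from conv_radius_geI[OF this] have "ereal R' \<le> conv_radius c" using R' by simp
  then have "ereal \<rho> < conv_radius c" using R'(1) by (simp add: less_le_trans[of "ereal \<rho>" "ereal R'"])
  from powser_uniform_limit[OF this, of 0]
  have ul: "uniform_limit (cball 0 \<rho>) (\<lambda>N x. \<Sum>n<N. c n * x ^ n) (\<lambda>x. \<Sum>n. c n * x ^ n) sequentially" by simp
  have lim: "uniform_limit {0..1} (\<lambda>N t. (\<Sum>n<N. c n * (of_real \<rho> * unit_e t) ^ n) * b t) (\<lambda>t. g (of_real \<rho> * unit_e t) * b t) sequentially"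
    if b: "\<And>t. cmod (b t) = 1" for b :: "real \<Rightarrow> complex"
  proof (rule uniform_limitI)
    fix e :: real assume "e > 0"
    from uniform_limitD[OF ul this]
    show "\<forall>\<^sub>F N in sequentially. \<forall>t\<in>{0..1}. dist ((\<Sum>n<N. c n * (of_real \<rho> * unit_e t) ^ n) * b t) (g (of_real \<rho> * unit_e t) * b t) < e"
    proof eventually_elim
      case (elim N)
      show ?case
      proof
        fix t :: real
        have z: "of_real \<rho> * unit_e t \<in> cball 0 \<rho>" using \<rho> by (simp add: norm_mult)
        have "g (of_real \<rho> * unit_e t) = (\<Sum>n. c n * (of_real \<rho> * unit_e t) ^ n)"
          using g[of "of_real \<rho> * unit_e t"] \<rho> by (simp add: norm_mult sums_iff)
        then have "cmod ((\<Sum>n<N. c n * (of_real \<rho> * unit_e t) ^ n) - g (of_real \<rho> * unit_e t)) < e"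
          using elim[rule_format, OF z] by (simp add: dist_norm)
        then show "dist ((\<Sum>n<N. c n * (of_real \<rho> * unit_e t) ^ n) * b t) (g (of_real \<rho> * unit_e t) * b t) < e"
          using b[of t] by (simp add: dist_norm norm_mult flip: left_diff_distrib)
      qed
    qed
  qed
  have main: "((\<lambda>t. g (of_real \<rho> * unit_e t) * b t) has_integral v) {0..1}"
    if b: "\<And>t. cmod (b t) = 1" and bc: "continuous_on {0..1} b" and I: "\<And>n. ((\<lambda>t. unit_e t ^ n * b t) has_integral (i n)) {0..1}"
      and L: "\<And>N. N \<ge> M \<Longrightarrow> (\<Sum>n<N. c n * of_real \<rho> ^ n * i n) = v" for b :: "real \<Rightarrow> complex" and i v M
  proof -
    have P: "((\<lambda>t. (\<Sum>n<N. c n * (of_real \<rho> * unit_e t) ^ n) * b t) has_integral (\<Sum>n<N. c n * of_real \<rho> ^ n * i n)) {0..1}" for N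
    proof -
      have "((\<lambda>t. \<Sum>n<N. c n * of_real \<rho> ^ n * (unit_e t ^ n * b t)) has_integral (\<Sum>n<N. c n * of_real \<rho> ^ n * i n)) {0..1}"
        by (intro has_integral_sum has_integral_mult_right I) auto
      moreover have "(\<Sum>n<N. c n * (of_real \<rho> * unit_e t) ^ n) * b t = (\<Sum>n<N. c n * of_real \<rho> ^ n * (unit_e t ^ n * b t))" for t
        unfolding sum_distrib_right by (intro sum.cong) (simp_all add: power_mult_distrib mult_ac)
      ultimately show ?thesis by simp
    qed
    have "continuous_on {0..1} (\<lambda>t. (\<Sum>n<N. c n * (of_real \<rho> * unit_e t) ^ n) * b t)" for N
      by (intro continuous_intros bc)
    then show ?thesis
    proof (rule uniform_limit_integral[OF lim[OF b] _ sequentially_bot])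
      fix I' J
      assume I': "\<And>N. ((\<lambda>t. (\<Sum>n<N. c n * (of_real \<rho> * unit_e t) ^ n) * b t) has_integral I' N) {0..1}"
        and J: "((\<lambda>t. g (of_real \<rho> * unit_e t) * b t) has_integral J) {0..1}" and lim: "I' \<longlonglongrightarrow> J"
      have "I' N = v" if "N \<ge> M" for N
        using has_integral_unique[OF I'[of N] P[of N]] L[OF that] by simp
      then have "I' \<longlonglongrightarrow> v"
        by (intro tendsto_eventually) (auto simp: eventually_sequentially)
      from LIMSEQ_unique[OF lim this] J show ?thesis by simp
    qed
  qed
  show "((\<lambda>t. g (of_real \<rho> * unit_e t) * unit_e t ^ k) has_integral (if k = 0 then c 0 else 0)) {0..1}"
  proof (rule main[where M = 1 and i = "\<lambda>n. if n + k = 0 then 1 else 0"])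
    show "((\<lambda>t. unit_e t ^ n * unit_e t ^ k) has_integral (if n + k = 0 then 1 else 0)) {0..1}" for n
      using unit_e_power_integral(1)[of "n + k"] by (simp add: power_add)
    show "(\<Sum>n<N. c n * of_real \<rho> ^ n * (if n + k = 0 then 1 else 0)) = (if k = 0 then c 0 else 0)" if "N \<ge> 1" for N
      using that by (cases "k = 0") (auto simp: if_distrib[of "\<lambda>x. _ * x"] sum.delta cong: if_cong)
  qed (simp_all add: norm_power continuous_on_power continuous_on_unit_e)
  show "((\<lambda>t. g (of_real \<rho> * unit_e t) * cnj (unit_e t) ^ k) has_integral (c k * of_real \<rho> ^ k)) {0..1}"
  proof (rule main[where M = "Suc k" and i = "\<lambda>n. if n = k then 1 else 0"])
    show "(\<Sum>n<N. c n * of_real \<rho> ^ n * (if n = k then 1 else 0)) = c k * of_real \<rho> ^ k" if "N \<ge> Suc k" for N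
      using that by (auto simp: if_distrib[of "\<lambda>x. _ * x"] sum.delta cong: if_cong)
  qed (simp_all add: norm_power unit_e_power_integral(2) continuous_on_power continuous_on_cnj continuous_on_unit_e)
qed

lemma Re_power_series_circle_coefficients:
  fixes c :: "nat \<Rightarrow> complex"
  assumes g: "\<And>z. cmod z < R \<Longrightarrow> (\<lambda>n. c n * z ^ n) sums g z" and \<rho>: "0 < \<rho>" "\<rho> < R"
  shows "((\<lambda>t. of_real (Re (g (of_real \<rho> * unit_e t))) * unit_e t ^ k) has_integral
     (if k = 0 then of_real (Re (c 0)) else cnj (c k) * of_real \<rho> ^ k / 2)) {0..1}"
proof -
  let ?g = "\<lambda>t. g (of_real \<rho> * unit_e t)"
  have 1: "((\<lambda>t. ?g t * unit_e t ^ k) has_integral (if k = 0 then c 0 else 0)) {0..1}"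
    by (rule power_series_circle_coefficients(1)[OF g \<rho>])
  have "((\<lambda>t. cnj (?g t * cnj (unit_e t) ^ k)) has_integral cnj (c k * of_real \<rho> ^ k)) {0..1}"
    using power_series_circle_coefficients(2)[OF g \<rho>, of k]
    by (subst has_integral_cnj[unfolded o_def])
  from has_integral_mult_right[OF has_integral_add[OF 1 this], of "1 / 2"]
  have "((\<lambda>t. 1 / 2 * (?g t * unit_e t ^ k + cnj (?g t * cnj (unit_e t) ^ k))) has_integral
     1 / 2 * ((if k = 0 then c 0 else 0) + cnj (c k * of_real \<rho> ^ k))) {0..1}" .
  moreover have "1 / 2 * (?g t * unit_e t ^ k + cnj (?g t * cnj (unit_e t) ^ k)) = of_real (Re (?g t)) * unit_e t ^ k" for t
  proof -
    have "of_real (Re (?g t)) = 1 / 2 * (?g t + cnj (?g t))" by (simp add: complex_add_cnj)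
    moreover have "cnj (?g t * cnj (unit_e t) ^ k) = cnj (?g t) * unit_e t ^ k" by simp
    ultimately show ?thesis by (simp only: mult.assoc distrib_right)
  qed
  moreover have "1 / 2 * ((if k = 0 then c 0 else 0) + cnj (c k * of_real \<rho> ^ k))
     = (if k = 0 then of_real (Re (c 0)) else cnj (c k) * of_real \<rho> ^ k / 2)"
    by (simp add: complex_add_cnj)
  ultimately show ?thesis by simp
qed

lemma Re_of_real_mult: "Re (of_real x * z) = x * Re z"
  and Re_of_nat_mult: "Re (of_nat m * z) = real m * Re z"
  by simp_all

lemma Ln_one_minus_series:
  assumes "cmod (b * z) < 1"
  shows "(\<lambda>n. - (b ^ n) / of_nat n * z ^ n) sums Ln (1 - b * z)"
proof -
  have "(\<lambda>n. (- 1) ^ Suc n / of_nat n * (- (b * z)) ^ n) sums Ln (1 + - (b * z))"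
    by (rule Ln_series) (use assms in simp)
  moreover have "(- 1) ^ Suc n / of_nat n * (- (b * z)) ^ n = - (b ^ n) / of_nat n * z ^ n" for n
  proof -
    have "(- (b * z)) ^ n = (- 1) ^ n * (b ^ n * z ^ n)" by (metis power_minus power_mult_distrib)
    then have "(- 1) ^ Suc n / of_nat n * (- (b * z)) ^ n = - (((- 1) ^ n * (- 1) ^ n) * (b ^ n * z ^ n) / of_nat n)"
      by simp
    also have "(- 1) ^ n * (- 1) ^ n = (1 :: complex)" by (simp flip: power_mult_distrib)
    finally show ?thesis by simp
  qed
  ultimately show ?thesis by (simp only: diff_conv_add_uminus)
qed

text \<open>For \<rho> < |a| expand Ln(1 - z/a). For \<rho> > |a| reflect the pole in the circle: on
  |z| = \<rho> one has |1 - z/a| = (\<rho>/|a|) |1 - b z| with b = cnj a / \<rho>^2, and the zero of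
  1 - b z lies outside the circle.\<close>

lemma ln_linear_circle_coefficients:
  fixes a :: complex
  assumes a: "a \<noteq> 0" and \<rho>: "\<rho> > 0" "\<rho> \<noteq> cmod a"
  shows "((\<lambda>t. of_real (ln (cmod (1 - of_real \<rho> * unit_e t / a))) * unit_e t ^ k) has_integral log_coeff a k \<rho>) {0..1}"
proof (cases "\<rho> < cmod a")
  case True
  have ser: "(\<lambda>n. - ((1 / a) ^ n) / of_nat n * z ^ n) sums Ln (1 - (1 / a) * z)" if "cmod z < cmod a" for z
    using that a by (intro Ln_one_minus_series) (simp add: norm_divide)
  have "Re (Ln (1 - (1 / a) * (of_real \<rho> * unit_e t))) = ln (cmod (1 - of_real \<rho> * unit_e t / a))" for t
  proof -
    have "cmod (of_real \<rho> * unit_e t / a) \<noteq> 1" using \<rho> a by (simp add: norm_divide norm_mult)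
    then have "1 - (1 / a) * (of_real \<rho> * unit_e t) \<noteq> 0" by auto
    from Re_Ln[OF this] show ?thesis by simp
  qed
  then have "((\<lambda>t. of_real (ln (cmod (1 - of_real \<rho> * unit_e t / a))) * unit_e t ^ k) has_integral
     (if k = 0 then of_real (Re (- ((1 / a) ^ 0) / of_nat 0)) else cnj (- ((1 / a) ^ k) / of_nat k) * of_real \<rho> ^ k / 2)) {0..1}"
    using Re_power_series_circle_coefficients[OF ser \<rho>(1) True, of k] by simp
  moreover have "(if k = 0 then of_real (Re (- ((1 / a) ^ 0) / of_nat 0)) else cnj (- ((1 / a) ^ k) / of_nat k) * of_real \<rho> ^ k / 2) = log_coeff a k \<rho>"
    using True by (simp add: log_coeff_def power_divide)
  ultimately show ?thesis by simp
next
  case False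
  then have out: "cmod a < \<rho>" using \<rho> by simp
  define b where "b = cnj a / of_real (\<rho>\<^sup>2)"
  have ser: "(\<lambda>n. - (b ^ n) / of_nat n * z ^ n) sums Ln (1 - b * z)" if "cmod z < \<rho>\<^sup>2 / cmod a" for z
    using that a \<rho> by (intro Ln_one_minus_series) (simp add: b_def norm_divide norm_mult norm_power pos_less_divide_eq mult.commute)
  have \<rho>R: "\<rho> < \<rho>\<^sup>2 / cmod a" using out a \<rho> by (simp add: pos_less_divide_eq power2_eq_square)
  have split: "ln (cmod (1 - of_real \<rho> * unit_e t / a)) = ln (\<rho> / cmod a) + Re (Ln (1 - b * (of_real \<rho> * unit_e t)))" for t
  proof -
    have "cmod (b * (of_real \<rho> * unit_e t)) \<noteq> 1"
      using \<rho> out by (simp add: b_def norm_divide norm_mult norm_power power2_eq_square)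
    then have nz: "1 - b * (of_real \<rho> * unit_e t) \<noteq> 0" by auto
    have e: "unit_e t * cnj (unit_e t) = 1"
      using complex_norm_square[of "unit_e t"] by simp
    have "1 - of_real \<rho> * unit_e t / a = - (of_real \<rho> * unit_e t / a) * cnj (1 - b * (of_real \<rho> * unit_e t))"
    proof -
      have "(of_real \<rho> * unit_e t / a) * cnj (b * (of_real \<rho> * unit_e t)) = unit_e t * cnj (unit_e t)"
        using a \<rho> by (simp add: b_def power2_eq_square)
      then have m: "(of_real \<rho> * unit_e t / a) * cnj (b * (of_real \<rho> * unit_e t)) = 1" unfolding e .
      have "- (of_real \<rho> * unit_e t / a) * cnj (1 - b * (of_real \<rho> * unit_e t))
          = - (of_real \<rho> * unit_e t / a) + (of_real \<rho> * unit_e t / a) * cnj (b * (of_real \<rho> * unit_e t))"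
        by (simp only: complex_cnj_diff complex_cnj_one right_diff_distrib mult_1_right mult_minus_left diff_minus_eq_add)
      then show ?thesis unfolding m by simp
    qed
    then have "cmod (1 - of_real \<rho> * unit_e t / a) = (\<rho> / cmod a) * cmod (1 - b * (of_real \<rho> * unit_e t))"
      using \<rho> by (simp only: norm_mult norm_minus_cancel norm_divide complex_mod_cnj) simp
    moreover have "ln ((\<rho> / cmod a) * cmod (1 - b * (of_real \<rho> * unit_e t))) = ln (\<rho> / cmod a) + ln (cmod (1 - b * (of_real \<rho> * unit_e t)))"
      using nz \<rho> a by (intro ln_mult_pos) auto
    ultimately show ?thesis using Re_Ln[OF nz] by simp
  qed
  have "((\<lambda>t. of_real (ln (\<rho> / cmod a)) * unit_e t ^ k) has_integral of_real (ln (\<rho> / cmod a)) * (if k = 0 then 1 else 0)) {0..1}"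
    by (intro has_integral_mult_right unit_e_power_integral(1))
  from has_integral_add[OF this Re_power_series_circle_coefficients[OF ser \<rho>(1) \<rho>R, of k]]
  have "((\<lambda>t. of_real (ln (cmod (1 - of_real \<rho> * unit_e t / a))) * unit_e t ^ k) has_integral
    (of_real (ln (\<rho> / cmod a)) * (if k = 0 then 1 else 0) +
     (if k = 0 then of_real (Re (- (b ^ 0) / of_nat 0)) else cnj (- (b ^ k) / of_nat k) * of_real \<rho> ^ k / 2))) {0..1}"
    unfolding split by (simp add: distrib_right)
  moreover have "of_real (ln (\<rho> / cmod a)) * (if k = 0 then 1 else 0) +
     (if k = 0 then of_real (Re (- (b ^ 0) / of_nat 0)) else cnj (- (b ^ k) / of_nat k) * of_real \<rho> ^ k / 2) = log_coeff a k \<rho>"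
  proof -
    have "cnj b * of_real \<rho> = a / of_real \<rho>" using \<rho> by (simp add: b_def power2_eq_square)
    then have "cnj b ^ k * of_real \<rho> ^ k = (a / of_real \<rho>) ^ k" by (metis power_mult_distrib)
    then show ?thesis using out by (simp add: log_coeff_def mult.commute)
  qed
  ultimately show ?thesis by simp
qed

section \<open>Weighted means of a logarithmic potential\<close>

definition trig_poly :: "(nat \<Rightarrow> complex) \<Rightarrow> nat \<Rightarrow> complex \<Rightarrow> real" where
  "trig_poly d N \<zeta> = Re (\<Sum>k\<le>N. d k * \<zeta> ^ k)"

text \<open>In the angle, \<open>trig_poly (curvature d) N\<close> is \<open>h + h''\<close> for \<open>h = trig_poly d N\<close>.\<close>

definition curvature :: "(nat \<Rightarrow> complex) \<Rightarrow> nat \<Rightarrow> complex" where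
  "curvature d k = of_real (1 - (real k)\<^sup>2) * d k"

text \<open>Models ln|G| on the disc of radius \<open>B\<close>, where G is exp(g) times the product
  of the factors (1 - z/a)^n(a) over \<open>X\<close>. The condition \<open>c 0 = 0\<close>
  normalises G(0) = 1.\<close>

locale log_potential =
  fixes X :: "complex set" and n :: "complex \<Rightarrow> nat" and c :: "nat \<Rightarrow> complex" and g :: "complex \<Rightarrow> complex" and B :: real
  assumes X: "finite X" "0 \<notin> X" and B: "B > 0"
    and g: "\<And>z. cmod z < B \<Longrightarrow> (\<lambda>n. c n * z ^ n) sums g z" and c0: "c 0 = 0"
begin

definition u :: "complex \<Rightarrow> real" where
  "u z = (\<Sum>a\<in>X. real (n a) * ln (cmod (1 - z / a))) + Re (g z)"

text \<open>The harmonic part Re g is disguised as a pole at the real point \<open>B\<close>: for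
  \<rho> \<le> B, \<open>log_coeff (of_real B) k \<rho>\<close> with k > 0 is a multiple of
  \<rho>^k, and the factor in front turns it into the k-th coefficient of Re g. One integral lemma
  then covers both parts, and a pole at B > R adds nothing to the sum over zeros.\<close>

definition J :: "nat \<Rightarrow> real \<Rightarrow> complex" where
  "J k \<rho> = (\<Sum>a\<in>X. of_nat (n a) * log_coeff a k \<rho>) + (- of_nat k * of_real B ^ k * cnj (c k)) * log_coeff (of_real B) k \<rho>"

lemma J_integral:
  assumes \<rho>: "0 < \<rho>" "\<rho> < B" "\<rho> \<notin> cmod ` X"
  shows "((\<lambda>t. of_real (u (of_real \<rho> * unit_e t)) * unit_e t ^ k) has_integral J k \<rho>) {0..1}"
proof -
  have "((\<lambda>t. \<Sum>a\<in>X. of_nat (n a) * (of_real (ln (cmod (1 - of_real \<rho> * unit_e t / a))) * unit_e t ^ k)) has_integral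
      (\<Sum>a\<in>X. of_nat (n a) * log_coeff a k \<rho>)) {0..1}"
    using X \<rho> by (intro has_integral_sum has_integral_mult_right ln_linear_circle_coefficients) auto
  note has_integral_add[OF this Re_power_series_circle_coefficients[OF g \<rho>(1,2), of k]]
  moreover have "(\<Sum>a\<in>X. of_nat (n a) * (of_real (ln (cmod (1 - of_real \<rho> * unit_e t / a))) * unit_e t ^ k))
      + of_real (Re (g (of_real \<rho> * unit_e t))) * unit_e t ^ k = of_real (u (of_real \<rho> * unit_e t)) * unit_e t ^ k" for t
  proof -
    have "of_real (u (of_real \<rho> * unit_e t)) = (\<Sum>a\<in>X. of_nat (n a) * of_real (ln (cmod (1 - of_real \<rho> * unit_e t / a))))
        + complex_of_real (Re (g (of_real \<rho> * unit_e t)))"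
      unfolding u_def by (simp only: of_real_add of_real_sum of_real_mult of_real_of_nat_eq)
    then show ?thesis by (simp only: distrib_right sum_distrib_right mult.assoc)
  qed
  ultimately have "((\<lambda>t. of_real (u (of_real \<rho> * unit_e t)) * unit_e t ^ k) has_integral
      ((\<Sum>a\<in>X. of_nat (n a) * log_coeff a k \<rho>) + (if k = 0 then of_real (Re (c 0)) else cnj (c k) * of_real \<rho> ^ k / 2))) {0..1}"
    by (simp only:)
  moreover have "(if k = 0 then of_real (Re (c 0)) else cnj (c k) * of_real \<rho> ^ k / 2)
      = (- of_nat k * of_real B ^ k * cnj (c k)) * log_coeff (of_real B) k \<rho>"
    using B \<rho> by (simp add: log_coeff_def c0 power_divide)
  ultimately show ?thesis by (simp add: J_def)
qed

text \<open>Defined through \<open>J\<close>, hence also for radii at which a zero lies on the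
  circle; \<open>M_integral\<close> identifies it with a circle mean at the remaining radii below
  \<open>B\<close>.\<close>

definition M :: "(nat \<Rightarrow> complex) \<Rightarrow> nat \<Rightarrow> real \<Rightarrow> real" where
  "M d N \<rho> = Re (\<Sum>k\<le>N. d k * J k \<rho>)"

lemma M_integral:
  assumes \<rho>: "0 < \<rho>" "\<rho> < B" "\<rho> \<notin> cmod ` X"
  shows "((\<lambda>t. trig_poly d N (unit_e t) * u (of_real \<rho> * unit_e t)) has_integral M d N \<rho>) {0..1}"
proof -
  have "((\<lambda>t. \<Sum>k\<le>N. d k * (of_real (u (of_real \<rho> * unit_e t)) * unit_e t ^ k)) has_integral (\<Sum>k\<le>N. d k * J k \<rho>)) {0..1}"
    by (intro has_integral_sum has_integral_mult_right J_integral[OF \<rho>]) auto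
  from has_integral_Re[OF this] have "((\<lambda>t. Re (\<Sum>k\<le>N. d k * (of_real (u (of_real \<rho> * unit_e t)) * unit_e t ^ k))) has_integral M d N \<rho>) {0..1}"
    by (simp add: M_def)
  moreover have "Re (\<Sum>k\<le>N. d k * (of_real (u (of_real \<rho> * unit_e t)) * unit_e t ^ k)) = trig_poly d N (unit_e t) * u (of_real \<rho> * unit_e t)" for t
  proof -
    have "(\<Sum>k\<le>N. d k * (of_real (u (of_real \<rho> * unit_e t)) * unit_e t ^ k)) = (\<Sum>k\<le>N. d k * unit_e t ^ k) * of_real (u (of_real \<rho> * unit_e t))"
      unfolding sum_distrib_right by (intro sum.cong) auto
    then show ?thesis by (simp add: trig_poly_def)
  qed
  ultimately show ?thesis by simp
qed

text \<open>Green's formula, mode by mode: summed with coefficients \<open>d k\<close>, the factor 1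
  - k^2 becomes \<open>curvature\<close>, and (a / |a|)^k becomes the value of
  \<open>trig_poly d N\<close> in the direction of \<open>a\<close>.\<close>

lemma weighted_zero_sum:
  assumes rR: "0 < r" "r < R" "R < B"
  shows "((\<lambda>\<rho>. radial_weight r R \<rho> * M (curvature d) N \<rho>) has_integral
     (2 / r * M d N r - 2 / R * M d N R
      + (\<Sum>a\<in>X. if cmod a < R then real (n a) * (cmod a * radial_weight r R (cmod a)) * trig_poly d N (a / of_real (cmod a)) else 0))) {0..R}"
proof -
  define j where "j a k = (if cmod a < R then of_real (cmod a * radial_weight r R (cmod a)) * (a / of_real (cmod a)) ^ k else 0)" for a k
  have z: "((\<lambda>\<rho>. of_real (radial_weight r R \<rho> * (1 - (real k)\<^sup>2)) * log_coeff a k \<rho>) has_integral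
     (of_real (2 / r) * log_coeff a k r - of_real (2 / R) * log_coeff a k R + j a k)) {0..R}" if "a \<noteq> 0" for a k
    unfolding j_def using log_coeff_radial_weight_integral[OF that rR(1,2)] .
  have jB: "j (of_real B) k = 0" for k using rR by (simp add: j_def)
  have "((\<lambda>\<rho>. \<Sum>k\<le>N. d k * ((\<Sum>a\<in>X. of_nat (n a) * (of_real (radial_weight r R \<rho> * (1 - (real k)\<^sup>2)) * log_coeff a k \<rho>))
       + (- of_nat k * of_real B ^ k * cnj (c k)) * (of_real (radial_weight r R \<rho> * (1 - (real k)\<^sup>2)) * log_coeff (of_real B) k \<rho>)))
    has_integral (\<Sum>k\<le>N. d k * ((\<Sum>a\<in>X. of_nat (n a) * (of_real (2 / r) * log_coeff a k r - of_real (2 / R) * log_coeff a k R + j a k))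
       + (- of_nat k * of_real B ^ k * cnj (c k)) * (of_real (2 / r) * log_coeff (of_real B) k r - of_real (2 / R) * log_coeff (of_real B) k R + j (of_real B) k)))) {0..R}"
    using X B by (intro has_integral_sum has_integral_mult_right has_integral_add z) auto
  moreover have "(\<Sum>k\<le>N. d k * ((\<Sum>a\<in>X. of_nat (n a) * (of_real (radial_weight r R \<rho> * (1 - (real k)\<^sup>2)) * log_coeff a k \<rho>))
       + (- of_nat k * of_real B ^ k * cnj (c k)) * (of_real (radial_weight r R \<rho> * (1 - (real k)\<^sup>2)) * log_coeff (of_real B) k \<rho>)))
     = of_real (radial_weight r R \<rho>) * (\<Sum>k\<le>N. curvature d k * J k \<rho>)" for \<rho>
  proof -
    have s: "(\<Sum>a\<in>X. of_nat (n a) * (y * log_coeff a k \<rho>)) = y * (\<Sum>a\<in>X. of_nat (n a) * log_coeff a k \<rho>)" for y k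
      unfolding sum_distrib_left by (intro sum.cong refl) simp
    show ?thesis
      unfolding J_def curvature_def s sum_distrib_left[of _ _ "{..N}"]
      by (intro sum.cong refl) (simp add: distrib_left right_diff_distrib mult_ac)
  qed
  moreover have "(\<Sum>k\<le>N. d k * ((\<Sum>a\<in>X. of_nat (n a) * (of_real (2 / r) * log_coeff a k r - of_real (2 / R) * log_coeff a k R + j a k))
       + (- of_nat k * of_real B ^ k * cnj (c k)) * (of_real (2 / r) * log_coeff (of_real B) k r - of_real (2 / R) * log_coeff (of_real B) k R + j (of_real B) k)))
     = of_real (2 / r) * (\<Sum>k\<le>N. d k * J k r) - of_real (2 / R) * (\<Sum>k\<le>N. d k * J k R) + (\<Sum>a\<in>X. of_nat (n a) * (\<Sum>k\<le>N. d k * j a k))"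
  proof -
    have s: "(\<Sum>a\<in>X. of_nat (n a) * (of_real (2 / r) * log_coeff a k r - of_real (2 / R) * log_coeff a k R + j a k))
       = of_real (2 / r) * (\<Sum>a\<in>X. of_nat (n a) * log_coeff a k r) - of_real (2 / R) * (\<Sum>a\<in>X. of_nat (n a) * log_coeff a k R) + (\<Sum>a\<in>X. of_nat (n a) * j a k)" for k
      unfolding sum_distrib_left sum_subtractf[symmetric] sum.distrib[symmetric]
      by (intro sum.cong refl) (simp add: algebra_simps)
    have sw: "(\<Sum>a\<in>X. of_nat (n a) * (\<Sum>k\<le>N. d k * j a k)) = (\<Sum>k\<le>N. d k * (\<Sum>a\<in>X. of_nat (n a) * j a k))"
      unfolding sum_distrib_left by (subst sum.swap) (intro sum.cong refl, simp add: mult_ac)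
    show ?thesis
      unfolding sw s jB J_def unfolding sum_distrib_left[of _ _ "{..N}"] sum_subtractf[symmetric] sum.distrib[symmetric]
      by (intro sum.cong refl) (simp add: algebra_simps)
  qed
  ultimately have "((\<lambda>\<rho>. of_real (radial_weight r R \<rho>) * (\<Sum>k\<le>N. curvature d k * J k \<rho>)) has_integral
     (of_real (2 / r) * (\<Sum>k\<le>N. d k * J k r) - of_real (2 / R) * (\<Sum>k\<le>N. d k * J k R) + (\<Sum>a\<in>X. of_nat (n a) * (\<Sum>k\<le>N. d k * j a k)))) {0..R}"
    by (simp only:)
  from has_integral_Re[OF this]
  have "((\<lambda>\<rho>. radial_weight r R \<rho> * M (curvature d) N \<rho>) has_integral
     (2 / r * M d N r - 2 / R * M d N R + (\<Sum>a\<in>X. Re (of_nat (n a) * (\<Sum>k\<le>N. d k * j a k))))) {0..R}"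
    unfolding M_def by (simp only: plus_complex.sel minus_complex.sel Re_sum Re_of_real_mult)
  moreover have "Re (of_nat (n a) * (\<Sum>k\<le>N. d k * j a k)) = (if cmod a < R then real (n a) * (cmod a * radial_weight r R (cmod a)) * trig_poly d N (a / of_real (cmod a)) else 0)" for a
  proof (cases "cmod a < R")
    case True
    have "(\<Sum>k\<le>N. d k * j a k) = of_real (cmod a * radial_weight r R (cmod a)) * (\<Sum>k\<le>N. d k * (a / of_real (cmod a)) ^ k)"
      unfolding sum_distrib_left using True by (intro sum.cong refl) (simp add: j_def)
    then have "Re (of_nat (n a) * (\<Sum>k\<le>N. d k * j a k)) = real (n a) * (cmod a * radial_weight r R (cmod a)) * trig_poly d N (a / of_real (cmod a))"
      unfolding trig_poly_def by (simp only: Re_of_real_mult Re_of_nat_mult mult.assoc)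
    then show ?thesis using True by simp
  qed (simp add: j_def)
  ultimately show ?thesis by simp
qed

end

lemma trig_poly_mean: "((\<lambda>t. trig_poly d N (unit_e t)) has_integral Re (d 0)) {0..1}"
proof -
  have "((\<lambda>t. \<Sum>k\<le>N. d k * unit_e t ^ k) has_integral (\<Sum>k\<le>N. d k * (if k = 0 then 1 else 0))) {0..1}"
    by (intro has_integral_sum has_integral_mult_right unit_e_power_integral(1)) auto
  moreover have "(\<Sum>k\<le>N. d k * (if k = 0 then 1 else 0)) = d 0"
    by (simp add: if_distrib[of "\<lambda>x. _ * x"] cong: if_cong)
  ultimately have "((\<lambda>t. \<Sum>k\<le>N. d k * unit_e t ^ k) has_integral d 0) {0..1}" by simp
  from has_integral_Re[OF this] show ?thesis unfolding trig_poly_def .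
qed

lemma radial_weight_integrals:
  assumes rR: "0 < r" "r < R"
  shows "((\<lambda>\<rho>. radial_weight r R \<rho>) has_integral (2 / r - 2 / R)) {0..R}"
    and "((\<lambda>\<rho>. radial_weight r R \<rho> * \<rho>) has_integral ln (R / r)) {0..R}"
proof -
  define \<kappa> where "\<kappa> = 1 / r\<^sup>2 - 1 / R\<^sup>2"
  have "((\<lambda>\<rho>. \<kappa>) has_integral \<kappa> * r) {0..r}"
    using has_integral_const_real[of \<kappa> 0 r] rR by (simp add: mult.commute)
  then have 1: "((\<lambda>\<rho>. radial_weight r R \<rho>) has_integral \<kappa> * r) {0..r}"
    by (rule has_integral_eq[rotated]) (auto simp: radial_weight_def \<kappa>_def max_def)
  have "((\<lambda>\<rho>. 1 / \<rho>\<^sup>2 - 1 / R\<^sup>2) has_integral ((- 1 / R - R / R\<^sup>2) - (- 1 / r - r / R\<^sup>2))) {r..R}"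
  proof (rule fundamental_theorem_of_calculus)
    fix x assume "x \<in> {r..R}"
    then have "x > 0" using rR by auto
    then show "((\<lambda>\<rho>. - 1 / \<rho> - \<rho> / R\<^sup>2) has_vector_derivative (1 / x\<^sup>2 - 1 / R\<^sup>2)) (at x within {r..R})"
      unfolding has_real_derivative_iff_has_vector_derivative[symmetric] using rR
      by (auto intro!: derivative_eq_intros simp: power2_eq_square)
  qed (use rR in auto)
  then have 2: "((\<lambda>\<rho>. radial_weight r R \<rho>) has_integral ((- 1 / R - R / R\<^sup>2) - (- 1 / r - r / R\<^sup>2))) {r..R}"
    by (rule has_integral_eq[rotated]) (auto simp: radial_weight_def max_def)
  have "\<kappa> * r + ((- 1 / R - R / R\<^sup>2) - (- 1 / r - r / R\<^sup>2)) = 2 / r - 2 / R"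
    using rR by (simp add: \<kappa>_def left_diff_distrib power2_eq_square)
  then show "((\<lambda>\<rho>. radial_weight r R \<rho>) has_integral (2 / r - 2 / R)) {0..R}"
    using has_integral_combine[OF _ _ 1 2] rR by simp
  have "((\<lambda>\<rho>. \<kappa> * \<rho>) has_integral (\<kappa> * r\<^sup>2 / 2 - \<kappa> * 0\<^sup>2 / 2)) {0..r}"
  proof (rule fundamental_theorem_of_calculus)
    fix x assume "x \<in> {0..r}"
    show "((\<lambda>\<rho>. \<kappa> * \<rho>\<^sup>2 / 2) has_vector_derivative \<kappa> * x) (at x within {0..r})"
      unfolding has_real_derivative_iff_has_vector_derivative[symmetric]
      by (auto intro!: derivative_eq_intros)
  qed (use rR in auto)
  then have 3: "((\<lambda>\<rho>. radial_weight r R \<rho> * \<rho>) has_integral (\<kappa> * r\<^sup>2 / 2 - \<kappa> * 0\<^sup>2 / 2)) {0..r}"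
    by (rule has_integral_eq[rotated]) (auto simp: radial_weight_def \<kappa>_def max_def)
  have "((\<lambda>\<rho>. (1 / \<rho>\<^sup>2 - 1 / R\<^sup>2) * \<rho>) has_integral ((ln R - R\<^sup>2 / (2 * R\<^sup>2)) - (ln r - r\<^sup>2 / (2 * R\<^sup>2)))) {r..R}"
  proof (rule fundamental_theorem_of_calculus)
    fix x assume "x \<in> {r..R}"
    then have "x > 0" using rR by auto
    then show "((\<lambda>\<rho>. ln \<rho> - \<rho>\<^sup>2 / (2 * R\<^sup>2)) has_vector_derivative (1 / x\<^sup>2 - 1 / R\<^sup>2) * x) (at x within {r..R})"
      unfolding has_real_derivative_iff_has_vector_derivative[symmetric] using rR
      by (auto intro!: derivative_eq_intros simp: power2_eq_square left_diff_distrib)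
  qed (use rR in auto)
  then have 4: "((\<lambda>\<rho>. radial_weight r R \<rho> * \<rho>) has_integral ((ln R - R\<^sup>2 / (2 * R\<^sup>2)) - (ln r - r\<^sup>2 / (2 * R\<^sup>2)))) {r..R}"
    by (rule has_integral_eq[rotated]) (auto simp: radial_weight_def max_def)
  have "(\<kappa> * r\<^sup>2 / 2 - \<kappa> * 0\<^sup>2 / 2) + ((ln R - R\<^sup>2 / (2 * R\<^sup>2)) - (ln r - r\<^sup>2 / (2 * R\<^sup>2))) = ln (R / r)"
    using rR by (simp add: \<kappa>_def left_diff_distrib ln_div diff_divide_distrib)
  then show "((\<lambda>\<rho>. radial_weight r R \<rho> * \<rho>) has_integral ln (R / r)) {0..R}"
    using has_integral_combine[OF _ _ 3 4] rR by simp
qed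

context log_potential
begin

text \<open>The sum over zeros in Jensen's formula; since u(0) = 0 it is the whole circle
  mean.\<close>

definition mean :: "real \<Rightarrow> real" where
  "mean \<rho> = (\<Sum>a\<in>X. real (n a) * (if \<rho> \<le> cmod a then 0 else ln (\<rho> / cmod a)))"

lemma mean_integral:
  assumes \<rho>: "0 < \<rho>" "\<rho> < B" "\<rho> \<notin> cmod ` X"
  shows "((\<lambda>t. u (of_real \<rho> * unit_e t)) has_integral mean \<rho>) {0..1}"
proof -
  have "((\<lambda>t. complex_of_real (u (of_real \<rho> * unit_e t))) has_integral J 0 \<rho>) {0..1}"
    using J_integral[OF \<rho>, of 0] by simp
  from has_integral_Re[OF this] have "((\<lambda>t. u (of_real \<rho> * unit_e t)) has_integral Re (J 0 \<rho>)) {0..1}" by simp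
  moreover have "Re (J 0 \<rho>) = mean \<rho>"
    unfolding J_def mean_def by (simp add: log_coeff_def Re_sum) (intro sum.cong refl, simp)
  ultimately show ?thesis by simp
qed

lemma mean_nonneg: "0 < \<rho> \<Longrightarrow> mean \<rho> \<ge> 0"
proof -
  assume \<rho>: "0 < \<rho>"
  show ?thesis
    unfolding mean_def
  proof (intro sum_nonneg mult_nonneg_nonneg)
    fix a assume "a \<in> X"
    then have "cmod a > 0" using X by auto
    then show "0 \<le> (if \<rho> \<le> cmod a then 0 else ln (\<rho> / cmod a))"
      by (auto intro!: ln_ge_zero simp: pos_le_divide_eq)
  qed simp
qed

text \<open>Each zero of modulus below r \<le> \<rho>/3 contributes at least ln 3 \<ge> 1 to
  Jensen's sum.\<close>

lemma zero_count_le: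
  assumes \<rho>: "0 < \<rho>" "\<rho> < B" "\<rho> \<notin> cmod ` X" and r: "3 * r \<le> \<rho>"
    and U: "\<And>t. u (of_real \<rho> * unit_e t) \<le> K"
  shows "(\<Sum>a\<in>X. if cmod a < r then real (n a) else 0) \<le> K"
proof -
  have "(\<Sum>a\<in>X. if cmod a < r then real (n a) else 0) \<le> mean \<rho>"
    unfolding mean_def
  proof (intro sum_mono)
    fix a assume a: "a \<in> X"
    then have a0: "cmod a > 0" using X by auto
    show "(if cmod a < r then real (n a) else 0) \<le> real (n a) * (if \<rho> \<le> cmod a then 0 else ln (\<rho> / cmod a))"
    proof (cases "cmod a < r")
      case True
      then have out: "cmod a < \<rho>" using r a0 by linarith
      have "3 \<le> \<rho> / cmod a" using True r a0 by (simp add: pos_le_divide_eq)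
      then have "exp 1 \<le> \<rho> / cmod a" using exp_le by linarith
      then have "1 \<le> ln (\<rho> / cmod a)" using a0 \<rho>(1) by (subst ln_ge_iff) auto
      then show ?thesis using True out by (simp add: mult_le_cancel_left1)
    next
      case False
      then show ?thesis using a0 by (auto intro!: mult_nonneg_nonneg ln_ge_zero simp: pos_le_divide_eq)
    qed
  qed
  also have "\<dots> \<le> K"
    using has_integral_le[OF mean_integral[OF \<rho>] has_integral_const_real[of K 0 1]] U by simp
  finally show ?thesis .
qed

lemma zero_sum_le:
  assumes rR: "0 < r" "r < R" "R < B" and crit: "r \<notin> cmod ` X" "R \<notin> cmod ` X" and C: "C \<ge> 0"
    and h: "\<And>t. 0 \<le> trig_poly d N (unit_e t)" "\<And>t. trig_poly d N (unit_e t) \<le> H"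
    and h2: "\<And>t. 0 \<le> trig_poly (curvature d) N (unit_e t)"
    and U: "\<And>\<rho> t. 0 < \<rho> \<Longrightarrow> \<rho> \<le> R \<Longrightarrow> \<rho> \<notin> cmod ` X \<Longrightarrow> u (of_real \<rho> * unit_e t) \<le> C + \<rho> * trig_poly d N (unit_e t)"
    and A: "((\<lambda>t. trig_poly d N (unit_e t) * trig_poly (curvature d) N (unit_e t)) has_integral A) {0..1}"
  shows "(\<Sum>a\<in>X. if cmod a < R then real (n a) * (cmod a * radial_weight r R (cmod a)) * trig_poly d N (a / of_real (cmod a)) else 0)
    \<le> A * ln (R / r) + 6 * C * H / r + 4 * H\<^sup>2"
proof -
  let ?h = "\<lambda>t. trig_poly d N (unit_e t)" and ?h2 = "\<lambda>t. trig_poly (curvature d) N (unit_e t)"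
  have H: "H \<ge> 0" using h[of 0] by linarith
  have MR: "M d N \<rho> \<le> H * (C + \<rho> * H)" if \<rho>: "0 < \<rho>" "\<rho> \<le> R" "\<rho> \<notin> cmod ` X" for \<rho>
  proof -
    have "?h t * u (of_real \<rho> * unit_e t) \<le> H * (C + \<rho> * H)" for t
    proof -
      have "?h t * u (of_real \<rho> * unit_e t) \<le> ?h t * (C + \<rho> * ?h t)"
        using U[OF \<rho>] h(1) by (intro mult_left_mono)
      also have "\<dots> \<le> H * (C + \<rho> * H)"
        using h C \<rho> H by (intro mult_mono add_mono add_nonneg_nonneg mult_nonneg_nonneg) auto
      finally show ?thesis .
    qed
    then show ?thesis
      using has_integral_le[OF M_integral has_integral_const_real[of "H * (C + \<rho> * H)" 0 1], of \<rho> d N] \<rho> rR by simp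
  qed
  \<comment> \<open>The lower bound at \<open>r\<close>: (H - h) u is bounded above because H - h
    \<ge> 0, and H times Jensen's mean is nonnegative.\<close>
  have Mr: "- M d N r \<le> H * (C + r * H)"
  proof -
    have r: "0 < r" "r < B" "r \<notin> cmod ` X" using rR crit by auto
    have "((\<lambda>t. H * u (of_real r * unit_e t) - ?h t * u (of_real r * unit_e t)) has_integral (H * mean r - M d N r)) {0..1}"
      by (intro has_integral_diff has_integral_mult_right mean_integral M_integral r)
    moreover have "H * u (of_real r * unit_e t) - ?h t * u (of_real r * unit_e t) \<le> H * (C + r * H)" for t
    proof -
      have "H * u (of_real r * unit_e t) - ?h t * u (of_real r * unit_e t) = (H - ?h t) * u (of_real r * unit_e t)"
        by (simp add: left_diff_distrib)
      also have "\<dots> \<le> (H - ?h t) * (C + r * ?h t)"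
        using U[of r t] h(2)[of t] rR crit by (intro mult_left_mono) auto
      also have "\<dots> \<le> H * (C + r * H)"
        using h C rR H by (intro mult_mono add_mono add_nonneg_nonneg mult_nonneg_nonneg) auto
      finally show ?thesis .
    qed
    ultimately have "H * mean r - M d N r \<le> H * (C + r * H)"
      using has_integral_le[OF _ has_integral_const_real[of "H * (C + r * H)" 0 1]] by fastforce
    moreover have "0 \<le> H * mean r" using H mean_nonneg[OF rR(1)] by simp
    ultimately show ?thesis by linarith
  qed
  \<comment> \<open>Mode 0 has curvature factor 1, so h + h'' has the same mean as h.\<close>
  have c0: "Re (curvature d 0) = Re (d 0)" by (simp add: curvature_def)
  have d0: "Re (d 0) \<le> H"
    using has_integral_le[OF trig_poly_mean[of d N] has_integral_const_real[of H 0 1]] h by simp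
  have Mc: "M (curvature d) N \<rho> \<le> C * H + A * \<rho>" if \<rho>: "0 < \<rho>" "\<rho> \<le> R" "\<rho> \<notin> cmod ` X" for \<rho>
  proof -
    have "((\<lambda>t. C * ?h2 t + \<rho> * (?h t * ?h2 t)) has_integral (C * Re (curvature d 0) + \<rho> * A)) {0..1}"
      by (intro has_integral_add has_integral_mult_right trig_poly_mean A)
    moreover have "?h2 t * u (of_real \<rho> * unit_e t) \<le> C * ?h2 t + \<rho> * (?h t * ?h2 t)" for t
      using mult_left_mono[OF U[OF \<rho>, of t] h2[of t]] by (simp add: algebra_simps)
    ultimately have "M (curvature d) N \<rho> \<le> C * Re (curvature d 0) + \<rho> * A"
      using has_integral_le[OF M_integral[of \<rho> "curvature d" N]] \<rho> rR by simp
    also have "\<dots> \<le> C * H + A * \<rho>" using mult_left_mono[OF d0 C] c0 by (simp add: mult.commute)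
    finally show ?thesis .
  qed
  \<comment> \<open>Radii at which \<open>M\<close> is not known to be a circle mean; being finite
    in number, they do not affect the integral.\<close>
  define S where "S = insert 0 (cmod ` X)"
  have "finite S" using X by (simp add: S_def)
  have ub: "((\<lambda>\<rho>. C * H * radial_weight r R \<rho> + A * (radial_weight r R \<rho> * \<rho>)) has_integral (C * H * (2 / r - 2 / R) + A * ln (R / r))) {0..R}"
    by (intro has_integral_add has_integral_mult_right radial_weight_integrals rR)
  have ub': "((\<lambda>\<rho>. if \<rho> \<in> S then radial_weight r R \<rho> * M (curvature d) N \<rho> else C * H * radial_weight r R \<rho> + A * (radial_weight r R \<rho> * \<rho>)) has_integral (C * H * (2 / r - 2 / R) + A * ln (R / r))) {0..R}"
    by (rule has_integral_spike_finite[OF \<open>finite S\<close> _ ub]) auto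
  let ?Z = "\<Sum>a\<in>X. if cmod a < R then real (n a) * (cmod a * radial_weight r R (cmod a)) * trig_poly d N (a / of_real (cmod a)) else 0"
  have "2 / r * M d N r - 2 / R * M d N R + ?Z \<le> C * H * (2 / r - 2 / R) + A * ln (R / r)"
  proof (rule has_integral_le[OF weighted_zero_sum[OF rR] ub'])
    fix \<rho> assume \<rho>: "\<rho> \<in> {0..R}"
    show "radial_weight r R \<rho> * M (curvature d) N \<rho> \<le> (if \<rho> \<in> S then radial_weight r R \<rho> * M (curvature d) N \<rho> else C * H * radial_weight r R \<rho> + A * (radial_weight r R \<rho> * \<rho>))"
    proof (cases "\<rho> \<in> S")
      case False
      then have "M (curvature d) N \<rho> \<le> C * H + A * \<rho>" using \<rho> by (intro Mc) (auto simp: S_def)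
      then have "radial_weight r R \<rho> * M (curvature d) N \<rho> \<le> radial_weight r R \<rho> * (C * H + A * \<rho>)"
        using \<rho> rR by (intro mult_left_mono radial_weight_nonneg) auto
      then show ?thesis using False by (simp add: algebra_simps)
    qed simp
  qed
  moreover have "2 / R * M d N R \<le> 2 / R * (H * (C + R * H))"
    using MR[of R] rR crit by (intro mult_left_mono) auto
  moreover have "2 / r * (- M d N r) \<le> 2 / r * (H * (C + r * H))"
    using Mr rR by (intro mult_left_mono) auto
  moreover have "2 / R * (H * (C + R * H)) = 2 * C * H / R + 2 * H\<^sup>2" "2 / r * (H * (C + r * H)) = 2 * C * H / r + 2 * H\<^sup>2"
    using rR by (simp_all add: power2_eq_square distrib_left)
  moreover have "C * H * (2 / r - 2 / R) = 2 * C * H / r - 2 * C * H / R" by (simp add: right_diff_distrib mult_ac)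
  moreover have "2 * C * H / r \<ge> 0" using C H rR by simp
  moreover have "6 * C * H / r = 3 * (2 * C * H / r)" by simp
  moreover have "2 / r * (- M d N r) = - (2 / r * M d N r)" by simp
  ultimately show ?thesis by linarith
qed

end

section \<open>Factoring the zeros out of an entire function\<close>

lemma entire_order_factor:
  fixes F :: "complex \<Rightarrow> complex"
  assumes F: "F holomorphic_on UNIV" and nz: "\<exists>z. F z \<noteq> 0"
  obtains k G where "G holomorphic_on UNIV" "G a \<noteq> 0" "\<And>z. F z = (z - a) ^ k * G z"
    "\<And>p. (\<And>q. q < p \<Longrightarrow> (deriv ^^ q) F a = 0) \<Longrightarrow> p \<le> k"
proof -
  have ex: "\<exists>q. (deriv ^^ q) F a \<noteq> 0"
    using holomorphic_fun_eq_0_on_connected[OF F, of a] nz by auto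
  define k where "k = (LEAST q. (deriv ^^ q) F a \<noteq> 0)"
  have dk: "(deriv ^^ k) F a \<noteq> 0" using LeastI_ex[OF ex] by (simp add: k_def)
  have dlt: "(deriv ^^ q) F a = 0" if "q < k" for q
    using not_less_Least[of q "\<lambda>q. (deriv ^^ q) F a \<noteq> 0"] that by (auto simp: k_def)
  have ple: "p \<le> k" if "\<And>q. q < p \<Longrightarrow> (deriv ^^ q) F a = 0" for p
    using that dk by (meson not_le)
  show thesis
  proof (cases "k = 0")
    case True
    show thesis
      by (rule that[of F k]) (use F dk ple True in auto)
  next
    case False
    have F0: "F a = 0" using dlt[of 0] False by simp
    obtain g r where g: "0 < r" "g holomorphic_on ball a r"
      "\<And>w. w \<in> ball a r \<Longrightarrow> F w - F a = (w - a) ^ k * g w" "\<And>w. w \<in> ball a r \<Longrightarrow> g w \<noteq> 0"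
      using holomorphic_factor_order_of_zero[OF F open_UNIV _ _ dk] dlt False by (metis UNIV_I neq0_conv)
    \<comment> \<open>The local factor near \<open>a\<close> and the quotient elsewhere agree on the
      overlap, so \<open>G\<close> is entire.\<close>
    define G where "G z = (if z \<in> ball a r then g z else F z / (z - a) ^ k)" for z
    have eq: "G z = F z / (z - a) ^ k" if "z \<noteq> a" for z
      using g(3)[of z] F0 that by (simp add: G_def)
    show thesis
    proof (rule that[of G k])
      have "G holomorphic_on ball a r"
        by (rule holomorphic_transform[OF g(2)]) (simp add: G_def)
      moreover have "G holomorphic_on (- {a})"
      proof (rule holomorphic_transform)
        show "(\<lambda>z. F z / (z - a) ^ k) holomorphic_on (- {a})"
          by (intro holomorphic_intros holomorphic_on_subset[OF F]) auto
      qed (simp add: eq)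
      moreover have "ball a r \<union> - {a} = UNIV" using g(1) by auto
      ultimately show "G holomorphic_on UNIV"
        using holomorphic_on_Un[of G "ball a r" "- {a}"] by auto
      show "G a \<noteq> 0" using g(1,4) by (simp add: G_def)
      show "F z = (z - a) ^ k * G z" for z
        using eq[of z] F0 False by (cases "z = a") auto
    qed (rule ple)
  qed
qed

lemma entire_tendsto:
  assumes "G holomorphic_on UNIV"
  shows "G \<midarrow>a\<rightarrow> G a"
  using holomorphic_on_imp_continuous_on[OF assms]
  by (simp add: continuous_on_eq_continuous_at isCont_def)

lemma vanishing_order_le:
  fixes F G :: "complex \<Rightarrow> complex"
  assumes G: "G holomorphic_on UNIV" "G a \<noteq> 0" and F: "\<And>z. F z = (z - a) ^ k * G z"
    and p: "\<And>q. q < p \<Longrightarrow> (deriv ^^ q) F a = 0"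
  shows "p \<le> k"
proof -
  have "F holomorphic_on UNIV" unfolding F[abs_def] by (intro holomorphic_intros G)
  moreover have "\<exists>z. F z \<noteq> 0"
  proof (rule ccontr)
    assume "\<not> ?thesis"
    then have "G z = 0" if "z \<noteq> a" for z using F that by auto
    then have "\<forall>\<^sub>F z in at a. G z = 0" by (auto simp: eventually_at intro: exI[of _ 1])
    then have "G \<midarrow>a\<rightarrow> 0" by (rule tendsto_eventually)
    moreover have "G \<midarrow>a\<rightarrow> G a"
      by (rule entire_tendsto[OF G(1)])
    ultimately show False using G(2) LIM_unique by blast
  qed
  ultimately obtain k' F1 where F1: "F1 holomorphic_on UNIV" "F1 a \<noteq> 0" "\<And>z. F z = (z - a) ^ k' * F1 z"
    and pk: "p \<le> k'"
    using entire_order_factor[of F a] p by metis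
  have "k' \<le> k"
  proof (rule ccontr)
    assume "\<not> k' \<le> k"
    then obtain j where j: "k' = k + Suc j" using less_imp_Suc_add by (metis add_Suc_right not_le)
    have "G z = (z - a) ^ Suc j * F1 z" if "z \<noteq> a" for z
      using F[of z] F1(3)[of z] that unfolding j power_add by (simp del: power_Suc)
    then have "\<forall>\<^sub>F z in at a. G z = (z - a) ^ Suc j * F1 z" by (auto simp: eventually_at intro: exI[of _ 1])
    moreover have "(\<lambda>z. (z - a) ^ Suc j * F1 z) \<midarrow>a\<rightarrow> (a - a) ^ Suc j * F1 a"
      by (intro tendsto_intros entire_tendsto[OF F1(1)])
    ultimately have "G \<midarrow>a\<rightarrow> 0" by (simp add: tendsto_cong)
    moreover have "G \<midarrow>a\<rightarrow> G a"
      by (rule entire_tendsto[OF G(1)])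
    ultimately show False using G(2) LIM_unique by blast
  qed
  with pk show ?thesis by simp
qed

lemma entire_factor_zeros:
  fixes F :: "complex \<Rightarrow> complex"
  assumes X: "finite X" and F: "F holomorphic_on UNIV" and nz: "\<exists>z. F z \<noteq> 0"
  shows "\<exists>h n. h holomorphic_on UNIV \<and> (\<forall>z. F z = (\<Prod>a\<in>X. (z - a) ^ n a) * h z) \<and> (\<forall>a\<in>X. h a \<noteq> 0)"
  using X
proof (induction X)
  case empty
  show ?case using F by (intro exI[of _ F]) auto
next
  case (insert a X)
  then obtain h n where h: "h holomorphic_on UNIV" "\<And>z. F z = (\<Prod>b\<in>X. (z - b) ^ n b) * h z" "\<And>b. b \<in> X \<Longrightarrow> h b \<noteq> 0"
    by blast
  have "\<exists>z. h z \<noteq> 0" using nz h(2) by auto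
  then obtain k G where G: "G holomorphic_on UNIV" "G a \<noteq> 0" "\<And>z. h z = (z - a) ^ k * G z"
    using entire_order_factor[OF h(1), of a] by metis
  have "(\<Prod>b\<in>X. (z - b) ^ (if b = a then k else n b)) = (\<Prod>b\<in>X. (z - b) ^ n b)" for z
    using insert.hyps by (intro prod.cong) auto
  then have "F z = (\<Prod>b\<in>insert a X. (z - b) ^ (if b = a then k else n b)) * G z" for z
    using insert.hyps by (simp add: h(2) G(3) mult_ac)
  moreover have "G b \<noteq> 0" if "b \<in> insert a X" for b
    using that G(2) G(3)[of b] h(3)[of b] by auto
  ultimately show ?case
    using G(1) by (intro exI[of _ G] exI[of _ "\<lambda>b. if b = a then k else n b"]) auto
qed

text \<open>On a disc the zero-free factor has a holomorphic logarithm. The last clause admits a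
  cofactor \<open>F1\<close> that does not vanish at \<open>a\<close>, because vanishing orders will
  be known for F = c0 z^m G and not directly for \<open>G\<close>.\<close>

lemma log_potential_entire:
  fixes G :: "complex \<Rightarrow> complex"
  assumes G: "G holomorphic_on UNIV" "G 0 = 1" and B: "B > 0"
  obtains X n c g where "log_potential X c g B" "X = {z \<in> cball 0 B. G z = 0}"
    "\<And>z. cmod z < B \<Longrightarrow> z \<notin> X \<Longrightarrow> log_potential.u X n g z = ln (cmod (G z))"
    "\<And>a p F1. a \<in> X \<Longrightarrow> F1 holomorphic_on UNIV \<Longrightarrow> F1 a \<noteq> 0 \<Longrightarrow>
       (\<And>q. q < p \<Longrightarrow> (deriv ^^ q) (\<lambda>z. F1 z * G z) a = 0) \<Longrightarrow> p \<le> n a"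
proof -
  define X where "X = {z \<in> cball 0 B. G z = 0}"
  have G0: "\<exists>z. G z \<noteq> 0" using G(2) by (metis zero_neq_one)
  have "\<not> G constant_on UNIV \<or> X = {}"
    using G(2) by (auto simp: constant_on_def X_def)
  then have finX: "finite X"
  proof
    assume nc: "\<not> G constant_on UNIV"
    have "finite {z \<in> cball 0 B. G z = 0}"
      using holomorphic_compact_finite_zeros[OF G(1) open_UNIV connected_UNIV compact_cball _ nc, of 0 B] by simp
    then show ?thesis by (simp add: X_def)
  qed simp
  have X0: "0 \<notin> X" using G by (simp add: X_def)
  obtain h n where h: "h holomorphic_on UNIV" "\<And>z. G z = (\<Prod>a\<in>X. (z - a) ^ n a) * h z" "\<And>a. a \<in> X \<Longrightarrow> h a \<noteq> 0"
    using entire_factor_zeros[OF finX G(1) G0] by blast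
  have hnz: "h z \<noteq> 0" if "z \<in> cball 0 B" for z
    using h(2)[of z] h(3)[of z] that by (cases "z \<in> X") (auto simp: X_def)
  have h0: "h 0 \<noteq> 0" using hnz[of 0] B by simp
  have "(\<lambda>z. h z / h 0) holomorphic_on ball 0 B"
    by (intro holomorphic_intros holomorphic_on_subset[OF h(1)]) (use h0 in auto)
  moreover have "contractible (ball (0::complex) B)"
    by (intro convex_imp_contractible convex_ball)
  moreover have "h z / h 0 \<noteq> 0" if "z \<in> ball 0 B" for z
    using hnz[of z] that h0 by auto
  ultimately obtain g0 where g0: "g0 holomorphic_on ball 0 B" "\<And>z. z \<in> ball 0 B \<Longrightarrow> h z / h 0 = exp (g0 z)"
    using contractible_imp_holomorphic_log[of "\<lambda>z. h z / h 0" "ball 0 B"] by metis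
  \<comment> \<open>Subtracting the constant selects the logarithm with g(0) = 0, as
    \<open>c 0 = 0\<close> demands.\<close>
  define g where "g z = g0 z - g0 0" for z
  have "exp (g0 0) = 1" using g0(2)[of 0] B h0 by simp
  then have ge: "h z / h 0 = exp (g z)" if "z \<in> ball 0 B" for z
    using g0(2)[OF that] by (simp add: g_def exp_diff)
  have gh: "g holomorphic_on ball 0 B" unfolding g_def by (intro holomorphic_intros g0)
  define c where "c k = (deriv ^^ k) g 0 / fact k" for k
  interpret log_potential X n c g B
  proof
    show "(\<lambda>k. c k * z ^ k) sums g z" if "cmod z < B" for z
      using holomorphic_power_series[OF gh, of z] that by (simp add: c_def)
    show "c 0 = 0" by (simp add: c_def g_def)
  qed (use finX X0 B in auto)
  have "G 0 = (\<Prod>a\<in>X. (- a) ^ n a) * h 0" by (simp add: h(2))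
  then have P0: "(\<Prod>a\<in>X. (- a) ^ n a) * h 0 = 1" using G(2) by simp
  have Geq: "G z = (\<Prod>a\<in>X. (1 - z / a) ^ n a) * exp (g z)" if "cmod z < B" for z
  proof -
    have "(\<Prod>a\<in>X. (z - a) ^ n a) = (\<Prod>a\<in>X. (- a) ^ n a * (1 - z / a) ^ n a)"
    proof (intro prod.cong refl)
      fix a assume "a \<in> X"
      then have "z - a = - a * (1 - z / a)" using X0 by (auto simp: right_diff_distrib)
      then show "(z - a) ^ n a = (- a) ^ n a * (1 - z / a) ^ n a" by (metis power_mult_distrib)
    qed
    then have "G z = (\<Prod>a\<in>X. (- a) ^ n a) * (\<Prod>a\<in>X. (1 - z / a) ^ n a) * (h 0 * exp (g z))"
      using h(2)[of z] ge[of z] that h0 by (simp add: prod.distrib field_simps)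
    also have "\<dots> = ((\<Prod>a\<in>X. (- a) ^ n a) * h 0) * ((\<Prod>a\<in>X. (1 - z / a) ^ n a) * exp (g z))"
      by (simp add: mult_ac)
    finally show ?thesis unfolding P0 by simp
  qed
  show thesis
  proof (rule that[of X c g n])
    show "log_potential X c g B" by (rule log_potential_axioms)
    show "u z = ln (cmod (G z))" if z: "cmod z < B" "z \<notin> X" for z
    proof -
      have nz: "cmod (1 - z / a) \<noteq> 0" if "a \<in> X" for a
        using that z(2) X0 by auto
      have "cmod (G z) = (\<Prod>a\<in>X. cmod (1 - z / a) ^ n a) * exp (Re (g z))"
        unfolding Geq[OF z(1)] by (simp add: norm_mult norm_exp_eq_Re prod_norm[symmetric] norm_power)
      moreover have "(\<Prod>a\<in>X. cmod (1 - z / a) ^ n a) > 0"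
        using nz by (intro prod_pos) auto
      ultimately have "ln (cmod (G z)) = ln (\<Prod>a\<in>X. cmod (1 - z / a) ^ n a) + Re (g z)"
        by (simp add: ln_mult_pos)
      also have "ln (\<Prod>a\<in>X. cmod (1 - z / a) ^ n a) = (\<Sum>a\<in>X. ln (cmod (1 - z / a) ^ n a))"
        using nz finX by (intro ln_prod) auto
      also have "\<dots> = (\<Sum>a\<in>X. real (n a) * ln (cmod (1 - z / a)))"
        by (intro sum.cong refl ln_realpow)
      finally show ?thesis by (simp add: u_def)
    qed
    fix a p and F1 :: "complex \<Rightarrow> complex"
    assume a: "a \<in> X" and F1: "F1 holomorphic_on UNIV" "F1 a \<noteq> 0"
      and p: "\<And>q. q < p \<Longrightarrow> (deriv ^^ q) (\<lambda>z. F1 z * G z) a = 0"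
    show "p \<le> n a"
    proof (rule vanishing_order_le[OF _ _ _ p])
      show "(\<lambda>z. F1 z * ((\<Prod>b\<in>X - {a}. (z - b) ^ n b) * h z)) holomorphic_on UNIV"
        by (intro holomorphic_intros F1 h)
      show "F1 a * ((\<Prod>b\<in>X - {a}. (a - b) ^ n b) * h a) \<noteq> 0"
        using F1 h(3)[OF a] finX by (auto simp: prod_zero_iff)
      show "F1 z * G z = (z - a) ^ n a * (F1 z * ((\<Prod>b\<in>X - {a}. (z - b) ^ n b) * h z))" for z
        unfolding h(2)[of z] prod.remove[OF finX a] by (simp add: mult_ac)
    qed
  qed (rule X_def)
qed

section \<open>Smoothing of support functions\<close>

lemma unit_e_add: "unit_e (s + t) = unit_e s * unit_e t"
  by (simp add: unit_e_def ring_distribs exp_add)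

lemma unit_e_of_int: "unit_e (of_int n) = 1"
  unfolding unit_e_def exp_eq_1 by (intro conjI exI[of _ n]) simp_all

lemma unit_e_surj:
  assumes "cmod \<zeta> = 1"
  obtains t where "0 \<le> t" "t < 1" "\<zeta> = unit_e t"
proof -
  obtain x where x: "0 \<le> x" "x < 2 * pi" "\<zeta> = exp (\<i> * of_real x)"
    using complex_unimodular_polar[OF assms] by (metis cis_conv_exp cis.ctr)
  show thesis
  proof (rule that[of "x / (2 * pi)"])
    show "\<zeta> = unit_e (x / (2 * pi))" unfolding x(3) by (simp add: unit_e_def)
  qed (use x in auto)
qed

lemma Re_unit_e: "Re (unit_e t) = cos (2 * pi * t)" "Im (unit_e t) = sin (2 * pi * t)"
  by (simp_all add: unit_e_def Re_exp Im_exp)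

lemma integral_circle_rotate:
  fixes f :: "complex \<Rightarrow> real"
  assumes f: "continuous_on UNIV f" and \<zeta>: "cmod \<zeta> = 1"
  shows "integral {0..1} (\<lambda>s. f (\<zeta> * unit_e s)) = integral {0..1} (\<lambda>s. f (unit_e s))"
proof -
  obtain t where t: "0 \<le> t" "t < 1" "\<zeta> = unit_e t" using unit_e_surj[OF \<zeta>] .
  define g where "g s = f (unit_e s)" for s
  have cg: "continuous_on A g" for A
    unfolding g_def by (intro continuous_on_compose2[OF f] continuous_intros) auto
  have int: "g integrable_on {a..b}" for a b
    by (intro integrable_continuous_interval cg)
  have per: "g (s + 1) = g s" for s
    using unit_e_of_int[of 1] by (simp add: g_def unit_e_add)
  have "integral {0..1} (\<lambda>s. f (\<zeta> * unit_e s)) = integral {0..1} (g \<circ> (\<lambda>s. s + t))"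
    unfolding t(3) by (simp add: g_def o_def unit_e_add mult.commute)
  also have "\<dots> = integral {0 + t..1 + t} g"
    by (rule integral_shift) (rule cg)
  also have "\<dots> = integral {t..1} g + integral {1..1 + t} g"
    using t int by (subst Henstock_Kurzweil_Integration.integral_combine[symmetric, of _ 1]) auto
  also have "integral {1..1 + t} g = integral {0 + 1..t + 1} g" by (simp add: add.commute)
  also have "\<dots> = integral {0..t} (g \<circ> (\<lambda>s. s + 1))"
    by (rule integral_shift[symmetric]) (rule cg)
  also have "g \<circ> (\<lambda>s. s + 1) = g" using per by auto
  also have "integral {t..1} g + integral {0..t} g = integral {0..1} g"
    using t int Henstock_Kurzweil_Integration.integral_combine[of 0 t 1 g] by auto
  finally show ?thesis by (simp add: g_def[abs_def])
qed

text \<open>Induction through 2 Re \<eta> Re(\<eta>^k) = Re(\<eta>^(k+1)) + Re(\<eta>^(k-1)) on the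
  unit circle. It makes convolution with the cosine kernel produce trigonometric
  polynomials.\<close>

lemma cosine_power_expansion:
  "\<exists>q::nat \<Rightarrow> real. \<forall>\<eta>. cmod \<eta> = 1 \<longrightarrow> (1 + Re \<eta>) ^ n = (\<Sum>k\<le>n. q k * Re (\<eta> ^ k))"
proof (induction n)
  case 0
  show ?case by (intro exI[of _ "\<lambda>k. 1"]) simp
next
  case (Suc n)
  then obtain q where q: "\<And>\<eta>. cmod \<eta> = 1 \<Longrightarrow> (1 + Re \<eta>) ^ n = (\<Sum>k\<le>n. q k * Re (\<eta> ^ k))" by blast
  define good where "good f \<longleftrightarrow> (\<exists>q::nat \<Rightarrow> real. \<forall>\<eta>. cmod \<eta> = 1 \<longrightarrow> f \<eta> = (\<Sum>k\<le>Suc n. q k * Re (\<eta> ^ k)))" for f :: "complex \<Rightarrow> real"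
  have good_add: "good (\<lambda>\<eta>. f \<eta> + g \<eta>)" if "good f" "good g" for f g
  proof -
    from that obtain q1 q2 where "\<forall>\<eta>. cmod \<eta> = 1 \<longrightarrow> f \<eta> = (\<Sum>k\<le>Suc n. q1 k * Re (\<eta> ^ k))"
      "\<forall>\<eta>. cmod \<eta> = 1 \<longrightarrow> g \<eta> = (\<Sum>k\<le>Suc n. q2 k * Re (\<eta> ^ k))" unfolding good_def by blast
    then show ?thesis unfolding good_def
      by (intro exI[of _ "\<lambda>k. q1 k + q2 k"]) (simp add: sum.distrib distrib_right)
  qed
  have good_mult: "good (\<lambda>\<eta>. c * f \<eta>)" if "good f" for f c
  proof -
    from that obtain q1 where "\<forall>\<eta>. cmod \<eta> = 1 \<longrightarrow> f \<eta> = (\<Sum>k\<le>Suc n. q1 k * Re (\<eta> ^ k))" unfolding good_def by blast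
    then show ?thesis unfolding good_def
      by (intro exI[of _ "\<lambda>k. c * q1 k"]) (simp add: sum_distrib_left distrib_left mult.assoc)
  qed
  have good_mono: "good (\<lambda>\<eta>. Re (\<eta> ^ k))" if "k \<le> Suc n" for k
    unfolding good_def
  proof (intro exI[of _ "\<lambda>j. if j = k then 1 else 0"] allI impI)
    fix \<eta> :: complex
    have "(\<Sum>j\<le>Suc n. (if j = k then 1 else 0) * Re (\<eta> ^ j)) = (\<Sum>j\<le>Suc n. if j = k then Re (\<eta> ^ k) else 0)"
      by (intro sum.cong) auto
    also have "\<dots> = Re (\<eta> ^ k)" using that by (subst sum.delta) auto
    finally show "Re (\<eta> ^ k) = (\<Sum>j\<le>Suc n. (if j = k then 1 else 0) * Re (\<eta> ^ j))" ..
  qed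
  have good_zero: "good (\<lambda>\<eta>. 0)" using good_mult[OF good_mono[of 0], of 0] by simp
  have good_sum: "good (\<lambda>\<eta>. \<Sum>k\<in>A. f k \<eta>)" if "\<And>k. k \<in> A \<Longrightarrow> good (f k)" "finite A" for A :: "nat set" and f
    using that(2,1)
  proof (induction A)
    case empty
    then show ?case using good_zero by simp
  next
    case (insert x A)
    then show ?case using good_add[of "f x" "\<lambda>\<eta>. \<Sum>k\<in>A. f k \<eta>"] by simp
  qed
  have good_cong: "good g" if "good f" "\<And>\<eta>. cmod \<eta> = 1 \<Longrightarrow> f \<eta> = g \<eta>" for f g
  proof -
    from that(1) obtain q1 where "\<forall>\<eta>. cmod \<eta> = 1 \<longrightarrow> f \<eta> = (\<Sum>k\<le>Suc n. q1 k * Re (\<eta> ^ k))" unfolding good_def by blast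
    with that(2) have "\<forall>\<eta>. cmod \<eta> = 1 \<longrightarrow> g \<eta> = (\<Sum>k\<le>Suc n. q1 k * Re (\<eta> ^ k))" by metis
    then show ?thesis unfolding good_def by (intro exI[of _ q1])
  qed
  have step: "good (\<lambda>\<eta>. Re \<eta> * Re (\<eta> ^ k))" if k: "k \<le> n" for k
  proof (cases k)
    case 0
    then show ?thesis using good_mono[of 1] by simp
  next
    case (Suc j)
    have "good (\<lambda>\<eta>. 1 / 2 * (Re (\<eta> ^ Suc k) + Re (\<eta> ^ j)))"
      using k Suc by (intro good_mult good_add good_mono) auto
    moreover have "1 / 2 * (Re (\<eta> ^ Suc k) + Re (\<eta> ^ j)) = Re \<eta> * Re (\<eta> ^ k)" if \<eta>: "cmod \<eta> = 1" for \<eta>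
    proof -
      have "cnj \<eta> * \<eta> = 1" using complex_norm_square[of \<eta>] \<eta> by (simp add: mult.commute)
      then have "\<eta> ^ j = cnj \<eta> * \<eta> ^ k" unfolding Suc by (simp flip: mult.assoc)
      then have "\<eta> ^ Suc k + \<eta> ^ j = (\<eta> + cnj \<eta>) * \<eta> ^ k" by (simp add: distrib_right)
      also have "\<dots> = of_real (2 * Re \<eta>) * \<eta> ^ k" by (simp add: complex_add_cnj)
      finally have "Re (\<eta> ^ Suc k + \<eta> ^ j) = 2 * Re \<eta> * Re (\<eta> ^ k)" by (simp only: Re_of_real_mult)
      then show ?thesis by simp
    qed
    ultimately show ?thesis by (rule good_cong)
  qed
  have "good (\<lambda>\<eta>. (\<Sum>k\<le>n. q k * Re (\<eta> ^ k)) + (\<Sum>k\<le>n. q k * (Re \<eta> * Re (\<eta> ^ k))))"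
    by (intro good_add good_sum good_mult step good_mono) auto
  then have "good (\<lambda>\<eta>. (1 + Re \<eta>) ^ Suc n)"
  proof (rule good_cong)
    fix \<eta> :: complex assume "cmod \<eta> = 1"
    note q1 = q[OF this]
    have "(\<Sum>k\<le>n. q k * (Re \<eta> * Re (\<eta> ^ k))) = Re \<eta> * (\<Sum>k\<le>n. q k * Re (\<eta> ^ k))"
      unfolding sum_distrib_left by (intro sum.cong) auto
    then show "(\<Sum>k\<le>n. q k * Re (\<eta> ^ k)) + (\<Sum>k\<le>n. q k * (Re \<eta> * Re (\<eta> ^ k))) = (1 + Re \<eta>) ^ Suc n"
      unfolding q1[symmetric] by (simp add: distrib_right)
  qed
  then show ?case unfolding good_def .
qed

text \<open>The unnormalised de la Vallee-Poussin kernel. The moment of 1 - cos, which measures the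
  concentration at s = 0, is exact because the derivative of sin(2 pi s) (1 + cos(2 pi s))^n / (2
  pi) integrates to 0 over a period. Bernoulli's inequality bounds the mass from below.\<close>

lemma cosine_kernel:
  defines "V n s \<equiv> (1 + Re (unit_e s)) ^ n"
  shows "V n integrable_on {0..1}" "integral {0..1} (V n) \<ge> 1"
    "((\<lambda>s. (1 - Re (unit_e s)) * V n s) has_integral (integral {0..1} (V n) / (real n + 1))) {0..1}"
proof -
  have cR: "continuous_on A (\<lambda>s. Re (unit_e s))" for A
    by (intro continuous_intros)
  show int: "V n integrable_on {0..1}" for n
    unfolding V_def by (intro integrable_continuous_interval continuous_intros cR)
  have mean0: "((\<lambda>s. Re (unit_e s)) has_integral 0) {0..1}"
    using has_integral_Re[OF unit_e_power_integral(1)[of 1]] by simp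
  have "((\<lambda>s. 1 + real n * Re (unit_e s)) has_integral (1 * (1 - 0) + real n * 0)) {0..1}"
    using has_integral_const_real[of "1::real" 0 1]
    by (intro has_integral_add has_integral_mult_right mean0) simp
  moreover have "1 + real n * Re (unit_e s) \<le> V n s" for s
    unfolding V_def using Bernoulli_inequality[of "Re (unit_e s)" n] abs_Re_le_cmod[of "unit_e s"] by (simp add: mult.commute)
  ultimately show "integral {0..1} (V n) \<ge> 1"
    using has_integral_le[OF _ integrable_integral[OF int[of n]]] by fastforce
  define F where "F s = Im (unit_e s) * V n s / (2 * pi)" for s
  have "((\<lambda>s. V n s * (1 - (real n + 1) * (1 - Re (unit_e s)))) has_integral (F 1 - F 0)) {0..1}"
  proof (rule fundamental_theorem_of_calculus)
    fix s :: real
    have sq: "(sin (2 * pi * s))\<^sup>2 = (1 - cos (2 * pi * s)) * (1 + cos (2 * pi * s))"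
      using sin_squared_eq[of "2 * pi * s"] by (simp add: power2_eq_square algebra_simps)
    have "(F has_real_derivative (cos (2 * pi * s) * (1 + cos (2 * pi * s)) ^ n - real n * (1 + cos (2 * pi * s)) ^ (n - 1) * (sin (2 * pi * s))\<^sup>2)) (at s within {0..1})"
      unfolding F_def V_def Re_unit_e
      by (auto intro!: derivative_eq_intros simp: power2_eq_square field_simps)
    moreover have "real n * (1 + cos (2 * pi * s)) ^ (n - 1) * (sin (2 * pi * s))\<^sup>2 = real n * (1 - cos (2 * pi * s)) * (1 + cos (2 * pi * s)) ^ n"
      unfolding sq by (cases n) (simp_all add: mult_ac)
    moreover have "c * P - real n * (1 - c) * P = P * (1 - (real n + 1) * (1 - c))" for c P :: real
      by (simp add: algebra_simps)
    ultimately show "(F has_vector_derivative V n s * (1 - (real n + 1) * (1 - Re (unit_e s)))) (at s within {0..1})"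
      unfolding has_real_derivative_iff_has_vector_derivative[symmetric] V_def Re_unit_e
      by (simp only:)
  qed simp
  moreover have "F 1 = F 0" by (simp add: F_def Re_unit_e)
  ultimately have "((\<lambda>s. V n s * (1 - (real n + 1) * (1 - Re (unit_e s)))) has_integral 0) {0..1}" by simp
  from has_integral_diff[OF integrable_integral[OF int[of n]] this]
  have "((\<lambda>s. V n s - V n s * (1 - (real n + 1) * (1 - Re (unit_e s)))) has_integral integral {0..1} (V n)) {0..1}" by simp
  from has_integral_mult_right[OF this, of "1 / (real n + 1)"]
  have "((\<lambda>s. 1 / (real n + 1) * (V n s - V n s * (1 - (real n + 1) * (1 - Re (unit_e s))))) has_integral integral {0..1} (V n) / (real n + 1)) {0..1}" by simp
  moreover have "1 / (real n + 1) * (V n s - V n s * (1 - (real n + 1) * (1 - Re (unit_e s)))) = (1 - Re (unit_e s)) * V n s" for s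
  proof -
    have "V n s - V n s * (1 - (real n + 1) * (1 - Re (unit_e s))) = (real n + 1) * ((1 - Re (unit_e s)) * V n s)"
      by (simp add: algebra_simps)
    then show ?thesis by simp
  qed
  ultimately show "((\<lambda>s. (1 - Re (unit_e s)) * V n s) has_integral (integral {0..1} (V n) / (real n + 1))) {0..1}" by simp
qed

text \<open>
  For a trigonometric polynomial, \<open>h(\<theta> + \<delta>) + h(\<theta> - \<delta>) - 2 cos \<delta> h(\<theta>)\<close> is asymptotic to \<open>\<delta>\<^sup>2 (h + h'')(\<theta>)\<close>.
\<close>

lemma curvature_nonneg:
  assumes conv: "\<And>\<delta>. \<bar>\<delta>\<bar> < 1 \<Longrightarrow> 2 * cos \<delta> * trig_poly d N \<zeta> \<le> trig_poly d N (\<zeta> * cis \<delta>) + trig_poly d N (\<zeta> * cis (- \<delta>))"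
  shows "0 \<le> trig_poly (curvature d) N \<zeta>"
proof -
  define q where "q k \<delta> = 4 * ((sin (\<delta> / 2) / \<delta>)\<^sup>2 - (sin (real k * \<delta> / 2) / \<delta>)\<^sup>2)" for k \<delta>
  have qlim: "((q k) \<longlongrightarrow> 1 - (real k)\<^sup>2) (at 0)" for k
  proof -
    have s: "((\<lambda>\<delta>. sin (c * \<delta>) / \<delta>) \<longlongrightarrow> c) (at 0)" for c :: real
    proof -
      have "((\<lambda>\<delta>. sin (c * \<delta>)) has_real_derivative c) (at 0)"
        by (auto intro!: derivative_eq_intros)
      then show ?thesis by (simp add: has_field_derivative_iff)
    qed
    have "((\<lambda>\<delta>. 4 * ((sin (1 / 2 * \<delta>) / \<delta>)\<^sup>2 - (sin (real k / 2 * \<delta>) / \<delta>)\<^sup>2)) \<longlongrightarrow> 4 * ((1 / 2)\<^sup>2 - (real k / 2)\<^sup>2)) (at 0)"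
      by (intro tendsto_intros s)
    then show ?thesis by (simp add: q_def[abs_def] power_divide)
  qed
  have eq: "trig_poly d N (\<zeta> * cis \<delta>) + trig_poly d N (\<zeta> * cis (- \<delta>)) - 2 * cos \<delta> * trig_poly d N \<zeta>
     = \<delta>\<^sup>2 * (\<Sum>k\<le>N. q k \<delta> * Re (d k * \<zeta> ^ k))" if "\<delta> \<noteq> 0" for \<delta>
  proof -
    have c: "2 * cos (real k * \<delta>) - 2 * cos \<delta> = \<delta>\<^sup>2 * q k \<delta>" for k
    proof -
      have "cos x = 1 - 2 * (sin (x / 2))\<^sup>2" for x :: real
        using cos_double_sin[of "x / 2"] by simp
      from this[of "real k * \<delta>"] this[of \<delta>] show ?thesis
        using that by (simp add: q_def power_divide right_diff_distrib)
    qed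
    have "Re (d k * (\<zeta> * cis \<delta>) ^ k) + Re (d k * (\<zeta> * cis (- \<delta>)) ^ k) - 2 * cos \<delta> * Re (d k * \<zeta> ^ k)
        = \<delta>\<^sup>2 * (q k \<delta> * Re (d k * \<zeta> ^ k))" for k
    proof -
      have "d k * (\<zeta> * cis \<delta>) ^ k + d k * (\<zeta> * cis (- \<delta>)) ^ k = of_real (2 * cos (real k * \<delta>)) * (d k * \<zeta> ^ k)"
      proof -
        have "cis (real k * \<delta>) + cis (- (real k * \<delta>)) = of_real (2 * cos (real k * \<delta>))"
          by (simp add: complex_eq_iff)
        then have "d k * \<zeta> ^ k * (cis (real k * \<delta>) + cis (- (real k * \<delta>))) = d k * \<zeta> ^ k * of_real (2 * cos (real k * \<delta>))" by simp
        then show ?thesis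
          by (simp add: power_mult_distrib Complex.DeMoivre distrib_left mult_ac)
      qed
      then have "Re (d k * (\<zeta> * cis \<delta>) ^ k) + Re (d k * (\<zeta> * cis (- \<delta>)) ^ k) = 2 * cos (real k * \<delta>) * Re (d k * \<zeta> ^ k)"
        by (metis Re_of_real_mult plus_complex.sel(1))
      then have "Re (d k * (\<zeta> * cis \<delta>) ^ k) + Re (d k * (\<zeta> * cis (- \<delta>)) ^ k) - 2 * cos \<delta> * Re (d k * \<zeta> ^ k)
         = (2 * cos (real k * \<delta>) - 2 * cos \<delta>) * Re (d k * \<zeta> ^ k)" by (simp only: left_diff_distrib)
      then show ?thesis unfolding c by (simp only: mult.assoc)
    qed
    then have "(\<Sum>k\<le>N. Re (d k * (\<zeta> * cis \<delta>) ^ k) + Re (d k * (\<zeta> * cis (- \<delta>)) ^ k) - 2 * cos \<delta> * Re (d k * \<zeta> ^ k))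
       = (\<Sum>k\<le>N. \<delta>\<^sup>2 * (q k \<delta> * Re (d k * \<zeta> ^ k)))" by (simp only:)
    then show ?thesis
      unfolding trig_poly_def Re_sum by (simp only: sum.distrib sum_subtractf sum_distrib_left)
  qed
  have "((\<lambda>\<delta>. \<Sum>k\<le>N. q k \<delta> * Re (d k * \<zeta> ^ k)) \<longlongrightarrow> (\<Sum>k\<le>N. (1 - (real k)\<^sup>2) * Re (d k * \<zeta> ^ k))) (at 0)"
    by (intro tendsto_intros qlim)
  moreover have "\<forall>\<^sub>F \<delta> in at 0. 0 \<le> (\<Sum>k\<le>N. q k \<delta> * Re (d k * \<zeta> ^ k))"
  proof -
    have "0 \<le> (\<Sum>k\<le>N. q k \<delta> * Re (d k * \<zeta> ^ k))" if "\<delta> \<noteq> 0" "\<bar>\<delta>\<bar> < 1" for \<delta>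
    proof -
      have "0 \<le> \<delta>\<^sup>2 * (\<Sum>k\<le>N. q k \<delta> * Re (d k * \<zeta> ^ k))"
        using eq[OF that(1)] conv[OF that(2)] by linarith
      then show ?thesis using that(1) by (simp add: zero_le_mult_iff)
    qed
    then show ?thesis by (auto simp: eventually_at intro!: exI[of _ 1])
  qed
  ultimately have "0 \<le> (\<Sum>k\<le>N. (1 - (real k)\<^sup>2) * Re (d k * \<zeta> ^ k))"
    by (rule tendsto_lowerbound) simp
  also have "\<dots> = trig_poly (curvature d) N \<zeta>"
    unfolding trig_poly_def Re_sum curvature_def mult.assoc Re_of_real_mult ..
  finally show ?thesis .
qed

text \<open>The properties of a support function regarded as a function on the plane. Subadditivity
  with homogeneity carries the convexity that h + h'' \<ge> 0 expresses for smooth h.\<close>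

locale plane_sublinear =
  fixes H :: "complex \<Rightarrow> real" and L :: real
  assumes sub: "\<And>z w. H (z + w) \<le> H z + H w"
    and hom: "\<And>r z. 0 \<le> r \<Longrightarrow> H (of_real r * z) = r * H z"
    and bound: "\<And>z. \<bar>H z\<bar> \<le> L * cmod z"
    and nonneg: "\<And>z. 0 \<le> H z"
begin

lemma lipschitz: "\<bar>H z - H w\<bar> \<le> L * cmod (z - w)"
proof -
  have "H z \<le> H w + H (z - w)" using sub[of w "z - w"] by simp
  moreover have "H w \<le> H z + H (w - z)" using sub[of z "w - z"] by simp
  ultimately show ?thesis
    using bound[of "z - w"] bound[of "w - z"] by (simp add: norm_minus_commute)
qed

lemma L_nonneg: "L \<ge> 0"
  using bound[of 1] by simp

lemma cont: "continuous_on A H"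
proof -
  have "L-lipschitz_on A H"
    using lipschitz L_nonneg by (intro lipschitz_onI) (auto simp: dist_norm)
  then show ?thesis by (rule lipschitz_on_continuous_on)
qed

definition kernel_mass :: "nat \<Rightarrow> real" where
  "kernel_mass n = integral {0..1} (\<lambda>s. (1 + Re (unit_e s)) ^ n)"

text \<open>Convolution on the circle with a nonnegative kernel: averaging rotated copies of
  \<open>H\<close> preserves the convexity inequality, and the kernel makes the result a
  trigonometric polynomial.\<close>

definition smooth :: "nat \<Rightarrow> complex \<Rightarrow> real" where
  "smooth n z = integral {0..1} (\<lambda>s. H (z * unit_e s) * (1 + Re (unit_e s)) ^ n) / kernel_mass n"

lemma kernel_mass_pos: "kernel_mass n \<ge> 1"
  using cosine_kernel(2)[of n] by (simp add: kernel_mass_def)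

lemma kernel_nonneg: "0 \<le> (1 + Re (unit_e s)) ^ n"
  using abs_Re_le_cmod[of "unit_e s"] by (intro zero_le_power) simp

lemma smooth_integrable: "(\<lambda>s. H (z * unit_e s) * (1 + Re (unit_e s)) ^ n) integrable_on {0..1}"
  by (intro integrable_continuous_interval continuous_intros continuous_on_compose2[OF cont[of UNIV]]) auto

lemma smooth_trig_poly: "\<exists>d. \<forall>\<zeta>. cmod \<zeta> = 1 \<longrightarrow> smooth n \<zeta> = trig_poly d n \<zeta>"
proof -
  obtain q where q: "\<And>\<eta>. cmod \<eta> = 1 \<Longrightarrow> (1 + Re \<eta>) ^ n = (\<Sum>k\<le>n. q k * Re (\<eta> ^ k))"
    using cosine_power_expansion[of n] by blast
  define b where "b k = integral {0..1} (\<lambda>s. of_real (H (unit_e s)) * cnj (unit_e s) ^ k)" for k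
  have bint: "((\<lambda>s. of_real (H (unit_e s)) * cnj (unit_e s) ^ k) has_integral b k) {0..1}" for k
    unfolding b_def
    by (intro integrable_integral integrable_continuous_interval continuous_intros continuous_on_compose2[OF cont[of UNIV]]) auto
  have "smooth n \<zeta> = trig_poly (\<lambda>k. of_real (q k / kernel_mass n) * b k) n \<zeta>" if \<zeta>: "cmod \<zeta> = 1" for \<zeta>
  proof -
    have cz: "cnj \<zeta> * \<zeta> = 1" using complex_norm_square[of \<zeta>] \<zeta> by (simp add: mult.commute)
    \<comment> \<open>Rotating the circle by \<zeta> moves the dependence on \<zeta> from
      \<open>H\<close> into the kernel, where \<open>cosine_power_expansion\<close> separates it
      from the integration variable.\<close>
    define f where "f w = H w * (1 + Re (\<zeta> * cnj w)) ^ n" for w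
    have cf: "continuous_on UNIV f"
      unfolding f_def by (intro continuous_intros cont)
    have "f (\<zeta> * unit_e s) = H (\<zeta> * unit_e s) * (1 + Re (unit_e s)) ^ n" for s
    proof -
      have "\<zeta> * cnj (\<zeta> * unit_e s) = (cnj \<zeta> * \<zeta>) * cnj (unit_e s)" by (simp add: mult_ac)
      then have "Re (\<zeta> * cnj (\<zeta> * unit_e s)) = Re (unit_e s)" by (simp only: cz mult_1_left cnj.sel)
      then show ?thesis unfolding f_def by (simp only:)
    qed
    then have "integral {0..1} (\<lambda>s. H (\<zeta> * unit_e s) * (1 + Re (unit_e s)) ^ n) = integral {0..1} (\<lambda>s. f (unit_e s))"
      using integral_circle_rotate[OF cf \<zeta>] by simp
    also have "\<dots> = (\<Sum>k\<le>n. q k * Re (\<zeta> ^ k * b k))"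
    proof (rule integral_unique)
      have "((\<lambda>s. \<Sum>k\<le>n. q k * Re (\<zeta> ^ k * (of_real (H (unit_e s)) * cnj (unit_e s) ^ k))) has_integral (\<Sum>k\<le>n. q k * Re (\<zeta> ^ k * b k))) {0..1}"
        by (intro has_integral_sum has_integral_mult_right has_integral_Re bint) auto
      moreover have "(\<Sum>k\<le>n. q k * Re (\<zeta> ^ k * (of_real (H (unit_e s)) * cnj (unit_e s) ^ k))) = f (unit_e s)" for s
      proof -
        have "f (unit_e s) = H (unit_e s) * (\<Sum>k\<le>n. q k * Re ((\<zeta> * cnj (unit_e s)) ^ k))"
          unfolding f_def using \<zeta> by (subst q) (simp_all add: norm_mult)
        moreover have "\<zeta> ^ k * (of_real (H (unit_e s)) * cnj (unit_e s) ^ k) = of_real (H (unit_e s)) * (\<zeta> * cnj (unit_e s)) ^ k" for k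
          by (simp add: power_mult_distrib mult_ac)
        ultimately show ?thesis
          by (simp only: Re_of_real_mult sum_distrib_left mult.left_commute)
      qed
      ultimately show "((\<lambda>s. f (unit_e s)) has_integral (\<Sum>k\<le>n. q k * Re (\<zeta> ^ k * b k))) {0..1}" by simp
    qed
    finally have "smooth n \<zeta> = (\<Sum>k\<le>n. q k * Re (\<zeta> ^ k * b k)) / kernel_mass n"
      by (simp add: smooth_def)
    also have "\<dots> = (\<Sum>k\<le>n. Re (of_real (q k / kernel_mass n) * b k * \<zeta> ^ k))"
      unfolding sum_divide_distrib
    proof (intro sum.cong refl)
      fix k
      have "of_real (q k / kernel_mass n) * b k * \<zeta> ^ k = of_real (q k / kernel_mass n) * (\<zeta> ^ k * b k)" by simp
      then show "q k * Re (\<zeta> ^ k * b k) / kernel_mass n = Re (of_real (q k / kernel_mass n) * b k * \<zeta> ^ k)"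
        by (simp only: Re_of_real_mult) simp
    qed
    finally show ?thesis by (simp only: trig_poly_def Re_sum)
  qed
  then show ?thesis by blast
qed

text \<open>Subadditivity and homogeneity applied to z e^(i\<delta>) + z e^(-i\<delta>) = 2
  cos(\<delta>) z, averaged over rotations. The range of \<delta> keeps cos \<delta> nonnegative, as
  homogeneity requires.\<close>

lemma smooth_convex:
  assumes "\<bar>\<delta>\<bar> < 1"
  shows "2 * cos \<delta> * smooth n z \<le> smooth n (z * cis \<delta>) + smooth n (z * cis (- \<delta>))"
proof -
  have c: "0 \<le> 2 * cos \<delta>" using assms pi_gt3 by (auto intro!: cos_ge_zero)
  have "(\<lambda>s. 2 * cos \<delta> * (H (z * unit_e s) * (1 + Re (unit_e s)) ^ n)) integrable_on {0..1}"
    by (intro integrable_on_mult_right smooth_integrable)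
  moreover have "2 * cos \<delta> * (H (z * unit_e s) * (1 + Re (unit_e s)) ^ n)
     \<le> H (z * cis \<delta> * unit_e s) * (1 + Re (unit_e s)) ^ n + H (z * cis (- \<delta>) * unit_e s) * (1 + Re (unit_e s)) ^ n" for s
  proof -
    have "cis \<delta> + cis (- \<delta>) = of_real (2 * cos \<delta>)" by (simp add: complex_eq_iff)
    then have "z * unit_e s * (cis \<delta> + cis (- \<delta>)) = of_real (2 * cos \<delta>) * (z * unit_e s)" by simp
    then have "z * cis \<delta> * unit_e s + z * cis (- \<delta>) * unit_e s = of_real (2 * cos \<delta>) * (z * unit_e s)"
      by (simp add: distrib_left mult_ac)
    then have "2 * cos \<delta> * H (z * unit_e s) \<le> H (z * cis \<delta> * unit_e s) + H (z * cis (- \<delta>) * unit_e s)"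
      using sub[of "z * cis \<delta> * unit_e s" "z * cis (- \<delta>) * unit_e s"] hom[OF c] by simp
    from mult_right_mono[OF this kernel_nonneg[of s n]] show ?thesis by (simp only: distrib_right mult.assoc)
  qed
  ultimately have "integral {0..1} (\<lambda>s. 2 * cos \<delta> * (H (z * unit_e s) * (1 + Re (unit_e s)) ^ n))
     \<le> integral {0..1} (\<lambda>s. H (z * cis \<delta> * unit_e s) * (1 + Re (unit_e s)) ^ n + H (z * cis (- \<delta>) * unit_e s) * (1 + Re (unit_e s)) ^ n)"
    by (intro integral_le integrable_add smooth_integrable) auto
  then have "2 * cos \<delta> * integral {0..1} (\<lambda>s. H (z * unit_e s) * (1 + Re (unit_e s)) ^ n)
     \<le> integral {0..1} (\<lambda>s. H (z * cis \<delta> * unit_e s) * (1 + Re (unit_e s)) ^ n) + integral {0..1} (\<lambda>s. H (z * cis (- \<delta>) * unit_e s) * (1 + Re (unit_e s)) ^ n)"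
    by (simp add: Henstock_Kurzweil_Integration.integral_add smooth_integrable)
  from divide_right_mono[OF this, of "kernel_mass n"] show ?thesis
    using kernel_mass_pos[of n] by (simp add: smooth_def add_divide_distrib)
qed

text \<open>By the Lipschitz bound it is enough to average x = |unit_e s - 1|. Here x \<le> e +
  x^2/e, and x^2 = 2 (1 - cos(2 pi s)) has an exactly known kernel moment.\<close>

lemma smooth_close:
  assumes \<zeta>: "cmod \<zeta> = 1" and e: "e > 0"
  shows "\<bar>smooth n \<zeta> - H \<zeta>\<bar> \<le> L * (e + 2 / (e * (real n + 1)))"
proof -
  have mass: "((\<lambda>s. (1 + Re (unit_e s)) ^ n) has_integral kernel_mass n) {0..1}"
    unfolding kernel_mass_def by (intro integrable_integral cosine_kernel(1))
  have mom: "((\<lambda>s. (1 - Re (unit_e s)) * (1 + Re (unit_e s)) ^ n) has_integral kernel_mass n / (real n + 1)) {0..1}"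
    unfolding kernel_mass_def by (rule cosine_kernel(3))
  have diff: "((\<lambda>s. H (\<zeta> * unit_e s) * (1 + Re (unit_e s)) ^ n - H \<zeta> * (1 + Re (unit_e s)) ^ n) has_integral
      (integral {0..1} (\<lambda>s. H (\<zeta> * unit_e s) * (1 + Re (unit_e s)) ^ n) - H \<zeta> * kernel_mass n)) {0..1}"
    by (intro has_integral_diff integrable_integral smooth_integrable has_integral_mult_right mass)
  have up: "((\<lambda>s. L * (e * (1 + Re (unit_e s)) ^ n + 2 / e * ((1 - Re (unit_e s)) * (1 + Re (unit_e s)) ^ n))) has_integral
      L * (e * kernel_mass n + 2 / e * (kernel_mass n / (real n + 1)))) {0..1}"
    by (intro has_integral_mult_right has_integral_add mass mom)
  have le: "\<bar>H (\<zeta> * unit_e s) * (1 + Re (unit_e s)) ^ n - H \<zeta> * (1 + Re (unit_e s)) ^ n\<bar>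
      \<le> L * (e * (1 + Re (unit_e s)) ^ n + 2 / e * ((1 - Re (unit_e s)) * (1 + Re (unit_e s)) ^ n))" for s
  proof -
    define x where "x = cmod (unit_e s - 1)"
    have x2: "x\<^sup>2 = 2 * (1 - Re (unit_e s))"
    proof -
      have "(Re (unit_e s))\<^sup>2 + (Im (unit_e s))\<^sup>2 = 1" by (metis cmod_power2 norm_unit_e one_power2)
      then show ?thesis unfolding x_def cmod_power2 by (simp add: power2_eq_square algebra_simps)
    qed
    have "x \<le> e + x\<^sup>2 / e"
    proof (cases "x \<le> e")
      case True
      then show ?thesis using e by (simp add: add_increasing2)
    next
      case False
      then have "x * e \<le> x * x" using e by (intro mult_left_mono) auto
      then have "x \<le> x\<^sup>2 / e" using e by (simp add: pos_le_divide_eq power2_eq_square)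
      then show ?thesis using e by simp
    qed
    have "\<bar>H (\<zeta> * unit_e s) - H \<zeta>\<bar> \<le> L * cmod (\<zeta> * unit_e s - \<zeta>)" by (rule lipschitz)
    also have "cmod (\<zeta> * unit_e s - \<zeta>) = x"
    proof -
      have "\<zeta> * unit_e s - \<zeta> = \<zeta> * (unit_e s - 1)" by (simp add: algebra_simps)
      then show ?thesis using \<zeta> by (simp add: norm_mult x_def)
    qed
    also have "L * x \<le> L * (e + 2 / e * (1 - Re (unit_e s)))"
      using \<open>x \<le> e + x\<^sup>2 / e\<close> L_nonneg x2 by (intro mult_left_mono) auto
    finally have "\<bar>H (\<zeta> * unit_e s) - H \<zeta>\<bar> * (1 + Re (unit_e s)) ^ n \<le> L * (e + 2 / e * (1 - Re (unit_e s))) * (1 + Re (unit_e s)) ^ n"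
      by (intro mult_right_mono kernel_nonneg)
    moreover have "\<bar>H (\<zeta> * unit_e s) * (1 + Re (unit_e s)) ^ n - H \<zeta> * (1 + Re (unit_e s)) ^ n\<bar>
       = \<bar>H (\<zeta> * unit_e s) - H \<zeta>\<bar> * (1 + Re (unit_e s)) ^ n"
      using kernel_nonneg[of s n] by (simp add: abs_mult flip: left_diff_distrib)
    moreover have "L * (e + 2 / e * (1 - Re (unit_e s))) * (1 + Re (unit_e s)) ^ n = L * (e * (1 + Re (unit_e s)) ^ n + 2 / e * ((1 - Re (unit_e s)) * (1 + Re (unit_e s)) ^ n))"
      by (simp only: distrib_right mult.assoc)
    ultimately show ?thesis by (simp only:)
  qed
  have "\<bar>integral {0..1} (\<lambda>s. H (\<zeta> * unit_e s) * (1 + Re (unit_e s)) ^ n) - H \<zeta> * kernel_mass n\<bar>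
     \<le> L * (e * kernel_mass n + 2 / e * (kernel_mass n / (real n + 1)))"
  proof (rule abs_leI)
    show "integral {0..1} (\<lambda>s. H (\<zeta> * unit_e s) * (1 + Re (unit_e s)) ^ n) - H \<zeta> * kernel_mass n
        \<le> L * (e * kernel_mass n + 2 / e * (kernel_mass n / (real n + 1)))"
      by (rule has_integral_le[OF diff up]) (use le in \<open>simp add: abs_le_iff\<close>)
    show "- (integral {0..1} (\<lambda>s. H (\<zeta> * unit_e s) * (1 + Re (unit_e s)) ^ n) - H \<zeta> * kernel_mass n)
        \<le> L * (e * kernel_mass n + 2 / e * (kernel_mass n / (real n + 1)))"
      by (rule has_integral_le[OF has_integral_neg[OF diff] up]) (use le in \<open>simp add: abs_le_iff\<close>)
  qed
  also have "\<dots> = L * (e + 2 / (e * (real n + 1))) * kernel_mass n"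
    by (simp add: distrib_left distrib_right mult_ac)
  finally have *: "\<bar>integral {0..1} (\<lambda>s. H (\<zeta> * unit_e s) * (1 + Re (unit_e s)) ^ n) - H \<zeta> * kernel_mass n\<bar> / kernel_mass n
     \<le> L * (e + 2 / (e * (real n + 1)))"
    using kernel_mass_pos[of n] by (simp add: pos_divide_le_eq)
  have "smooth n \<zeta> - H \<zeta> = (integral {0..1} (\<lambda>s. H (\<zeta> * unit_e s) * (1 + Re (unit_e s)) ^ n) - H \<zeta> * kernel_mass n) / kernel_mass n"
    using kernel_mass_pos[of n] by (simp add: smooth_def diff_divide_distrib)
  then show ?thesis using * kernel_mass_pos[of n] by (simp add: abs_divide)
qed

lemma trig_poly_approx:
  assumes \<eta>: "\<eta> > 0"
  obtains d N where "\<And>\<zeta>. cmod \<zeta> = 1 \<Longrightarrow> H \<zeta> \<le> trig_poly d N \<zeta>" "\<And>\<zeta>. cmod \<zeta> = 1 \<Longrightarrow> trig_poly d N \<zeta> \<le> H \<zeta> + 3 * \<eta>"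
    "\<And>\<zeta>. cmod \<zeta> = 1 \<Longrightarrow> \<eta> \<le> trig_poly d N \<zeta>" "\<And>\<zeta>. cmod \<zeta> = 1 \<Longrightarrow> \<eta> \<le> trig_poly (curvature d) N \<zeta>"
proof -
  \<comment> \<open>Chosen so that, after multiplication by \<open>L\<close>, both parts e and 2 /
    (e (n + 1)) of the error are at most \<eta>/2; \<open>L + 1\<close> guards against L =
    0.\<close>
  define e where "e = (\<eta> / (L + 1)) / 2"
  have e: "e > 0" using \<eta> L_nonneg by (simp add: e_def)
  obtain n where n: "2 / (e * e) < real n" using reals_Archimedean2 by blast
  have "2 / (e * (real n + 1)) \<le> e"
  proof -
    have "2 < real n * (e * e)" using n e by (simp add: pos_divide_less_eq)
    also have "\<dots> \<le> (real n + 1) * (e * e)" using e by (intro mult_right_mono) auto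
    finally show ?thesis using e by (simp add: pos_divide_le_eq mult_ac)
  qed
  then have "L * (e + 2 / (e * (real n + 1))) \<le> (L + 1) * (e + e)"
    using L_nonneg e by (intro mult_mono) auto
  also have "\<dots> = \<eta>"
  proof -
    have "L + 1 > 0" using L_nonneg by simp
    moreover have "e + e = \<eta> / (L + 1)" unfolding e_def by (rule field_sum_of_halves)
    ultimately show ?thesis by simp
  qed
  finally have close: "\<bar>smooth n \<zeta> - H \<zeta>\<bar> \<le> \<eta>" if "cmod \<zeta> = 1" for \<zeta>
    using smooth_close[OF that e, of n] by linarith
  obtain d0 where d0: "\<And>\<zeta>. cmod \<zeta> = 1 \<Longrightarrow> smooth n \<zeta> = trig_poly d0 n \<zeta>"
    using smooth_trig_poly[of n] by blast
  \<comment> \<open>Adding 2 \<eta> to the constant term raises both h and h + h'' by 2 \<eta>.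
    Against the approximation error \<eta> this gives a majorant of \<open>H\<close> and the lower
    bounds \<eta>.\<close>
  define d where "d k = d0 k + (if k = 0 then of_real (2 * \<eta>) else 0)" for k
  have tr: "trig_poly d n \<zeta> = trig_poly d0 n \<zeta> + 2 * \<eta>" for \<zeta>
  proof -
    have "(\<Sum>k\<le>n. d k * \<zeta> ^ k) = (\<Sum>k\<le>n. d0 k * \<zeta> ^ k) + (\<Sum>k\<le>n. if k = 0 then of_real (2 * \<eta>) else 0)"
      unfolding sum.distrib[symmetric] by (intro sum.cong) (auto simp: d_def distrib_right)
    then show ?thesis by (simp add: trig_poly_def)
  qed
  have trc: "trig_poly (curvature d) n \<zeta> = trig_poly (curvature d0) n \<zeta> + 2 * \<eta>" for \<zeta>
  proof -
    have "(\<Sum>k\<le>n. curvature d k * \<zeta> ^ k) = (\<Sum>k\<le>n. curvature d0 k * \<zeta> ^ k) + (\<Sum>k\<le>n. if k = 0 then of_real (2 * \<eta>) else 0)"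
      unfolding sum.distrib[symmetric] by (intro sum.cong) (auto simp: d_def curvature_def distrib_right distrib_left)
    then show ?thesis by (simp add: trig_poly_def)
  qed
  have c0: "0 \<le> trig_poly (curvature d0) n \<zeta>" if \<zeta>: "cmod \<zeta> = 1" for \<zeta>
  proof (rule curvature_nonneg)
    fix \<delta> :: real assume "\<bar>\<delta>\<bar> < 1"
    from smooth_convex[OF this, of n \<zeta>] show "2 * cos \<delta> * trig_poly d0 n \<zeta> \<le> trig_poly d0 n (\<zeta> * cis \<delta>) + trig_poly d0 n (\<zeta> * cis (- \<delta>))"
      using \<zeta> by (simp add: d0 norm_mult)
  qed
  show thesis
  proof (rule that[of d n])
    fix \<zeta> :: complex assume \<zeta>: "cmod \<zeta> = 1"
    have s: "\<bar>trig_poly d0 n \<zeta> - H \<zeta>\<bar> \<le> \<eta>" using close[OF \<zeta>] d0[OF \<zeta>] by simp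
    show "H \<zeta> \<le> trig_poly d n \<zeta>" using s \<eta> unfolding tr by linarith
    show "trig_poly d n \<zeta> \<le> H \<zeta> + 3 * \<eta>" using s unfolding tr by linarith
    show "\<eta> \<le> trig_poly d n \<zeta>" using s nonneg[of \<zeta>] unfolding tr by linarith
    show "\<eta> \<le> trig_poly (curvature d) n \<zeta>" using c0[OF \<zeta>] \<eta> unfolding trc by linarith
  qed
qed

end

section \<open>Area of a convex body in terms of its support function\<close>

text \<open>Variation of constants: D(x) is the integral of (D'' + D)(y) sin(x - y) over [0, x],
  where the sine is positive as x \<le> pi. The auxiliary function \<open>E\<close> has this
  integrand as derivative and runs from 0 to D(x).\<close>

lemma sine_comparison:
  fixes D D1 D2 :: "real \<Rightarrow> real"
  assumes D: "\<And>x. (D has_real_derivative D1 x) (at x)" "\<And>x. (D1 has_real_derivative D2 x) (at x)"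
    and pos: "\<And>x. D2 x + D x > 0" and init: "D 0 = 0" "D1 0 = 0" and x: "0 < x" "x \<le> pi"
  shows "D x > 0"
proof -
  define E where "E y = D1 y * sin (x - y) + D y * cos (x - y)" for y
  have dE: "(E has_real_derivative ((D2 y + D y) * sin (x - y))) (at y)" for y
    unfolding E_def using D by (auto intro!: derivative_eq_intros simp: algebra_simps)
  have "E 0 < E x"
  proof (rule DERIV_pos_imp_increasing_open[OF x(1)])
    show "\<exists>z. (E has_real_derivative z) (at y) \<and> 0 < z" if "0 < y" "y < x" for y
    proof -
      have "0 < sin (x - y)" using that x by (intro sin_gt_zero) auto
      then show ?thesis using dE pos[of y] by (intro exI[of _ "(D2 y + D y) * sin (x - y)"]) simp
    qed
    show "continuous_on {0..x} E"
      using dE by (intro DERIV_atLeastAtMost_imp_continuous_on) (auto intro: exI)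
  qed
  then show ?thesis by (simp add: E_def init)
qed

lemma DERIV_affine:
  assumes "(f has_real_derivative D) (at (b + a * t))"
  shows "((\<lambda>t. f (b + a * t)) has_real_derivative D * a) (at t)"
proof -
  have "((\<lambda>t. b + a * t) has_real_derivative a) (at t)" by (auto intro!: derivative_eq_intros)
  then show ?thesis using DERIV_chain2[where f = f and g = "\<lambda>t. b + a * t", OF assms] by blast
qed

lemma sine_comparison_abs:
  fixes D D1 D2 :: "real \<Rightarrow> real"
  assumes D: "\<And>x. (D has_real_derivative D1 x) (at x)" "\<And>x. (D1 has_real_derivative D2 x) (at x)"
    and pos: "\<And>x. D2 x + D x > 0" and init: "D 0 = 0" "D1 0 = 0" and x: "x \<noteq> 0" "\<bar>x\<bar> \<le> pi"
  shows "D x > 0"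
proof (cases "x > 0")
  case True
  then show ?thesis using sine_comparison[of D D1 D2 x] assms by simp
next
  case False
  have "0 < D (- (- x))"
  proof (rule sine_comparison[of "\<lambda>y. D (- y)" "\<lambda>y. - D1 (- y)" "\<lambda>y. D2 (- y)" "- x"])
    show "((\<lambda>y. D (- y)) has_real_derivative - D1 (- y)) (at y)" for y
      using DERIV_affine[of D "D1 (- y)" 0 "-1" y] D(1) by simp
    show "((\<lambda>y. - D1 (- y)) has_real_derivative D2 (- y)) (at y)" for y
      using DERIV_minus[OF DERIV_affine[of D1 "D2 (- y)" 0 "-1" y]] D(2) by simp
  qed (use assms False in auto)
  then show ?thesis by simp
qed

section \<open>The boundary curve of the body of a trigonometric polynomial\<close>

lemma trig_poly_cis_deriv:
  "((\<lambda>\<theta>. trig_poly d N (cis \<theta>)) has_real_derivative trig_poly (\<lambda>k. \<i> * of_nat k * d k) N (cis \<theta>)) (at \<theta>)"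
proof -
  have eq: "(\<Sum>k\<le>N. d k * cis \<theta> ^ k) = (\<Sum>k\<le>N. d k * cis (real k * \<theta>))" for \<theta> and d :: "nat \<Rightarrow> complex"
    by (simp add: Complex.DeMoivre)
  have tr: "trig_poly d N (cis \<theta>) = (\<Sum>k\<le>N. Re (d k) * cos (real k * \<theta>) - Im (d k) * sin (real k * \<theta>))" for \<theta> and d :: "nat \<Rightarrow> complex"
    unfolding trig_poly_def eq by simp
  have "((\<lambda>\<theta>. \<Sum>k\<le>N. Re (d k) * cos (real k * \<theta>) - Im (d k) * sin (real k * \<theta>)) has_real_derivative
     (\<Sum>k\<le>N. - (Re (d k) * sin (real k * \<theta>) * real k) - Im (d k) * cos (real k * \<theta>) * real k)) (at \<theta>)"
    by (auto intro!: derivative_eq_intros sum.cong)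
  moreover have "(\<Sum>k\<le>N. - (Re (d k) * sin (real k * \<theta>) * real k) - Im (d k) * cos (real k * \<theta>) * real k) = trig_poly (\<lambda>k. \<i> * of_nat k * d k) N (cis \<theta>)"
    unfolding tr by (intro sum.cong) (auto simp: algebra_simps)
  ultimately show ?thesis unfolding tr by simp
qed

lemma trig_poly_curvature_split: "trig_poly (\<lambda>k. \<i> * of_nat k * (\<i> * of_nat k * d k)) N \<zeta> + trig_poly d N \<zeta> = trig_poly (curvature d) N \<zeta>"
proof -
  have "(\<Sum>k\<le>N. \<i> * of_nat k * (\<i> * of_nat k * d k) * \<zeta> ^ k) + (\<Sum>k\<le>N. d k * \<zeta> ^ k) = (\<Sum>k\<le>N. curvature d k * \<zeta> ^ k)"
    unfolding sum.distrib[symmetric] by (intro sum.cong) (auto simp: curvature_def power2_eq_square algebra_simps)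
  then show ?thesis unfolding trig_poly_def by (metis plus_complex.sel(1))
qed

lemma continuous_on_trig_poly [continuous_intros]: "continuous_on A g \<Longrightarrow> continuous_on A (\<lambda>x. trig_poly d N (g x))"
  unfolding trig_poly_def by (intro continuous_intros)

lemma trig_poly_bound: "cmod \<zeta> = 1 \<Longrightarrow> trig_poly d N \<zeta> \<le> (\<Sum>k\<le>N. cmod (d k))"
proof -
  assume z: "cmod \<zeta> = 1"
  have "trig_poly d N \<zeta> \<le> cmod (\<Sum>k\<le>N. d k * \<zeta> ^ k)" unfolding trig_poly_def by (rule complex_Re_le_cmod)
  also have "\<dots> \<le> (\<Sum>k\<le>N. cmod (d k * \<zeta> ^ k))" by (rule norm_sum)
  finally show ?thesis using z by (simp add: norm_mult norm_power)
qed

text \<open>The point with outer normal direction \<open>cnj \<zeta>\<close> on the boundary of the body with support function \<open>trig_poly d N\<close>.\<close>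

definition boundary_point :: "(nat \<Rightarrow> complex) \<Rightarrow> nat \<Rightarrow> complex \<Rightarrow> complex" where
  "boundary_point d N \<zeta> = (of_real (trig_poly d N \<zeta>) - \<i> * of_real (trig_poly (\<lambda>k. \<i> * of_nat k * d k) N \<zeta>)) * cnj \<zeta>"

text \<open>\<open>D\<close> is h minus the support function of the boundary point, in the angle
  measured from \<zeta>. It vanishes to second order at 0 and satisfies D'' + D = h + h'' > 0, so
  the comparison lemma makes it positive at every other angle. The strict inequality is what yields
  injectivity in \<open>trig_poly_area\<close>.\<close>

lemma boundary_point_support:
  assumes pos: "\<And>\<zeta>. cmod \<zeta> = 1 \<Longrightarrow> 0 < trig_poly (curvature d) N \<zeta>" and \<zeta>: "cmod \<zeta> = 1" and \<xi>: "cmod \<xi> = 1" "\<xi> \<noteq> \<zeta>"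
  shows "Re (boundary_point d N \<zeta> * \<xi>) < trig_poly d N \<xi>"
proof -
  define d1 where "d1 k = \<i> * of_nat k * d k" for k
  define d2 where "d2 k = \<i> * of_nat k * d1 k" for k
  define a where "a = Arg \<zeta>"
  have a: "\<zeta> = cis a" using \<zeta> cis_Arg[of \<zeta>] by (cases "\<zeta> = 0") (auto simp: a_def sgn_eq)
  define x where "x = Arg (\<xi> * cnj \<zeta>)"
  have "cmod (\<xi> * cnj \<zeta>) = 1" using \<zeta> \<xi> by (simp add: norm_mult)
  then have cx: "\<xi> * cnj \<zeta> = cis x" using cis_Arg[of "\<xi> * cnj \<zeta>"] by (cases "\<xi> * cnj \<zeta> = 0") (auto simp: x_def sgn_eq)
  have "\<zeta> * cnj \<zeta> = 1" using complex_norm_square[of \<zeta>] \<zeta> by simp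
  then have xi: "\<xi> = cis (a + x)" using cx by (metis a cis_mult mult.assoc mult.commute mult_1)
  have x: "x \<noteq> 0" "\<bar>x\<bar> \<le> pi"
    using \<xi>(2) a xi Arg_bounded[of "\<xi> * cnj \<zeta>", folded x_def] by auto
  define D where "D y = trig_poly d N (cis (a + y)) - trig_poly d N \<zeta> * cos y - trig_poly d1 N \<zeta> * sin y" for y
  have "0 < D x"
  proof (rule sine_comparison_abs[of D "\<lambda>y. trig_poly d1 N (cis (a + y)) + trig_poly d N \<zeta> * sin y - trig_poly d1 N \<zeta> * cos y"
        "\<lambda>y. trig_poly d2 N (cis (a + y)) + trig_poly d N \<zeta> * cos y + trig_poly d1 N \<zeta> * sin y"])
    have shift: "((\<lambda>y. trig_poly c N (cis (a + y))) has_real_derivative trig_poly (\<lambda>k. \<i> * of_nat k * c k) N (cis (a + y))) (at y)" for c y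
      using DERIV_affine[of "\<lambda>y. trig_poly c N (cis y)" _ a 1 y] trig_poly_cis_deriv[of c N "a + y"] by simp
    show "(D has_real_derivative (trig_poly d1 N (cis (a + y)) + trig_poly d N \<zeta> * sin y - trig_poly d1 N \<zeta> * cos y)) (at y)" for y
      unfolding D_def d1_def by (rule derivative_eq_intros shift refl | simp)+
    show "((\<lambda>y. trig_poly d1 N (cis (a + y)) + trig_poly d N \<zeta> * sin y - trig_poly d1 N \<zeta> * cos y) has_real_derivative
        (trig_poly d2 N (cis (a + y)) + trig_poly d N \<zeta> * cos y + trig_poly d1 N \<zeta> * sin y)) (at y)" for y
      unfolding d2_def by (rule derivative_eq_intros shift refl | simp)+
    show "0 < trig_poly d2 N (cis (a + y)) + trig_poly d N \<zeta> * cos y + trig_poly d1 N \<zeta> * sin y + D y" for y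
      using pos[of "cis (a + y)"] trig_poly_curvature_split[of d N "cis (a + y)", folded d1_def, folded d2_def] by (simp add: D_def)
    show "D 0 = 0" by (simp add: D_def a)
    show "trig_poly d1 N (cis (a + 0)) + trig_poly d N \<zeta> * sin 0 - trig_poly d1 N \<zeta> * cos 0 = 0" by (simp add: a)
  qed (use x in auto)
  moreover have "Re (boundary_point d N \<zeta> * \<xi>) = trig_poly d N \<zeta> * cos x + trig_poly d1 N \<zeta> * sin x"
  proof -
    have "boundary_point d N \<zeta> * \<xi> = (of_real (trig_poly d N \<zeta>) - \<i> * of_real (trig_poly d1 N \<zeta>)) * cis x"
      unfolding boundary_point_def d1_def[symmetric] cx[symmetric] by (simp add: mult_ac)
    then show ?thesis by simp
  qed
  ultimately show ?thesis by (simp add: D_def xi)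
qed

lemma boundary_point_self: "cmod \<zeta> = 1 \<Longrightarrow> Re (boundary_point d N \<zeta> * \<zeta>) = trig_poly d N \<zeta>"
proof -
  assume "cmod \<zeta> = 1"
  then have "cnj \<zeta> * \<zeta> = 1" using complex_norm_square[of \<zeta>] by (simp add: mult.commute)
  then show ?thesis unfolding boundary_point_def mult.assoc by simp
qed

lemma unit_e_cis: "unit_e t = cis (2 * pi * t)"
  by (simp add: unit_e_def cis_conv_exp mult_ac)

lemma unit_e_inj: "unit_e s = unit_e t \<Longrightarrow> 0 < s \<Longrightarrow> s < 1 \<Longrightarrow> 0 < t \<Longrightarrow> t < 1 \<Longrightarrow> s = t"
proof -
  assume e: "unit_e s = unit_e t" and st: "0 < s" "s < 1" "0 < t" "t < 1"
  then obtain n :: int where "2 * of_real pi * \<i> * of_real s = 2 * of_real pi * \<i> * of_real t + of_int (2 * n) * pi * \<i>"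
    unfolding unit_e_def exp_eq by auto
  then have "2 * pi * s = 2 * pi * t + of_int (2 * n) * pi" by (auto simp: complex_eq_iff)
  then have "2 * pi * s = 2 * pi * (t + of_int n)" by (simp add: algebra_simps)
  then have "s = t + of_int n" by simp
  moreover from this st have "n = 0"
  proof -
    have "real_of_int n < 1" "real_of_int n > - 1" using \<open>s = t + of_int n\<close> st by linarith+
    then show ?thesis by linarith
  qed
  ultimately show ?thesis by simp
qed

lemma trig_poly_unit_e_deriv:
  "((\<lambda>t. trig_poly d N (unit_e t)) has_real_derivative 2 * pi * trig_poly (\<lambda>k. \<i> * of_nat k * d k) N (unit_e t)) (at t)"
  unfolding unit_e_cis
  using DERIV_affine[of "\<lambda>y. trig_poly d N (cis y)" "trig_poly (\<lambda>k. \<i> * of_nat k * d k) N (cis (2 * pi * t))" 0 "2 * pi" t] trig_poly_cis_deriv[of d N "2 * pi * t"]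
  by (simp add: mult.commute)

text \<open>The curve moves along its tangent with speed 2 pi (h + h''); here h + h'' is the radius
  of curvature of the boundary.\<close>

lemma boundary_point_deriv:
  "((\<lambda>t. boundary_point d N (unit_e t)) has_vector_derivative (- \<i> * of_real (2 * pi * trig_poly (curvature d) N (unit_e t)) * cnj (unit_e t))) (at t)"
proof -
  define d1 where "d1 k = \<i> * of_nat k * d k" for k
  define d2 where "d2 k = \<i> * of_nat k * d1 k" for k
  have re: "((\<lambda>t. of_real (trig_poly c N (unit_e t)) :: complex) has_vector_derivative of_real (2 * pi * trig_poly (\<lambda>k. \<i> * of_nat k * c k) N (unit_e t))) (at t)" for c
    by (rule has_vector_derivative_of_real) (use trig_poly_unit_e_deriv in \<open>simp add: has_real_derivative_iff_has_vector_derivative\<close>)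
  have "((\<lambda>t. unit_e t) has_vector_derivative (2 * of_real pi * \<i> * unit_e t)) (at t)"
    unfolding unit_e_def
    by (rule has_vector_derivative_real_field) (auto intro!: derivative_eq_intros)
  then have e: "((\<lambda>t. cnj (unit_e t)) has_vector_derivative cnj (2 * of_real pi * \<i> * unit_e t)) (at t)"
    by (rule has_vector_derivative_cnj)
  have "((\<lambda>t. (of_real (trig_poly d N (unit_e t)) - \<i> * of_real (trig_poly d1 N (unit_e t))) * cnj (unit_e t)) has_vector_derivative
     (of_real (trig_poly d N (unit_e t)) - \<i> * of_real (trig_poly d1 N (unit_e t))) * cnj (2 * of_real pi * \<i> * unit_e t)
     + (of_real (2 * pi * trig_poly d1 N (unit_e t)) - \<i> * of_real (2 * pi * trig_poly d2 N (unit_e t))) * cnj (unit_e t)) (at t)"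
    using re[of d] re[of d1] unfolding d1_def[symmetric] d2_def[symmetric]
    by (intro has_vector_derivative_mult has_vector_derivative_diff has_vector_derivative_mult_right e)
  moreover have "(of_real (trig_poly d N (unit_e t)) - \<i> * of_real (trig_poly d1 N (unit_e t))) * cnj (2 * of_real pi * \<i> * unit_e t)
     + (of_real (2 * pi * trig_poly d1 N (unit_e t)) - \<i> * of_real (2 * pi * trig_poly d2 N (unit_e t))) * cnj (unit_e t)
     = - \<i> * of_real (2 * pi * (trig_poly d2 N (unit_e t) + trig_poly d N (unit_e t))) * cnj (unit_e t)"
    by (simp add: algebra_simps)
  ultimately show ?thesis
    using trig_poly_curvature_split[of d N "unit_e t"] unfolding boundary_point_def d2_def d1_def by simp
qed

text \<open>Change of variables is carried out on \<open>real^2\<close>, Fubini on pairs; this map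
  identifies the two.\<close>

definition vec_of_pair :: "real \<times> real \<Rightarrow> real^2" where "vec_of_pair p = vector [fst p, snd p]"

lemma measurable_vec_of_pair [measurable]: "vec_of_pair \<in> borel_measurable borel"
proof -
  have "linear vec_of_pair" by (auto simp: vec_of_pair_def linear_iff vec_eq_iff forall_2)
  then show ?thesis
    by (intro borel_measurable_continuous_onI linear_continuous_on) (simp add: linear_conv_bounded_linear)
qed

lemma lborel_real2_distr: "lborel = distr lborel borel vec_of_pair"
proof (rule lborel_eqI)
  fix l u :: "real^2"
  assume lu: "\<And>b. b \<in> Basis \<Longrightarrow> l \<bullet> b \<le> u \<bullet> b"
  have B: "(Basis :: (real^2) set) = {axis 1 1, axis 2 1}"
    by (auto simp: Basis_vec_def) (metis exhaust_2)
  have ne: "axis 1 1 \<noteq> (axis 2 1 :: real^2)"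
    by (simp add: axis_eq_axis)
  have lu': "l$1 \<le> u$1" "l$2 \<le> u$2" using lu[of "axis 1 1"] lu[of "axis 2 1"] unfolding B by (auto simp: inner_axis)
  have pB: "(Basis :: (real \<times> real) set) = {(1, 0), (0, 1)}" by (auto simp: Basis_prod_def)
  have "vec_of_pair -` box l u = box (l$1, l$2) (u$1, u$2)"
    unfolding box_def B pB by (auto simp: vec_of_pair_def inner_axis)
  moreover have "emeasure lborel (box (l$1, l$2) (u$1, u$2)) = (\<Prod>b\<in>Basis. (u - l) \<bullet> b)"
  proof -
    have "(\<Prod>b\<in>Basis. ((u$1, u$2) - (l$1, l$2)) \<bullet> b) = (\<Prod>b\<in>Basis. (u - l) \<bullet> b)"
      unfolding B pB using ne by (simp add: inner_axis)
    moreover have "(l$1, l$2) \<bullet> b \<le> (u$1, u$2) \<bullet> b" if "b \<in> Basis" for b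
      using that lu' unfolding pB by auto
    ultimately show ?thesis by (subst emeasure_lborel_box) auto
  qed
  ultimately show "emeasure (distr lborel borel vec_of_pair) (box l u) = (\<Prod>b\<in>Basis. (u - l) \<bullet> b)"
    by (subst emeasure_distr) auto
qed auto

lemma unit_square_integral:
  fixes q :: "real \<Rightarrow> real"
  assumes q: "continuous_on UNIV q" "\<And>t. 0 \<le> q t" and Q: "(q has_integral Q) {0..1}"
  shows "((\<lambda>x::real^2. x$1 * q (x$2)) has_integral Q / 2) {x. 0 < x$1 \<and> x$1 < 1 \<and> 0 < x$2 \<and> x$2 < 1}"
proof -
  have [measurable]: "q \<in> borel_measurable borel" using q(1) by (rule borel_measurable_continuous_onI)
  define f where "f x = indicator {0<..<1} (x$1) * x$1 * (indicator {0<..<1} (x$2) * q (x$2))" for x :: "real^2"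
  have mf [measurable]: "f \<in> borel_measurable borel"
    unfolding f_def by measurable
  have "(\<integral>\<^sup>+x. f x \<partial>lborel) = (\<integral>\<^sup>+p. f (vec_of_pair p) \<partial>lborel)"
    by (subst lborel_real2_distr) (simp add: nn_integral_distr)
  also have "\<dots> = (\<integral>\<^sup>+p. f (vec_of_pair p) \<partial>(lborel \<Otimes>\<^sub>M lborel))" by (simp add: lborel_prod)
  also have "\<dots> = (\<integral>\<^sup>+a. (\<integral>\<^sup>+b. f (vec_of_pair (a, b)) \<partial>lborel) \<partial>lborel)"
  proof (rule lborel.nn_integral_fst[symmetric])
    show "(\<lambda>p. ennreal (f (vec_of_pair p))) \<in> borel_measurable (lborel \<Otimes>\<^sub>M lborel)"
      unfolding lborel_prod by measurable
  qed
  also have "\<dots> = (\<integral>\<^sup>+a. ennreal (indicator {0<..<1} a * a) * (\<integral>\<^sup>+b. ennreal (indicator {0<..<1} b * q b) \<partial>lborel) \<partial>lborel)"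
  proof (intro nn_integral_cong)
    fix a :: real
    have "ennreal (f (vec_of_pair (a, b))) = ennreal (indicator {0<..<1} a * a) * ennreal (indicator {0<..<1} b * q b)" for b
      unfolding f_def vec_of_pair_def by (subst ennreal_mult[symmetric]) (auto simp: q indicator_def)
    then show "(\<integral>\<^sup>+b. f (vec_of_pair (a, b)) \<partial>lborel) = ennreal (indicator {0<..<1} a * a) * (\<integral>\<^sup>+b. ennreal (indicator {0<..<1} b * q b) \<partial>lborel)"
      by (simp add: nn_integral_cmult)
  qed
  also have "(\<integral>\<^sup>+b. ennreal (indicator {0<..<1} b * q b) \<partial>lborel) = ennreal Q"
  proof (rule nn_integral_has_integral_lebesgue)
    show "(q has_integral Q) {0<..<1}" using Q by (simp add: has_integral_Icc_iff_Ioo)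
  qed (use q in auto)
  also have "(\<integral>\<^sup>+a. ennreal (indicator {0<..<1} a * a) * ennreal Q \<partial>lborel) = (\<integral>\<^sup>+a. ennreal (indicator {0<..<1} a * a) \<partial>lborel) * ennreal Q"
    by (rule nn_integral_multc) measurable
  also have "(\<integral>\<^sup>+a. ennreal (indicator {0<..<1} a * a) \<partial>lborel) = ennreal (1 / 2)"
  proof (rule nn_integral_has_integral_lebesgue)
    have "((\<lambda>a::real. a) has_integral (1\<^sup>2 / 2 - 0\<^sup>2 / 2)) {0..1}"
      by (intro fundamental_theorem_of_calculus)
        (auto intro!: derivative_eq_intros simp flip: has_real_derivative_iff_has_vector_derivative)
    then show "((\<lambda>a::real. a) has_integral 1 / 2) {0<..<1}" by (simp add: has_integral_Icc_iff_Ioo)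
  qed auto
  finally have "(\<integral>\<^sup>+x. f x \<partial>lborel) = ennreal (1 / 2) * ennreal Q" .
  moreover have Q0: "0 \<le> Q" using has_integral_nonneg[OF Q] q by simp
  ultimately have "(\<integral>\<^sup>+x. f x \<partial>lborel) = ennreal (Q / 2)"
    using ennreal_mult[of "1 / 2" Q] by simp
  then have "(f has_integral (Q / 2)) UNIV"
    by (intro nn_integral_has_integral[OF mf]) (use Q0 q in \<open>auto simp: f_def indicator_def\<close>)
  moreover have "f = (\<lambda>x. if x \<in> {x. 0 < x$1 \<and> x$1 < 1 \<and> 0 < x$2 \<and> x$2 < 1} then x$1 * q (x$2) else 0)"
    by (auto simp: f_def indicator_def)
  ultimately have "((\<lambda>x::real^2. if x \<in> {x. 0 < x$1 \<and> x$1 < 1 \<and> 0 < x$2 \<and> x$2 < 1} then x$1 * q (x$2) else 0) has_integral (Q / 2)) UNIV"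
    by (simp only:)
  then show ?thesis unfolding has_integral_restrict_UNIV .
qed

definition vec_of_complex :: "complex \<Rightarrow> real^2" where "vec_of_complex w = vector [Re w, Im w]"

lemma complex_of_vec_of_complex [simp]: "complex_of_vec (vec_of_complex w) = w"
  by (simp add: complex_of_vec_def vec_of_complex_def)

lemma bounded_linear_vec_of_complex: "bounded_linear vec_of_complex"
  unfolding linear_conv_bounded_linear[symmetric]
  by (auto simp: vec_of_complex_def linear_iff vec_eq_iff forall_2)

text \<open>The map (s, t) -> s b(t), with b the boundary curve and s, t in (0, 1), is injective
  into the body and has Jacobian 2 pi s h (h + h''). The integral over the square is pi A, a lower
  bound for the area because the image lies in the body.\<close>

lemma trig_poly_area:
  assumes pos: "\<And>\<zeta>. cmod \<zeta> = 1 \<Longrightarrow> 0 < trig_poly d N \<zeta>" "\<And>\<zeta>. cmod \<zeta> = 1 \<Longrightarrow> 0 < trig_poly (curvature d) N \<zeta>"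
    and A: "((\<lambda>t. trig_poly d N (unit_e t) * trig_poly (curvature d) N (unit_e t)) has_integral A) {0..1}"
  shows "pi * A \<le> measure lebesgue {z. \<forall>\<zeta>. cmod \<zeta> = 1 \<longrightarrow> Re (z * \<zeta>) \<le> trig_poly d N \<zeta>}"
proof -
  define K where "K = {z. \<forall>\<zeta>. cmod \<zeta> = 1 \<longrightarrow> Re (z * \<zeta>) \<le> trig_poly d N \<zeta>}"
  define Dm where "Dm = {x::real^2. 0 < x$1 \<and> x$1 < 1 \<and> 0 < x$2 \<and> x$2 < 1}"
  define G where "G x = of_real (x$1) * boundary_point d N (unit_e (x$2))" for x :: "real^2"
  define b' where "b' t = - \<i> * of_real (2 * pi * trig_poly (curvature d) N (unit_e t)) * cnj (unit_e t)" for t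
  define G' where "G' x h = of_real (x$1) * ((h$2) *\<^sub>R b' (x$2)) + of_real (h$1) * boundary_point d N (unit_e (x$2))" for x h :: "real^2"
  define q where "q t = 2 * pi * (trig_poly d N (unit_e t) * trig_poly (curvature d) N (unit_e t))" for t
  have G': "(G has_derivative G' x) (at x)" for x
  proof -
    have "((\<lambda>x::real^2. x$2) has_derivative (\<lambda>h. h$2)) (at x)"
      by (rule bounded_linear_imp_has_derivative[OF bounded_linear_vec_nth])
    from has_derivative_compose[OF this, of "\<lambda>t. boundary_point d N (unit_e t)" "\<lambda>s. s *\<^sub>R b' (x$2)"]
    have "((\<lambda>x. boundary_point d N (unit_e (x$2))) has_derivative (\<lambda>h. (h$2) *\<^sub>R b' (x$2))) (at x)"
      using boundary_point_deriv[of d N "x$2"] by (simp add: has_vector_derivative_def b'_def)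
    moreover have "((\<lambda>x::real^2. of_real (x$1) :: complex) has_derivative (\<lambda>h. of_real (h$1))) (at x)"
      by (rule has_derivative_of_real[OF bounded_linear_imp_has_derivative[OF bounded_linear_vec_nth]])
    ultimately show ?thesis
      unfolding G_def G'_def by (rule has_derivative_mult[rotated])
  qed
  have g': "((\<lambda>x. vec_of_complex (G x)) has_derivative (\<lambda>h. vec_of_complex (G' x h))) (at x within Dm)" for x
    using bounded_linear.has_derivative[OF bounded_linear_vec_of_complex G'] has_derivative_at_withinI by blast
  have inj: "inj_on (\<lambda>x. vec_of_complex (G x)) Dm"
  proof (rule inj_onI)
    fix x y assume xy: "x \<in> Dm" "y \<in> Dm" "vec_of_complex (G x) = vec_of_complex (G y)"
    then have GG: "G x = G y" by (metis complex_of_vec_of_complex)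
    \<comment> \<open>If equal images had different angles, testing in the direction of one of them
      would make its scale strictly smaller than the other's; by symmetry this is absurd.\<close>
    have lt: "x$1 < y$1" if "x \<in> Dm" "y \<in> Dm" "G x = G y" "x$2 \<noteq> y$2" for x y :: "real^2"
    proof -
      have ne: "unit_e (x$2) \<noteq> unit_e (y$2)" using that unit_e_inj by (auto simp: Dm_def)
      have "Re (G x * unit_e (x$2)) = x$1 * trig_poly d N (unit_e (x$2))"
        unfolding G_def mult.assoc Re_of_real_mult by (simp only: boundary_point_self[OF norm_unit_e])
      moreover have "Re (G y * unit_e (x$2)) < y$1 * trig_poly d N (unit_e (x$2))"
        unfolding G_def mult.assoc Re_of_real_mult using that ne pos
        by (intro mult_strict_left_mono boundary_point_support) (auto simp: Dm_def)
      ultimately have "x$1 * trig_poly d N (unit_e (x$2)) < y$1 * trig_poly d N (unit_e (x$2))" using that by simp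
      then show ?thesis using pos(1)[of "unit_e (x$2)"] by simp
    qed
    have 2: "x$2 = y$2"
      using lt[of x y] lt[of y x] xy GG by force
    have "Re (G x * unit_e (x$2)) = Re (G y * unit_e (x$2))" using GG by simp
    then have "x$1 * trig_poly d N (unit_e (x$2)) = y$1 * trig_poly d N (unit_e (x$2))"
      unfolding G_def mult.assoc Re_of_real_mult 2 by (simp only: boundary_point_self[OF norm_unit_e])
    then have "x$1 = y$1" using pos(1)[of "unit_e (x$2)"] by simp
    with 2 show "x = y" by (simp add: vec_eq_iff forall_2)
  qed
  have det: "\<bar>det (matrix (\<lambda>h. vec_of_complex (G' x h)))\<bar> = x$1 * q (x$2)" if "x \<in> Dm" for x
  proof -
    define w where "w = of_real (trig_poly d N (unit_e (x$2))) - \<i> * of_real (trig_poly (\<lambda>k. \<i> * of_nat k * d k) N (unit_e (x$2)))"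
    define p where "p = trig_poly (curvature d) N (unit_e (x$2))"
    define e where "e = unit_e (x$2)"
    have e1: "(Re e)\<^sup>2 + (Im e)\<^sup>2 = 1" unfolding e_def by (metis cmod_power2 norm_unit_e one_power2)
    have c1: "G' x (axis 1 1) = w * cnj e" by (simp add: G'_def axis_def boundary_point_def w_def e_def)
    have c2: "G' x (axis 2 1) = of_real (x$1) * (- \<i> * of_real (2 * pi * p) * cnj e)" by (simp add: G'_def axis_def b'_def p_def e_def)
    have "det (matrix (\<lambda>h. vec_of_complex (G' x h))) = Re (G' x (axis 1 1)) * Im (G' x (axis 2 1)) - Re (G' x (axis 2 1)) * Im (G' x (axis 1 1))"
      by (simp add: det_2 matrix_def vec_of_complex_def)
    \<comment> \<open>The sign is negative because the outer normal is \<open>cnj \<zeta>\<close>,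
      so the curve runs clockwise.\<close>
    also have "\<dots> = - (x$1 * (2 * pi * p) * Re w) * ((Re e)\<^sup>2 + (Im e)\<^sup>2)"
      unfolding c1 c2 by (simp add: algebra_simps power2_eq_square)
    also have "\<dots> = - (x$1 * q (x$2))" unfolding e1 by (simp add: q_def p_def w_def)
    finally have "det (matrix (\<lambda>h. vec_of_complex (G' x h))) = - (x$1 * q (x$2))" .
    moreover have "0 \<le> x$1 * q (x$2)"
      using that pos[of "unit_e (x$2)"] by (auto simp: q_def Dm_def intro!: mult_nonneg_nonneg)
    ultimately show ?thesis by simp
  qed
  have "continuous_on UNIV q" unfolding q_def by (intro continuous_intros)
  moreover have "0 \<le> q t" for t using pos[of "unit_e t"] by (simp add: q_def)
  moreover have "(q has_integral 2 * pi * A) {0..1}" unfolding q_def by (rule has_integral_mult_right[OF A])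
  ultimately have "((\<lambda>x::real^2. x$1 * q (x$2)) has_integral 2 * pi * A / 2) Dm"
    unfolding Dm_def by (rule unit_square_integral)
  then have "((\<lambda>x. \<bar>det (matrix (\<lambda>h. vec_of_complex (G' x h)))\<bar>) has_integral pi * A) Dm"
    by (subst has_integral_cong[OF det]) auto
  moreover have "Dm \<in> sets lebesgue"
  proof -
    have "open Dm" unfolding Dm_def
      by (intro open_Collect_conj open_Collect_less continuous_intros)
    then show ?thesis by (simp add: sets_completionI_sets)
  qed
  ultimately have T: "(\<lambda>x. vec_of_complex (G x)) ` Dm \<in> lmeasurable" "measure lebesgue ((\<lambda>x. vec_of_complex (G x)) ` Dm) = pi * A"
    using has_measure_differentiable_image[OF _ g' inj] by blast+
  have Kc: "closed K"
  proof -
    have "K = (\<Inter>\<zeta>\<in>{\<zeta>. cmod \<zeta> = 1}. {z. Re (z * \<zeta>) \<le> trig_poly d N \<zeta>})" by (auto simp: K_def)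
    then show ?thesis by (auto intro!: closed_INT closed_Collect_le continuous_intros)
  qed
  have Kb: "cmod z \<le> (\<Sum>k\<le>N. cmod (d k))" if "z \<in> K" for z
  proof (cases "z = 0")
    case False
    define \<zeta> where "\<zeta> = cnj (sgn z)"
    have z1: "cmod \<zeta> = 1" using False by (simp add: \<zeta>_def norm_sgn)
    have "z * \<zeta> = of_real (cmod z)"
      using False by (simp add: \<zeta>_def sgn_eq complex_norm_square[symmetric] power2_eq_square)
    then have "cmod z \<le> trig_poly d N \<zeta>" using that z1 unfolding K_def by (metis (mono_tags, lifting) Re_complex_of_real mem_Collect_eq)
    also have "\<dots> \<le> (\<Sum>k\<le>N. cmod (d k))" by (rule trig_poly_bound[OF z1])
    finally show ?thesis .
  qed (simp add: sum_nonneg)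
  have Kcomp: "compact K"
    using Kc Kb by (auto simp: compact_eq_bounded_closed bounded_iff)
  have sub: "(\<lambda>x. vec_of_complex (G x)) ` Dm \<subseteq> complex_of_vec -` K"
  proof
    fix y assume "y \<in> (\<lambda>x. vec_of_complex (G x)) ` Dm"
    then obtain x where x: "x \<in> Dm" "y = vec_of_complex (G x)" by blast
    have "Re (G x * \<xi>) \<le> trig_poly d N \<xi>" if \<xi>: "cmod \<xi> = 1" for \<xi>
    proof -
      have "Re (boundary_point d N (unit_e (x$2)) * \<xi>) \<le> trig_poly d N \<xi>"
        using boundary_point_support[of d N "unit_e (x$2)" \<xi>] pos(2) \<xi> boundary_point_self[of \<xi> d N] by (cases "\<xi> = unit_e (x$2)") (auto intro: less_imp_le)
      then have "x$1 * Re (boundary_point d N (unit_e (x$2)) * \<xi>) \<le> x$1 * trig_poly d N \<xi>"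
        using x(1) by (intro mult_left_mono) (auto simp: Dm_def)
      also have "\<dots> \<le> 1 * trig_poly d N \<xi>"
        using x(1) pos(1)[OF \<xi>] by (intro mult_right_mono) (auto simp: Dm_def)
      finally show ?thesis unfolding G_def mult.assoc Re_of_real_mult by simp
    qed
    then show "y \<in> complex_of_vec -` K" using x(2) by (auto simp: K_def)
  qed
  have Kbor: "K \<in> sets borel" using Kc by auto
  have vK: "emeasure lborel (complex_of_vec -` K) = emeasure lborel K"
    by (subst lborel_complex_distr_vec) (use Kbor in \<open>simp add: emeasure_distr\<close>)
  have mK: "complex_of_vec -` K \<in> sets borel" using measurable_sets[OF measurable_complex_of_vec Kbor] by simp
  have fin: "emeasure lborel K < \<infinity>" using emeasure_compact_finite[OF Kcomp] by simp
  have "complex_of_vec -` K \<in> lmeasurable"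
    using fin vK mK by (auto simp: fmeasurable_def)
  then have "measure lebesgue ((\<lambda>x. vec_of_complex (G x)) ` Dm) \<le> measure lebesgue (complex_of_vec -` K)"
    using T(1) sub by (intro measure_mono_fmeasurable) (auto simp: fmeasurable_def)
  also have "\<dots> = measure lebesgue K"
    using vK mK Kbor by (simp add: measure_def)
  finally show ?thesis using T(2) K_def by simp
qed

text \<open>There is no conjugate in \<open>w * z\<close> because |exp(z w)| = exp(Re(w z)) is the
  quantity to be bounded. In the direction \<open>cis \<theta>\<close> it is the usual support
  function of the conjugate set, by \<open>spf_cnj_image\<close>.\<close>

definition support_fun :: "complex set \<Rightarrow> complex \<Rightarrow> real" where
  "support_fun S z = (SUP w\<in>S. Re (w * z))"

section \<open>Support function and convex hull of a compact set\<close>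

context
  fixes S :: "complex set"
  assumes S: "compact S" "0 \<in> convex hull S"
begin

lemma support_bdd: "bdd_above ((\<lambda>w. Re (w * z)) ` S)"
  using S by (intro bounded_imp_bdd_above compact_imp_bounded compact_continuous_image continuous_intros) auto

lemma support_nonempty: "S \<noteq> {}"
  using S(2) by auto

lemma support_upper: "w \<in> S \<Longrightarrow> Re (w * z) \<le> support_fun S z"
  unfolding support_fun_def by (rule cSUP_upper[OF _ support_bdd])

lemma support_least: "(\<And>w. w \<in> S \<Longrightarrow> Re (w * z) \<le> m) \<Longrightarrow> support_fun S z \<le> m"
  unfolding support_fun_def by (rule cSUP_least[OF support_nonempty])

lemma support_hull_upper:
  assumes "w \<in> convex hull S"
  shows "Re (w * z) \<le> support_fun S z"
proof -
  have "{w. Re (w * z) \<le> support_fun S z} = {w. inner (cnj z) w \<le> support_fun S z}"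
    by (auto simp: inner_complex_def algebra_simps)
  then have "convex {w. Re (w * z) \<le> support_fun S z}" by (simp add: convex_halfspace_le)
  then have "convex hull S \<subseteq> {w. Re (w * z) \<le> support_fun S z}"
    using support_upper by (intro hull_minimal) auto
  then show ?thesis using assms by auto
qed

lemma plane_sublinear_support: "\<exists>L. plane_sublinear (support_fun S) L"
proof -
  obtain L where L: "\<And>w. w \<in> S \<Longrightarrow> cmod w \<le> L"
    using compact_imp_bounded[OF S(1)] by (auto simp: bounded_iff)
  have nonneg: "0 \<le> support_fun S z" for z
    using support_hull_upper[OF S(2), of z] by simp
  have "plane_sublinear (support_fun S) L"
  proof
    show "support_fun S (z + w) \<le> support_fun S z + support_fun S w" for z w
    proof (rule support_least)
      fix v assume "v \<in> S"
      from support_upper[OF this, of z] support_upper[OF this, of w]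
      show "Re (v * (z + w)) \<le> support_fun S z + support_fun S w" by (simp add: distrib_left)
    qed
    show "support_fun S (of_real r * z) = r * support_fun S z" if "0 \<le> r" for r z
    proof (cases "r = 0")
      case True
      then show ?thesis using support_nonempty by (simp add: support_fun_def)
    next
      case False
      with that have r: "r > 0" by simp
      have e: "Re (v * (of_real r * z)) = r * Re (v * z)" for v
        using Re_of_real_mult[of r "v * z"] by (simp only: mult.left_commute)
      show ?thesis
      proof (rule antisym)
        show "support_fun S (of_real r * z) \<le> r * support_fun S z"
          using support_upper r by (intro support_least) (simp only: e mult_left_mono less_imp_le)
        have "support_fun S z \<le> support_fun S (of_real r * z) / r"
        proof (rule support_least)
          fix v assume "v \<in> S"
          from support_upper[OF this, of "of_real r * z"]
          show "Re (v * z) \<le> support_fun S (of_real r * z) / r"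
            using r unfolding e by (simp add: pos_le_divide_eq mult.commute)
        qed
        then show "r * support_fun S z \<le> support_fun S (of_real r * z)"
          using r by (simp add: pos_le_divide_eq mult.commute)
      qed
    qed
    show "0 \<le> support_fun S z" for z by (rule nonneg)
    show "\<bar>support_fun S z\<bar> \<le> L * cmod z" for z
    proof -
      have "support_fun S z \<le> L * cmod z"
      proof (rule support_least)
        fix v assume "v \<in> S"
        have "Re (v * z) \<le> cmod (v * z)" by (rule complex_Re_le_cmod)
        also have "\<dots> \<le> L * cmod z" unfolding norm_mult by (intro mult_right_mono L \<open>v \<in> S\<close>) simp
        finally show "Re (v * z) \<le> L * cmod z" .
      qed
      then show ?thesis using nonneg[of z] by simp
    qed
  qed
  then show ?thesis by blast
qed

lemma support_body: "{z. \<forall>\<zeta>. cmod \<zeta> = 1 \<longrightarrow> Re (z * \<zeta>) \<le> support_fun S \<zeta>} = convex hull S" (is "?K = _")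
proof
  show "convex hull S \<subseteq> ?K" using support_hull_upper by auto
  show "?K \<subseteq> convex hull S"
  proof
    fix z assume z: "z \<in> ?K"
    show "z \<in> convex hull S"
    proof (rule ccontr)
      assume "z \<notin> convex hull S"
      moreover have "closed (convex hull S)" using S(1) by (intro compact_imp_closed compact_convex_hull)
      ultimately obtain a b where ab: "inner a z < b" "\<And>x. x \<in> convex hull S \<Longrightarrow> b < inner a x"
        using separating_hyperplane_closed_point[OF convex_convex_hull] by blast
      have a0: "a \<noteq> 0" using ab(1) ab(2)[OF S(2)] by auto
      \<comment> \<open>The unit direction for which Re(w \<zeta>) is the separating functional with
        reversed sign, divided by |a|.\<close>
      define \<zeta> where "\<zeta> = - cnj (sgn a)"
      have z1: "cmod \<zeta> = 1" using a0 by (simp add: \<zeta>_def norm_sgn)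
      have e: "Re (w * \<zeta>) = - (inner a w / cmod a)" for w
        by (simp add: \<zeta>_def sgn_div_norm inner_complex_def scaleR_conv_of_real divide_simps)
      have "support_fun S \<zeta> \<le> - (b / cmod a)"
      proof (rule support_least)
        fix w assume "w \<in> S"
        then have "b < inner a w" using ab(2) hull_inc by metis
        then show "Re (w * \<zeta>) \<le> - (b / cmod a)" unfolding e by (simp add: divide_right_mono)
      qed
      also have "\<dots> < Re (z * \<zeta>)" unfolding e using ab(1) a0 by (simp add: divide_strict_right_mono)
      finally show False using z z1 by force
    qed
  qed
qed

text \<open>The bodies with bounds h + 1/(n + 1) decrease to the convex hull by
  \<open>support_body\<close>, and Lebesgue measure is continuous from above on sets of finite
  measure.\<close>

lemma area_parallel_body:
  assumes e: "e > 0"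
  obtains \<delta> where "\<delta> > 0" "\<delta> \<le> 1"
    "measure lebesgue {z. \<forall>\<zeta>. cmod \<zeta> = 1 \<longrightarrow> Re (z * \<zeta>) \<le> support_fun S \<zeta> + \<delta>} \<le> measure lebesgue (convex hull S) + e"
    "compact {z. \<forall>\<zeta>. cmod \<zeta> = 1 \<longrightarrow> Re (z * \<zeta>) \<le> support_fun S \<zeta> + \<delta>}"
proof -
  define K where "K n = {z. \<forall>\<zeta>. cmod \<zeta> = 1 \<longrightarrow> Re (z * \<zeta>) \<le> support_fun S \<zeta> + 1 / real (Suc n)}" for n
  obtain L where "plane_sublinear (support_fun S) L" using plane_sublinear_support by blast
  then interpret plane_sublinear "support_fun S" L .
  have cl: "closed (K n)" for n
  proof -
    have "K n = (\<Inter>\<zeta>\<in>{\<zeta>. cmod \<zeta> = 1}. {z. Re (z * \<zeta>) \<le> support_fun S \<zeta> + 1 / real (Suc n)})" by (auto simp: K_def)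
    then show ?thesis by (auto intro!: closed_INT closed_Collect_le continuous_intros)
  qed
  have bd: "cmod z \<le> L + 1" if "z \<in> K n" for z n
  proof (cases "z = 0")
    case False
    define \<zeta> where "\<zeta> = cnj (sgn z)"
    have z1: "cmod \<zeta> = 1" using False by (simp add: \<zeta>_def norm_sgn)
    have "z * \<zeta> = of_real (cmod z)"
      using False by (simp add: \<zeta>_def sgn_eq complex_norm_square[symmetric] power2_eq_square)
    then have "cmod z \<le> support_fun S \<zeta> + 1 / real (Suc n)" using that z1 unfolding K_def by (metis (mono_tags, lifting) Re_complex_of_real mem_Collect_eq)
    also have "1 / real (Suc n) \<le> 1" by simp
    also have "support_fun S \<zeta> \<le> L" using bound[of \<zeta>] z1 by simp
    finally show ?thesis by simp
  qed (use L_nonneg in simp)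
  have comp: "compact (K n)" for n
    using cl bd by (auto simp: compact_eq_bounded_closed bounded_iff)
  have fm: "K n \<in> lmeasurable" for n using comp by (rule lmeasurable_compact)
  have "(\<lambda>n. measure lebesgue (K n)) \<longlonglongrightarrow> measure lebesgue (\<Inter>n. K n)"
  proof (rule Lim_measure_decseq)
    show "range K \<subseteq> sets lebesgue" using fm by (auto simp: fmeasurable_def)
    show "decseq K"
    proof (rule antimonoI)
      fix m n :: nat assume "m \<le> n"
      then have "1 / real (Suc n) \<le> 1 / real (Suc m)" by (intro divide_left_mono) auto
      then show "K n \<subseteq> K m" unfolding K_def by (fastforce intro: order_trans)
    qed
    show "emeasure lebesgue (K n) \<noteq> \<infinity>" for n using fm[of n] by (auto simp: fmeasurable_def)
  qed
  also have "(\<Inter>n. K n) = convex hull S"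
  proof -
    have "(\<Inter>n. K n) = {z. \<forall>\<zeta>. cmod \<zeta> = 1 \<longrightarrow> Re (z * \<zeta>) \<le> support_fun S \<zeta>}"
    proof -
      have le: "x \<le> y" if "\<And>n. x \<le> y + 1 / real (Suc n)" for x y :: real
      proof (rule field_le_epsilon)
        fix e :: real assume "e > 0"
        then obtain n where "1 / real (Suc n) < e" using nat_approx_posE by blast
        then show "x \<le> y + e" using that[of n] by simp
      qed
      show ?thesis
      proof (intro set_eqI iffI)
        fix z assume "z \<in> (\<Inter>n. K n)"
        then have "Re (z * \<zeta>) \<le> support_fun S \<zeta> + 1 / real (Suc n)" if "cmod \<zeta> = 1" for \<zeta> n
          using that by (simp add: K_def)
        then show "z \<in> {z. \<forall>\<zeta>. cmod \<zeta> = 1 \<longrightarrow> Re (z * \<zeta>) \<le> support_fun S \<zeta>}"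
          using le by blast
      next
        fix z assume z: "z \<in> {z. \<forall>\<zeta>. cmod \<zeta> = 1 \<longrightarrow> Re (z * \<zeta>) \<le> support_fun S \<zeta>}"
        have "Re (z * \<zeta>) \<le> support_fun S \<zeta> + 1 / real (Suc n)" if "cmod \<zeta> = 1" for \<zeta> n
        proof -
          have "Re (z * \<zeta>) \<le> support_fun S \<zeta>" using z that by blast
          moreover have "0 \<le> 1 / real (Suc n)" by simp
          ultimately show ?thesis by linarith
        qed
        then show "z \<in> (\<Inter>n. K n)" by (simp add: K_def)
      qed
    qed
    then show ?thesis using support_body by simp
  qed
  finally have "\<forall>\<^sub>F n in sequentially. measure lebesgue (K n) < measure lebesgue (convex hull S) + e"
    using e by (intro order_tendstoD(2)) auto
  then obtain n where "measure lebesgue (K n) < measure lebesgue (convex hull S) + e"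
    by (auto simp: eventually_sequentially)
  then show thesis
    using comp[of n] by (intro that[of "1 / real (Suc n)"]) (auto simp: K_def)
qed

lemma support_trig_poly_approx:
  assumes e: "e > 0"
  obtains d N A where "\<And>\<zeta>. cmod \<zeta> = 1 \<Longrightarrow> support_fun S \<zeta> \<le> trig_poly d N \<zeta>"
    "\<And>\<zeta>. cmod \<zeta> = 1 \<Longrightarrow> trig_poly d N \<zeta> \<le> support_fun S \<zeta> + 1"
    "\<And>\<zeta>. cmod \<zeta> = 1 \<Longrightarrow> 0 \<le> trig_poly (curvature d) N \<zeta>"
    "((\<lambda>t. trig_poly d N (unit_e t) * trig_poly (curvature d) N (unit_e t)) has_integral A) {0..1}"
    "pi * A \<le> measure lebesgue (convex hull S) + e"
proof -
  obtain \<delta> where \<delta>: "\<delta> > 0" "\<delta> \<le> 1"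
    "measure lebesgue {z. \<forall>\<zeta>. cmod \<zeta> = 1 \<longrightarrow> Re (z * \<zeta>) \<le> support_fun S \<zeta> + \<delta>} \<le> measure lebesgue (convex hull S) + e"
    and cK: "compact {z. \<forall>\<zeta>. cmod \<zeta> = 1 \<longrightarrow> Re (z * \<zeta>) \<le> support_fun S \<zeta> + \<delta>}"
    using area_parallel_body[OF e] .
  obtain L where "plane_sublinear (support_fun S) L" using plane_sublinear_support by blast
  then interpret plane_sublinear "support_fun S" L .
  \<comment> \<open>With \<eta> = \<delta>/3 the polynomial lies between the support function and
    the support function plus \<delta>, so its body fits into the parallel body.\<close>
  obtain d N where d: "\<And>\<zeta>. cmod \<zeta> = 1 \<Longrightarrow> support_fun S \<zeta> \<le> trig_poly d N \<zeta>" "\<And>\<zeta>. cmod \<zeta> = 1 \<Longrightarrow> trig_poly d N \<zeta> \<le> support_fun S \<zeta> + 3 * (\<delta> / 3)"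
    "\<And>\<zeta>. cmod \<zeta> = 1 \<Longrightarrow> \<delta> / 3 \<le> trig_poly d N \<zeta>" "\<And>\<zeta>. cmod \<zeta> = 1 \<Longrightarrow> \<delta> / 3 \<le> trig_poly (curvature d) N \<zeta>"
    using trig_poly_approx[of "\<delta> / 3"] \<delta>(1) by auto
  define A where "A = integral {0..1} (\<lambda>t. trig_poly d N (unit_e t) * trig_poly (curvature d) N (unit_e t))"
  have A: "((\<lambda>t. trig_poly d N (unit_e t) * trig_poly (curvature d) N (unit_e t)) has_integral A) {0..1}"
    unfolding A_def by (intro integrable_integral integrable_continuous_interval continuous_intros)
  have pos: "0 < trig_poly d N \<zeta>" "0 < trig_poly (curvature d) N \<zeta>" if "cmod \<zeta> = 1" for \<zeta>
    using d(3,4)[OF that] \<delta>(1) by linarith+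
  have "pi * A \<le> measure lebesgue {z. \<forall>\<zeta>. cmod \<zeta> = 1 \<longrightarrow> Re (z * \<zeta>) \<le> trig_poly d N \<zeta>}"
    by (rule trig_poly_area[OF pos A])
  also have "\<dots> \<le> measure lebesgue {z. \<forall>\<zeta>. cmod \<zeta> = 1 \<longrightarrow> Re (z * \<zeta>) \<le> support_fun S \<zeta> + \<delta>}"
  proof (rule measure_mono_fmeasurable)
    show "{z. \<forall>\<zeta>. cmod \<zeta> = 1 \<longrightarrow> Re (z * \<zeta>) \<le> trig_poly d N \<zeta>} \<subseteq> {z. \<forall>\<zeta>. cmod \<zeta> = 1 \<longrightarrow> Re (z * \<zeta>) \<le> support_fun S \<zeta> + \<delta>}"
      using d(2) by (fastforce intro: order_trans)
    have "{z. \<forall>\<zeta>. cmod \<zeta> = 1 \<longrightarrow> Re (z * \<zeta>) \<le> trig_poly d N \<zeta>} = (\<Inter>\<zeta>\<in>{\<zeta>. cmod \<zeta> = 1}. {z. Re (z * \<zeta>) \<le> trig_poly d N \<zeta>})" by auto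
    then have "closed {z. \<forall>\<zeta>. cmod \<zeta> = 1 \<longrightarrow> Re (z * \<zeta>) \<le> trig_poly d N \<zeta>}"
      by (auto intro!: closed_INT closed_Collect_le continuous_intros)
    then show "{z. \<forall>\<zeta>. cmod \<zeta> = 1 \<longrightarrow> Re (z * \<zeta>) \<le> trig_poly d N \<zeta>} \<in> sets lebesgue" by (simp add: borel_closed)
    show "{z. \<forall>\<zeta>. cmod \<zeta> = 1 \<longrightarrow> Re (z * \<zeta>) \<le> support_fun S \<zeta> + \<delta>} \<in> lmeasurable" using cK by (rule lmeasurable_compact)
  qed
  also note \<delta>(3)
  finally have area: "pi * A \<le> measure lebesgue (convex hull S) + e" .
  show thesis
  proof (rule that[OF d(1) _ _ A area])
    show "trig_poly d N \<zeta> \<le> support_fun S \<zeta> + 1" if "cmod \<zeta> = 1" for \<zeta>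
      using d(2)[OF that] \<delta>(2) by linarith
    show "0 \<le> trig_poly (curvature d) N \<zeta>" if "cmod \<zeta> = 1" for \<zeta>
      using pos(2)[OF that] by simp
  qed
qed

end

section \<open>The radial counting function\<close>

lemma spf_cnj_image: "spf (cnj ` S) \<theta> = support_fun S (cis \<theta>)"
proof -
  have "Re (cnj w * exp (- (\<i> * complex_of_real \<theta>))) = Re (w * cis \<theta>)" for w
  proof -
    have "cnj w * exp (- (\<i> * complex_of_real \<theta>)) = cnj (w * cis \<theta>)"
      by (simp add: cis_conv_exp exp_cnj)
    then show ?thesis by (simp only: cnj.sel)
  qed
  then show ?thesis unfolding spf_def support_fun_def image_image by (simp only:)
qed

lemma noncritical_value:
  fixes a b :: real
  assumes "finite T" "a < b"
  obtains x where "a < x" "x < b" "x \<notin> T"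
proof -
  have "\<not> {a<..<b} \<subseteq> T" using assms infinite_Ioo finite_subset by blast
  then obtain x where "x \<in> {a<..<b}" "x \<notin> T" by blast
  then show thesis using that[of x] by simp
qed

text \<open>The share of a single point of modulus \<open>c\<close> in the integral of a counting
  function over t^2.\<close>

lemma inverse_square_tail_integral:
  fixes r R c :: real
  assumes "0 < r" "r < R"
  shows "((\<lambda>t. if c \<le> t then 1 / t\<^sup>2 else 0) has_integral (if c \<le> R then 1 / max r c - 1 / R else 0)) {r..R}"
proof (cases "c \<le> R")
  case True
  define s where "s = max r c"
  have s: "0 < s" "r \<le> s" "s \<le> R" using assms True by (auto simp: s_def)
  have "((\<lambda>t. 1 / t\<^sup>2) has_integral ((- 1 / R) - (- 1 / s))) {s..R}"
    using s by (intro fundamental_theorem_of_calculus)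
      (auto intro!: derivative_eq_intros simp: power2_eq_square simp flip: has_real_derivative_iff_has_vector_derivative)
  then have "((\<lambda>t. if t \<in> {s..R} then 1 / t\<^sup>2 else 0) has_integral (1 / s - 1 / R)) {r..R}"
    using s by (subst has_integral_restrict) auto
  then have "((\<lambda>t. if c \<le> t then 1 / t\<^sup>2 else 0) has_integral (1 / s - 1 / R)) {r..R}"
    by (rule has_integral_eq[rotated]) (auto simp: s_def)
  then show ?thesis using True by (simp add: s_def)
next
  case False
  then have "((\<lambda>t. if c \<le> t then 1 / t\<^sup>2 else 0) has_integral 0) {r..R}"
    by (intro has_integral_is_0) auto
  then show ?thesis using False by simp
qed

text \<open>Dividing by z^m does not increase the modulus for |z| \<ge> 1, and on the unit disc
  compactness gives a bound; since H \<ge> 0, both are absorbed into the constant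
  \<open>C\<close>.\<close>

lemma entire_exponential_type_normalize:
  fixes H :: "complex \<Rightarrow> real"
  assumes F: "F holomorphic_on UNIV" "\<exists>z. F z \<noteq> 0" and bd: "\<And>z. cmod (F z) \<le> exp (H z)" and H: "\<And>z. 0 \<le> H z"
  obtains m c0 G C where "c0 \<noteq> 0" "G holomorphic_on UNIV" "G 0 = 1" "\<And>z. F z = c0 * z ^ m * G z"
    "C \<ge> 0" "\<And>z. G z \<noteq> 0 \<Longrightarrow> ln (cmod (G z)) \<le> C + H z"
    "\<And>p. (\<And>q. q < p \<Longrightarrow> (deriv ^^ q) F 0 = 0) \<Longrightarrow> p \<le> m"
proof -
  obtain m G0 where G0: "G0 holomorphic_on UNIV" "G0 0 \<noteq> 0" "\<And>z. F z = (z - 0) ^ m * G0 z"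
    "\<And>p. (\<And>q. q < p \<Longrightarrow> (deriv ^^ q) F 0 = 0) \<Longrightarrow> p \<le> m"
    using entire_order_factor[OF F, of 0] by metis
  define G where "G z = G0 z / G0 0" for z
  have G: "G holomorphic_on UNIV" unfolding G_def using G0 by (intro holomorphic_intros) auto
  have "bounded (G ` cball 0 1)"
    using G by (intro compact_imp_bounded compact_continuous_image)
      (auto intro: continuous_on_subset[OF holomorphic_on_imp_continuous_on])
  then obtain K1 where "\<forall>z\<in>cball 0 1. cmod (G z) \<le> K1" by (auto simp: bounded_iff)
  then have K1: "\<And>z. cmod z \<le> 1 \<Longrightarrow> cmod (G z) \<le> K1" by simp
  define K where "K = max 1 (max K1 (1 / cmod (G0 0)))"
  have K: "K \<ge> 1" by (simp add: K_def)
  have GK: "cmod (G z) \<le> K * exp (H z)" for z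
  proof (cases "cmod z \<le> 1")
    case True
    have "cmod (G z) \<le> K * 1" using K1[OF True] by (simp add: K_def)
    also have "\<dots> \<le> K * exp (H z)" using H K by (intro mult_left_mono) auto
    finally show ?thesis .
  next
    case False
    have p: "cmod z ^ m \<ge> 1" using False by (intro one_le_power) simp
    have "cmod (G0 z) \<le> cmod z ^ m * cmod (G0 z)" using mult_right_mono[OF p, of "cmod (G0 z)"] by simp
    also have "\<dots> = cmod (F z)" using G0(3)[of z] by (simp add: norm_mult norm_power)
    also have "\<dots> \<le> exp (H z)" by (rule bd)
    finally have "cmod (G z) \<le> 1 / cmod (G0 0) * exp (H z)"
      using G0(2) by (simp add: G_def norm_divide divide_right_mono)
    also have "\<dots> \<le> K * exp (H z)" by (intro mult_right_mono) (simp_all add: K_def)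
    finally show ?thesis .
  qed
  show thesis
  proof (rule that[of "G0 0" G m "ln K"])
    show "ln (cmod (G z)) \<le> ln K + H z" if "G z \<noteq> 0" for z
    proof -
      have "ln (cmod (G z)) \<le> ln (K * exp (H z))" using GK[of z] that K by (subst ln_le_cancel_iff) auto
      also have "\<dots> = ln K + H z" using K by (subst ln_mult) auto
      finally show ?thesis .
    qed
    show "F z = G0 0 * z ^ m * G z" for z using G0(2) G0(3)[of z] by (simp add: G_def)
  qed (use G0 G K in \<open>auto simp: G_def\<close>)
qed

section \<open>Upper bound for the weighted sum over zeros\<close>

context
  fixes S :: "complex set"
  assumes S: "compact S" "0 \<in> convex hull S"
begin

text \<open>The additive terms depend on C, L, r0 and the area, but not on r and R. Zeros of modulus
  at least r are handled by \<open>zero_sum_le\<close>, those below r by Jensen's count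
  \<open>zero_count_le\<close>.\<close>

lemma zero_sum_bound:
  fixes G :: "complex \<Rightarrow> complex"
  assumes G: "G holomorphic_on UNIV" "G 0 = 1" and C: "C \<ge> 0"
    and bd: "\<And>z. G z \<noteq> 0 \<Longrightarrow> ln (cmod (G z)) \<le> C + support_fun S z"
    and L: "\<And>z. \<bar>support_fun S z\<bar> \<le> L * cmod z" and r0: "r0 > 0" "r0 \<le> r" "r < R"
  shows "\<exists>X n. finite X \<and> (\<forall>z. z \<in> X \<longleftrightarrow> cmod z \<le> 5 * R \<and> G z = 0) \<and>
    (\<forall>a\<in>X. \<forall>p F1. F1 holomorphic_on UNIV \<and> F1 a \<noteq> 0 \<and> (\<forall>q<p. (deriv ^^ q) (\<lambda>z. F1 z * G z) a = 0) \<longrightarrow> p \<le> n a) \<and>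
    (\<Sum>a\<in>X. real (n a) * support_fun S (a / of_real (cmod a)) * (if cmod a \<le> R then 1 / max r (cmod a) - 1 / R else 0))
       \<le> measure lebesgue (convex hull S) / pi * ln (R / r) + 1 + (measure lebesgue (convex hull S) + 1) * ln 4
         + 12 * C * (L + 1) / r0 + 4 * (L + 1)\<^sup>2 + (L + 1) * (C / r0 + 4 * L)"
proof -
  let ?H = "support_fun S" and ?area = "measure lebesgue (convex hull S)"
  have r: "r > 0" "R > 0" using r0 by auto
  have B: "5 * R > 0" using r by simp
  have L0: "L \<ge> 0" using L[of 1] by simp
  obtain L' where "plane_sublinear ?H L'" using plane_sublinear_support[OF S] by blast
  then interpret plane_sublinear ?H L' .
  \<comment> \<open>The area error gets multiplied by ln(R/r); this choice keeps the product at most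
    1, at the price of a trigonometric polynomial that depends on R/r. The other terms use only its
    bound L + 1.\<close>
  define \<epsilon> where "\<epsilon> = 1 / (1 + ln (R / r))"
  have lnRr: "ln (R / r) > 0" using r r0 by simp
  have \<epsilon>: "\<epsilon> > 0" "\<epsilon> \<le> 1" "\<epsilon> * ln (R / r) \<le> 1" using lnRr by (auto simp: \<epsilon>_def)
  obtain d N A where d: "\<And>\<zeta>. cmod \<zeta> = 1 \<Longrightarrow> ?H \<zeta> \<le> trig_poly d N \<zeta>"
    "\<And>\<zeta>. cmod \<zeta> = 1 \<Longrightarrow> trig_poly d N \<zeta> \<le> ?H \<zeta> + 1"
    "\<And>\<zeta>. cmod \<zeta> = 1 \<Longrightarrow> 0 \<le> trig_poly (curvature d) N \<zeta>"
    "((\<lambda>t. trig_poly d N (unit_e t) * trig_poly (curvature d) N (unit_e t)) has_integral A) {0..1}"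
    "pi * A \<le> ?area + \<epsilon>"
    by (rule support_trig_poly_approx[OF S \<epsilon>(1)]) blast
  have d0: "0 \<le> trig_poly d N \<zeta>" "trig_poly d N \<zeta> \<le> L + 1" if "cmod \<zeta> = 1" for \<zeta>
    using d(1,2)[OF that] nonneg[of \<zeta>] L[of \<zeta>] that by auto
  have A0: "A \<ge> 0"
    using d(3) d0(1) by (intro has_integral_nonneg[OF d(4)]) auto
  obtain X n c g where lp: "log_potential X c g (5 * R)" and X: "X = {z \<in> cball 0 (5 * R). G z = 0}"
    and u: "\<And>z. cmod z < 5 * R \<Longrightarrow> z \<notin> X \<Longrightarrow> log_potential.u X n g z = ln (cmod (G z))"
    and n: "\<And>a p F1. a \<in> X \<Longrightarrow> F1 holomorphic_on UNIV \<Longrightarrow> F1 a \<noteq> 0 \<Longrightarrow>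
       (\<And>q. q < p \<Longrightarrow> (deriv ^^ q) (\<lambda>z. F1 z * G z) a = 0) \<Longrightarrow> p \<le> n a"
    by (rule log_potential_entire[OF G B]) blast
  interpret P: log_potential X n c g "5 * R" by (rule lp)
  have finX: "finite X" by (rule P.X)
  have ub: "P.u (of_real \<rho> * unit_e t) \<le> C + \<rho> * ?H (unit_e t)" if "0 < \<rho>" "\<rho> < 5 * R" "\<rho> \<notin> cmod ` X" for \<rho> t
  proof -
    let ?z = "of_real \<rho> * unit_e t"
    have cz: "cmod ?z = \<rho>" using that by (simp add: norm_mult)
    have zX: "?z \<notin> X" using that cz by (metis image_eqI)
    then have "G ?z \<noteq> 0" using that cz by (auto simp: X)
    then have "ln (cmod (G ?z)) \<le> C + ?H ?z" by (rule bd)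
    also have "?H ?z = \<rho> * ?H (unit_e t)" using that by (intro hom) simp
    finally show ?thesis using u[of ?z] cz that zX by simp
  qed
  have fc: "finite (cmod ` X)" using finX by simp
  \<comment> \<open>Radii that avoid the moduli of zeros, within a factor 2 of r and R: hence
    \<open>ln 4\<close> and the change from 6 to 12. The radius \<rho>1 in (3 r, 4 r) serves
    Jensen's count, and 5 R exceeds all of them.\<close>
  obtain r' where r': "r / 2 < r'" "r' < r" "r' \<notin> cmod ` X" using noncritical_value[OF fc, of "r / 2" r] r by auto
  obtain R' where R': "R < R'" "R' < 2 * R" "R' \<notin> cmod ` X" using noncritical_value[OF fc, of R "2 * R"] r by auto
  obtain \<rho>1 where \<rho>1: "3 * r < \<rho>1" "\<rho>1 < 4 * r" "\<rho>1 \<notin> cmod ` X" using noncritical_value[OF fc, of "3 * r" "4 * r"] r by auto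
  define cnt where "cnt = (\<Sum>a\<in>X. if cmod a < r then real (n a) else 0)"
  have cnt: "cnt \<le> C + 4 * r * L"
    unfolding cnt_def
  proof (rule P.zero_count_le[of \<rho>1])
    show "P.u (of_real \<rho>1 * unit_e t) \<le> C + 4 * r * L" for t
    proof -
      have "P.u (of_real \<rho>1 * unit_e t) \<le> C + \<rho>1 * ?H (unit_e t)" using \<rho>1 r r0 by (intro ub) auto
      also have "\<rho>1 * ?H (unit_e t) \<le> 4 * r * L" using \<rho>1 r nonneg[of "unit_e t"] L[of "unit_e t"] by (intro mult_mono) auto
      finally show ?thesis by simp
    qed
  qed (use \<rho>1 r r0 in auto)
  define ms where "ms = (\<Sum>a\<in>X. if cmod a < R' then real (n a) * (cmod a * radial_weight r' R' (cmod a)) * trig_poly d N (a / of_real (cmod a)) else 0)"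
  have ms: "ms \<le> A * ln (R' / r') + 6 * C * (L + 1) / r' + 4 * (L + 1)\<^sup>2"
    unfolding ms_def
  proof (rule P.zero_sum_le)
    show "P.u (of_real \<rho> * unit_e t) \<le> C + \<rho> * trig_poly d N (unit_e t)" if "0 < \<rho>" "\<rho> \<le> R'" "\<rho> \<notin> cmod ` X" for \<rho> t
    proof -
      have "P.u (of_real \<rho> * unit_e t) \<le> C + \<rho> * ?H (unit_e t)" using that R' by (intro ub) auto
      also have "\<rho> * ?H (unit_e t) \<le> \<rho> * trig_poly d N (unit_e t)" using d(1) that by (intro mult_left_mono) auto
      finally show ?thesis by simp
    qed
    show "R' < 5 * R" using R' by simp
  qed (use r' R' r r0 C d0 d in auto)
  \<comment> \<open>Let \<rho> = |a|. For r \<le> \<rho> \<le> R the weight 1/\<rho> - \<rho>/R'^2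
    dominates 1/\<rho> - 1/R. For \<rho> < r the weight is too small, and each zero is charged (L +
    1)/r instead. Beyond R the left side is 0.\<close>
  have summand: "real (n a) * ?H (a / of_real (cmod a)) * (if cmod a \<le> R then 1 / max r (cmod a) - 1 / R else 0)
      \<le> (if cmod a < R' then real (n a) * (cmod a * radial_weight r' R' (cmod a)) * trig_poly d N (a / of_real (cmod a)) else 0)
        + (L + 1) / r * (if cmod a < r then real (n a) else 0)" if a: "a \<in> X" for a
  proof -
    define \<rho> where "\<rho> = cmod a"
    define \<zeta> where "\<zeta> = a / of_real (cmod a)"
    have a0: "a \<noteq> 0" using a P.X by auto
    then have \<rho>0: "\<rho> > 0" by (simp add: \<rho>_def)
    have \<zeta>: "cmod \<zeta> = 1" using a0 by (simp add: \<zeta>_def norm_divide)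
    have W0: "0 \<le> radial_weight r' R' \<rho>" if "\<rho> < R'" using that r' R' r r0 by (intro radial_weight_nonneg) auto
    have m0: "0 \<le> (if \<rho> < R' then real (n a) * (\<rho> * radial_weight r' R' \<rho>) * trig_poly d N \<zeta> else 0)"
      using W0 \<rho>0 d0(1)[OF \<zeta>] by simp
    have c0: "0 \<le> (L + 1) / r * (if \<rho> < r then real (n a) else 0)" using L0 r by simp
    consider "\<rho> > R" | "\<rho> < r" | "r \<le> \<rho>" "\<rho> \<le> R" by linarith
    then have "real (n a) * ?H \<zeta> * (if \<rho> \<le> R then 1 / max r \<rho> - 1 / R else 0)
      \<le> (if \<rho> < R' then real (n a) * (\<rho> * radial_weight r' R' \<rho>) * trig_poly d N \<zeta> else 0)
        + (L + 1) / r * (if \<rho> < r then real (n a) else 0)"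
    proof cases
      case 1
      then show ?thesis using m0 c0 by simp
    next
      case 2
      have "real (n a) * ?H \<zeta> * (1 / r - 1 / R) \<le> real (n a) * (L + 1) * (1 / r)"
        using L[of \<zeta>] \<zeta> nonneg[of \<zeta>] r r0 L0 by (intro mult_mono) (auto intro!: divide_left_mono)
      then show ?thesis using 2 m0 r0 by (simp add: mult_ac)
    next
      case 3
      have "1 / \<rho> - 1 / R \<le> \<rho> * radial_weight r' R' \<rho>"
      proof -
        have "max r' \<rho> = \<rho>" using 3 r' by simp
        then have "\<rho> * radial_weight r' R' \<rho> = 1 / \<rho> - \<rho> / R'\<^sup>2"
          using \<rho>0 by (simp add: radial_weight_def right_diff_distrib power2_eq_square)
        moreover have "\<rho> / R'\<^sup>2 \<le> R / R\<^sup>2"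
          using 3 R' r by (intro frac_le power_mono) auto
        moreover have "R / R\<^sup>2 = 1 / R" using r by (simp add: power2_eq_square)
        ultimately show ?thesis by simp
      qed
      then have "real (n a) * ?H \<zeta> * (1 / \<rho> - 1 / R) \<le> real (n a) * trig_poly d N \<zeta> * (\<rho> * radial_weight r' R' \<rho>)"
        using 3 \<rho>0 nonneg[of \<zeta>] d(1)[OF \<zeta>] d0(1)[OF \<zeta>] by (intro mult_mono) (auto intro!: divide_left_mono)
      then show ?thesis using 3 R' by (simp add: mult_ac)
    qed
    then show ?thesis unfolding \<rho>_def \<zeta>_def .
  qed
  have "(\<Sum>a\<in>X. real (n a) * ?H (a / of_real (cmod a)) * (if cmod a \<le> R then 1 / max r (cmod a) - 1 / R else 0)) \<le> ms + (L + 1) / r * cnt"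
    unfolding ms_def cnt_def sum_distrib_left sum.distrib[symmetric] by (intro sum_mono summand)
  also have "(L + 1) / r * cnt \<le> (L + 1) * (C / r0 + 4 * L)"
  proof -
    have "(L + 1) / r * cnt \<le> (L + 1) / r * (C + 4 * r * L)" using cnt L0 r by (intro mult_left_mono) auto
    also have "\<dots> = (L + 1) * ((C + 4 * r * L) / r)" by simp
    also have "(C + 4 * r * L) / r = C / r + 4 * L" using r by (simp add: add_divide_distrib)
    also have "(L + 1) * (C / r + 4 * L) \<le> (L + 1) * (C / r0 + 4 * L)" using L0 C r0 by (intro mult_left_mono add_right_mono divide_left_mono) auto
    finally show ?thesis .
  qed
  also have "ms \<le> ?area / pi * ln (R / r) + 1 + (?area + 1) * ln 4 + 12 * C * (L + 1) / r0 + 4 * (L + 1)\<^sup>2"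
  proof -
    have Ar: "0 \<le> ?area" by simp
    have pA: "A \<le> ?area / pi + \<epsilon> / pi" using d(5) by (simp add: pos_le_divide_eq mult.commute flip: add_divide_distrib)
    have pe: "\<epsilon> / pi \<le> \<epsilon>" using \<epsilon> pi_gt3 by (simp add: pos_divide_le_eq)
    have pa: "?area / pi \<le> ?area" using Ar pi_gt3 by (simp add: pos_divide_le_eq mult_left_mono[of 1 pi ?area, simplified])
    have "R' / r' \<le> 4 * (R / r)"
    proof -
      have "R' / r' \<le> (2 * R) / (r / 2)" using r' R' r by (intro frac_le) auto
      then show ?thesis by simp
    qed
    then have "ln (R' / r') \<le> ln (4 * (R / r))" using r r' R' by (subst ln_le_cancel_iff) auto
    also have "\<dots> = ln 4 + ln (R / r)" using r by (subst ln_mult) auto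
    finally have "A * ln (R' / r') \<le> A * (ln 4 + ln (R / r))" using A0 by (intro mult_left_mono) auto
    also have "\<dots> = A * ln 4 + A * ln (R / r)" by (rule distrib_left)
    also have "A * ln 4 \<le> (?area + 1) * ln 4" using pA pe pa \<epsilon> by (intro mult_right_mono) auto
    also have "A * ln (R / r) \<le> (?area / pi + \<epsilon>) * ln (R / r)" using pA pe lnRr by (intro mult_right_mono) auto
    also have "\<dots> \<le> ?area / pi * ln (R / r) + 1" using \<epsilon>(3) by (simp add: distrib_right)
    finally have 1: "A * ln (R' / r') \<le> (?area + 1) * ln 4 + (?area / pi * ln (R / r) + 1)" by simp
    have "6 * C * (L + 1) / r' \<le> 6 * C * (L + 1) / (r0 / 2)"
      using r' r0 C L0 by (intro divide_left_mono) auto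
    then have "6 * C * (L + 1) / r' \<le> 12 * C * (L + 1) / r0" by simp
    then show ?thesis using ms 1 by linarith
  qed
  finally have fin: "(\<Sum>a\<in>X. real (n a) * ?H (a / of_real (cmod a)) * (if cmod a \<le> R then 1 / max r (cmod a) - 1 / R else 0))
     \<le> ?area / pi * ln (R / r) + 1 + (?area + 1) * ln 4 + 12 * C * (L + 1) / r0 + 4 * (L + 1)\<^sup>2 + (L + 1) * (C / r0 + 4 * L)"
    by simp
  have "\<forall>z. z \<in> X \<longleftrightarrow> cmod z \<le> 5 * R \<and> G z = 0" by (auto simp: X)
  moreover have "\<forall>a\<in>X. \<forall>p F1. F1 holomorphic_on UNIV \<and> F1 a \<noteq> 0 \<and> (\<forall>q<p. (deriv ^^ q) (\<lambda>z. F1 z * G z) a = 0) \<longrightarrow> p \<le> n a"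
  proof (intro ballI allI impI, elim conjE)
    fix a p F1 assume "a \<in> X" "F1 holomorphic_on UNIV" "F1 a \<noteq> 0" "\<forall>q<p. (deriv ^^ q) (\<lambda>z. F1 z * G z) a = 0"
    then show "p \<le> n a" by (intro n[of a F1 p]) simp_all
  qed
  ultimately show ?thesis
    by (intro exI[of _ X] exI[of _ n] conjI finX fin)
qed

end

text \<open>Every point of \<open>Z\<close> is a zero of F of at least the same multiplicity, and F
  is not identically 0. So \<open>Z\<close> has finite mass in each disc, and the radial counting
  function is dominated by a finite sum of step functions whose integrals over t^2 are
  explicit.\<close>

lemma Zrad_integral_bound:
  fixes S :: "complex set"
  assumes S: "compact S" "0 \<in> convex hull S"
    and F: "F holomorphic_on UNIV" "\<exists>z. F z \<noteq> 0" and bd: "\<And>z. cmod (F z) \<le> exp (support_fun S z)"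
    and zeros: "\<And>z p. enat p < Z z \<Longrightarrow> (deriv ^^ p) F z = 0" and r0: "r0 > 0"
  obtains K where "K \<ge> 0" "\<And>r R. r0 \<le> r \<Longrightarrow> r < R \<Longrightarrow>
    (\<integral>\<^sup>+ t \<in> {r..R}. (Zrad Z (cnj ` S) t / ennreal (t\<^sup>2)) \<partial>lborel) \<le> ennreal (measure lebesgue (convex hull S) / pi * ln (R / r) + K)"
proof -
  let ?H = "support_fun S" and ?area = "measure lebesgue (convex hull S)"
  obtain L where "plane_sublinear ?H L" using plane_sublinear_support[OF S] by blast
  then interpret plane_sublinear ?H L .
  obtain m c0 G C where c0: "c0 \<noteq> 0" and G: "G holomorphic_on UNIV" "G 0 = 1" and FG: "\<And>z. F z = c0 * z ^ m * G z"
    and C: "C \<ge> 0" "\<And>z. G z \<noteq> 0 \<Longrightarrow> ln (cmod (G z)) \<le> C + ?H z"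
    and m: "\<And>p. (\<And>q. q < p \<Longrightarrow> (deriv ^^ q) F 0 = 0) \<Longrightarrow> p \<le> m"
    by (rule entire_exponential_type_normalize[OF F bd nonneg]) blast
  \<comment> \<open>This also excludes infinite multiplicity: if \<open>Z a\<close> exceeded
    \<open>k\<close>, the derivatives of order 0 to k would vanish, and the premise would give k + 1
    \<le> k.\<close>
  have mult_le: "Z a \<le> enat k" if k: "\<And>p. (\<And>q. q < p \<Longrightarrow> (deriv ^^ q) F a = 0) \<Longrightarrow> p \<le> k" for a k
  proof (rule ccontr)
    assume "\<not> Z a \<le> enat k"
    then have lt: "enat k < Z a" by simp
    have "(deriv ^^ q) F a = 0" if "q < Suc k" for q
    proof -
      have "enat q \<le> enat k" using that by simp
      then show ?thesis using lt by (intro zeros) (rule le_less_trans)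
    qed
    then have "Suc k \<le> k" by (rule k)
    then show False by simp
  qed
  define K0 where "K0 = 1 + (?area + 1) * ln 4 + 12 * C * (L + 1) / r0 + 4 * (L + 1)\<^sup>2 + (L + 1) * (C / r0 + 4 * L)"
  have K0: "K0 \<ge> 0"
    unfolding K0_def using C(1) L_nonneg r0 by (intro add_nonneg_nonneg mult_nonneg_nonneg divide_nonneg_pos) auto
  show thesis
  proof (rule that[of "real m * L / r0 + K0"])
    show "0 \<le> real m * L / r0 + K0" using K0 L_nonneg r0 by simp
    fix r R assume rR: "r0 \<le> r" "r < R"
    have r: "r > 0" "R > 0" using rR r0 by auto
    obtain X n where Xn: "finite X \<and> (\<forall>z. z \<in> X \<longleftrightarrow> cmod z \<le> 5 * R \<and> G z = 0) \<and>
      (\<forall>a\<in>X. \<forall>p F1. F1 holomorphic_on UNIV \<and> F1 a \<noteq> 0 \<and> (\<forall>q<p. (deriv ^^ q) (\<lambda>z. F1 z * G z) a = 0) \<longrightarrow> p \<le> n a) \<and>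
      (\<Sum>a\<in>X. real (n a) * ?H (a / of_real (cmod a)) * (if cmod a \<le> R then 1 / max r (cmod a) - 1 / R else 0))
       \<le> ?area / pi * ln (R / r) + 1 + (?area + 1) * ln 4
         + 12 * C * (L + 1) / r0 + 4 * (L + 1)\<^sup>2 + (L + 1) * (C / r0 + 4 * L)"
      by (rule exE[OF zero_sum_bound[OF S G C bound r0 rR]], assumption, elim exE) blast
    note X = Xn[THEN conjunct1] Xn[THEN conjunct2, THEN conjunct1, rule_format]
      and n = Xn[THEN conjunct2, THEN conjunct2, THEN conjunct1]
      and sum = Xn[THEN conjunct2, THEN conjunct2, THEN conjunct2]
    define h where "h a = ?H (a / of_real (cmod a))" for a
    \<comment> \<open>A majorant of the integrand on [r, R]. The origin enters as a zero of modulus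
      0 with support value \<open>L\<close>, so that \<open>inverse_square_tail_integral\<close>
      covers it too.\<close>
    define f where "f t = real m * L * (if 0 \<le> t then 1 / t\<^sup>2 else 0) + (\<Sum>a\<in>X. real (n a) * h a * (if cmod a \<le> t then 1 / t\<^sup>2 else 0))" for t
    define I where "I = real m * L * (if 0 \<le> R then 1 / max r 0 - 1 / R else 0) + (\<Sum>a\<in>X. real (n a) * h a * (if cmod a \<le> R then 1 / max r (cmod a) - 1 / R else 0))"
    have fI: "(f has_integral I) {r..R}"
      unfolding f_def I_def
      by (intro has_integral_add has_integral_sum has_integral_mult_right inverse_square_tail_integral X(1) r rR(2))
    have f0: "0 \<le> f t" for t
      unfolding f_def using L_nonneg nonneg by (intro add_nonneg_nonneg mult_nonneg_nonneg sum_nonneg) (auto simp: h_def)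
    have I: "I \<le> ?area / pi * ln (R / r) + (real m * L / r0 + K0)"
    proof -
      have "1 / r \<le> 1 / r0" using rR r0 by (intro divide_left_mono) auto
      moreover have "1 / R > 0" using r by simp
      ultimately have "1 / r - 1 / R \<le> 1 / r0" by linarith
      then have "real m * L * (1 / r - 1 / R) \<le> real m * L * (1 / r0)"
        using L_nonneg by (intro mult_left_mono) auto
      then show ?thesis using sum r unfolding I_def K0_def h_def by simp
    qed
    have X0: "a \<noteq> 0" if "a \<in> X" for a using that X(2) G(2) by auto
    have Zn: "Z a \<le> enat (n a)" if "a \<in> X" for a
    proof (rule mult_le)
      fix p assume p: "\<And>q. q < p \<Longrightarrow> (deriv ^^ q) F a = 0"
      \<comment> \<open>The cofactor c0 z^m does not vanish at a, since a is not 0.\<close>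
      have "(\<lambda>z. (c0 * z ^ m) * G z) = F" using FG by (auto simp: fun_eq_iff)
      then have "\<forall>q<p. (deriv ^^ q) (\<lambda>z. (c0 * z ^ m) * G z) a = 0" using p by simp
      moreover have "(\<lambda>z. c0 * z ^ m) holomorphic_on UNIV" by (intro holomorphic_intros)
      moreover have "c0 * a ^ m \<noteq> 0" using X0[OF that] c0 by simp
      ultimately show "p \<le> n a" using n that by blast
    qed
    have Z0: "Z a = 0" if "a \<notin> X" "a \<noteq> 0" "cmod a \<le> 5 * R" for a
    proof (rule ccontr)
      assume "Z a \<noteq> 0"
      then have "F a = 0" using zeros[of 0 a] by (simp add: zero_enat_def[symmetric])
      then show False using that FG[of a] c0 X(2) by auto
    qed
    have Zr: "Zrad Z (cnj ` S) t / ennreal (t\<^sup>2) \<le> ennreal (f t)" if t: "t \<in> {r..R}" for t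
    proof -
      have t0: "t > 0" using t r by auto
      have "(SUP \<theta>. \<bar>spf (cnj ` S) \<theta>\<bar>) \<le> L"
      proof (rule cSUP_least)
        show "\<bar>spf (cnj ` S) \<theta>\<bar> \<le> L" for \<theta> using bound[of "cis \<theta>"] by (simp add: spf_cnj_image)
      qed simp
      moreover have "ennreal_of_enat (Z 0) \<le> ennreal_of_enat (enat m)"
        unfolding ennreal_of_enat_le_iff using m by (rule mult_le)
      ultimately have "ennreal_of_enat (Z 0) * ennreal (SUP \<theta>. \<bar>spf (cnj ` S) \<theta>\<bar>) \<le> ennreal_of_enat (enat m) * ennreal L"
        by (intro mult_mono ennreal_leI) (assumption | simp only: zero_le)+
      also have "\<dots> = ennreal (real m * L)"
        using L_nonneg by (simp add: ennreal_mult ennreal_of_nat_eq_real_of_nat)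
      finally have 1: "ennreal_of_enat (Z 0) * ennreal (SUP \<theta>. \<bar>spf (cnj ` S) \<theta>\<bar>) \<le> ennreal (real m * L)" .
      have "(\<integral>\<^sup>+ z. ennreal_of_enat (Z z) * ennreal (spf (cnj ` S) (Arg z)) \<partial>count_space {z. 0 < cmod z \<and> cmod z \<le> t})
          = (\<Sum>a\<in>{a\<in>X. cmod a \<le> t}. ennreal_of_enat (Z a) * ennreal (spf (cnj ` S) (Arg a)))"
      proof (rule nn_integral_count_space')
        show "ennreal_of_enat (Z z) * ennreal (spf (cnj ` S) (Arg z)) = 0"
          if "z \<in> {z. 0 < cmod z \<and> cmod z \<le> t}" "z \<notin> {a\<in>X. cmod a \<le> t}" for z
        proof -
          have "Z z = 0" using that t r by (intro Z0) auto
          then show ?thesis by simp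
        qed
        show "finite {a\<in>X. cmod a \<le> t}" using X(1) by (rule finite_subset[rotated]) blast
        show "{a\<in>X. cmod a \<le> t} \<subseteq> {z. 0 < cmod z \<and> cmod z \<le> t}" using X0 by fastforce
      qed
      also have "\<dots> \<le> (\<Sum>a\<in>{a\<in>X. cmod a \<le> t}. ennreal (real (n a) * h a))"
      proof (intro sum_mono)
        fix a assume a: "a \<in> {a\<in>X. cmod a \<le> t}"
        then have a0: "a \<noteq> 0" using X0 by auto
        have "spf (cnj ` S) (Arg a) = h a"
          using a0 by (simp add: spf_cnj_image h_def cis_Arg sgn_eq)
        moreover have "ennreal_of_enat (Z a) \<le> ennreal_of_enat (enat (n a))"
          unfolding ennreal_of_enat_le_iff using Zn[of a] a by blast
        ultimately have "ennreal_of_enat (Z a) * ennreal (spf (cnj ` S) (Arg a)) \<le> ennreal_of_enat (enat (n a)) * ennreal (h a)"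
          by (simp only: mult_right_mono zero_le)
        then show "ennreal_of_enat (Z a) * ennreal (spf (cnj ` S) (Arg a)) \<le> ennreal (real (n a) * h a)"
          using nonneg by (simp add: ennreal_mult ennreal_of_nat_eq_real_of_nat h_def)
      qed
      also have "\<dots> = ennreal (\<Sum>a\<in>{a\<in>X. cmod a \<le> t}. real (n a) * h a)"
        using nonneg by (intro sum_ennreal) (simp add: h_def)
      finally have 2: "(\<integral>\<^sup>+ z. ennreal_of_enat (Z z) * ennreal (spf (cnj ` S) (Arg z)) \<partial>count_space {z. 0 < cmod z \<and> cmod z \<le> t})
          \<le> ennreal (\<Sum>a\<in>{a\<in>X. cmod a \<le> t}. real (n a) * h a)" .
      have s0: "0 \<le> (\<Sum>a\<in>{a\<in>X. cmod a \<le> t}. real (n a) * h a)"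
        using nonneg by (intro sum_nonneg) (simp add: h_def)
      have "Zrad Z (cnj ` S) t \<le> ennreal (real m * L) + ennreal (\<Sum>a\<in>{a\<in>X. cmod a \<le> t}. real (n a) * h a)"
        unfolding Zrad_def by (rule add_mono[OF 1 2])
      also have "\<dots> = ennreal (real m * L + (\<Sum>a\<in>{a\<in>X. cmod a \<le> t}. real (n a) * h a))"
        using s0 L_nonneg by (subst ennreal_plus) auto
      finally have "Zrad Z (cnj ` S) t / ennreal (t\<^sup>2) \<le> ennreal (real m * L + (\<Sum>a\<in>{a\<in>X. cmod a \<le> t}. real (n a) * h a)) / ennreal (t\<^sup>2)"
        by (rule divide_right_mono_ennreal)
      also have "\<dots> = ennreal ((real m * L + (\<Sum>a\<in>{a\<in>X. cmod a \<le> t}. real (n a) * h a)) / t\<^sup>2)"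
        using s0 L_nonneg t0 by (intro divide_ennreal) auto
      also have "(real m * L + (\<Sum>a\<in>{a\<in>X. cmod a \<le> t}. real (n a) * h a)) / t\<^sup>2 = f t"
      proof -
        have "(\<Sum>a\<in>{a\<in>X. cmod a \<le> t}. real (n a) * h a) / t\<^sup>2 = (\<Sum>a\<in>{a\<in>X. cmod a \<le> t}. real (n a) * h a * (1 / t\<^sup>2))"
          by (simp add: sum_divide_distrib)
        also have "\<dots> = (\<Sum>a\<in>X. if cmod a \<le> t then real (n a) * h a * (1 / t\<^sup>2) else 0)"
          by (rule sum.inter_filter[OF X(1)])
        also have "\<dots> = (\<Sum>a\<in>X. real (n a) * h a * (if cmod a \<le> t then 1 / t\<^sup>2 else 0))"
          by (intro sum.cong) auto
        finally show ?thesis using t0 by (simp add: f_def add_divide_distrib)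
      qed
      finally show ?thesis .
    qed
    have "(\<integral>\<^sup>+ t \<in> {r..R}. (Zrad Z (cnj ` S) t / ennreal (t\<^sup>2)) \<partial>lborel) \<le> (\<integral>\<^sup>+ t. ennreal (indicator {r..R} t * f t) \<partial>lborel)"
      using Zr by (intro nn_integral_mono) (auto simp: indicator_def)
    also have "\<dots> = ennreal I" using f0 by (intro nn_integral_has_integral_lebesgue[OF _ fI])
    also have "\<dots> \<le> ennreal (?area / pi * ln (R / r) + (real m * L / r0 + K0))" using I by (rule ennreal_leI)
    finally show "(\<integral>\<^sup>+ t \<in> {r..R}. (Zrad Z (cnj ` S) t / ennreal (t\<^sup>2)) \<partial>lborel) \<le> ennreal (?area / pi * ln (R / r) + (real m * L / r0 + K0))" .
  qed
qed

text \<open>If an element of the span were within r/4 of the polynomial that Mergelyan's theorem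
  provides within r/4 of \<open>f\<close>, it would be within r/2 of \<open>f\<close>. Working with
  a polynomial lets the duality argument run on the space of polynomials alone.\<close>

lemma not_complete_imp_distant_poly:
  assumes S: "compact S" "connected (- S)" "S \<noteq> {}" and nc: "\<not> complete_in_CHol S (Exp_system Z)"
  obtains P e where "e > 0" "\<And>v. v \<in> cfun.span (Exp_system Z) \<Longrightarrow> \<exists>w\<in>S. e \<le> cmod (poly P w - v w)"
proof -
  let ?V = "(\<lambda>f. restrict f S) ` cfun.span (Exp_system Z)"
  interpret Ms: Metric_space "mspace (CHol S)" "mdist (CHol S)"
    by (rule Metric_space_mspace_mdist)
  have cl: "mtopology_of (CHol S) closure_of ?V = {f \<in> mspace (CHol S). \<forall>r>0. \<exists>v\<in>?V. v \<in> Ms.mball f r}"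
    unfolding mtopology_of_def by (rule Ms.metric_closure_of)
  obtain f r where f: "f \<in> mspace (CHol S)" and r: "r > 0" "\<And>v. v \<in> ?V \<Longrightarrow> v \<notin> Ms.mball f r"
    using nc unfolding complete_in_CHol_def cl by blast
  have fc: "continuous_on S f" "f holomorphic_on interior S" using f by (auto simp: mspace_CHol[OF S(1)])
  have r4: "r / 4 > 0" using r by simp
  obtain P where P: "\<And>z. z \<in> S \<Longrightarrow> cmod (f z - poly P z) < r / 4"
    using Mergelyan[OF S(1,2) fc] r4 unfolding polyapprox_def by blast
  show thesis
  proof (rule that[OF r4, of P])
    fix v assume v: "v \<in> cfun.span (Exp_system Z)"
    then have vV: "restrict v S \<in> ?V" by blast
    have vm: "restrict v S \<in> mspace (CHol S)" using restrict_span_Exp_system[OF S(1)] vV by blast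
    show "\<exists>w\<in>S. r / 4 \<le> cmod (poly P w - v w)"
    proof (rule ccontr)
      assume "\<not> ?thesis"
      then have lt: "cmod (poly P w - v w) < r / 4" if "w \<in> S" for w using that by (auto simp: not_le)
      have "mdist (CHol S) f (restrict v S) = (SUP w\<in>S. cmod (f w - restrict v S w))"
        by (rule mdist_CHol[OF S(1,3) f vm])
      also have "\<dots> \<le> r / 2"
      proof (rule cSUP_least[OF S(3)])
        fix w assume w: "w \<in> S"
        have "cmod (f w - restrict v S w) = cmod ((f w - poly P w) + (poly P w - v w))" using w by simp
        also have "\<dots> \<le> cmod (f w - poly P w) + cmod (poly P w - v w)" by (rule norm_triangle_ineq)
        finally show "cmod (f w - restrict v S w) \<le> r / 2" using P[OF w] lt[OF w] by simp
      qed
      finally have "mdist (CHol S) f (restrict v S) < r" using r by simp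
      then have "restrict v S \<in> Ms.mball f r" using f vm by simp
      with r(2)[OF vV] show False by blast
    qed
  qed
qed

theorem mainTheorem1:
  fixes Z :: "complex \<Rightarrow> enat" and S :: "complex set" and r\<^sub>0 :: real
  assumes "compact S"
    and "connected (- S)"
    and "0 \<in> convex hull S"
    and "r\<^sub>0 > 0"
    and "(SUP (r, R) \<in> {(r, R). r\<^sub>0 \<le> r \<and> r < R}.
            enn2ereal (\<integral>\<^sup>+ t \<in> {r..R}. (Zrad Z (cnj ` S) t / ennreal (t\<^sup>2)) \<partial>lborel)
            - ereal (measure lebesgue (convex hull S) / pi * ln (R / r))) = \<infinity>"
  shows "complete_in_CHol S (Exp_system Z)"
proof (rule ccontr)
  assume nc: "\<not> complete_in_CHol S (Exp_system Z)"
  have ne: "S \<noteq> {}" using assms(3) by auto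
  obtain P e where e: "e > 0" and P: "\<And>v. v \<in> cfun.span (Exp_system Z) \<Longrightarrow> \<exists>w\<in>S. e \<le> cmod (poly P w - v w)"
    by (rule not_complete_imp_distant_poly[OF assms(1,2) ne nc]) blast
  obtain F where F: "F holomorphic_on UNIV" "\<exists>z. F z \<noteq> 0"
    and Fb: "\<And>z m. (\<And>w. w \<in> S \<Longrightarrow> Re (z * w) \<le> m) \<Longrightarrow> cmod (F z) \<le> exp m"
    and Fz: "\<And>z p. (\<lambda>w. w ^ p * exp (z * w)) \<in> cfun.span (Exp_system Z) \<Longrightarrow> (deriv ^^ p) F z = 0"
    by (rule annihilating_entire_function[OF assms(1) cfun.subspace_span P e]) blast+
  have "cmod (F z) \<le> exp (support_fun S z)" for z
    using support_upper[OF assms(1,3)] by (intro Fb) (simp add: mult.commute)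
  moreover have "(deriv ^^ p) F z = 0" if "enat p < Z z" for z p
  proof -
    have "0 < Z z" using that by (metis i0_lb le_less_trans)
    \<comment> \<open>On \<open>enat\<close> one has \<infinity> - 1 = \<infinity>, and a finite
      \<open>Z z\<close> is positive here, so the subtraction is not truncated.\<close>
    moreover have "enat p \<le> Z z - 1"
      using that by (cases "Z z") (auto simp: one_enat_def)
    ultimately have "(\<lambda>w. w ^ p * exp (z * w)) \<in> Exp_system Z" unfolding Exp_system_def by blast
    then show ?thesis by (intro Fz cfun.span_base)
  qed
  ultimately obtain K where K: "K \<ge> 0" "\<And>r R. r\<^sub>0 \<le> r \<Longrightarrow> r < R \<Longrightarrow>
    (\<integral>\<^sup>+ t \<in> {r..R}. (Zrad Z (cnj ` S) t / ennreal (t\<^sup>2)) \<partial>lborel) \<le> ennreal (measure lebesgue (convex hull S) / pi * ln (R / r) + K)"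
    using Zrad_integral_bound[OF assms(1,3) F _ _ assms(4), of Z] by blast
  \<comment> \<open>\<open>K\<close> does not depend on r and R, so it bounds the whole supremum,
    which is assumed to be infinite.\<close>
  have "(SUP (r, R) \<in> {(r, R). r\<^sub>0 \<le> r \<and> r < R}.
            enn2ereal (\<integral>\<^sup>+ t \<in> {r..R}. (Zrad Z (cnj ` S) t / ennreal (t\<^sup>2)) \<partial>lborel)
            - ereal (measure lebesgue (convex hull S) / pi * ln (R / r))) \<le> ereal K"
  proof (rule SUP_least, clarify)
    fix r R assume rR: "r\<^sub>0 \<le> r" "r < R"
    define x where "x = measure lebesgue (convex hull S) / pi * ln (R / r)"
    have "ln (R / r) \<ge> 0" using rR assms(4) by simp
    then have x: "x \<ge> 0" by (simp add: x_def)
    have "enn2ereal (\<integral>\<^sup>+ t \<in> {r..R}. (Zrad Z (cnj ` S) t / ennreal (t\<^sup>2)) \<partial>lborel) \<le> enn2ereal (ennreal (x + K))"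
      using K(2)[OF rR] unfolding x_def less_eq_ennreal.rep_eq .
    also have "\<dots> = ereal (x + K)" using x K(1) by (intro enn2ereal_ennreal) simp
    finally show "enn2ereal (\<integral>\<^sup>+ t \<in> {r..R}. (Zrad Z (cnj ` S) t / ennreal (t\<^sup>2)) \<partial>lborel)
            - ereal (measure lebesgue (convex hull S) / pi * ln (R / r)) \<le> ereal K"
      unfolding x_def[symmetric] by (simp add: ereal_minus_le_iff add.commute)
  qed
  then show False using assms(5) by simp
qed

end
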